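(* Let $M$ be a $0$-admissible half-flat spin $\frac32$ Grassmann manifold with harmonic space $\pi:S_H=M\times\mathrm{Sp}(1,\mathbb C)\to M$. Let $A_{++}$ be an analytic prepotential, i.e. an $r\times r$-matrix-valued function on a domain $U=\pi^{-1}(V)\subset S_H$, $V\subset M$ a simply connected domain, satisfying $X^e_{+++}A_{++}=0$ for all local sections $e$ of $E^*$ and $\partial_0A_{++}=2A_{++}$, and let $\Phi$ be an invertible matrix-valued function on $U$ which satisfies the equations $$\partial_{++}\Phi=-A_{++}\Phi,\qquad\partial_0\Phi=0 .$$ Such a function $\Phi$ always exists. Then the pair $(A_{++},\Phi)$ determines an almost $0$-partially flat connection $\nabla^S=\nabla^{(A_{++},\Phi)}$. Its potentials with respect to an analytic frame are given by $A(\partial_{++})=A_{++}$, $A(\partial_{--})=A_{--}=-(\partial_{--}\Phi)\Phi^{-1}$ and $$A(X^e_+)=-\tfrac13X^e_{+++}A_{--},$$ $$A(X^e_-)=\tfrac12\left(\partial_{--}A(X^e_+)-X^e_+A_{--}+[A_{--},A(X^e_+)]\right),$$ $$A(X^e_{---})=\partial_{--}A(X^e_-)-X^e_-A_{--}+[A_{--},A(X^e_-)]$$ (and $A(X^e_{+++})=A(\partial_0)=0$). Conversely, any almost $0$-partially flat connection is of this form.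
   Context: All objects are holomorphic; the construction is local in $M$ and vector bundles are trivial. A half-flat spin $\frac32$ Grassmann manifold is a complex manifold $M$ with $T^*M\cong E\otimes S^3H$, where $E,H$ are holomorphic vector bundles, $H$ of rank $2$, with holomorphic connections $\nabla^E$ and $\nabla^H$, $\nabla^H$ preserving a form $\omega_H\in\Gamma(\wedge^2H)$ (symplectic on $H^*$), such that the connection $\nabla^F$ induced on $F=S^3H$ is flat; $\nabla=\nabla^E\otimes\mathrm{Id}+\mathrm{Id}\otimes\nabla^F$, with torsion $T$. $\pi:S_H\to M$ is the $\mathrm{Sp}(1,\mathbb C)$-principal bundle of pairs $(h_+,h_-)$ in fibres of $H^*$ with $\omega_H(h_+,h_-)=1$; a fixed parallel symplectic frame $(h_1,h_2)$ of $H^*$ identifies $S_H=M\times\mathrm{Sp}(1,\mathbb C)$ via $h_\pm=u_\pm^\alpha h_\alpha$. Vertical fields: $\partial_{++}=u_+^\alpha\frac{\partial}{\partial u_-^\alpha}$, $\partial_{--}=u_-^\alpha\frac{\partial}{\partial u_+^\alpha}$, $\partial_0=u_+^\alpha\frac{\partial}{\partial u_+^\alpha}-u_-^\alpha\frac{\partial}{\partial u_-^\alpha}$. For a section $e$ of $E^*$ let $X^e_{\alpha\beta\gamma}=e\otimes h_\alpha h_\beta h_\gamma$, with horizontal lift $\widetilde{X^e_{\alpha\beta\gamma}}$ to $S_H$, and set $X^e_{+++}=u_+^\alpha u_+^\beta u_+^\gamma\widetilde{X^e_{\alpha\beta\gamma}}$, $X^e_+=u_+^\alpha u_+^\beta u_-^\gamma\widetilde{X^e_{\alpha\beta\gamma}}$,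 $X^e_-=u_-^\alpha u_-^\beta u_+^\gamma\widetilde{X^e_{\alpha\beta\gamma}}$, $X^e_{---}=u_-^\alpha u_-^\beta u_-^\gamma\widetilde{X^e_{\alpha\beta\gamma}}$. $\mathcal D_{3\pm}$ is the distribution spanned by the $X^e_{\pm\pm\pm}$. $M$ is $0$-admissible if $T(\mathcal D_{3\pm},\mathcal D_{3\pm})\subset\mathcal D_{3\pm}$ ($T$ lifted horizontally to $S_H$); then $\mathcal D_{3\pm}$ are integrable. A connection over (an open subset of) $S_H$ is almost $0$-partially flat if $F(X^e_{+++},X^{e'}_{+++})=F(X^e_{+++},v)=F(X^e_\pm,v)=0$ for all vertical $v$, and $F(\partial_{++},\cdot)=F(\partial_0,\cdot)=0$. An analytic frame is a frame parallel along the leaves of the integrable distribution $\langle\mathcal D_{3+},\partial_0\rangle$. The potential $A$ is the connection $1$-form in a frame: $\nabla_X=X+A(X)$.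
   Formalization: Φ need not exist on all of U (for r=2 the prepotential can define O(1)+O(-1) on fibres), so its existence is stated on each set u_+^α≠0; in the converse analytic frames exist locally and the form holds locally, or on all of U given an analytic frame on U. *)

theory Defs
  imports "HOL-Analysis.Analysis"
begin

section \<open>Holomorphic functions\<close>

text \<open>The first argument is the complex scalar multiplication of the ambient space. For open \<open>S\<close> this
  is holomorphy on an open set; for a relatively open subset \<open>S\<close> of a complex submanifold it is
  holomorphy on that manifold (complex differentiability at every point).\<close>

definition holo :: "(complex \<Rightarrow> 'a \<Rightarrow> 'a) \<Rightarrow> 'a set \<Rightarrow> ('a::real_normed_vector \<Rightarrow> complex) \<Rightarrow> bool" where
  "holo sc S f \<longleftrightarrow>
     (\<forall>z\<in>S. \<exists>L. (f has_derivative L) (at z within S) \<and> (\<forall>c w. L (sc c w) = c * L w))"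

definition holo_vec :: "(complex \<Rightarrow> 'a \<Rightarrow> 'a) \<Rightarrow> 'a set \<Rightarrow> ('a::real_normed_vector \<Rightarrow> complex^'k) \<Rightarrow> bool" where
  "holo_vec sc S f \<longleftrightarrow> (\<forall>i. holo sc S (\<lambda>z. f z $ i))"

definition holo_mat :: "(complex \<Rightarrow> 'a \<Rightarrow> 'a) \<Rightarrow> 'a set \<Rightarrow> ('a::real_normed_vector \<Rightarrow> complex^'k^'l) \<Rightarrow> bool" where
  "holo_mat sc S f \<longleftrightarrow> (\<forall>i j. holo sc S (\<lambda>z. f z $ i $ j))"


section \<open>Half-flat spin 3/2 Grassmann structures on a coordinate domain\<close>

text \<open>\<open>M\<close> is an open subset of \<open>\<complex>\<^sup>n\<close>, and \<open>E\<close> (rank \<open>CARD('p)\<close>) and \<open>H\<close> (rank 2) are trivialised over \<open>M\<close>.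
  A matrix valued 1-form is given by its coefficients: \<open>a x $ k\<close> is the coefficient of \<open>dx\<^sup>k\<close> at \<open>x\<close>. The
  connections of \<open>E\<close> and \<open>H\<close> are \<open>d + aE\<close> and \<open>d + aH\<close>, those of the dual bundles are
  \<open>d - aE\<^sup>T\<close> and \<open>d - aH\<^sup>T\<close>.\<close>

definition form :: "(complex^'n \<Rightarrow> complex^'k^'k^'n) \<Rightarrow> complex^'n \<Rightarrow> complex^'n \<Rightarrow> complex^'k^'k" where
  "form a x v = (\<chi> i j. \<Sum>k\<in>UNIV. v $ k * a x $ k $ i $ j)"

definition holo_form :: "(complex^'n) set \<Rightarrow> (complex^'n \<Rightarrow> complex^'k^'k^'n) \<Rightarrow> bool" where
  "holo_form M a \<longleftrightarrow> (\<forall>k. holo_mat (*s) M (\<lambda>x. a x $ k))"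

text \<open>Elements of \<open>S\<^sup>3H\<close> and \<open>S\<^sup>3H\<^sup>*\<close> are symmetric tensors; \<open>sym_tensors\<close> serves as the fibre of both
  \<open>E \<otimes> S\<^sup>3H\<close> and \<open>E\<^sup>* \<otimes> S\<^sup>3H\<^sup>*\<close>.\<close>

definition sym3 :: "(complex^2^2^2) set" where
  "sym3 = {f. \<forall>a b c. f $ a $ b $ c = f $ b $ a $ c \<and> f $ a $ b $ c = f $ a $ c $ b}"

definition sym_tensors :: "(complex^2^2^2^'p) set" where
  "sym_tensors = {t. \<forall>i. t $ i \<in> sym3}"

definition sprod :: "complex^2 \<Rightarrow> complex^2 \<Rightarrow> complex^2 \<Rightarrow> complex^2^2^2" where
  "sprod p q r = (\<chi> a b c. (p$a * q$b * r$c + p$a * r$b * q$c + q$a * p$b * r$c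
                         + q$a * r$b * p$c + r$a * p$b * q$c + r$a * q$b * p$c) / 6)"

definition tens :: "complex^'p \<Rightarrow> complex^2^2^2 \<Rightarrow> complex^2^2^2^'p" where
  "tens e f = (\<chi> i a b c. e $ i * f $ a $ b $ c)"

definition pairing :: "complex^2^2^2^'p \<Rightarrow> complex^2^2^2^'p \<Rightarrow> complex" where
  "pairing s t = (\<Sum>i\<in>UNIV. \<Sum>a\<in>UNIV. \<Sum>b\<in>UNIV. \<Sum>c\<in>UNIV. s $ i $ a $ b $ c * t $ i $ a $ b $ c)"

text \<open>The isomorphism \<open>T\<^sup>*M \<cong> E \<otimes> S\<^sup>3H\<close> is encoded by the images \<open>\<sigma> x $ k\<close> of the covectors \<open>dx\<^sup>k\<close>.\<close>

definition cotangent_iso ::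
    "(complex^'n \<Rightarrow> complex^2^2^2^'p^'n) \<Rightarrow> complex^'n \<Rightarrow> complex^'n \<Rightarrow> complex^2^2^2^'p" where
  "cotangent_iso \<sigma> x \<xi> = (\<chi> i a b c. \<Sum>k\<in>UNIV. \<xi> $ k * \<sigma> x $ k $ i $ a $ b $ c)"

text \<open>The dual isomorphism \<open>E\<^sup>* \<otimes> S\<^sup>3H\<^sup>* \<rightarrow> TM\<close>, and its inverse.\<close>

definition tvec :: "(complex^'n \<Rightarrow> complex^2^2^2^'p^'n) \<Rightarrow> complex^'n \<Rightarrow> complex^2^2^2^'p \<Rightarrow> complex^'n" where
  "tvec \<sigma> x t = (\<chi> k. pairing (cotangent_iso \<sigma> x (axis k 1)) t)"

definition tvec_inv :: "(complex^'n \<Rightarrow> complex^2^2^2^'p^'n) \<Rightarrow> complex^'n \<Rightarrow> complex^'n \<Rightarrow> complex^2^2^2^'p" where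
  "tvec_inv \<sigma> x v = inv_into sym_tensors (tvec \<sigma> x) v"

definition act3 :: "complex^2^2 \<Rightarrow> complex^2^2^2 \<Rightarrow> complex^2^2^2" where
  "act3 Q f = (\<chi> a b c. (\<Sum>d\<in>UNIV. Q$a$d * f$d$b$c) + (\<Sum>d\<in>UNIV. Q$b$d * f$a$d$c)
                      + (\<Sum>d\<in>UNIV. Q$c$d * f$a$b$d))"

text \<open>The covariant derivative of a section \<open>f\<close> of \<open>F = S\<^sup>3H\<close> in direction \<open>v\<close>.\<close>

definition covF :: "(complex^'n \<Rightarrow> complex^2^2^'n) \<Rightarrow> complex^'n \<Rightarrow>
    (complex^'n \<Rightarrow> complex^2^2^2) \<Rightarrow> complex^'n \<Rightarrow> complex^2^2^2" where
  "covF aH v f x = frechet_derivative f (at x) v + act3 (form aH x v) (f x)"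

text \<open>Constant vector fields \<open>v\<close>, \<open>w\<close> commute, so their curvature needs no bracket term.\<close>

definition flat_F :: "(complex^'n) set \<Rightarrow> (complex^'n \<Rightarrow> complex^2^2^'n) \<Rightarrow> bool" where
  "flat_F M aH \<longleftrightarrow>
     (\<forall>f v w. (\<forall>a b. holo_vec (*s) M (\<lambda>x. f x $ a $ b)) \<and> (\<forall>x\<in>M. f x \<in> sym3) \<longrightarrow>
        (\<forall>x\<in>M. covF aH v (covF aH w f) x - covF aH w (covF aH v f) x = 0))"

definition omega :: "(complex^'n \<Rightarrow> complex^2^2) \<Rightarrow> complex^'n \<Rightarrow> complex^2 \<Rightarrow> complex^2 \<Rightarrow> complex" where
  "omega \<omega> x p q = (\<Sum>a\<in>UNIV. \<Sum>b\<in>UNIV. \<omega> x $ a $ b * p $ a * q $ b)"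

definition parallel_symplectic ::
    "(complex^'n) set \<Rightarrow> (complex^'n \<Rightarrow> complex^2^2^'n) \<Rightarrow> (complex^'n \<Rightarrow> complex^2^2) \<Rightarrow> bool" where
  "parallel_symplectic M aH \<omega> \<longleftrightarrow> holo_mat (*s) M \<omega> \<and>
     (\<forall>x\<in>M. transpose (\<omega> x) = - \<omega> x \<and> \<omega> x \<noteq> 0 \<and>
        (\<forall>v. frechet_derivative \<omega> (at x) v + form aH x v ** \<omega> x + \<omega> x ** transpose (form aH x v) = 0))"

definition half_flat_grassmann :: "(complex^'n) set \<Rightarrow> (complex^'n \<Rightarrow> complex^'p^'p^'n) \<Rightarrow>
    (complex^'n \<Rightarrow> complex^2^2^'n) \<Rightarrow> (complex^'n \<Rightarrow> complex^2^2) \<Rightarrow>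
    (complex^'n \<Rightarrow> complex^2^2^2^'p^'n) \<Rightarrow> bool" where
  "half_flat_grassmann M aE aH \<omega> \<sigma> \<longleftrightarrow>
     open M \<and> holo_form M aE \<and> holo_form M aH \<and> parallel_symplectic M aH \<omega> \<and> flat_F M aH \<and>
     (\<forall>k i a b. holo_vec (*s) M (\<lambda>x. \<sigma> x $ k $ i $ a $ b)) \<and>
     (\<forall>x\<in>M. bij_betw (cotangent_iso \<sigma> x) UNIV sym_tensors)"

text \<open>Parallel symplectic frame \<open>(h 1, h 2)\<close> of \<open>H\<^sup>*\<close>.\<close>

definition symplectic_frame :: "(complex^'n) set \<Rightarrow> (complex^'n \<Rightarrow> complex^2^2^'n) \<Rightarrow>
    (complex^'n \<Rightarrow> complex^2^2) \<Rightarrow> (2 \<Rightarrow> complex^'n \<Rightarrow> complex^2) \<Rightarrow> bool" where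
  "symplectic_frame M aH \<omega> h \<longleftrightarrow>
     (\<forall>\<alpha>. holo_vec (*s) M (h \<alpha>)) \<and>
     (\<forall>x\<in>M. omega \<omega> x (h 1 x) (h 2 x) = 1 \<and>
        (\<forall>\<alpha> v. frechet_derivative (h \<alpha>) (at x) v - transpose (form aH x v) *v h \<alpha> x = 0))"

text \<open>The connection on \<open>TM \<cong> E\<^sup>* \<otimes> S\<^sup>3H\<^sup>*\<close> dual to \<open>\<nabla>\<^sup>E \<otimes> Id + Id \<otimes> \<nabla>\<^sup>F\<close>.\<close>

definition cov_tensor :: "(complex^'n \<Rightarrow> complex^'p^'p^'n) \<Rightarrow> (complex^'n \<Rightarrow> complex^2^2^'n) \<Rightarrow>
    complex^'n \<Rightarrow> (complex^'n \<Rightarrow> complex^2^2^2^'p) \<Rightarrow> complex^'n \<Rightarrow> complex^2^2^2^'p" where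
  "cov_tensor aE aH v t x = frechet_derivative t (at x) v
     + (\<chi> i a b c. \<Sum>j\<in>UNIV. (- transpose (form aE x v)) $ i $ j * t x $ j $ a $ b $ c)
     + (\<chi> i. act3 (- transpose (form aH x v)) (t x $ i))"

definition covTM :: "(complex^'n \<Rightarrow> complex^'p^'p^'n) \<Rightarrow> (complex^'n \<Rightarrow> complex^2^2^'n) \<Rightarrow>
    (complex^'n \<Rightarrow> complex^2^2^2^'p^'n) \<Rightarrow>
    complex^'n \<Rightarrow> (complex^'n \<Rightarrow> complex^'n) \<Rightarrow> complex^'n \<Rightarrow> complex^'n" where
  "covTM aE aH \<sigma> v Y x = tvec \<sigma> x (cov_tensor aE aH v (\<lambda>y. tvec_inv \<sigma> y (Y y)) x)"

text \<open>The torsion tensor at \<open>x\<close>, evaluated by extending \<open>v\<close> and \<open>w\<close> to constant, hence commuting,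
  vector fields.\<close>

definition torsion :: "(complex^'n \<Rightarrow> complex^'p^'p^'n) \<Rightarrow> (complex^'n \<Rightarrow> complex^2^2^'n) \<Rightarrow>
    (complex^'n \<Rightarrow> complex^2^2^2^'p^'n) \<Rightarrow> complex^'n \<Rightarrow> complex^'n \<Rightarrow> complex^'n \<Rightarrow> complex^'n" where
  "torsion aE aH \<sigma> x v w = covTM aE aH \<sigma> v (\<lambda>_. w) x - covTM aE aH \<sigma> w (\<lambda>_. v) x"


section \<open>Harmonic space\<close>

text \<open>Points \<open>(x, u\<^sub>+, u\<^sub>-)\<close> of \<open>S\<^sub>H = M \<times> Sp(1,\<complex>)\<close>; the frame \<open>h\<^sub>\<plusminus> = u\<^sub>\<plusminus>\<^sup>\<alpha> h\<^sub>\<alpha>\<close> is symplectic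
  iff \<open>u\<^sub>+\<^sup>1 u\<^sub>-\<^sup>2 - u\<^sub>+\<^sup>2 u\<^sub>-\<^sup>1 = 1\<close>.\<close>

type_synonym 'n hpoint = "(complex^'n) \<times> (complex^2) \<times> (complex^2)"

abbreviation uplus :: "'n hpoint \<Rightarrow> complex^2" where "uplus z \<equiv> fst (snd z)"
abbreviation uminus' :: "'n hpoint \<Rightarrow> complex^2" where "uminus' z \<equiv> snd (snd z)"

definition hscale :: "complex \<Rightarrow> 'n::finite hpoint \<Rightarrow> 'n hpoint" where
  "hscale c z = (c *s fst z, c *s uplus z, c *s uminus' z)"

definition harmonic_space :: "(complex^'n) set \<Rightarrow> ('n hpoint) set" where
  "harmonic_space M = {z. fst z \<in> M \<and> uplus z $ 1 * uminus' z $ 2 - uplus z $ 2 * uminus' z $ 1 = 1}"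

text \<open>Tangent vectors of harmonic space, as vectors of the ambient space annihilated by the differential
  of the defining equation.\<close>

definition tangent :: "'n::finite hpoint \<Rightarrow> 'n hpoint \<Rightarrow> bool" where
  "tangent z w \<longleftrightarrow> uplus w $ 1 * uminus' z $ 2 + uplus z $ 1 * uminus' w $ 2
                 - uplus w $ 2 * uminus' z $ 1 - uplus z $ 2 * uminus' w $ 1 = 0"

text \<open>Directional derivative. The derivative within a relatively open subset of harmonic space is
  unique only on tangent vectors; it is never applied to others.\<close>

definition der :: "('n::finite hpoint) set \<Rightarrow> ('n hpoint \<Rightarrow> 'b::real_normed_vector) \<Rightarrow> 'n hpoint \<Rightarrow> 'n hpoint \<Rightarrow> 'b" where
  "der \<Omega> f z w = frechet_derivative f (at z within \<Omega>) w"

definition tangent_field :: "('n::finite hpoint) set \<Rightarrow> ('n hpoint \<Rightarrow> 'n hpoint) \<Rightarrow> bool" where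
  "tangent_field \<Omega> W \<longleftrightarrow> (\<forall>z\<in>\<Omega>. tangent z (W z)) \<and> holo_vec hscale \<Omega> (\<lambda>z. fst (W z)) \<and>
     holo_vec hscale \<Omega> (\<lambda>z. uplus (W z)) \<and> holo_vec hscale \<Omega> (\<lambda>z. uminus' (W z))"

definition vertical_field :: "('n::finite hpoint) set \<Rightarrow> ('n hpoint \<Rightarrow> 'n hpoint) \<Rightarrow> bool" where
  "vertical_field \<Omega> W \<longleftrightarrow> tangent_field \<Omega> W \<and> (\<forall>z\<in>\<Omega>. fst (W z) = 0)"

definition bracket :: "('n::finite hpoint) set \<Rightarrow> ('n hpoint \<Rightarrow> 'n hpoint) \<Rightarrow> ('n hpoint \<Rightarrow> 'n hpoint) \<Rightarrow>
    'n hpoint \<Rightarrow> 'n hpoint" where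
  "bracket \<Omega> X Y z = der \<Omega> Y z (X z) - der \<Omega> X z (Y z)"

definition dpp :: "'n::finite hpoint \<Rightarrow> 'n hpoint" where "dpp z = (0, 0, uplus z)"
definition dmm :: "'n::finite hpoint \<Rightarrow> 'n hpoint" where "dmm z = (0, uminus' z, 0)"
definition d0 :: "'n::finite hpoint \<Rightarrow> 'n hpoint" where "d0 z = (0, uplus z, - uminus' z)"

text \<open>As \<open>h\<close> is parallel, the horizontal lift to \<open>M \<times> Sp(1,\<complex>)\<close> has no vertical component.\<close>

definition hlift :: "complex^'n \<Rightarrow> 'n hpoint" where "hlift v = (v, 0, 0)"

definition sectionE :: "(complex^'n) set \<Rightarrow> (complex^'n \<Rightarrow> complex^'p) \<Rightarrow> bool" where
  "sectionE B e \<longleftrightarrow> holo_vec (*s) B e"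

definition Xabc :: "(complex^'n \<Rightarrow> complex^2^2^2^'p^'n) \<Rightarrow> (2 \<Rightarrow> complex^'n \<Rightarrow> complex^2) \<Rightarrow>
    (complex^'n \<Rightarrow> complex^'p) \<Rightarrow> 2 \<Rightarrow> 2 \<Rightarrow> 2 \<Rightarrow> complex^'n \<Rightarrow> complex^'n" where
  "Xabc \<sigma> h e \<alpha> \<beta> \<gamma> x = tvec \<sigma> x (tens (e x) (sprod (h \<alpha> x) (h \<beta> x) (h \<gamma> x)))"

definition Xuuu :: "(complex^'n \<Rightarrow> complex^2^2^2^'p^'n) \<Rightarrow> (2 \<Rightarrow> complex^'n \<Rightarrow> complex^2) \<Rightarrow>
    (complex^'n \<Rightarrow> complex^'p) \<Rightarrow> complex^2 \<Rightarrow> complex^2 \<Rightarrow> complex^2 \<Rightarrow> complex^'n \<Rightarrow> 'n hpoint" where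
  "Xuuu \<sigma> h e p q r x =
     (\<Sum>\<alpha>\<in>UNIV. \<Sum>\<beta>\<in>UNIV. \<Sum>\<gamma>\<in>UNIV. hscale (p $ \<alpha> * q $ \<beta> * r $ \<gamma>) (hlift (Xabc \<sigma> h e \<alpha> \<beta> \<gamma> x)))"

definition Xppp where "Xppp \<sigma> h e z = Xuuu \<sigma> h e (uplus z) (uplus z) (uplus z) (fst z)"
definition Xp where "Xp \<sigma> h e z = Xuuu \<sigma> h e (uplus z) (uplus z) (uminus' z) (fst z)"
definition Xm where "Xm \<sigma> h e z = Xuuu \<sigma> h e (uminus' z) (uminus' z) (uplus z) (fst z)"
definition Xmmm where "Xmmm \<sigma> h e z = Xuuu \<sigma> h e (uminus' z) (uminus' z) (uminus' z) (fst z)"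

text \<open>The fibres at \<open>z\<close> of the distributions \<open>D\<^sub>3\<^sub>+\<close> and \<open>D\<^sub>3\<^sub>-\<close>; these sets are linear subspaces because the
  fields depend linearly on the value of \<open>e\<close>.\<close>

definition D3p :: "(complex^'n \<Rightarrow> complex^2^2^2^'p^'n) \<Rightarrow> (2 \<Rightarrow> complex^'n \<Rightarrow> complex^2) \<Rightarrow>
    'n hpoint \<Rightarrow> ('n hpoint) set" where
  "D3p \<sigma> h z = range (\<lambda>c::complex^'p. Xppp \<sigma> h (\<lambda>_. c) z)"

definition D3m :: "(complex^'n \<Rightarrow> complex^2^2^2^'p^'n) \<Rightarrow> (2 \<Rightarrow> complex^'n \<Rightarrow> complex^2) \<Rightarrow>
    'n hpoint \<Rightarrow> ('n hpoint) set" where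
  "D3m \<sigma> h z = range (\<lambda>c::complex^'p. Xmmm \<sigma> h (\<lambda>_. c) z)"

definition zero_admissible :: "(complex^'n) set \<Rightarrow> (complex^'n \<Rightarrow> complex^'p^'p^'n) \<Rightarrow>
    (complex^'n \<Rightarrow> complex^2^2^'n) \<Rightarrow> (complex^'n \<Rightarrow> complex^2^2^2^'p^'n) \<Rightarrow>
    (2 \<Rightarrow> complex^'n \<Rightarrow> complex^2) \<Rightarrow> bool" where
  "zero_admissible M aE aH \<sigma> h \<longleftrightarrow>
     (\<forall>z\<in>harmonic_space M.
        (\<forall>v\<in>D3p \<sigma> h z. \<forall>w\<in>D3p \<sigma> h z. hlift (torsion aE aH \<sigma> (fst z) (fst v) (fst w)) \<in> D3p \<sigma> h z) \<and>
        (\<forall>v\<in>D3m \<sigma> h z. \<forall>w\<in>D3m \<sigma> h z. hlift (torsion aE aH \<sigma> (fst z) (fst v) (fst w)) \<in> D3m \<sigma> h z))"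


section \<open>Connections over harmonic space\<close>

definition comm :: "complex^'r^'r \<Rightarrow> complex^'r^'r \<Rightarrow> complex^'r^'r" where
  "comm P Q = P ** Q - Q ** P"

text \<open>A connection \<open>d + A\<close> on the trivial bundle of rank \<open>CARD('r)\<close> over \<open>\<Omega>\<close>, i.e. a holomorphic matrix
  valued 1-form: \<open>A z\<close> is linear on the tangent space at \<open>z\<close> (its values elsewhere are irrelevant), and
  \<open>A(W)\<close> is holomorphic for every holomorphic vector field \<open>W\<close>.\<close>

definition connection :: "('n::finite hpoint) set \<Rightarrow> ('n hpoint \<Rightarrow> 'n hpoint \<Rightarrow> complex^'r^'r) \<Rightarrow> bool" where
  "connection \<Omega> A \<longleftrightarrow>
     (\<forall>z\<in>\<Omega>. \<forall>v w. tangent z v \<and> tangent z w \<longrightarrow> A z (v + w) = A z v + A z w) \<and>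
     (\<forall>z\<in>\<Omega>. \<forall>c w. tangent z w \<longrightarrow> A z (hscale c w) = mat c ** A z w) \<and>
     (\<forall>W. tangent_field \<Omega> W \<longrightarrow> holo_mat hscale \<Omega> (\<lambda>z. A z (W z)))"

text \<open>The curvature \<open>F(X,Y) = X(A(Y)) - Y(A(X)) + [A(X),A(Y)] - A([X,Y])\<close>.\<close>

definition curvature :: "('n::finite hpoint) set \<Rightarrow> ('n hpoint \<Rightarrow> 'n hpoint \<Rightarrow> complex^'r^'r) \<Rightarrow>
    ('n hpoint \<Rightarrow> 'n hpoint) \<Rightarrow> ('n hpoint \<Rightarrow> 'n hpoint) \<Rightarrow> 'n hpoint \<Rightarrow> complex^'r^'r" where
  "curvature \<Omega> A X Y z =
     der \<Omega> (\<lambda>y. A y (Y y)) z (X z) - der \<Omega> (\<lambda>y. A y (X y)) z (Y z)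
     + comm (A z (X z)) (A z (Y z)) - A z (bracket \<Omega> X Y z)"

text \<open>Sections of \<open>E\<^sup>*\<close> are taken over the whole projection of \<open>\<Omega>\<close> to \<open>M\<close>. As \<open>E\<close> is trivial and all
  conditions are local and tensorial in \<open>e\<close>, this amounts to the same as allowing local sections.\<close>

definition almost_0_partially_flat :: "(complex^'n \<Rightarrow> complex^2^2^2^'p^'n) \<Rightarrow> (2 \<Rightarrow> complex^'n \<Rightarrow> complex^2) \<Rightarrow>
    ('n hpoint) set \<Rightarrow> ('n hpoint \<Rightarrow> 'n hpoint \<Rightarrow> complex^'r^'r) \<Rightarrow> bool" where
  "almost_0_partially_flat \<sigma> h \<Omega> A \<longleftrightarrow>
     (\<forall>e e'. sectionE (fst ` \<Omega>) e \<and> sectionE (fst ` \<Omega>) e' \<longrightarrow>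
        (\<forall>z\<in>\<Omega>. curvature \<Omega> A (Xppp \<sigma> h e) (Xppp \<sigma> h e') z = 0)) \<and>
     (\<forall>e v. sectionE (fst ` \<Omega>) e \<and> vertical_field \<Omega> v \<longrightarrow>
        (\<forall>z\<in>\<Omega>. curvature \<Omega> A (Xppp \<sigma> h e) v z = 0 \<and>
               curvature \<Omega> A (Xp \<sigma> h e) v z = 0 \<and> curvature \<Omega> A (Xm \<sigma> h e) v z = 0)) \<and>
     (\<forall>W. tangent_field \<Omega> W \<longrightarrow>
        (\<forall>z\<in>\<Omega>. curvature \<Omega> A dpp W z = 0 \<and> curvature \<Omega> A d0 W z = 0))"

definition frame :: "('n::finite hpoint) set \<Rightarrow> ('n hpoint \<Rightarrow> complex^'r^'r) \<Rightarrow> bool" where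
  "frame \<Omega> \<psi> \<longleftrightarrow> holo_mat hscale \<Omega> \<psi> \<and> (\<forall>z\<in>\<Omega>. invertible (\<psi> z))"

text \<open>The columns of \<open>\<psi>\<close> are parallel along \<open>D\<^sub>3\<^sub>+\<close> and \<open>\<partial>\<^sub>0\<close>.\<close>

definition analytic_frame :: "(complex^'n \<Rightarrow> complex^2^2^2^'p^'n) \<Rightarrow> (2 \<Rightarrow> complex^'n \<Rightarrow> complex^2) \<Rightarrow>
    ('n hpoint) set \<Rightarrow> ('n hpoint \<Rightarrow> 'n hpoint \<Rightarrow> complex^'r^'r) \<Rightarrow> ('n hpoint \<Rightarrow> complex^'r^'r) \<Rightarrow> bool" where
  "analytic_frame \<sigma> h \<Omega> A \<psi> \<longleftrightarrow> frame \<Omega> \<psi> \<and>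
     (\<forall>z\<in>\<Omega>. der \<Omega> \<psi> z (d0 z) + A z (d0 z) ** \<psi> z = 0 \<and>
        (\<forall>e. sectionE (fst ` \<Omega>) e \<longrightarrow>
           der \<Omega> \<psi> z (Xppp \<sigma> h e z) + A z (Xppp \<sigma> h e z) ** \<psi> z = 0))"

text \<open>The connection 1-form of \<open>d + A\<close> with respect to the frame \<open>\<psi>\<close>.\<close>

definition potential :: "('n::finite hpoint) set \<Rightarrow> ('n hpoint \<Rightarrow> complex^'r^'r) \<Rightarrow>
    ('n hpoint \<Rightarrow> 'n hpoint \<Rightarrow> complex^'r^'r) \<Rightarrow> 'n hpoint \<Rightarrow> 'n hpoint \<Rightarrow> complex^'r^'r" where
  "potential \<Omega> \<psi> A z w = matrix_inv (\<psi> z) ** A z w ** \<psi> z + matrix_inv (\<psi> z) ** der \<Omega> \<psi> z w"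

definition prepotential :: "(complex^'n \<Rightarrow> complex^2^2^2^'p^'n) \<Rightarrow> (2 \<Rightarrow> complex^'n \<Rightarrow> complex^2) \<Rightarrow>
    ('n hpoint) set \<Rightarrow> ('n hpoint \<Rightarrow> complex^'r^'r) \<Rightarrow> bool" where
  "prepotential \<sigma> h \<Omega> App \<longleftrightarrow> holo_mat hscale \<Omega> App \<and>
     (\<forall>z\<in>\<Omega>. der \<Omega> App z (d0 z) = 2 *\<^sub>R App z \<and>
        (\<forall>e. sectionE (fst ` \<Omega>) e \<longrightarrow> der \<Omega> App z (Xppp \<sigma> h e z) = 0))"

definition solves_bridge :: "('n::finite hpoint) set \<Rightarrow> ('n hpoint \<Rightarrow> complex^'r^'r) \<Rightarrow>
    ('n hpoint \<Rightarrow> complex^'r^'r) \<Rightarrow> bool" where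
  "solves_bridge \<Omega> App \<Phi> \<longleftrightarrow> frame \<Omega> \<Phi> \<and>
     (\<forall>z\<in>\<Omega>. der \<Omega> \<Phi> z (dpp z) = - (App z ** \<Phi> z) \<and> der \<Omega> \<Phi> z (d0 z) = 0)"

definition Amm :: "('n::finite hpoint) set \<Rightarrow> ('n hpoint \<Rightarrow> complex^'r^'r) \<Rightarrow> 'n hpoint \<Rightarrow> complex^'r^'r" where
  "Amm \<Omega> \<Phi> z = - (der \<Omega> \<Phi> z (dmm z) ** matrix_inv (\<Phi> z))"

definition has_potentials :: "(complex^'n \<Rightarrow> complex^2^2^2^'p^'n) \<Rightarrow> (2 \<Rightarrow> complex^'n \<Rightarrow> complex^2) \<Rightarrow>
    ('n hpoint) set \<Rightarrow> ('n hpoint \<Rightarrow> complex^'r^'r) \<Rightarrow> ('n hpoint \<Rightarrow> complex^'r^'r) \<Rightarrow>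
    ('n hpoint \<Rightarrow> 'n hpoint \<Rightarrow> complex^'r^'r) \<Rightarrow> bool" where
  "has_potentials \<sigma> h \<Omega> App \<Phi> A \<longleftrightarrow>
     (\<forall>z\<in>\<Omega>. A z (dpp z) = App z \<and> A z (dmm z) = Amm \<Omega> \<Phi> z \<and> A z (d0 z) = 0) \<and>
     (\<forall>e. sectionE (fst ` \<Omega>) e \<longrightarrow> (\<forall>z\<in>\<Omega>.
        A z (Xppp \<sigma> h e z) = 0 \<and>
        A z (Xp \<sigma> h e z) = - ((1/3) *\<^sub>R der \<Omega> (Amm \<Omega> \<Phi>) z (Xppp \<sigma> h e z)) \<and>
        A z (Xm \<sigma> h e z) = (1/2) *\<^sub>R (der \<Omega> (\<lambda>y. A y (Xp \<sigma> h e y)) z (dmm z)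
             - der \<Omega> (Amm \<Omega> \<Phi>) z (Xp \<sigma> h e z) + comm (Amm \<Omega> \<Phi> z) (A z (Xp \<sigma> h e z))) \<and>
        A z (Xmmm \<sigma> h e z) = der \<Omega> (\<lambda>y. A y (Xm \<sigma> h e y)) z (dmm z)
             - der \<Omega> (Amm \<Omega> \<Phi>) z (Xm \<sigma> h e z) + comm (Amm \<Omega> \<Phi> z) (A z (Xm \<sigma> h e z))))"

end

theory Submission
  imports Defs "HOL-Complex_Analysis.Cauchy_Integral_Formula"
begin

text \<open>
  In the gauge \<open>\<Phi>\<close> (parallel along \<open>\<partial>\<^sub>+\<^sub>+\<close> and \<open>\<partial>\<^sub>0\<close>) all
  vertical potentials vanish, and \<open>F(\<partial>\<^sub>-\<^sub>-, X) = 0\<close> computes \<open>A(X\<^sub>+), A(X\<^sub>-), A(X\<^sub>-\<^sub>-\<^sub>-)\<close> successively from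
  \<open>A(X\<^sub>+\<^sub>+\<^sub>+) = \<Phi>\<^sup>-\<^sup>1 X\<^sub>+\<^sub>+\<^sub>+ \<Phi>\<close> by applying \<open>\<partial>\<^sub>-\<^sub>-\<close>. These functions form a finite-dimensional
  representation of \<open>sl\<^sub>2\<close>, which yields the remaining vanishing components of the curvature. Conversely, flatness
  along the integrable distributions gives analytic frames and local solutions \<open>\<Phi>\<close>. The global \<open>\<Phi>\<close>
  comes from linear ordinary differential equations in the two charts \<open>u\<^sub>+\<^sup>\<alpha> \<noteq> 0\<close>; on the overlap the two
  solutions differ by a function of \<open>x\<close> alone.
\<close>

section \<open>Holomorphic functions of several variables\<close>

text \<open>Three obstacles shape the development. Holomorphy is given only as complex
  differentiability at each point, and on the hypersurface of harmonic space derivatives are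
  determined on tangent vectors only; so second derivatives are built from Cauchy estimates, and
  calculus is moved to an open set by the retraction \<open>rho\<close>. Next, parallel frames along
  an involutive distribution are needed with holomorphic parameters. A commuting frame is normalised
  against constant functionals, one radial equation is solved by iteration, and its solution turns
  out to be parallel; the fields are not constant, so each iteration costs a derivative, as in the
  Cauchy-Kovalevskaya theorem. Finally, the equations along \<open>dpp\<close> and \<open>d0\<close>
  alone leave on the overlap of the charts a freedom depending on x and the direction of u_+, the
  transition matrix of a possibly nontrivial bundle over projective lines; only the
  \<open>dmm\<close> equation, available in the converse, reduces it to a function of x. The factors
  1/3, 1/2, 1 come from [\<open>dmm\<close>, \<open>Y m\<close>] = (3 - m) \<open>Y (m+1)\<close>,
  the action on cubic monomials in u_+ and u_-.\<close>

abbreviation fd :: "('a::real_normed_vector \<Rightarrow> 'b::real_normed_vector) \<Rightarrow> 'a \<Rightarrow> 'a \<Rightarrow> 'b" where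
  "fd f z w \<equiv> frechet_derivative f (at z) w"

lemma fd_eqI: "(f has_derivative L) (at z) \<Longrightarrow> fd f z w = L w"
  by (metis frechet_derivative_at)

text \<open>The complex structure is a parameter, because the same calculus is used for
  \<open>hscale\<close> on points of harmonic space and for \<open>*s\<close> on the base. By
  \<open>norm_sc\<close>, a complex line through a point in direction w is parametrised
  isometrically up to the factor \<open>norm w\<close>.\<close>

locale complex_scaling =
  fixes sc :: "complex \<Rightarrow> 'a::euclidean_space \<Rightarrow> 'a"
  assumes sc_add_left: "sc (a + b) w = sc a w + sc b w"
    and sc_add_right: "sc a (v + w) = sc a v + sc a w"
    and sc_sc: "sc a (sc b w) = sc (a * b) w"
    and sc_of_real: "sc (of_real r) w = r *\<^sub>R w"
    and norm_sc: "norm (sc a w) = norm a * norm w"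
begin

lemma bounded_bilinear_sc: "bounded_bilinear sc"
proof
  show "sc (r *\<^sub>R a) b = r *\<^sub>R sc a b" for r a b
    by (simp add: scaleR_conv_of_real sc_sc[symmetric] sc_of_real)
  show "sc a (r *\<^sub>R b) = r *\<^sub>R sc a b" for r a b
    by (metis sc_of_real sc_sc mult.commute)
  show "\<exists>K. \<forall>a b. norm (sc a b) \<le> norm a * norm b * K"
    by (intro exI[of _ 1]) (simp add: norm_sc)
qed (simp_all add: sc_add_left sc_add_right)

sublocale sc: bounded_bilinear sc
  by (rule bounded_bilinear_sc)

declare sc.zero_left [simp] sc.zero_right [simp]

lemma sc_1 [simp]: "sc 1 w = w"
  using sc_of_real[of 1 w] by simp

text \<open>Fields are maps of the space to itself, so that shifts along a field and the retraction
  \<open>rho\<close> are instances as well and can be composed with functions.\<close>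

definition holo_fld :: "'a set \<Rightarrow> ('a \<Rightarrow> 'a) \<Rightarrow> bool" where
  "holo_fld S X \<longleftrightarrow> (\<forall>z\<in>S. \<exists>L. (X has_derivative L) (at z within S) \<and> (\<forall>c w. L (sc c w) = sc c (L w)))"

lemma holo_fldD:
  assumes "holo_fld S X" "open S" "z \<in> S"
  shows "(X has_derivative fd X z) (at z)" "fd X z (sc c w) = sc c (fd X z w)"
proof -
  obtain L where L: "(X has_derivative L) (at z within S)" "\<And>c w. L (sc c w) = sc c (L w)"
    using assms by (auto simp: holo_fld_def)
  have "(X has_derivative L) (at z)"
    using L(1) assms at_within_open by metis
  moreover from this have "L = fd X z" by (rule frechet_derivative_at)
  ultimately show "(X has_derivative fd X z) (at z)" "fd X z (sc c w) = sc c (fd X z w)"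
    using L(2) by simp_all
qed

lemma holoD:
  assumes "holo sc S f" "open S" "z \<in> S"
  shows "(f has_derivative fd f z) (at z)" "fd f z (sc c w) = c * fd f z w"
proof -
  obtain L where L: "(f has_derivative L) (at z within S)" "\<And>c w. L (sc c w) = c * L w"
    using assms by (auto simp: holo_def)
  have "(f has_derivative L) (at z)"
    using L(1) assms at_within_open by metis
  moreover from this have "L = fd f z" by (rule frechet_derivative_at)
  ultimately show "(f has_derivative fd f z) (at z)" "fd f z (sc c w) = c * fd f z w"
    using L(2) by simp_all
qed

lemma fd_linear:
  assumes "holo sc S f" "open S" "z \<in> S"
  shows "bounded_linear (fd f z)"
  using holoD(1)[OF assms] has_derivative_bounded_linear by blast

section \<open>Closure properties of holomorphic functions and fields\<close>

lemma holoI: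
  assumes "\<And>z. z \<in> S \<Longrightarrow> (f has_derivative L z) (at z within S)"
    and "\<And>z c w. z \<in> S \<Longrightarrow> L z (sc c w) = c * L z w"
  shows "holo sc S f"
  using assms unfolding holo_def by blast

lemma holoE:
  assumes "holo sc S f" "z \<in> S"
  obtains L where "(f has_derivative L) (at z within S)" "\<And>c w. L (sc c w) = c * L w"
  using assms unfolding holo_def by blast

lemma holo_fldE:
  assumes "holo_fld S f" "z \<in> S"
  obtains L where "(f has_derivative L) (at z within S)" "\<And>c w. L (sc c w) = sc c (L w)"
  using assms unfolding holo_fld_def by blast

lemma holo_subset: "holo sc S f \<Longrightarrow> T \<subseteq> S \<Longrightarrow> holo sc T f"
  unfolding holo_def by (meson has_derivative_subset subset_iff)

lemma holo_continuous_on: "holo sc S f \<Longrightarrow> continuous_on S f"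
  unfolding holo_def continuous_on_eq_continuous_within
  by (meson has_derivative_continuous)

lemma holo_fld_continuous_on: "holo_fld S f \<Longrightarrow> continuous_on S f"
  unfolding holo_fld_def continuous_on_eq_continuous_within
  by (meson has_derivative_continuous)

lemma holo_const [simp]: "holo sc S (\<lambda>_. k)"
  by (rule holoI[where L = "\<lambda>_ _. 0"]) auto

lemma holo_add:
  assumes "holo sc S f" "holo sc S g"
  shows "holo sc S (\<lambda>z. f z + g z)"
  unfolding holo_def
proof
  fix z assume z: "z \<in> S"
  obtain L where L: "(f has_derivative L) (at z within S)" "\<And>c w. L (sc c w) = c * L w"
    using holoE[OF assms(1) z] by blast
  obtain K where K: "(g has_derivative K) (at z within S)" "\<And>c w. K (sc c w) = c * K w"
    using holoE[OF assms(2) z] by blast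
  show "\<exists>L. ((\<lambda>z. f z + g z) has_derivative L) (at z within S) \<and> (\<forall>c w. L (sc c w) = c * L w)"
    using has_derivative_add[OF L(1) K(1)] L(2) K(2)
    by (intro exI[of _ "\<lambda>h. L h + K h"]) (auto simp: algebra_simps)
qed

lemma holo_diff:
  assumes "holo sc S f" "holo sc S g"
  shows "holo sc S (\<lambda>z. f z - g z)"
  unfolding holo_def
proof
  fix z assume z: "z \<in> S"
  obtain L where L: "(f has_derivative L) (at z within S)" "\<And>c w. L (sc c w) = c * L w"
    using holoE[OF assms(1) z] by blast
  obtain K where K: "(g has_derivative K) (at z within S)" "\<And>c w. K (sc c w) = c * K w"
    using holoE[OF assms(2) z] by blast
  show "\<exists>L. ((\<lambda>z. f z - g z) has_derivative L) (at z within S) \<and> (\<forall>c w. L (sc c w) = c * L w)"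
    using has_derivative_diff[OF L(1) K(1)] L(2) K(2)
    by (intro exI[of _ "\<lambda>h. L h - K h"]) (auto simp: algebra_simps)
qed

lemma holo_minus: "holo sc S f \<Longrightarrow> holo sc S (\<lambda>z. - f z)"
  using holo_diff[OF holo_const[of S 0]] by simp

lemma holo_mult:
  assumes "holo sc S f" "holo sc S g"
  shows "holo sc S (\<lambda>z. f z * g z)"
  unfolding holo_def
proof
  fix z assume z: "z \<in> S"
  obtain L where L: "(f has_derivative L) (at z within S)" "\<And>c w. L (sc c w) = c * L w"
    using holoE[OF assms(1) z] by blast
  obtain K where K: "(g has_derivative K) (at z within S)" "\<And>c w. K (sc c w) = c * K w"
    using holoE[OF assms(2) z] by blast
  show "\<exists>L. ((\<lambda>z. f z * g z) has_derivative L) (at z within S) \<and> (\<forall>c w. L (sc c w) = c * L w)"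
    using has_derivative_mult[OF L(1) K(1)] L(2) K(2)
    by (intro exI[of _ "\<lambda>h. f z * K h + L h * g z"]) (auto simp: algebra_simps)
qed

lemma holo_sum: "(\<And>i. i \<in> A \<Longrightarrow> holo sc S (f i)) \<Longrightarrow> holo sc S (\<lambda>z. \<Sum>i\<in>A. f i z)"
  by (induction A rule: infinite_finite_induct) (auto intro: holo_add)

lemma holo_prod: "(\<And>i. i \<in> A \<Longrightarrow> holo sc S (f i)) \<Longrightarrow> holo sc S (\<lambda>z. \<Prod>i\<in>A. f i z)"
  by (induction A rule: infinite_finite_induct) (auto intro: holo_mult)

lemma holo_inverse:
  assumes "holo sc S f" "\<And>z. z \<in> S \<Longrightarrow> f z \<noteq> 0"
  shows "holo sc S (\<lambda>z. inverse (f z))"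
  unfolding holo_def
proof (intro ballI)
  fix z assume z: "z \<in> S"
  obtain L where L: "(f has_derivative L) (at z within S)" "\<And>c w. L (sc c w) = c * L w"
    using holoE[OF assms(1) z] by blast
  show "\<exists>L. ((\<lambda>z. inverse (f z)) has_derivative L) (at z within S) \<and> (\<forall>c w. L (sc c w) = c * L w)"
    using Deriv.has_derivative_inverse[OF assms(2)[OF z] L(1)] L(2)
    by (intro exI[of _ "\<lambda>h. - (inverse (f z) * L h * inverse (f z))"]) auto
qed

lemma holo_divide:
  assumes "holo sc S f" "holo sc S g" "\<And>z. z \<in> S \<Longrightarrow> g z \<noteq> 0"
  shows "holo sc S (\<lambda>z. f z / g z)"
  using holo_mult[OF assms(1) holo_inverse[OF assms(2,3)]] by (simp add: divide_inverse)

lemma holo_cong_imp: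
  assumes "holo sc S f" "\<And>z. z \<in> S \<Longrightarrow> f z = g z"
  shows "holo sc S g"
  unfolding holo_def
proof
  fix z assume z: "z \<in> S"
  obtain L where L: "(f has_derivative L) (at z within S)" "\<And>c w. L (sc c w) = c * L w"
    using holoE[OF assms(1) z] by blast
  have "(g has_derivative L) (at z within S)"
    by (rule has_derivative_transform[OF z _ L(1)]) (simp add: assms(2))
  then show "\<exists>L. (g has_derivative L) (at z within S) \<and> (\<forall>c w. L (sc c w) = c * L w)"
    using L(2) by blast
qed

lemma holo_fld_subset: "holo_fld S f \<Longrightarrow> T \<subseteq> S \<Longrightarrow> holo_fld T f"
  unfolding holo_fld_def by (meson has_derivative_subset subset_iff)

lemma holo_fld_const [simp]: "holo_fld S (\<lambda>_. k)"
  unfolding holo_fld_def by (intro ballI exI[of _ "\<lambda>_. 0"]) (auto simp: sc.zero_right)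

lemma holo_fld_id [simp]: "holo_fld S (\<lambda>z. z)"
  unfolding holo_fld_def by (intro ballI exI[of _ "\<lambda>w. w"]) auto

lemma holo_fld_add:
  assumes "holo_fld S f" "holo_fld S g"
  shows "holo_fld S (\<lambda>z. f z + g z)"
  unfolding holo_fld_def
proof (intro ballI)
  fix z assume z: "z \<in> S"
  obtain L where L: "(f has_derivative L) (at z within S)" "\<And>c w. L (sc c w) = sc c (L w)"
    using holo_fldE[OF assms(1) z] by blast
  obtain K where K: "(g has_derivative K) (at z within S)" "\<And>c w. K (sc c w) = sc c (K w)"
    using holo_fldE[OF assms(2) z] by blast
  show "\<exists>L. ((\<lambda>z. f z + g z) has_derivative L) (at z within S) \<and> (\<forall>c w. L (sc c w) = sc c (L w))"
    using has_derivative_add[OF L(1) K(1)] L(2) K(2)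
    by (intro exI[of _ "\<lambda>h. L h + K h"]) (auto simp: sc.add_right)
qed

lemma holo_fld_diff:
  assumes "holo_fld S f" "holo_fld S g"
  shows "holo_fld S (\<lambda>z. f z - g z)"
  unfolding holo_fld_def
proof (intro ballI)
  fix z assume z: "z \<in> S"
  obtain L where L: "(f has_derivative L) (at z within S)" "\<And>c w. L (sc c w) = sc c (L w)"
    using holo_fldE[OF assms(1) z] by blast
  obtain K where K: "(g has_derivative K) (at z within S)" "\<And>c w. K (sc c w) = sc c (K w)"
    using holo_fldE[OF assms(2) z] by blast
  show "\<exists>L. ((\<lambda>z. f z - g z) has_derivative L) (at z within S) \<and> (\<forall>c w. L (sc c w) = sc c (L w))"
    using has_derivative_diff[OF L(1) K(1)] L(2) K(2)
    by (intro exI[of _ "\<lambda>h. L h - K h"]) (auto simp: sc.diff_right)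
qed

lemma holo_fld_sc:
  assumes "holo sc S f" "holo_fld S g"
  shows "holo_fld S (\<lambda>z. sc (f z) (g z))"
  unfolding holo_fld_def
proof
  fix z assume z: "z \<in> S"
  obtain L where L: "(f has_derivative L) (at z within S)" "\<And>c w. L (sc c w) = c * L w"
    using holoE[OF assms(1) z] by blast
  obtain K where K: "(g has_derivative K) (at z within S)" "\<And>c w. K (sc c w) = sc c (K w)"
    using holo_fldE[OF assms(2) z] by blast
  show "\<exists>L. ((\<lambda>z. sc (f z) (g z)) has_derivative L) (at z within S) \<and> (\<forall>c w. L (sc c w) = sc c (L w))"
    using sc.FDERIV[OF L(1) K(1)] L(2) K(2)
    by (intro exI[of _ "\<lambda>h. sc (f z) (K h) + sc (L h) (g z)"])
       (auto simp: sc.add_right sc_sc mult.commute)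
qed

lemma holo_fld_sum: "(\<And>i. i \<in> A \<Longrightarrow> holo_fld S (f i)) \<Longrightarrow> holo_fld S (\<lambda>z. \<Sum>i\<in>A. f i z)"
  by (induction A rule: infinite_finite_induct) (auto intro: holo_fld_add)

lemma holo_compose_fld:
  assumes f: "holo sc T f" and X: "holo_fld S X" and "X ` S \<subseteq> T"
  shows "holo sc S (\<lambda>z. f (X z))"
  unfolding holo_def
proof (intro ballI)
  fix z assume z: "z \<in> S"
  obtain K where K: "(X has_derivative K) (at z within S)" "\<And>c w. K (sc c w) = sc c (K w)"
    using holo_fldE[OF X z] by blast
  have Xz: "X z \<in> T" using z assms(3) by blast
  obtain L where L: "(f has_derivative L) (at (X z) within T)" "\<And>c w. L (sc c w) = c * L w"
    using holoE[OF f Xz] by blast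
  have "((\<lambda>z. f (X z)) has_derivative (\<lambda>w. L (K w))) (at z within S)"
    using has_derivative_in_compose[OF K(1)] has_derivative_subset[OF L(1) assms(3)] by blast
  then show "\<exists>L. ((\<lambda>z. f (X z)) has_derivative L) (at z within S) \<and> (\<forall>c w. L (sc c w) = c * L w)"
    using K(2) L(2) by auto
qed

section \<open>Cauchy estimates on complex lines and locally uniform limits\<close>

lemma holo_field_derivative_line:
  assumes "holo sc S f" "open S" "z + sc \<zeta> w \<in> S"
  shows "((\<lambda>\<zeta>. f (z + sc \<zeta> w)) has_field_derivative fd f (z + sc \<zeta> w) w) (at \<zeta>)"
proof -
  have 1: "((\<lambda>\<zeta>. z + sc \<zeta> w) has_derivative (\<lambda>h. sc h w)) (at \<zeta>)"
    by (auto intro!: derivative_eq_intros bounded_linear_imp_has_derivative sc.bounded_linear_left)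
  have "((\<lambda>\<zeta>. f (z + sc \<zeta> w)) has_derivative (\<lambda>h. fd f (z + sc \<zeta> w) (sc h w))) (at \<zeta>)"
    using has_derivative_compose[OF 1 holoD(1)[OF assms]] by simp
  moreover have "fd f (z + sc \<zeta> w) (sc h w) = fd f (z + sc \<zeta> w) w * h" for h
    using holoD(2)[OF assms] by (simp add: mult.commute)
  ultimately show ?thesis by (simp add: has_field_derivative_def)
qed

text \<open>The Cauchy inequality in one variable, for the restriction of f to the complex line
  through z in direction w. The vector w is not normalised, so r is a radius in the parameter of the
  line.\<close>

lemma fd_Cauchy:
  assumes f: "holo sc S f" "open S" and r: "r > 0"
    and in_S: "\<And>\<zeta>. norm \<zeta> \<le> r \<Longrightarrow> z + sc \<zeta> w \<in> S"
    and B: "\<And>\<zeta>. norm \<zeta> \<le> r \<Longrightarrow> norm (f (z + sc \<zeta> w)) \<le> B"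
  shows "norm (fd f z w) \<le> B / r"
proof -
  let ?F = "\<lambda>\<zeta>. f (z + sc \<zeta> w)"
  have der: "(?F has_field_derivative fd f (z + sc \<zeta> w) w) (at \<zeta>)" if "norm \<zeta> \<le> r" for \<zeta>
    using holo_field_derivative_line[OF f in_S[OF that]] .
  have "?F holomorphic_on ball 0 r"
    by (rule holomorphic_onI, rule field_differentiable_at_within)
      (use der in \<open>force simp: field_differentiable_def\<close>)
  moreover have "continuous_on (cball 0 r) ?F"
    by (rule DERIV_continuous_on) (use der in \<open>auto intro: has_field_derivative_at_within\<close>)
  ultimately have "norm ((deriv ^^ 1) ?F 0) \<le> fact 1 * B / r ^ 1"
    by (rule Cauchy_inequality) (use r B in auto)
  moreover have "deriv ?F 0 = fd f z w"
    using der[of 0] r by (auto intro: DERIV_imp_deriv)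
  ultimately show ?thesis by simp
qed

text \<open>The remainder is quadratic with a constant that depends only on the bound B and the
  radius; this uniformity makes difference quotients converge uniformly.\<close>

lemma Taylor_line:
  assumes f: "holo sc S f" "open S" and r: "r > 0"
    and in_S: "\<And>\<zeta>. norm \<zeta> < r \<Longrightarrow> z + sc \<zeta> w \<in> S"
    and B: "\<And>\<zeta>. norm \<zeta> < r \<Longrightarrow> norm (f (z + sc \<zeta> w)) \<le> B"
    and \<zeta>: "norm \<zeta> < r / 2"
  shows "norm (f (z + sc \<zeta> w) - f z - \<zeta> * fd f z w) \<le> 32 * B / r\<^sup>2 * norm \<zeta> ^ 2"
proof -
  let ?F = "\<lambda>\<zeta>. f (z + sc \<zeta> w)"
  have der: "(?F has_field_derivative fd f (z + sc \<zeta> w) w) (at \<zeta>)" if "norm \<zeta> < r" for \<zeta>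
    using holo_field_derivative_line[OF f in_S[OF that]] .
  have hol: "?F holomorphic_on ball 0 r"
    by (rule holomorphic_onI, rule field_differentiable_at_within)
      (use der in \<open>force simp: field_differentiable_def\<close>)
  have der2: "((deriv ^^ i) ?F has_field_derivative (deriv ^^ Suc i) ?F x) (at x within ball 0 (r/2))"
    if "x \<in> ball 0 (r/2)" for i x
    using has_field_derivative_higher_deriv[OF hol, of x i] that r
    by (auto intro: has_field_derivative_at_within)
  have B2: "norm ((deriv ^^ Suc 1) ?F x) \<le> 32 * B / r\<^sup>2" if x: "x \<in> ball 0 (r/2)" for x
  proof -
    \<comment> \<open>Discs of radius r/4 about points of the disc of radius r/2 stay in the disc of
      radius r; the second Cauchy inequality gives 2 B / (r/4)^2 = 32 B / r^2.\<close>
    have "norm ((deriv ^^ Suc 1) ?F x) \<le> fact (Suc 1) * B / (r/4) ^ Suc 1"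
    proof (rule Cauchy_inequality)
      have sub: "cball x (r/4) \<subseteq> ball 0 r"
      proof
        fix y assume "y \<in> cball x (r/4)"
        then have "norm y \<le> norm x + r/4"
          using norm_triangle_ineq2[of y x] by (simp add: dist_norm norm_minus_commute)
        then show "y \<in> ball 0 r" using x r by simp
      qed
      then show "?F holomorphic_on ball x (r/4)" "continuous_on (cball x (r/4)) ?F"
        using hol holomorphic_on_subset holomorphic_on_imp_continuous_on ball_subset_cball by (metis order.trans)+
      show "norm (?F y) \<le> B" if "norm (x - y) = r/4" for y
        using sub that by (intro B) (auto simp: subset_iff dist_norm)
    qed (use r in auto)
    then show ?thesis by (simp add: power2_eq_square field_simps)
  qed
  have "norm ((deriv ^^ 0) ?F \<zeta> - (\<Sum>i\<le>1. (deriv ^^ i) ?F 0 * (\<zeta> - 0) ^ i / fact i))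
     \<le> 32 * B / r\<^sup>2 * norm (\<zeta> - 0) ^ Suc 1 / fact 1"
    using \<zeta> r der2 B2
    by (intro complex_Taylor[where S = "ball 0 (r/2)" and f = "\<lambda>i. (deriv ^^ i) ?F"]) auto
  moreover have "deriv ?F 0 = fd f z w"
    using der[of 0] r by (auto intro: DERIV_imp_deriv)
  ultimately show ?thesis by (simp add: algebra_simps numeral_2_eq_2)
qed


text \<open>The theorem of Weierstrass on limits. By the Cauchy estimate, uniform closeness of the
  functions on the ball forces closeness of the derivatives on the half ball, up to an error
  proportional to \<open>norm w\<close>; this is the hypothesis under which limit and derivative may
  be exchanged.\<close>

lemma holo_limit_ball:
  assumes f: "\<And>n. holo sc (ball a r) (f n)" and r: "r > 0"
    and lim: "uniform_limit (ball a r) f g sequentially"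
    and z: "z \<in> ball a (r/2)"
  shows "(g has_derivative fd g z) (at z)" "fd g z (sc c w) = c * fd g z w"
    "(\<lambda>n. fd (f n) z w) \<longlonglongrightarrow> fd g z w"
proof -
  have sub: "ball a (r/2) \<subseteq> ball a r" using r by auto
  \<comment> \<open>From the half ball a displacement of at most r/4 stays in the ball; this is the
    parameter radius r / (4 norm w) and the origin of the factor 4 / r.\<close>
  have diff: "norm (fd (f n) z w - fd (f m) z w) \<le> 4 * e / r * norm w"
    if e: "\<And>x. x \<in> ball a r \<Longrightarrow> norm (f n x - f m x) \<le> e" and z: "z \<in> ball a (r/2)" for n m e z w
  proof (cases "w = 0")
    case True
    then show ?thesis
      using fd_linear[OF f, of z n] fd_linear[OF f, of z m] z sub
      by (auto simp: linear_simps)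
  next
    case False
    have in_ball: "z + sc \<zeta> w \<in> ball a r" if "norm \<zeta> \<le> r / (4 * norm w)" for \<zeta>
    proof -
      have "norm (sc \<zeta> w) \<le> r / 4" using that False by (simp add: norm_sc field_simps)
      then show ?thesis
        using z r norm_triangle_ineq4[of "a - z" "sc \<zeta> w"] by (simp add: dist_norm algebra_simps)
    qed
    have zr: "z \<in> ball a r" using z sub by auto
    have "norm (fd (\<lambda>x. f n x - f m x) z w) \<le> e / (r / (4 * norm w))"
      by (rule fd_Cauchy[OF holo_diff[OF f f]]) (use r False in_ball e in auto)
    moreover have "fd (\<lambda>x. f n x - f m x) z w = fd (f n) z w - fd (f m) z w"
      by (rule fd_eqI) (intro has_derivative_diff holoD(1)[OF f] open_ball zr)
    ultimately show ?thesis using False r by (simp add: field_simps)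
  qed
  have Cauchy: "\<exists>N. \<forall>n\<ge>N. \<forall>m\<ge>N. \<forall>z\<in>ball a (r/2). \<forall>w. norm (fd (f n) z w - fd (f m) z w) \<le> e * norm w"
    if "e > 0" for e
  proof -
    have "e * r / 8 > 0" using that r by simp
    then obtain N where N: "\<And>n x. n \<ge> N \<Longrightarrow> x \<in> ball a r \<Longrightarrow> dist (f n x) (g x) < e * r / 8"
      using lim unfolding uniform_limit_iff eventually_sequentially by blast
    show ?thesis
    proof (intro exI[of _ N] allI ballI impI)
      fix n m z w assume nm: "n \<ge> N" "m \<ge> N" and z: "z \<in> ball a (r/2)"
      have "norm (fd (f n) z w - fd (f m) z w) \<le> 4 * (e * r / 4) / r * norm w"
      proof (rule diff[OF _ z])
        fix x assume x: "x \<in> ball a r"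
        have "dist (f n x) (f m x) \<le> dist (f n x) (g x) + dist (f m x) (g x)"
          by (rule dist_triangle2)
        then show "norm (f n x - f m x) \<le> e * r / 4"
          using N[OF nm(1) x] N[OF nm(2) x] by (simp add: dist_norm)
      qed
      then show "norm (fd (f n) z w - fd (f m) z w) \<le> e * norm w" using r by simp
    qed
  qed
  define g' where "g' z w = lim (\<lambda>n. fd (f n) z w)" for z w
  have g': "(\<lambda>n. fd (f n) z w) \<longlonglongrightarrow> g' z w" if "z \<in> ball a (r/2)" for z w
  proof -
    have "Cauchy (\<lambda>n. fd (f n) z w)"
    proof (rule CauchyI)
      fix e :: real assume e: "e > 0"
      have "e / (2 * (norm w + 1)) > 0" using e by (intro divide_pos_pos mult_pos_pos add_nonneg_pos) auto
      from Cauchy[OF this] obtain N where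
        "\<forall>n\<ge>N. \<forall>m\<ge>N. \<forall>z\<in>ball a (r/2). \<forall>w'. norm (fd (f n) z w' - fd (f m) z w') \<le> e / (2 * (norm w + 1)) * norm w'"
        by (elim exE)
      then have N: "\<forall>n\<ge>N. \<forall>m\<ge>N. norm (fd (f n) z w - fd (f m) z w) \<le> e / (2 * (norm w + 1)) * norm w"
        using that by simp
      have less: "e / (2 * (norm w + 1)) * norm w < e"
      proof -
        have "0 < 2 * (norm w + 1)" by (intro mult_pos_pos add_nonneg_pos) auto
        moreover have "e * norm w < e * (2 * (norm w + 1))"
          using e by (simp add: algebra_simps add_nonneg_pos)
        ultimately show ?thesis by (simp only: times_divide_eq_left pos_divide_less_eq)
      qed
      show "\<exists>N. \<forall>m\<ge>N. \<forall>n\<ge>N. norm (fd (f m) z w - fd (f n) z w) < e"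
        by (intro exI[of _ N] allI impI le_less_trans[OF _ less]) (use N in blast)
    qed
    then show ?thesis
      by (simp add: g'_def Cauchy_convergent_iff convergent_LIMSEQ_iff)
  qed
  have nle: "\<forall>\<^sub>F n in sequentially. \<forall>z\<in>ball a (r/2). \<forall>w. norm (fd (f n) z w - g' z w) \<le> e * norm w"
    if e: "e > 0" for e
  proof -
    obtain N where N: "\<forall>n\<ge>N. \<forall>m\<ge>N. \<forall>z\<in>ball a (r/2). \<forall>w. norm (fd (f n) z w - fd (f m) z w) \<le> e * norm w"
      using Cauchy[OF e] by blast
    show ?thesis unfolding eventually_sequentially
    proof (intro exI[of _ N] allI ballI impI)
      fix n z w assume n: "n \<ge> N" and z: "z \<in> ball a (r/2)"
      have "(\<lambda>m. norm (fd (f n) z w - fd (f m) z w)) \<longlonglongrightarrow> norm (fd (f n) z w - g' z w)"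
        by (intro tendsto_intros g'[OF z])
      then show "norm (fd (f n) z w - g' z w) \<le> e * norm w"
        by (rule Lim_bounded[where M = N]) (use N n z in blast)
    qed
  qed
  have "\<exists>G. \<forall>x\<in>ball a (r/2). (\<lambda>n. f n x) \<longlonglongrightarrow> G x \<and> (G has_derivative g' x) (at x within ball a (r/2))"
  proof (rule has_derivative_sequence[OF convex_ball _ nle])
    show "(f n has_derivative fd (f n) x) (at x within ball a (r/2))" if "x \<in> ball a (r/2)" for n x
      by (rule has_derivative_at_withinI, rule holoD(1)[OF f open_ball]) (use that sub in auto)
    show "z \<in> ball a (r/2)" by fact
    show "(\<lambda>n. f n z) \<longlonglongrightarrow> g z"
      by (rule tendsto_uniform_limitI[OF lim]) (use z sub in auto)
  qed
  then obtain G where G: "\<And>x. x \<in> ball a (r/2) \<Longrightarrow> (\<lambda>n. f n x) \<longlonglongrightarrow> G x"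
    "\<And>x. x \<in> ball a (r/2) \<Longrightarrow> (G has_derivative g' x) (at x within ball a (r/2))"
    by blast
  have Gg: "G x = g x" if "x \<in> ball a (r/2)" for x
    using G(1)[OF that] tendsto_uniform_limitI[OF lim, of x] that sub LIMSEQ_unique by blast
  have der: "(g has_derivative g' z) (at z)"
    by (rule has_derivative_transform_within_open[of G _ _ UNIV "ball a (r/2)"])
      (use G(2)[OF z] Gg z at_within_open[OF z open_ball] in auto)
  then have g'fd: "g' z = fd g z" by (rule frechet_derivative_at)
  show "(g has_derivative fd g z) (at z)" using der g'fd by simp
  show "(\<lambda>n. fd (f n) z w) \<longlonglongrightarrow> fd g z w" for w using g'[OF z] g'fd by simp
  have "fd (f n) z (sc c w) = c * fd (f n) z w" for n
    using holoD(2)[OF f] z sub by blast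
  moreover have "(\<lambda>n. c * fd (f n) z w) \<longlonglongrightarrow> c * g' z w"
    by (intro tendsto_intros g'[OF z])
  ultimately have "(\<lambda>n. fd (f n) z (sc c w)) \<longlonglongrightarrow> c * g' z w" by simp
  then show "fd g z (sc c w) = c * fd g z w"
    using g'[OF z, of "sc c w"] LIMSEQ_unique g'fd by metis
qed

text \<open>The shift by N is there for difference quotients along a field: near a given point the
  shifted arguments stay in S only for large n, with a threshold that depends on the point.\<close>

lemma holo_limit:
  assumes "open S"
    and "\<And>a. a \<in> S \<Longrightarrow> \<exists>r N. r > 0 \<and> (\<forall>n. holo sc (ball a r) (f (n + N))) \<and>
           uniform_limit (ball a r) (\<lambda>n. f (n + N)) g sequentially"
  shows "holo sc S g" "z \<in> S \<Longrightarrow> (\<lambda>n. fd (f n) z w) \<longlonglongrightarrow> fd g z w"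
proof -
  have *: "(g has_derivative fd g z) (at z)" "\<And>c w. fd g z (sc c w) = c * fd g z w"
    "\<And>w. (\<lambda>n. fd (f n) z w) \<longlonglongrightarrow> fd g z w" if z: "z \<in> S" for z
  proof -
    obtain r N where r: "r > 0" "\<And>n. holo sc (ball z r) (f (n + N))"
      "uniform_limit (ball z r) (\<lambda>n. f (n + N)) g sequentially"
      using assms(2)[OF z] by blast
    have zz: "z \<in> ball z (r/2)" using r(1) by simp
    note L = holo_limit_ball[OF r(2,1,3) zz]
    show "(g has_derivative fd g z) (at z)" "\<And>c w. fd g z (sc c w) = c * fd g z w"
      using L(1,2) by auto
    show "(\<lambda>n. fd (f n) z w) \<longlonglongrightarrow> fd g z w" for w
      using L(3)[of w] by (rule LIMSEQ_offset)
  qed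
  show "holo sc S g"
    by (rule holoI[where L = "fd g"]) (use * has_derivative_at_withinI in blast)+
  show "z \<in> S \<Longrightarrow> (\<lambda>n. fd (f n) z w) \<longlonglongrightarrow> fd g z w" using *(3) .
qed

text \<open>The Taylor remainder is of order 1/n^2, so after multiplication by n the quotients
  converge at rate 1/n, uniformly on a small ball.\<close>

lemma difference_quotient:
  assumes f: "holo sc S f" "open S" and X: "holo_fld S X" and a: "a \<in> S"
  defines "q \<equiv> \<lambda>n z. of_nat n * (f (z + sc (1 / of_nat n) (X z)) - f z)"
  shows "\<exists>r N. r > 0 \<and> (\<forall>n. holo sc (ball a r) (q (n + N))) \<and>
    (\<forall>n. \<forall>z\<in>ball a r. z + sc (1 / of_nat (n + N)) (X z) \<in> S) \<and>
    uniform_limit (ball a r) (\<lambda>n. q (n + N)) (\<lambda>z. fd f z (X z)) sequentially"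
proof -
  obtain r0 where r0: "r0 > 0" "cball a r0 \<subseteq> S"
    using f(2) a open_contains_cball by blast
  have "compact (f ` cball a r0)" "compact (X ` cball a r0)"
    using r0 f X by (auto intro!: compact_continuous_image intro: continuous_on_subset holo_continuous_on holo_fld_continuous_on)
  then obtain B C where B: "\<And>z. z \<in> cball a r0 \<Longrightarrow> norm (f z) \<le> B"
    and C: "\<And>z. z \<in> cball a r0 \<Longrightarrow> norm (X z) \<le> C" "C > 0"
    by (metis (no_types, lifting) bounded_pos compact_imp_bounded imageI)
  define r where "r = r0 / 2"
  \<comment> \<open>C bounds the field, so parameters below s = r / C move points of
    \<open>ball a r\<close> by at most r = r0 / 2 and hence keep them in
    \<open>cball a r0\<close>.\<close>
  define s where "s = r / C"
  have pos: "r > 0" "s > 0" using r0 C by (auto simp: r_def s_def)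
  have sub: "ball a r \<subseteq> S" "ball a r \<subseteq> cball a r0" using r0 by (auto simp: r_def)
  have line: "z + sc \<zeta> (X z) \<in> cball a r0" if z: "z \<in> ball a r" and \<zeta>: "norm \<zeta> < s" for z \<zeta>
  proof -
    have "norm (sc \<zeta> (X z)) \<le> s * C"
      using C z sub \<zeta> pos by (auto simp: norm_sc intro!: mult_mono)
    then have "norm (sc \<zeta> (X z)) \<le> r" using C by (simp add: s_def)
    then show ?thesis
      using z norm_triangle_ineq4[of "a - z" "sc \<zeta> (X z)"] by (simp add: dist_norm algebra_simps r_def)
  qed
  obtain N :: nat where N: "N > 0" "1 / real N < s / 2"
    using pos by (metis half_gt_zero nat_approx_posE of_nat_0_less_iff zero_less_Suc)
  have small: "norm (1 / of_nat (n + N) :: complex) < s / 2" for n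
  proof -
    have "1 / real (n + N) \<le> 1 / real N" using N(1) by (simp add: frac_le)
    moreover have "norm (1 / of_nat (n + N) :: complex) = 1 / real (n + N)"
      by (simp only: norm_divide norm_of_nat norm_one)
    ultimately show ?thesis using N(2) by simp
  qed
  have inS: "z + sc (1 / of_nat (n + N)) (X z) \<in> S" if "z \<in> ball a r" for z n
    using line[OF that] small[of n] pos r0 by fastforce
  have hol: "holo sc (ball a r) (q (n + N))" for n
    unfolding q_def
  proof (intro holo_mult holo_const holo_diff)
    have "holo_fld (ball a r) (\<lambda>z. z + sc (1 / of_nat (n + N)) (X z))"
      using holo_fld_subset[OF X sub(1)] by (intro holo_fld_add holo_fld_sc) auto
    then show "holo sc (ball a r) (\<lambda>z. f (z + sc (1 / of_nat (n + N)) (X z)))"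
      by (rule holo_compose_fld[OF f(1)]) (use inS in auto)
    show "holo sc (ball a r) f" using f sub holo_subset by blast
  qed
  have bound: "norm (q (n + N) z - fd f z (X z)) \<le> 32 * B / s\<^sup>2 / real (n + N)" if z: "z \<in> ball a r" for n z
  proof -
    let ?m = "of_nat (n + N) :: complex"
    have "norm (f (z + sc (1 / ?m) (X z)) - f z - 1 / ?m * fd f z (X z)) \<le> 32 * B / s\<^sup>2 * norm (1 / ?m) ^ 2"
      by (rule Taylor_line[OF f pos(2)]) (use line[OF z] r0 B small in auto)
    then have "real (n + N) * norm (f (z + sc (1 / ?m) (X z)) - f z - 1 / ?m * fd f z (X z))
        \<le> real (n + N) * (32 * B / s\<^sup>2 * norm (1 / ?m) ^ 2)"
      by (rule mult_left_mono) simp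
    also have "\<dots> = 32 * B / s\<^sup>2 / real (n + N)"
      using N(1) by (simp add: norm_divide power2_eq_square field_simps flip: of_nat_add)
    also have "real (n + N) * norm (f (z + sc (1 / ?m) (X z)) - f z - 1 / ?m * fd f z (X z))
      = norm (?m * (f (z + sc (1 / ?m) (X z)) - f z - 1 / ?m * fd f z (X z)))"
      by (simp only: norm_mult norm_of_nat)
    also have "?m * (f (z + sc (1 / ?m) (X z)) - f z - 1 / ?m * fd f z (X z)) = q (n + N) z - fd f z (X z)"
      using N(1) by (simp add: q_def right_diff_distrib del: of_nat_add)
    finally show ?thesis .
  qed
  have "uniform_limit (ball a r) (\<lambda>n. q (n + N)) (\<lambda>z. fd f z (X z)) sequentially"
    unfolding uniform_limit_iff
  proof (intro allI impI)
    fix e :: real assume e: "e > 0"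
    have "(\<lambda>n. 32 * B / s\<^sup>2 / real (n + N)) \<longlonglongrightarrow> 0"
      by (rule LIMSEQ_ignore_initial_segment[OF lim_const_over_n])
    then have "\<forall>\<^sub>F n in sequentially. 32 * B / s\<^sup>2 / real (n + N) < e"
      using e order_tendstoD(2) by blast
    then show "\<forall>\<^sub>F n in sequentially. \<forall>x\<in>ball a r. dist (q (n + N) x) (fd f x (X x)) < e"
      unfolding dist_norm by eventually_elim (use bound in \<open>blast intro: le_less_trans\<close>)
  qed
  then show ?thesis using pos(1) hol inS by blast
qed

text \<open>The derivative along a field is a locally uniform limit of holomorphic difference
  quotients; integral formulas in several variables are thereby avoided, and iteration gives higher
  derivatives.\<close>

lemma holo_fd_fld:
  assumes "holo sc S f" "open S" "holo_fld S X"
  shows "holo sc S (\<lambda>z. fd f z (X z))"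
  by (rule holo_limit(1)[OF assms(2), where f = "\<lambda>n z. of_nat n * (f (z + sc (1 / of_nat n) (X z)) - f z)"])
    (use difference_quotient[OF assms] in blast)

lemma holo_fd: "holo sc S f \<Longrightarrow> open S \<Longrightarrow> holo sc S (\<lambda>z. fd f z w)"
  by (rule holo_fd_fld) auto

text \<open>Obtained by differentiating the difference quotients: the n-th one splits into a
  quotient of \<open>fd f\<close> in direction v and the value of \<open>fd f\<close> at the shifted
  point on the derivative of X. For a constant X the identity is the symmetry of the second
  derivative.\<close>

lemma fd_fd_fld:
  assumes f: "holo sc S f" "open S" and X: "holo_fld S X" and z: "z \<in> S"
  shows "fd (\<lambda>y. fd f y (X y)) z v = fd (\<lambda>y. fd f y v) z (X z) + fd f z (fd X z v)"
proof -
  let ?q = "\<lambda>n z. of_nat n * (f (z + sc (1 / of_nat n) (X z)) - f z)"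
  let ?p = "\<lambda>n z. of_nat n * (fd f (z + sc (1 / of_nat n) (X z)) v - fd f z v)"
  obtain r N where rN: "r > 0" "\<And>n y. y \<in> ball z r \<Longrightarrow> y + sc (1 / of_nat (n + N)) (X y) \<in> S"
    using difference_quotient[OF f X z] by blast
  have lim1: "(\<lambda>n. fd (?q n) z v) \<longlonglongrightarrow> fd (\<lambda>y. fd f y (X y)) z v"
    by (rule holo_limit(2)[OF f(2)]) (use difference_quotient[OF f X] z in blast)+
  obtain r' N' where r': "r' > 0"
    "uniform_limit (ball z r') (\<lambda>n. ?p (n + N')) (\<lambda>z. fd (\<lambda>y. fd f y v) z (X z)) sequentially"
    using difference_quotient[OF holo_fd[OF f] f(2) X z] by blast
  have lim2: "(\<lambda>n. ?p n z) \<longlonglongrightarrow> fd (\<lambda>y. fd f y v) z (X z)"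
    by (rule LIMSEQ_offset[where k = N']) (use tendsto_uniform_limitI[OF r'(2), of z] r'(1) in auto)
  have "continuous_on S (\<lambda>y. fd f y (fd X z v))"
    by (rule holo_continuous_on[OF holo_fd[OF f]])
  then have "isCont (\<lambda>y. fd f y (fd X z v)) z"
    using f(2) z by (simp add: continuous_on_eq_continuous_at)
  moreover have "(\<lambda>n. z + sc (1 / of_nat n) (X z)) \<longlonglongrightarrow> z + sc 0 (X z)"
    by (intro tendsto_intros sc.tendsto lim_1_over_n)
  ultimately have lim3: "(\<lambda>n. fd f (z + sc (1 / of_nat n) (X z)) (fd X z v)) \<longlonglongrightarrow> fd f z (fd X z v)"
    using isCont_tendsto_compose by fastforce
  have eq: "fd (?q n) z v = ?p n z + fd f (z + sc (1 / of_nat n) (X z)) (fd X z v)" if n: "n > N" for n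
  proof -
    let ?y = "z + sc (1 / of_nat n) (X z)"
    have y: "?y \<in> S" using rN(2)[of z "n - N"] rN(1) n by simp
    have dy: "((\<lambda>z. z + sc (1 / of_nat n) (X z)) has_derivative (\<lambda>h. h + sc (1 / of_nat n) (fd X z h))) (at z)"
      by (intro has_derivative_add has_derivative_ident
          bounded_linear.has_derivative[OF sc.bounded_linear_right] holo_fldD(1)[OF X f(2) z])
    have "(?q n has_derivative (\<lambda>h. of_nat n * (fd f ?y (h + sc (1 / of_nat n) (fd X z h)) - fd f z h))) (at z)"
      by (intro has_derivative_mult_right has_derivative_diff has_derivative_compose[OF dy holoD(1)[OF f y]]
          holoD(1)[OF f z])
    then have "fd (?q n) z v = of_nat n * (fd f ?y (v + sc (1 / of_nat n) (fd X z v)) - fd f z v)"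
      by (rule fd_eqI)
    also have "fd f ?y (v + sc (1 / of_nat n) (fd X z v)) = fd f ?y v + 1 / of_nat n * fd f ?y (fd X z v)"
      using fd_linear[OF f y] holoD(2)[OF f y] by (simp add: linear_simps)
    finally have "fd (?q n) z v = ?p n z + of_nat n * (1 / of_nat n) * fd f ?y (fd X z v)"
      by (simp only: algebra_simps)
    then show ?thesis using n by simp
  qed
  have "(\<lambda>n. fd (?q n) z v) \<longlonglongrightarrow> fd (\<lambda>y. fd f y v) z (X z) + fd f z (fd X z v)"
    by (rule Lim_transform_eventually[OF tendsto_add[OF lim2 lim3]])
      (use eq in \<open>auto simp: eventually_at_top_dense intro!: exI[of _ N]\<close>)
  then show ?thesis using lim1 LIMSEQ_unique by blast
qed

lemma fd_bracket:
  assumes f: "holo sc S f" "open S" and X: "holo_fld S X" and Y: "holo_fld S Y" and z: "z \<in> S"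
  shows "fd (\<lambda>y. fd f y (Y y)) z (X z) - fd (\<lambda>y. fd f y (X y)) z (Y z)
       = fd f z (fd Y z (X z) - fd X z (Y z))"
proof -
  have sym: "fd (\<lambda>y. fd f y w) z v = fd (\<lambda>y. fd f y v) z w" for v w
    using fd_fd_fld[OF f holo_fld_const[of S w] z, of v] fd_linear[OF f z]
    by (simp add: linear_simps)
  show ?thesis
    using fd_linear[OF f z] sym
    by (simp add: fd_fd_fld[OF f X z] fd_fd_fld[OF f Y z] linear_simps)
qed


lemma holo_series:
  assumes S: "open S" and f: "\<And>n. holo sc S (f n)"
    and bound: "\<And>a. a \<in> S \<Longrightarrow> \<exists>r M. r > 0 \<and> summable M \<and> (\<forall>n. \<forall>z\<in>ball a r \<inter> S. norm (f n z) \<le> M n)"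
  shows "holo sc S (\<lambda>z. \<Sum>n. f n z)" "z \<in> S \<Longrightarrow> (\<lambda>n. fd (f n) z w) sums fd (\<lambda>z. \<Sum>n. f n z) z w"
    "z \<in> S \<Longrightarrow> summable (\<lambda>n. f n z)"
proof -
  have *: "\<exists>r N. r > 0 \<and> (\<forall>n. holo sc (ball a r) (\<lambda>z. \<Sum>i<n + N. f i z)) \<and>
     uniform_limit (ball a r) (\<lambda>n z. \<Sum>i<n + N. f i z) (\<lambda>z. \<Sum>n. f n z) sequentially" if a: "a \<in> S" for a
  proof -
    obtain r1 M where r1: "r1 > 0" "summable M" "\<And>n z. z \<in> ball a r1 \<inter> S \<Longrightarrow> norm (f n z) \<le> M n"
      using bound[OF a] by blast
    obtain r2 where r2: "r2 > 0" "ball a r2 \<subseteq> S"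
      using S a open_contains_ball by blast
    have "uniform_limit (ball a (min r1 r2)) (\<lambda>n z. \<Sum>i<n. f i z) (\<lambda>z. \<Sum>n. f n z) sequentially"
      by (rule Weierstrass_m_test[OF _ r1(2)]) (use r1 r2 in auto)
    moreover have "holo sc (ball a (min r1 r2)) (\<lambda>z. \<Sum>i<n. f i z)" for n
      using r2 by (intro holo_sum holo_subset[OF f]) auto
    ultimately show ?thesis
      using r1 r2 by (intro exI[of _ "min r1 r2"] exI[of _ 0]) auto
  qed
  show "holo sc S (\<lambda>z. \<Sum>n. f n z)"
    by (rule holo_limit(1)[OF S *])
  show "(\<lambda>n. fd (f n) z w) sums fd (\<lambda>z. \<Sum>n. f n z) z w" if z: "z \<in> S"
  proof -
    have "(\<lambda>n. fd (\<lambda>z. \<Sum>i<n. f i z) z w) \<longlonglongrightarrow> fd (\<lambda>z. \<Sum>n. f n z) z w"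
      by (rule holo_limit(2)[OF S * z])
    moreover have "fd (\<lambda>z. \<Sum>i<n. f i z) z w = (\<Sum>i<n. fd (f i) z w)" for n
      by (rule fd_eqI) (intro has_derivative_sum holoD(1)[OF f S z])
    ultimately show ?thesis by (simp add: sums_def)
  qed
  show "summable (\<lambda>n. f n z)" if z: "z \<in> S"
    using bound[OF z] z by (meson IntI centre_in_ball summable_comparison_test')
qed

end

lemma has_derivative_vec:
  fixes f :: "'a::real_normed_vector \<Rightarrow> 'b::real_normed_vector ^ 'n"
  assumes "\<And>i. ((\<lambda>x. f x $ i) has_derivative (\<lambda>w. L w $ i)) F"
  shows "(f has_derivative L) F"
proof -
  have lin: "bounded_linear (axis i :: 'b::real_normed_vector \<Rightarrow> 'b ^ 'n)" for i
  proof (rule bounded_linear_intro[where K = 1])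
    fix x :: 'b
    have "(\<Sum>j\<in>UNIV. (norm (axis i x $ j))\<^sup>2) = (\<Sum>j\<in>UNIV. if j = i then (norm x)\<^sup>2 else 0)"
      by (intro sum.cong) (auto simp: axis_def)
    then show "norm (axis i x :: 'b ^ 'n) \<le> norm x * 1"
      by (simp add: norm_vec_def L2_set_def)
  qed (auto simp: axis_def vec_eq_iff)
  have eq: "x = (\<Sum>i\<in>UNIV. axis i (x $ i))" for x :: "'b ^ 'n"
    by (simp add: vec_eq_iff axis_def sum.delta if_distrib cong: if_cong)
  have "((\<lambda>x. \<Sum>i\<in>UNIV. axis i (f x $ i)) has_derivative (\<lambda>w. \<Sum>i\<in>UNIV. axis i (L w $ i))) F"
    by (intro has_derivative_sum) (rule bounded_linear.has_derivative[OF lin assms])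
  then show ?thesis by (simp flip: eq)
qed

lemma has_derivative_vec_nth: "(f has_derivative L) F \<Longrightarrow> ((\<lambda>x. f x $ i) has_derivative (\<lambda>w. L w $ i)) F"
  by (rule bounded_linear.has_derivative[OF bounded_linear_vec_nth])

section \<open>Integration along rays\<close>

text \<open>P is a complex linear projection. Moving along a ray scales only the P-part of z - z0,
  so integration along rays solves equations in the P-directions with the complementary coordinates
  as holomorphic parameters.\<close>

locale radial = complex_scaling sc for sc :: "complex \<Rightarrow> 'a::euclidean_space \<Rightarrow> 'a" +
  fixes P :: "'a \<Rightarrow> 'a" and z0 :: 'a
  assumes P_linear: "bounded_linear P" and P_sc: "P (sc c w) = sc c (P w)" and P_P: "P (P w) = P w"
begin

definition ray :: "real \<Rightarrow> 'a \<Rightarrow> 'a" where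
  "ray s z = z - (1 - s) *\<^sub>R P (z - z0)"

definition star_shaped :: "'a set \<Rightarrow> bool" where
  "star_shaped S \<longleftrightarrow> open S \<and> (\<forall>z\<in>S. \<forall>s\<in>{0..1}. ray s z \<in> S)"

lemma P_ray: "P (ray s z - z0) = s *\<^sub>R P (z - z0)"
  using P_linear by (simp add: ray_def linear_simps P_P algebra_simps)

lemma ray_1 [simp]: "ray 1 z = z"
  by (simp add: ray_def)

lemma ray_ray: "ray s (ray t z) = ray (s * t) z"
  using P_ray[of t z] by (simp add: ray_def algebra_simps)

lemma ray_has_derivative: "(ray s has_derivative (\<lambda>w. w - (1 - s) *\<^sub>R P w)) (at z within S)"
  unfolding ray_def
  by (auto intro!: derivative_eq_intros bounded_linear.has_derivative[OF P_linear])

lemma continuous_on_ray: "continuous_on A (\<lambda>(s, z). ray s z)"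
  unfolding ray_def case_prod_beta
  by (intro continuous_intros bounded_linear.continuous_on[OF P_linear])

lemma ray_vector_derivative: "((\<lambda>s. ray s z) has_vector_derivative P (z - z0)) (at s within A)"
  unfolding ray_def by (auto intro!: derivative_eq_intros)

lemma fd_along_ray:
  assumes f: "holo sc S f" and S: "star_shaped S" and z: "z \<in> S" and s: "s \<in> {0..1}"
  shows "((\<lambda>s. f (ray s z)) has_vector_derivative fd f (ray s z) (P (z - z0))) (at s within {0..1})"
proof -
  have o: "open S" and m: "ray s z \<in> S" using S z s by (auto simp: star_shaped_def)
  have "((\<lambda>s. f (ray s z)) has_derivative (\<lambda>h. fd f (ray s z) (h *\<^sub>R P (z - z0)))) (at s within {0..1})"
    using has_derivative_compose[OF ray_vector_derivative[unfolded has_vector_derivative_def] holoD(1)[OF f o m]]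
    by simp
  then show ?thesis
    using fd_linear[OF f o m] by (simp add: has_vector_derivative_def linear_simps)
qed

lemma continuous_on_along_ray:
  assumes "holo sc S f" "star_shaped S" "z \<in> S"
  shows "continuous_on {0..1} (\<lambda>s. f (ray s z))"
  unfolding continuous_on_eq_continuous_within
  using fd_along_ray[OF assms] has_vector_derivative_continuous by blast

text \<open>The integrand is the derivative of s f(\<open>ray s z\<close>) in s; the factor s
  removes the boundary term at s = 0.\<close>

lemma euler_integral:
  assumes f: "holo sc S f" and S: "star_shaped S" and z: "z \<in> S"
  shows "((\<lambda>s. f (ray s z) + fd f (ray s z) (P (ray s z - z0))) has_integral f z) {0..1}"
proof -
  have "((\<lambda>s. f (ray s z) + fd f (ray s z) (P (ray s z - z0))) has_integral
      (of_real 1 * f (ray 1 z) - of_real 0 * f (ray 0 z))) {0..1}"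
  proof (rule fundamental_theorem_of_calculus)
    fix s :: real assume s: "s \<in> {0..1}"
    have m: "ray s z \<in> S" and o: "open S" using S z s by (auto simp: star_shaped_def)
    have "fd f (ray s z) (P (ray s z - z0)) = of_real s * fd f (ray s z) (P (z - z0))"
      using fd_linear[OF f o m] by (simp add: P_ray linear_simps scaleR_conv_of_real)
    then show "((\<lambda>s. of_real s * f (ray s z)) has_vector_derivative
        f (ray s z) + fd f (ray s z) (P (ray s z - z0))) (at s within {0..1})"
      by (auto intro!: derivative_eq_intros fd_along_ray[OF f S z s])
  qed simp
  then show ?thesis by simp
qed

text \<open>Integrating s^k over the unit interval yields 1 / (k + 1). This gain per integration
  produces the factorials in \<open>ode_exists\<close> and pays for the derivative lost in
  \<open>nagumo_step\<close>.\<close>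

lemma euler_bound:
  assumes f: "holo sc S f" and S: "star_shaped S" and z: "z \<in> S"
    and eq: "\<And>y. y \<in> S \<Longrightarrow> f y + fd f y (P (y - z0)) = g y"
    and bound: "\<And>s. s \<in> {0..1} \<Longrightarrow> norm (g (ray s z)) \<le> Q * s ^ k"
  shows "norm (f z) \<le> Q / (k + 1)"
proof -
  have "((\<lambda>s. g (ray s z)) has_integral f z) {0..1}"
    by (rule has_integral_eq[OF _ euler_integral[OF f S z]]) (use S z eq in \<open>auto simp: star_shaped_def\<close>)
  moreover have "((\<lambda>s. Q * s ^ k) has_integral Q / (k + 1) * 1 ^ Suc k - Q / (k + 1) * 0 ^ Suc k) {0..1}"
  proof (rule fundamental_theorem_of_calculus)
    fix s :: real
    have "((\<lambda>s. Q / (k + 1) * s ^ Suc k) has_real_derivative Q / (k + 1) * (real (Suc k) * s ^ k)) (at s within {0..1})"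
      by (rule derivative_eq_intros refl)+ simp
    then show "((\<lambda>s. Q / (k + 1) * s ^ Suc k) has_vector_derivative Q * s ^ k) (at s within {0..1})"
      by (simp add: has_real_derivative_iff_has_vector_derivative add.commute)
  qed simp
  then have "((\<lambda>s. Q * s ^ k) has_integral Q / (k + 1)) {0..1}" by simp
  ultimately show ?thesis
    using bound by (metis has_integral_iff integral_norm_bound_integral)
qed

text \<open>The inverse of 1 plus the Euler field of P. The summand 1 makes the operator invertible
  at z0; multiplying \<open>euler_inv g\<close> by a function that is linear in the P-part of z - z0
  then gives a radial primitive.\<close>

definition euler_inv :: "('a \<Rightarrow> complex) \<Rightarrow> 'a \<Rightarrow> complex" where
  "euler_inv g z = integral {0..1} (\<lambda>s. g (ray s z))"

lemma euler_inv:
  assumes g: "holo sc S g" and S: "star_shaped S"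
  shows "holo sc S (euler_inv g)" "z \<in> S \<Longrightarrow> euler_inv g z + fd (euler_inv g) z (P (z - z0)) = g z"
proof -
  have o: "open S" using S by (simp add: star_shaped_def)
  have rS: "ray s z \<in> S" if "z \<in> S" "s \<in> {0..1}" for s z using S that by (simp add: star_shaped_def)
  have *: "(euler_inv g has_derivative (\<lambda>w. integral {0..1} (\<lambda>s. fd g (ray s z) (w - (1 - s) *\<^sub>R P w)))) (at z)"
    "(\<lambda>s. fd g (ray s z) (w - (1 - s) *\<^sub>R P w)) integrable_on {0..1}"
    if z: "z \<in> S" for z w
  proof -
    obtain r where r: "r > 0" "ball z r \<subseteq> S" using o z open_contains_ball by blast
    \<comment> \<open>The derivative of the integrand as a bounded linear operator, jointly
      continuous in the point and the parameter, for differentiation under the integral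
      sign.\<close>
    define D where "D x s = Blinfun (\<lambda>w. fd g (ray s x) (w - (1 - s) *\<^sub>R P w))" for x s
    have D: "blinfun_apply (D x s) = (\<lambda>w. fd g (ray s x) (w - (1 - s) *\<^sub>R P w))"
      if "x \<in> S" "s \<in> {0..1}" for x s
      unfolding D_def
      by (rule bounded_linear_Blinfun_apply)
        (intro bounded_linear_compose[OF fd_linear[OF g o rS[OF that]]] bounded_linear_intros P_linear)
    have cont: "continuous_on (ball z r \<times> cbox 0 1) (\<lambda>(x, s). D x s)"
    proof (rule continuous_on_blinfun_componentwise)
      fix i :: 'a assume "i \<in> Basis"
      have c: "continuous_on (ball z r \<times> cbox 0 1) (\<lambda>p. fd g (ray (snd p) (fst p)) v)" for v
      proof (rule continuous_on_compose2[OF holo_continuous_on[OF holo_fd[OF g o]]])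
        have "continuous_on (ball z r \<times> cbox 0 (1::real)) ((\<lambda>(s, z). ray s z) \<circ> (\<lambda>p. (snd p, fst p)))"
          by (intro continuous_on_compose continuous_intros continuous_on_ray)
        then show "continuous_on (ball z r \<times> cbox 0 1) (\<lambda>p. ray (snd p) (fst p))"
          by (simp add: o_def)
      qed (use r rS in auto)
      have "continuous_on (ball z r \<times> cbox 0 1)
          (\<lambda>p. fd g (ray (snd p) (fst p)) i - of_real (1 - snd p) * fd g (ray (snd p) (fst p)) (P i))"
        by (intro continuous_intros c)
      then show "continuous_on (ball z r \<times> cbox 0 1) (\<lambda>p. blinfun_apply (case p of (x, s) \<Rightarrow> D x s) i)"
      proof (rule continuous_on_eq)
        fix p assume "p \<in> ball z r \<times> cbox 0 (1::real)"
        then have p: "fst p \<in> S" "snd p \<in> {0..1}" using r by auto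
        show "fd g (ray (snd p) (fst p)) i - of_real (1 - snd p) * fd g (ray (snd p) (fst p)) (P i)
            = blinfun_apply (case p of (x, s) \<Rightarrow> D x s) i"
          using fd_linear[OF g o rS[OF p]] by (simp add: case_prod_beta D[OF p] linear_simps scaleR_conv_of_real)
      qed
    qed
    have int: "(\<lambda>s. g (ray s x)) integrable_on cbox 0 1" if "x \<in> S" for x
      using continuous_on_along_ray[OF g S that] by (auto intro: integrable_continuous_interval)
    have "((\<lambda>x. integral (cbox 0 1) (\<lambda>s. g (ray s x))) has_derivative
        blinfun_apply (integral (cbox 0 1) (D z))) (at z within ball z r)"
    proof (rule leibniz_rule[where f = "\<lambda>x s. g (ray s x)", OF _ int cont])
      fix x and s :: real assume x: "x \<in> ball z r" and s: "s \<in> cbox 0 1"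
      then have xs: "x \<in> S" "s \<in> {0..1}" using r by auto
      show "((\<lambda>x. g (ray s x)) has_derivative blinfun_apply (D x s)) (at x within ball z r)"
        unfolding D[OF xs] by (rule has_derivative_compose[OF ray_has_derivative holoD(1)[OF g o rS[OF xs]]])
    qed (use r in auto)
    moreover have cD: "continuous_on (cbox 0 1) (D z)"
    proof -
      have "continuous_on (cbox 0 1) (\<lambda>s. (\<lambda>(x, s). D x s) (z, s))"
        by (rule continuous_on_compose2[OF cont]) (use r in \<open>auto intro!: continuous_intros\<close>)
      then show ?thesis by simp
    qed
    moreover have Di: "D z integrable_on cbox 0 1"
      by (rule integrable_continuous[OF cD])
    moreover have eq: "blinfun_apply (integral (cbox 0 1) (D z)) w = integral {0..1} (\<lambda>s. fd g (ray s z) (w - (1 - s) *\<^sub>R P w))" for w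
      using blinfun_apply_integral[OF Di] by (auto simp: D[OF z] intro!: integral_cong)
    moreover have "blinfun_apply (integral (cbox 0 1) (D z)) = (\<lambda>w. integral {0..1} (\<lambda>s. fd g (ray s z) (w - (1 - s) *\<^sub>R P w)))"
      by (rule ext) (rule eq)
    ultimately show "(euler_inv g has_derivative (\<lambda>w. integral {0..1} (\<lambda>s. fd g (ray s z) (w - (1 - s) *\<^sub>R P w)))) (at z)"
      using at_within_open[of z "ball z r"] r by (simp add: euler_inv_def[abs_def])
    have "(\<lambda>s. blinfun_apply (D z s) w) integrable_on {0..1}"
      using bounded_linear.continuous_on[OF blinfun.bounded_linear_left cD]
      by (auto intro: integrable_continuous_interval)
    then show "(\<lambda>s. fd g (ray s z) (w - (1 - s) *\<^sub>R P w)) integrable_on {0..1}"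
      by (rule integrable_eq) (simp add: D[OF z])
  qed
  have sub_sc: "sc c w - (1 - s) *\<^sub>R P (sc c w) = sc c (w - (1 - s) *\<^sub>R P w)" for c w s
    by (simp add: P_sc sc.diff_right sc.scaleR_right)
  have lin: "integral {0..1} (\<lambda>s. fd g (ray s z) (sc c w - (1 - s) *\<^sub>R P (sc c w)))
    = c * integral {0..1} (\<lambda>s. fd g (ray s z) (w - (1 - s) *\<^sub>R P w))" if z: "z \<in> S" for z c w
  proof -
    have "integral {0..1} (\<lambda>s. fd g (ray s z) (sc c w - (1 - s) *\<^sub>R P (sc c w)))
      = integral {0..1} (\<lambda>s. c * fd g (ray s z) (w - (1 - s) *\<^sub>R P w))"
      by (rule integral_cong) (simp add: sub_sc holoD(2)[OF g o rS[OF z]])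
    then show ?thesis by simp
  qed
  show "holo sc S (euler_inv g)"
    by (rule holoI[OF has_derivative_at_withinI[OF *(1)]]) (use lin in auto)
  show "euler_inv g z + fd (euler_inv g) z (P (z - z0)) = g z" if z: "z \<in> S"
  proof -
    have arg: "P w - (1 - s) *\<^sub>R P (P w) = s *\<^sub>R P w" for s w
      by (simp add: P_P algebra_simps)
    have "fd (euler_inv g) z (P (z - z0)) = integral {0..1} (\<lambda>s. fd g (ray s z) (P (ray s z - z0)))"
      using fd_eqI[OF *(1)[OF z], of "P (z - z0)"] by (simp only: arg P_ray)
    moreover have "integral {0..1} (\<lambda>s. g (ray s z)) + integral {0..1} (\<lambda>s. fd g (ray s z) (P (ray s z - z0)))
      = integral {0..1} (\<lambda>s. g (ray s z) + fd g (ray s z) (P (ray s z - z0)))"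
    proof (rule integral_add[symmetric])
      show "(\<lambda>s. g (ray s z)) integrable_on {0..1}"
        using continuous_on_along_ray[OF g S z] by (rule integrable_continuous_interval)
      show "(\<lambda>s. fd g (ray s z) (P (ray s z - z0))) integrable_on {0..1}"
        using *(2)[OF z, of "P (z - z0)"] by (simp only: arg P_ray)
    qed
    ultimately show ?thesis
      using integral_unique[OF euler_integral[OF g S z]] by (simp only: euler_inv_def)
  qed
qed

text \<open>Picard iteration in the direction e, where P w = \<open>sc (t w) e\<close>. The
  derivative of t J along e is J plus the Euler derivative of J, so J = \<open>euler_inv g\<close>
  makes it equal to g.\<close>

fun ode_iter :: "('a \<Rightarrow> complex) \<Rightarrow> ('r::finite \<Rightarrow> 'r \<Rightarrow> 'a \<Rightarrow> complex) \<Rightarrow> ('r \<Rightarrow> complex) \<Rightarrow> nat \<Rightarrow> 'r \<Rightarrow> 'a \<Rightarrow> complex" where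
  "ode_iter t b v 0 a z = v a"
| "ode_iter t b v (Suc k) a z = t (z - z0) * euler_inv (\<lambda>z. \<Sum>c\<in>UNIV. b a c z * ode_iter t b v k c z) z"

text \<open>The equation being linear, the solution exists on the whole star-shaped set: on compact
  sets closed under rays the k-th iterate is at most V (R |t|)^k / k!.\<close>

lemma ode_exists:
  fixes b :: "'r::finite \<Rightarrow> 'r \<Rightarrow> 'a \<Rightarrow> complex"
  assumes S: "star_shaped S" and b: "\<And>a c. holo sc S (b a c)"
    and t: "bounded_linear t" "\<And>c w. t (sc c w) = c * t w" and P: "\<And>w. P w = sc (t w) e" and te: "t e = 1"
  shows "\<exists>\<psi>. (\<forall>a. holo sc S (\<psi> a)) \<and> (\<forall>z\<in>S. \<forall>a. fd (\<psi> a) z e = (\<Sum>c\<in>UNIV. b a c z * \<psi> c z)) \<and>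
    (\<forall>z\<in>S. \<forall>a. t (z - z0) = 0 \<longrightarrow> \<psi> a z = v a)"
proof -
  let ?I = "ode_iter t b v"
  have o: "open S" using S by (simp add: star_shaped_def)
  have t_holo: "holo sc S (\<lambda>z. t (z - z0))"
    by (rule holoI[where L = "\<lambda>_. t"]) (auto intro!: derivative_eq_intros bounded_linear.has_derivative[OF t(1)] simp: t(2))
  have fd_t: "fd (\<lambda>z. t (z - z0)) z w = t w" for z w
    by (rule fd_eqI) (auto intro!: derivative_eq_intros bounded_linear.has_derivative[OF t(1)])
  have I_holo: "holo sc S (?I k a)" for k a
  proof (induction k arbitrary: a)
    case 0
    then show ?case by (simp add: ode_iter.simps(1)[abs_def])
  next
    case (Suc k)
    have "holo sc S (\<lambda>z. \<Sum>c\<in>UNIV. b a c z * ?I k c z)"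
      by (intro holo_sum holo_mult b Suc)
    then show ?case
      unfolding ode_iter.simps(2)[abs_def] by (intro holo_mult t_holo euler_inv(1)[OF _ S])
  qed
  have rhs_holo: "holo sc S (\<lambda>z. \<Sum>c\<in>UNIV. b a c z * ?I k c z)" for k a
    by (intro holo_sum holo_mult b I_holo)
  have fd_I: "fd (?I (Suc k) a) z e = (\<Sum>c\<in>UNIV. b a c z * ?I k c z)" if z: "z \<in> S" for k a z
  proof -
    let ?J = "euler_inv (\<lambda>z. \<Sum>c\<in>UNIV. b a c z * ?I k c z)"
    have J: "holo sc S ?J" "?J z + fd ?J z (P (z - z0)) = (\<Sum>c\<in>UNIV. b a c z * ?I k c z)"
      by (rule euler_inv(1)[OF rhs_holo S]) (rule euler_inv(2)[OF rhs_holo S z])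
    have "fd (?I (Suc k) a) z e = t (z - z0) * fd ?J z e + t e * ?J z"
      unfolding ode_iter.simps(2)[abs_def]
      by (rule fd_eqI[OF has_derivative_mult, THEN trans])
        (use holoD(1)[OF t_holo o z] holoD(1)[OF J(1) o z] in \<open>auto simp: fd_t\<close>)
    also have "t (z - z0) * fd ?J z e = fd ?J z (P (z - z0))"
      using holoD(2)[OF J(1) o z] by (simp add: P)
    finally have "fd (?I (Suc k) a) z e = ?J z + fd ?J z (P (z - z0))" using te
      by (simp only: mult_1_left add.commute)
    then show ?thesis by (rule trans[OF _ J(2)])
  qed
  have bound: "\<exists>r M. r > 0 \<and> summable M \<and> (\<forall>n. \<forall>z\<in>ball z1 r \<inter> S. norm (?I n a z) \<le> M n)" if z1: "z1 \<in> S" for z1 a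
  proof -
    obtain r where r: "r > 0" "cball z1 r \<subseteq> S" using o z1 open_contains_cball by blast
    \<comment> \<open>All rays from points of a closed ball: a compact set closed under
      \<open>ray\<close>, so one bound B for the coefficients holds at every point to which the
      iterates refer.\<close>
    define K where "K = (\<lambda>(s, z). ray s z) ` ({0..1} \<times> cball z1 r)"
    have K: "compact K"
      unfolding K_def by (intro compact_continuous_image continuous_on_ray compact_Times) auto
    have KS: "K \<subseteq> S" using S r by (auto simp: K_def star_shaped_def)
    have Kray: "ray s z \<in> K" if zK: "z \<in> K" and s: "s \<in> {0..1}" for s z
    proof -
      obtain p where "z = (\<lambda>(s, z). ray s z) p" "p \<in> {0..1} \<times> cball z1 r"
        using zK unfolding K_def by (rule imageE)
      then obtain s' y where y: "z = ray s' y" "s' \<in> {0..1}" "y \<in> cball z1 r"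
        by (cases p) auto
      have "ray s z = ray (s * s') y" by (simp add: y ray_ray)
      moreover have "s * s' \<in> {0..1}" using s y(2) by (auto simp: mult_le_one)
      ultimately show ?thesis using y(3) by (auto simp: K_def)
    qed
    have "bounded (b a c ` K)" for a c
      by (intro compact_imp_bounded compact_continuous_image K continuous_on_subset[OF holo_continuous_on[OF b] KS])
    then have "bounded (\<Union>a. \<Union>c. b a c ` K)" by (intro bounded_UN ballI finite)
    then obtain B where B: "B > 0" "\<forall>w\<in>(\<Union>a. \<Union>c. b a c ` K). norm w \<le> B"
      unfolding bounded_pos by (elim exE conjE) (rule that)
    have bB: "norm (b a c z) \<le> B" if "z \<in> K" for a c z
      using B(2) that by (metis (no_types, lifting) UN_I UNIV_I imageI)
    have "bounded ((\<lambda>z. t (z - z0)) ` K)"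
      by (intro compact_imp_bounded compact_continuous_image K continuous_on_subset[OF holo_continuous_on[OF t_holo] KS])
    then obtain T where T: "T > 0" "\<forall>w\<in>(\<lambda>z. t (z - z0)) ` K. norm w \<le> T"
      unfolding bounded_pos by (elim exE conjE) (rule that)
    have tT: "norm (t (z - z0)) \<le> T" if "z \<in> K" for z
      using T(2) that by simp
    define R where "R = real CARD('r) * B"
    define V where "V = (\<Sum>c\<in>UNIV. norm (v c))"
    have R: "R > 0" using B by (simp add: R_def)
    have t_ray: "norm (t (ray s z - z0)) = s * norm (t (z - z0))" if "s \<in> {0..1}" for s z
    proof -
      have "t (P w) = t w" for w using P te t(2) by simp
      then have "t (ray s z - z0) = t (s *\<^sub>R P (z - z0))"
        using P_ray[of s z] by metis
      also have "\<dots> = s *\<^sub>R t (P (z - z0))" using t(1) by (simp add: linear_simps)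
      finally show ?thesis using that \<open>t (P _) = t _\<close> by simp
    qed
    have main: "norm (?I k a z) \<le> V * (R * norm (t (z - z0))) ^ k / fact k" if "z \<in> K" for k a z
      using that
    proof (induction k arbitrary: a z)
      case 0
      then show ?case by (auto simp: V_def intro: member_le_sum)
    next
      case (Suc k)
      let ?g = "\<lambda>z. \<Sum>c\<in>UNIV. b a c z * ?I k c z"
      let ?Q = "R * (V * (R * norm (t (z - z0))) ^ k / fact k)"
      have "norm (euler_inv ?g z) \<le> ?Q / (k + 1)"
      proof (rule euler_bound[OF euler_inv(1)[OF rhs_holo S] S _ euler_inv(2)[OF rhs_holo S]])
        show "z \<in> S" using Suc.prems KS by auto
        fix s :: real assume s: "s \<in> {0..1}"
        have "norm (?g (ray s z)) \<le> (\<Sum>c\<in>(UNIV::'r set). B * (V * (R * (s * norm (t (z - z0)))) ^ k / fact k))"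
        proof (rule order.trans[OF norm_sum sum_mono], unfold norm_mult, rule mult_mono)
          show "norm (b a c (ray s z)) \<le> B" for c by (rule bB) (rule Kray[OF Suc.prems s])
          show "norm (?I k c (ray s z)) \<le> V * (R * (s * norm (t (z - z0)))) ^ k / fact k" for c
            using Suc.IH[OF Kray[OF Suc.prems s], of c] by (simp add: t_ray[OF s])
        qed (use B in auto)
        also have "\<dots> = ?Q * s ^ k" by (simp add: R_def power_mult_distrib)
        finally show "norm (?g (ray s z)) \<le> ?Q * s ^ k" .
      qed
      then have "norm (t (z - z0)) * norm (euler_inv ?g z) \<le> norm (t (z - z0)) * (?Q / (k + 1))"
        by (rule mult_left_mono) simp
      also have "\<dots> = V * (R * norm (t (z - z0))) ^ Suc k / fact (Suc k)"
        by (simp add: field_simps)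
      finally show ?case by (simp add: norm_mult)
    qed
    have "summable (\<lambda>k. V * (inverse (fact k) * (R * T) ^ k))"
      by (intro summable_mult summable_exp)
    moreover have "norm (?I n a z) \<le> V * (inverse (fact n) * (R * T) ^ n)" if "z \<in> ball z1 r" for n z
    proof -
      have "z = ray 1 z" "z \<in> cball z1 r" using that by auto
      then have z: "z \<in> K" unfolding K_def by (metis atLeastAtMost_iff case_prod_conv image_eqI mem_Sigma_iff order_refl zero_le_one)
      have "V \<ge> 0" by (auto simp: V_def intro: sum_nonneg)
      then have "V * (R * norm (t (z - z0))) ^ n / fact n \<le> V * (R * T) ^ n / fact n"
        using tT[OF z] R by (intro divide_right_mono mult_left_mono power_mono) auto
      then show ?thesis using main[OF z, of n a] by (simp add: field_simps)
    qed
    ultimately show ?thesis using r(1) by blast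
  qed
  define \<psi> where "\<psi> a z = (\<Sum>n. ?I n a z)" for a z
  have \<psi>: "\<psi> a = (\<lambda>z. \<Sum>n. ?I n a z)" for a by (simp add: \<psi>_def fun_eq_iff)
  note ser = holo_series[OF o I_holo bound]
  show ?thesis
  proof (intro exI[of _ \<psi>] conjI ballI allI impI)
    show "holo sc S (\<psi> a)" for a unfolding \<psi> by (rule ser(1))
    fix z a assume z: "z \<in> S"
    \<comment> \<open>Differentiation lowers the index by one: iterate k feeds the derivative of
      iterate k + 1, and iterate 0 is constant.\<close>
    have "(\<lambda>n. fd (?I (Suc n) a) z e) sums (fd (\<psi> a) z e - fd (?I 0 a) z e)"
      using ser(2)[OF _ z, of a e] unfolding \<psi> by (subst sums_Suc_iff) simp
    moreover have "fd (?I 0 a) z e = 0"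
      by (rule fd_eqI[THEN trans]) (auto simp: ode_iter.simps(1)[abs_def])
    ultimately have "(\<lambda>n. \<Sum>c\<in>UNIV. b a c z * ?I n c z) sums fd (\<psi> a) z e"
      by (simp add: fd_I[OF z])
    moreover have "(\<lambda>n. \<Sum>c\<in>UNIV. b a c z * ?I n c z) sums (\<Sum>c\<in>UNIV. b a c z * \<psi> c z)"
      unfolding \<psi>_def by (intro sums_sum sums_mult summable_sums ser(3)[OF _ z])
    ultimately show "fd (\<psi> a) z e = (\<Sum>c\<in>UNIV. b a c z * \<psi> c z)"
      by (rule sums_unique2)
    show "\<psi> a z = v a" if "t (z - z0) = 0"
    proof -
      have "?I n a z = (if n = 0 then v a else 0)" for n using that by (cases n) auto
      then show ?thesis
        using sums_unique[OF sums_single[of 0 "\<lambda>_. v a"]] by (simp only: \<psi>_def)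
    qed
  qed
qed

lemma constant_along_ray:
  assumes f: "holo sc S f" and S: "star_shaped S" and z: "z \<in> S"
    and eq: "\<And>y. y \<in> S \<Longrightarrow> fd f y (P (z - z0)) = 0"
  shows "f z = f (ray 0 z)"
proof -
  have "\<exists>c. \<forall>s\<in>{0..1}. f (ray s z) = c"
  proof (rule has_vector_derivative_zero_constant[of "{0..1::real}"])
    show "((\<lambda>s. f (ray s z)) has_vector_derivative 0) (at s within {0..1})" if "s \<in> {0..1}" for s
      using fd_along_ray[OF f S z that] eq S z that by (auto simp: star_shaped_def)
  qed auto
  then show ?thesis using ray_1[of z] by (metis atLeastAtMost_iff order_refl zero_le_one)
qed

end

section \<open>Local parallel sections along involutive distributions\<close>

text \<open>The constant functionals \<open>\<pi> i\<close> are dual to the fields at every point,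
  so \<open>X i z - X i z0\<close> lies in their common kernel. \<open>flat\<close> is the vanishing
  of the curvature of d + b on pairs of the fields; no bracket term occurs since they
  commute.\<close>

locale commuting_frame = complex_scaling sc for sc :: "complex \<Rightarrow> 'a::euclidean_space \<Rightarrow> 'a" +
  fixes S :: "'a set" and z0 :: 'a and X :: "'q::finite \<Rightarrow> 'a \<Rightarrow> 'a" and \<pi> :: "'q \<Rightarrow> 'a \<Rightarrow> complex"
    and b :: "'q \<Rightarrow> 'r::finite \<Rightarrow> 'r \<Rightarrow> 'a \<Rightarrow> complex"
  assumes S: "open S" "z0 \<in> S" and X: "holo_fld S (X i)"
    and \<pi>_lin: "bounded_linear (\<pi> i)" and \<pi>_sc: "\<pi> i (sc k w) = k * \<pi> i w"
    and \<pi>_X: "z \<in> S \<Longrightarrow> \<pi> i (X j z) = (if i = j then 1 else 0)"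
    and commute: "z \<in> S \<Longrightarrow> fd (X j) z (X i z) = fd (X i) z (X j z)"
    and b: "holo sc S (b i a c)"
    and flat: "z \<in> S \<Longrightarrow> fd (b j a c) z (X i z) - fd (b i a c) z (X j z)
       + (\<Sum>d\<in>UNIV. b i a d z * b j d c z - b j a d z * b i d c z) = 0"
begin

definition P :: "'a \<Rightarrow> 'a" where "P w = (\<Sum>i\<in>UNIV. sc (\<pi> i w) (X i z0))"

lemma \<pi>_sum: "\<pi> i (\<Sum>j\<in>A. f j) = (\<Sum>j\<in>A. \<pi> i (f j))"
  using bounded_linear.linear[OF \<pi>_lin] by (rule linear_sum)

lemma \<pi>_P: "\<pi> i (P w) = \<pi> i w"
  by (simp add: P_def \<pi>_sum \<pi>_sc \<pi>_X S if_distrib cong: if_cong)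

sublocale radial sc P z0
proof (intro radial.intro radial_axioms.intro complex_scaling_axioms)
  show "bounded_linear P"
    unfolding P_def
    by (intro bounded_linear_sum bounded_linear_compose[OF sc.bounded_linear_left] \<pi>_lin)
  show "P (sc c w) = sc c (P w)" for c w
    by (simp add: P_def \<pi>_sc sc.sum_right sc_sc)
  show "P (P w) = P w" for w
    by (subst (1) P_def) (simp add: \<pi>_P P_def[symmetric])
qed

text \<open>p measures the displacement in the leaf directions at z0 and q the transverse one; along
  rays p scales and q stays fixed. \<open>f i\<close> is the variation of the field
  \<open>X i\<close>, and motion along it changes only q.\<close>

definition p :: "'a \<Rightarrow> real" where "p z = (\<Sum>i\<in>UNIV. norm (\<pi> i (z - z0)))"
definition q :: "'a \<Rightarrow> real" where "q z = norm (z - z0 - P (z - z0))"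
definition box :: "real \<Rightarrow> 'a set" where "box R = {z. p z < R \<and> q z < R}"
definition f :: "'q \<Rightarrow> 'a \<Rightarrow> 'a" where "f i z = X i z - X i z0"

lemma p_sum: "(\<Sum>i\<in>UNIV. norm (\<pi> i (z - z0)) * K) = p z * K"
  by (simp add: p_def sum_distrib_right)

lemma p_nonneg: "p z \<ge> 0" and q_nonneg: "q z \<ge> 0"
  by (auto simp: p_def q_def intro: sum_nonneg)

lemma p_ray: "s \<ge> 0 \<Longrightarrow> p (ray s z) = s * p z"
proof -
  assume s: "s \<ge> 0"
  have "\<pi> i (ray s z - z0) = s *\<^sub>R \<pi> i (z - z0)" for i
    using P_ray[of s z] \<pi>_P[of i "ray s z - z0"] \<pi>_P[of i "z - z0"] \<pi>_lin[of i] by (simp add: linear_simps)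
  then show ?thesis using s by (simp add: p_def sum_distrib_left)
qed

lemma q_ray: "q (ray s z) = q z"
proof -
  have "ray s z - z0 - P (ray s z - z0) = z - z0 - P (z - z0)"
    by (simp add: P_ray) (simp add: ray_def algebra_simps)
  then show ?thesis by (simp only: q_def)
qed

lemma continuous_p: "continuous_on A p" and continuous_q: "continuous_on A q"
  unfolding p_def q_def
  by (intro continuous_intros bounded_linear.continuous_on[OF \<pi>_lin] bounded_linear.continuous_on[OF P_linear])+

lemma open_box: "open (box R)"
  unfolding box_def by (intro open_Collect_conj open_Collect_less continuous_p continuous_q continuous_intros)

lemma star_shaped_box: "star_shaped (box R)"
  unfolding star_shaped_def
proof (intro conjI ballI open_box)
  fix z s assume "z \<in> box R" "s \<in> {0..1::real}"
  moreover have "s * p z \<le> p z" using calculation p_nonneg by (simp add: mult_left_le_one_le)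
  ultimately show "ray s z \<in> box R" by (auto simp: box_def p_ray q_ray)
qed

lemma small_box:
  assumes "open T" "z0 \<in> T"
  obtains R r where "0 < R" "R \<le> 1" "box R \<subseteq> cball z0 r" "cball z0 r \<subseteq> T"
proof -
  obtain r where r: "r > 0" "cball z0 r \<subseteq> T" using assms open_contains_cball by blast
  define K where "K = (\<Sum>i\<in>UNIV. norm (X i z0)) + 1"
  have K: "K \<ge> 1" by (simp add: K_def sum_nonneg)
  define R where "R = min 1 (r / K)"
  have "box R \<subseteq> cball z0 r"
  proof
    fix z assume z: "z \<in> box R"
    have "norm (P (z - z0)) \<le> (\<Sum>i\<in>UNIV. p z * norm (X i z0))"
      unfolding P_def
      by (rule order.trans[OF norm_sum], intro sum_mono, unfold norm_sc, intro mult_right_mono)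
        (auto simp: p_def intro: member_le_sum)
    also have "\<dots> \<le> R * (\<Sum>i\<in>UNIV. norm (X i z0))"
      unfolding sum_distrib_left[symmetric] using z by (intro mult_right_mono) (auto simp: box_def sum_nonneg)
    finally have 1: "norm (P (z - z0)) \<le> R * (K - 1)" by (simp add: K_def)
    have "norm (z - z0) \<le> norm (P (z - z0)) + q z"
      unfolding q_def using norm_triangle_ineq[of "P (z - z0)" "z - z0 - P (z - z0)"] by simp
    also have "\<dots> \<le> R * (K - 1) + R" using 1 z by (auto simp: box_def)
    also have "\<dots> = R * K" by (simp add: algebra_simps)
    also have "\<dots> \<le> r / K * K" using K by (intro mult_right_mono) (auto simp: R_def)
    also have "\<dots> = r" using K by simp
    finally show "z \<in> cball z0 r" by (simp add: dist_norm norm_minus_commute)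
  qed
  moreover have "0 < R" "R \<le> 1" using r K by (auto simp: R_def)
  ultimately show ?thesis using that r by blast
qed

lemma P_f: "z \<in> S \<Longrightarrow> P (f i z) = 0"
  using \<pi>_lin by (simp add: P_def f_def linear_simps \<pi>_X S)

text \<open>The loss in a bound with k-th powers of 1 / (R - q) when the distance R - q shrinks by
  the fraction 1 / (k + 2).\<close>

lemma pow_le_3: "((real k + 2) / (real k + 1)) ^ k \<le> 3"
proof -
  have "((real k + 2) / (real k + 1)) ^ k = (1 + 1 / (real k + 1)) ^ k"
    by (simp add: add_divide_distrib[symmetric] field_simps)
  also have "\<dots> \<le> exp (1 / (real k + 1)) ^ k"
    by (intro power_mono exp_ge_add_one_self) auto
  also have "\<dots> = exp (real k * (1 / (real k + 1)))" by (rule exp_of_nat_mult[symmetric])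
  also have "\<dots> \<le> exp 1" by simp
  also have "\<dots> \<le> 3" by (rule exp_le)
  finally show ?thesis .
qed

text \<open>Nagumo's estimate: differentiating along \<open>f i\<close>, which leaves \<open>p\<close> unchanged, costs a factor
  \<open>(k + 1) / (R - q)\<close>; the factor \<open>k + 1\<close> is regained by integrating along rays.\<close>

lemma nagumo_step:
  assumes J: "\<And>c. holo sc (box R) (J c)" and R: "R \<le> 1" and sub: "box R \<subseteq> S"
    and F: "F > (0::real)" "\<And>i z. z \<in> box R \<Longrightarrow> norm (f i z) \<le> F" "\<And>i a c z. z \<in> box R \<Longrightarrow> norm (b i a c z) \<le> F"
    and C_eq: "C = F * (6 + real CARD('r))" and V: "V \<ge> 0"
    and bound: "\<And>z c. z \<in> box R \<Longrightarrow> norm (J c z) \<le> V * (C * p z / (R - q z)) ^ k"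
    and z: "z \<in> box R"
  shows "norm (fd (J a) z (f i z) + (\<Sum>c\<in>UNIV. b i a c z * J c z))
    \<le> (real k + 1) * C / (R - q z) * (V * (C * p z / (R - q z)) ^ k)"
proof -
  have C: "C \<ge> 0" using F(1) by (simp add: C_eq)
  have q: "R - q z > 0" using z by (simp add: box_def)
  \<comment> \<open>The admissible motion of q in the Cauchy estimate: it leaves the fraction
    (k+1)/(k+2) of the distance, which costs at most the factor 3 in the k-th power.\<close>
  define \<delta> where "\<delta> = (R - q z) / (real k + 2)"
  have \<delta>: "\<delta> > 0" using q by (simp add: \<delta>_def)
  let ?A = "V * (C * p z / (R - q z)) ^ k"
  have A: "?A \<ge> 0" using V C q p_nonneg by (intro mult_nonneg_nonneg zero_le_power divide_nonneg_pos) auto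
  have line: "p (z + sc \<zeta> (f i z)) = p z" "q (z + sc \<zeta> (f i z)) \<le> q z + \<delta>" if "norm \<zeta> \<le> \<delta> / F" for \<zeta>
  proof -
    have zS: "z \<in> S" using z sub by auto
    have "\<pi> j (z + sc \<zeta> (f i z) - z0) = \<pi> j (z - z0)" for j
      using \<pi>_lin[of j] zS S by (simp add: linear_simps \<pi>_sc f_def \<pi>_X)
    then show "p (z + sc \<zeta> (f i z)) = p z" by (simp add: p_def)
    have "z + sc \<zeta> (f i z) - z0 - P (z + sc \<zeta> (f i z) - z0) = (z - z0 - P (z - z0)) + sc \<zeta> (f i z)"
      using P_linear by (simp add: linear_simps P_sc P_f[OF zS])
    then have "q (z + sc \<zeta> (f i z)) \<le> q z + norm (sc \<zeta> (f i z))"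
      unfolding q_def by (metis norm_triangle_ineq)
    also have "norm (sc \<zeta> (f i z)) \<le> \<delta> / F * F"
      unfolding norm_sc using that F z \<delta> by (intro mult_mono) auto
    finally show "q (z + sc \<zeta> (f i z)) \<le> q z + \<delta>" using F by simp
  qed
  have \<delta>_less: "\<delta> < R - q z"
    unfolding \<delta>_def using mult_strict_left_mono[OF _ q, of 1 "real k + 2"] by (subst pos_divide_less_eq) auto
  have "norm (fd (J a) z (f i z)) \<le> 3 * ?A / (\<delta> / F)"
  proof (rule fd_Cauchy[OF J open_box])
    show "\<delta> / F > 0" using \<delta> F by simp
    fix \<zeta> :: complex assume \<zeta>: "norm \<zeta> \<le> \<delta> / F"
    show in_box: "z + sc \<zeta> (f i z) \<in> box R"
      using line[OF \<zeta>] \<delta>_less z by (simp add: box_def)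
    have le: "(R - q z) * ((real k + 1) / (real k + 2)) \<le> R - q (z + sc \<zeta> (f i z))"
    proof -
      have "(R - q z) * ((real k + 1) / (real k + 2)) = R - q z - \<delta>"
        by (simp add: \<delta>_def field_simps)
      then show ?thesis using line(2)[OF \<zeta>] by simp
    qed
    have "C * p (z + sc \<zeta> (f i z)) / (R - q (z + sc \<zeta> (f i z)))
       \<le> C * p z / ((R - q z) * ((real k + 1) / (real k + 2)))"
    proof -
      have "0 < (R - q z) * ((real k + 1) / (real k + 2))" using q by (intro mult_pos_pos divide_pos_pos) auto
      moreover from this have "0 < R - q (z + sc \<zeta> (f i z))" using le by linarith
      ultimately show ?thesis
        unfolding line(1)[OF \<zeta>]
        by (intro divide_left_mono[OF le mult_nonneg_nonneg[OF C p_nonneg]]) (rule mult_pos_pos)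
    qed
    also have "\<dots> = C * p z / (R - q z) * ((real k + 2) / (real k + 1))" by simp
    finally have "(C * p (z + sc \<zeta> (f i z)) / (R - q (z + sc \<zeta> (f i z)))) ^ k
        \<le> (C * p z / (R - q z) * ((real k + 2) / (real k + 1))) ^ k"
      using in_box C p_nonneg by (intro power_mono) (auto simp: box_def)
    also have "\<dots> \<le> (C * p z / (R - q z)) ^ k * 3"
      unfolding power_mult_distrib using pow_le_3 q C p_nonneg by (intro mult_left_mono) auto
    finally have "V * (C * p (z + sc \<zeta> (f i z)) / (R - q (z + sc \<zeta> (f i z)))) ^ k \<le> V * ((C * p z / (R - q z)) ^ k * 3)"
      using V by (rule mult_left_mono)
    then show "norm (J a (z + sc \<zeta> (f i z))) \<le> 3 * ?A"
      using bound[OF in_box, of a] by simp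
  qed
  also have "3 * ?A / (\<delta> / F) = 3 * ?A * F * ((real k + 2) / (R - q z))"
    using q by (simp add: \<delta>_def)
  \<comment> \<open>Since k + 2 \<le> 2 (k + 1), the factor 3 becomes the 6 in C.\<close>
  also have "\<dots> \<le> 3 * ?A * F * (2 * (real k + 1) / (R - q z))"
    using A F q by (intro mult_left_mono divide_right_mono) auto
  finally have 1: "norm (fd (J a) z (f i z)) \<le> (real k + 1) * (F * 6) / (R - q z) * ?A"
    by (simp add: algebra_simps)
  have "norm (\<Sum>c\<in>UNIV. b i a c z * J c z) \<le> (\<Sum>c\<in>(UNIV :: 'r set). F * ?A)"
    by (rule order.trans[OF norm_sum sum_mono], unfold norm_mult, rule mult_mono) (use F z bound in auto)
  also have "\<dots> = F * CARD('r) * ?A" by simp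
  also have "\<dots> \<le> (real k + 1) * (F * CARD('r)) / (R - q z) * ?A"
  proof (rule mult_right_mono[OF _ A])
    \<comment> \<open>Here R \<le> 1 is used: it lets the term without derivatives be absorbed into
      a bound of the same shape.\<close>
    have "1 \<le> (real k + 1) / (R - q z)" using q R q_nonneg[of z] by (simp add: field_simps)
    then have "F * CARD('r) * 1 \<le> F * CARD('r) * ((real k + 1) / (R - q z))"
      using F by (intro mult_left_mono) auto
    then show "F * CARD('r) \<le> (real k + 1) * (F * CARD('r)) / (R - q z)" by (simp add: mult_ac)
  qed
  finally have "norm (\<Sum>c\<in>UNIV. b i a c z * J c z) \<le> (real k + 1) * (F * CARD('r)) / (R - q z) * ?A" .
  then have "norm (fd (J a) z (f i z) + (\<Sum>c\<in>UNIV. b i a c z * J c z))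
     \<le> (real k + 1) * (F * 6) / (R - q z) * ?A + (real k + 1) * (F * CARD('r)) / (R - q z) * ?A"
    using 1 norm_triangle_le add_mono by blast
  also have "\<dots> = (real k + 1) * (F * (6 + CARD('r))) / (R - q z) * ?A"
    by (simp add: distrib_left distrib_right add_divide_distrib)
  finally show ?thesis by (simp add: add.commute C_eq)
qed

lemma regain_factor:
  "x * ((real k + 1) * C / d * (V * (C * x / d) ^ k) / real (k + 1)) = V * (C * x / d) ^ Suc k"
  "x * ((real k + 1) * C / d * (V * (C * x / d) ^ k)) / real (k + 1) = V * (C * x / d) ^ Suc k"
proof -
  have cancel: "m * c / m = c" if "m \<noteq> 0" for m c :: real using that by simp
  have "(real k + 1) * C / d * (V * (C * x / d) ^ k) / real (k + 1) = C / d * (V * (C * x / d) ^ k)"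
    using cancel[of "real k + 1" "C / d * (V * (C * x / d) ^ k)"] by (simp add: add.commute)
  then show "x * ((real k + 1) * C / d * (V * (C * x / d) ^ k) / real (k + 1)) = V * (C * x / d) ^ Suc k"
    by simp
  then show "x * ((real k + 1) * C / d * (V * (C * x / d) ^ k)) / real (k + 1) = V * (C * x / d) ^ Suc k"
    by simp
qed

lemma box_bounds:
  assumes "box R \<subseteq> cball z0 r" "cball z0 r \<subseteq> S"
  obtains F where "F > 0" "\<And>i z. z \<in> box R \<Longrightarrow> norm (f i z) \<le> F" "\<And>i a c z. z \<in> box R \<Longrightarrow> norm (b i a c z) \<le> F"
proof -
  have "bounded (f i ` cball z0 r)" for i
    unfolding f_def
    by (intro compact_imp_bounded compact_continuous_image continuous_intros
        continuous_on_subset[OF holo_fld_continuous_on[OF X] assms(2)]) auto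
  then have 1: "bounded (\<Union>i. f i ` cball z0 r)" by (intro bounded_UN ballI finite)
  have "bounded (b i a c ` cball z0 r)" for i a c
    by (intro compact_imp_bounded compact_continuous_image
        continuous_on_subset[OF holo_continuous_on[OF b] assms(2)]) auto
  then have 2: "bounded (\<Union>i. \<Union>a. \<Union>c. b i a c ` cball z0 r)" by (intro bounded_UN ballI finite)
  obtain F1 where F1: "F1 > 0" "\<forall>w\<in>(\<Union>i. f i ` cball z0 r). norm w \<le> F1"
    using 1 unfolding bounded_pos by (elim exE conjE) (rule that)
  obtain F2 where F2: "F2 > 0" "\<forall>w\<in>(\<Union>i. \<Union>a. \<Union>c. b i a c ` cball z0 r). norm w \<le> F2"
    using 2 unfolding bounded_pos by (elim exE conjE) (rule that)
  show ?thesis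
  proof (rule that[of "max F1 F2"])
    show "norm (f i z) \<le> max F1 F2" if "z \<in> box R" for i z
      using F1(2) subsetD[OF assms(1) that] by (metis (no_types, lifting) UN_I UNIV_I imageI max.coboundedI1)
    show "norm (b i a c z) \<le> max F1 F2" if "z \<in> box R" for i a c z
      using F2(2) subsetD[OF assms(1) that] by (metis (no_types, lifting) UN_I UNIV_I imageI max.coboundedI2)
  qed (use F1 in auto)
qed


section \<open>Covariant derivatives along the commuting frame\<close>

definition nabla :: "'q \<Rightarrow> ('r \<Rightarrow> 'a \<Rightarrow> complex) \<Rightarrow> 'r \<Rightarrow> 'a \<Rightarrow> complex" where
  "nabla i \<psi> a z = fd (\<psi> a) z (X i z) + (\<Sum>c\<in>UNIV. b i a c z * \<psi> c z)"

lemma holo_nabla: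
  assumes "open T" "T \<subseteq> S" "\<And>a. holo sc T (\<psi> a)"
  shows "holo sc T (nabla i \<psi> a)"
  unfolding nabla_def[abs_def]
  by (intro holo_add holo_sum holo_mult holo_fd_fld holo_subset[OF b] holo_fld_subset[OF X] assms)

text \<open>The second derivatives cancel because the fields commute, the first order terms cancel
  by symmetry, and what remains is the curvature applied to \<psi>.\<close>

lemma nabla_commute:
  assumes T: "open T" "T \<subseteq> S" and \<psi>: "\<And>a. holo sc T (\<psi> a)" and z: "z \<in> T"
  shows "nabla i (nabla j \<psi>) a z = nabla j (nabla i \<psi>) a z"
proof -
  have zS: "z \<in> S" using z T by auto
  have Xh: "holo_fld T (X i)" for i by (rule holo_fld_subset[OF X T(2)])
  have dpsi: "(\<psi> c has_derivative fd (\<psi> c) z) (at z)" for c by (rule holoD(1)[OF \<psi> T(1) z])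
  have db: "(b i a c has_derivative fd (b i a c) z) (at z)" for i a c by (rule holoD(1)[OF b S(1) zS])
  have fdn: "fd (nabla j \<psi> a) z w = fd (\<lambda>y. fd (\<psi> a) y (X j y)) z w
      + (\<Sum>c\<in>UNIV. b j a c z * fd (\<psi> c) z w + fd (b j a c) z w * \<psi> c z)" for j a w
    unfolding nabla_def[abs_def]
    by (rule fd_eqI, intro has_derivative_add has_derivative_sum has_derivative_mult dpsi db
        holoD(1)[OF holo_fd_fld[OF \<psi> T(1) Xh] T(1) z])
  have br: "fd (\<lambda>y. fd (\<psi> a) y (X j y)) z (X i z) - fd (\<lambda>y. fd (\<psi> a) y (X i y)) z (X j z) = 0"
    using fd_bracket[OF \<psi> T(1) Xh Xh z, of a j i] fd_linear[OF \<psi> T(1) z]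
    by (simp add: commute[OF zS] linear_simps)
  have exp: "nabla i (nabla j \<psi>) a z = fd (\<lambda>y. fd (\<psi> a) y (X j y)) z (X i z)
     + (\<Sum>c\<in>UNIV. b j a c z * fd (\<psi> c) z (X i z) + b i a c z * fd (\<psi> c) z (X j z))
     + (\<Sum>c\<in>UNIV. (fd (b j a c) z (X i z) + (\<Sum>d\<in>UNIV. b i a d z * b j d c z)) * \<psi> c z)" for i j
  proof -
    have "(\<Sum>c\<in>UNIV. b i a c z * (\<Sum>d\<in>UNIV. b j c d z * \<psi> d z))
        = (\<Sum>c\<in>UNIV. (\<Sum>d\<in>UNIV. b i a d z * b j d c z) * \<psi> c z)"
      unfolding sum_distrib_left sum_distrib_right by (subst sum.swap) (simp add: mult.assoc)
    then show ?thesis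
      unfolding nabla_def[of i "nabla j \<psi>"] fdn
      by (simp add: nabla_def distrib_left distrib_right sum.distrib)
  qed
  have "nabla i (nabla j \<psi>) a z - nabla j (nabla i \<psi>) a z
     = (\<Sum>c\<in>UNIV. (fd (b j a c) z (X i z) - fd (b i a c) z (X j z)
         + (\<Sum>d\<in>UNIV. b i a d z * b j d c z - b j a d z * b i d c z)) * \<psi> c z)"
    using br by (simp add: exp sum.distrib sum_subtractf left_diff_distrib distrib_right add.commute)
  also have "\<dots> = 0" by (simp add: flat[OF zS])
  finally show ?thesis by simp
qed

text \<open>The radial displacement in terms of the fields at the current point: replacing
  \<open>X i z0\<close> by \<open>X i z\<close> costs the correction \<open>f i z\<close>.\<close>

lemma displacement: "P (z - z0) = (\<Sum>i\<in>UNIV. sc (\<pi> i (z - z0)) (X i z - f i z))"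
  by (simp add: P_def f_def)

lemma split_sum:
  fixes x D E B :: "'i::finite \<Rightarrow> complex"
  shows "(\<Sum>i\<in>UNIV. x i * (D i - E i)) = (\<Sum>i\<in>UNIV. x i * (D i + B i)) + (\<Sum>i\<in>UNIV. x i * - (E i + B i))"
  unfolding sum.distrib[symmetric] by (intro sum.cong refl) (simp add: algebra_simps)

lemma add_shift: "a + s = 0 \<Longrightarrow> t = s + u \<Longrightarrow> a + t = u" for a s t u :: complex
  by (simp add: add.assoc[symmetric])

lemma fd_displacement:
  assumes "holo sc T g" "open T" "z \<in> T"
  shows "fd g z (P (z - z0)) = (\<Sum>i\<in>UNIV. \<pi> i (z - z0) * (fd g z (X i z) - fd g z (f i z)))"
proof -
  have l: "bounded_linear (fd g z)" by (rule fd_linear[OF assms])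
  show ?thesis
    unfolding displacement using l bounded_linear.linear[OF l]
    by (simp add: linear_sum holoD(2)[OF assms] linear_simps)
qed

text \<open>Iteration for one equation only: the sum of \<open>\<pi> i (z - z0)\<close> times
  \<open>nabla i \<psi>\<close> is to vanish. Its right hand side contains derivatives of the
  previous iterate along \<open>f i\<close>, so the Picard bounds do not suffice and Nagumo's
  estimate takes their place.\<close>

fun iter :: "('r \<Rightarrow> complex) \<Rightarrow> nat \<Rightarrow> 'r \<Rightarrow> 'a \<Rightarrow> complex" where
  "iter v 0 a z = v a"
| "iter v (Suc k) a z = (\<Sum>i\<in>UNIV. \<pi> i (z - z0) * euler_inv
     (\<lambda>z. - (fd (iter v k a) z (f i z) + (\<Sum>c\<in>UNIV. b i a c z * iter v k c z))) z)"

lemma holo_\<pi>: "holo sc T (\<lambda>z. \<pi> i (z - z0))"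
  by (rule holoI[where L = "\<lambda>_. \<pi> i"])
    (auto intro!: derivative_eq_intros bounded_linear.has_derivative[OF \<pi>_lin] simp: \<pi>_sc)

lemma fd_\<pi>: "fd (\<lambda>z. \<pi> i (z - z0)) z w = \<pi> i w"
  by (rule fd_eqI) (auto intro!: derivative_eq_intros bounded_linear.has_derivative[OF \<pi>_lin])

lemma holo_fld_f: "holo_fld S (f i)"
  unfolding f_def[abs_def] by (intro holo_fld_diff X holo_fld_const)

text \<open>The radial combination of the equations has a solution by iteration; each
  \<open>nabla j \<psi>\<close> then satisfies a homogeneous equation of the same type and has to
  vanish. The neighbourhood N is chosen before the initial value v, so that a whole frame exists on
  it.\<close>

theorem parallel_sections:
  "\<exists>N. open N \<and> z0 \<in> N \<and> N \<subseteq> S \<and> (\<forall>v. \<exists>\<psi>. (\<forall>a. holo sc N (\<psi> a)) \<and> (\<forall>a. \<psi> a z0 = v a) \<and>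
     (\<forall>z\<in>N. \<forall>i a. fd (\<psi> a) z (X i z) + (\<Sum>c\<in>UNIV. b i a c z * \<psi> c z) = 0))"
proof -
  obtain R r where R: "0 < R" "R \<le> 1" "box R \<subseteq> cball z0 r" "cball z0 r \<subseteq> S"
    using small_box[OF S] by blast
  obtain F where F: "F > (0::real)" "\<And>i z. z \<in> box R \<Longrightarrow> norm (f i z) \<le> F" "\<And>i a c z. z \<in> box R \<Longrightarrow> norm (b i a c z) \<le> F"
    using box_bounds[OF R(3,4)] by blast
  have sub: "box R \<subseteq> S" using R by auto
  define C where "C = F * (6 + real CARD('r))"
  have C: "C > 0" using F by (simp add: C_def add_pos_nonneg)
  \<comment> \<open>In N1 the ratio C p / (R - q) is below 1/2, so the iterates are dominated by a
    geometric series.\<close>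
  define N1 where "N1 = {z \<in> box R. 2 * C * p z + q z < R}"
  have N1_alt: "N1 = box R \<inter> {z. 2 * C * p z + q z < R}" by (auto simp: N1_def)
  have oN1: "open N1"
    unfolding N1_alt by (intro open_Int open_box open_Collect_less continuous_intros continuous_p continuous_q)
  have p0: "p z0 = 0" and q0: "q z0 = 0"
    using \<pi>_lin P_linear by (simp_all add: p_def q_def linear_simps)
  have z0N1: "z0 \<in> N1" using R by (simp add: N1_def box_def p0 q0)
  \<comment> \<open>A second box, in a closed ball inside N1: the proof that
    \<open>nabla j \<psi>\<close> vanishes needs a bound for it, which compactness provides
    there.\<close>
  obtain R2 r2 where R2: "0 < R2" "R2 \<le> 1" "box R2 \<subseteq> cball z0 r2" "cball z0 r2 \<subseteq> N1"
    using small_box[OF oN1 z0N1] by blast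
  have sub2: "box R2 \<subseteq> box R" using R2 by (auto simp: N1_def)
  \<comment> \<open>In N the ratio C p / (R2 - q) is below 1, so its powers tend to 0.\<close>
  define N where "N = {z \<in> box R2. C * p z + q z < R2}"
  have N_alt: "N = box R2 \<inter> {z. C * p z + q z < R2}" by (auto simp: N_def)
  have oN: "open N"
    unfolding N_alt by (intro open_Int open_box open_Collect_less continuous_intros continuous_p continuous_q)
  have z0N: "z0 \<in> N" using R2 by (simp add: N_def box_def p0 q0)
  have NN1: "N \<subseteq> N1" using R2 by (auto simp: N_def)
  show ?thesis
  proof (intro exI[of _ N] conjI oN z0N allI)
    show "N \<subseteq> S" using NN1 sub by (auto simp: N1_def)
    fix v :: "'r \<Rightarrow> complex"
    define g where "g k i a z = - (fd (iter v k a) z (f i z) + (\<Sum>c\<in>UNIV. b i a c z * iter v k c z))" for k i a z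
    have iter_Suc: "iter v (Suc k) a = (\<lambda>z. \<Sum>i\<in>UNIV. \<pi> i (z - z0) * euler_inv (g k i a) z)" for k a
      by (simp add: fun_eq_iff g_def[abs_def])
    have iter_0: "iter v 0 a = (\<lambda>z. v a)" for a by (simp add: fun_eq_iff)
    have g_holo: "holo sc (box R) (g k i a)" if "\<And>a. holo sc (box R) (iter v k a)" for k i a
      unfolding g_def[abs_def]
      by (intro holo_minus holo_add holo_sum holo_mult holo_fd_fld holo_subset[OF b sub] holo_fld_subset[OF holo_fld_f sub] open_box that)
    have I_holo: "holo sc (box R) (iter v k a)" for k a
    proof (induction k arbitrary: a)
      case 0
      show ?case unfolding iter_0 by simp
    next
      case (Suc k)
      show ?case unfolding iter_Suc
        by (intro holo_sum holo_mult holo_\<pi> euler_inv(1)[OF g_holo star_shaped_box] Suc)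
    qed
    note g_holo = g_holo[OF I_holo]
    have fd_I: "fd (iter v (Suc k) a) z (P (z - z0)) = (\<Sum>i\<in>UNIV. \<pi> i (z - z0) * g k i a z)" if z: "z \<in> box R" for k a z
    proof -
      note E = euler_inv[OF g_holo star_shaped_box]
      have "fd (iter v (Suc k) a) z (P (z - z0)) = (\<Sum>i\<in>UNIV. \<pi> i (z - z0) * fd (euler_inv (g k i a)) z (P (z - z0)) + \<pi> i (P (z - z0)) * euler_inv (g k i a) z)"
        unfolding iter_Suc
        by (rule fd_eqI[OF has_derivative_sum[OF has_derivative_mult], THEN trans])
          (use holoD(1)[OF holo_\<pi> open_box z] holoD(1)[OF E(1) open_box z] in \<open>auto simp: fd_\<pi>\<close>)
      also have "\<dots> = (\<Sum>i\<in>UNIV. \<pi> i (z - z0) * (euler_inv (g k i a) z + fd (euler_inv (g k i a)) z (P (z - z0))))"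
        by (simp add: \<pi>_P algebra_simps)
      finally show ?thesis by (simp add: E(2)[OF z])
    qed
    define V where "V = (\<Sum>a\<in>UNIV. norm (v a))"
    have V: "V \<ge> 0" by (simp add: V_def sum_nonneg)
    have main: "norm (iter v k a z) \<le> V * (C * p z / (R - q z)) ^ k" if "z \<in> box R" for k a z
      using that
    proof (induction k arbitrary: a z)
      case 0
      then show ?case by (auto simp: V_def intro: member_le_sum)
    next
      case (Suc k)
      let ?Q = "(real k + 1) * C / (R - q z) * (V * (C * p z / (R - q z)) ^ k)"
      have E: "norm (euler_inv (g k i a) z) \<le> ?Q / (k + 1)" for i
      proof (rule euler_bound[OF euler_inv(1)[OF g_holo star_shaped_box] star_shaped_box Suc.prems euler_inv(2)[OF g_holo star_shaped_box]])
        fix s :: real assume s: "s \<in> {0..1}"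
        have y: "ray s z \<in> box R" using star_shaped_box Suc.prems s by (auto simp: star_shaped_def)
        have "norm (g k i a (ray s z)) \<le> (real k + 1) * C / (R - q (ray s z)) * (V * (C * p (ray s z) / (R - q (ray s z))) ^ k)"
          unfolding g_def norm_minus_cancel
          by (rule nagumo_step[where J = "iter v k", OF I_holo R(2) sub F(1) _ _ C_def V _ y]) (fact F(2) F(3) Suc.IH)+
        also have "\<dots> = ?Q * s ^ k" using s by (simp add: p_ray q_ray power_mult_distrib power_divide)
        finally show "norm (g k i a (ray s z)) \<le> ?Q * s ^ k" .
      qed
      have "norm (iter v (Suc k) a z) \<le> (\<Sum>i\<in>UNIV. norm (\<pi> i (z - z0)) * (?Q / (k + 1)))"
        unfolding iter_Suc
        by (rule order.trans[OF norm_sum sum_mono], unfold norm_mult, rule mult_left_mono[OF E]) simp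
      also have "\<dots> = p z * (?Q / (k + 1))" by (rule p_sum)
      also have "\<dots> = V * (C * p z / (R - q z)) ^ Suc k" by (rule regain_factor)
      finally show ?case .
    qed
    have half: "norm (iter v k a z) \<le> V * (1/2) ^ k" if "z \<in> N1" for k a z
    proof -
      have z: "z \<in> box R" "2 * (C * p z) < R - q z" using that by (auto simp: N1_def)
      have "R - q z > 0" using z by (simp add: box_def)
      then have "C * p z / (R - q z) \<le> 1/2" using z by (simp add: field_simps)
      then have "V * (C * p z / (R - q z)) ^ k \<le> V * (1/2) ^ k"
        using V C p_nonneg \<open>R - q z > 0\<close> by (intro mult_left_mono power_mono) auto
      then show ?thesis using main[OF z(1), of k a] by simp
    qed
    define \<psi> where "\<psi> a = (\<lambda>z. \<Sum>k. iter v k a z)" for a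
    have N1R: "N1 \<subseteq> box R" by (auto simp: N1_def)
    have bd: "\<exists>r M. r > 0 \<and> summable M \<and> (\<forall>k. \<forall>z\<in>ball y r \<inter> N1. norm (iter v k a z) \<le> M k)" for y a
      using half by (intro exI[of _ 1] exI[of _ "\<lambda>k. V * (1/2) ^ k"] conjI summable_mult summable_geometric) auto
    note ser = holo_series[OF oN1 holo_subset[OF I_holo N1R] bd]
    have psi_holo: "holo sc N1 (\<psi> a)" for a unfolding \<psi>_def by (rule ser(1))
    have N1S: "N1 \<subseteq> S" using N1R sub by auto
    have radial_eq: "(\<Sum>i\<in>UNIV. \<pi> i (z - z0) * nabla i \<psi> a z) = 0" if z: "z \<in> N1" for z a
    proof -
      have zR: "z \<in> box R" using z N1R by auto
      have "(\<lambda>k. fd (iter v (Suc k) a) z (P (z - z0))) sums (fd (\<psi> a) z (P (z - z0)) - fd (iter v 0 a) z (P (z - z0)))"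
        using ser(2)[OF z, of a "P (z - z0)"] unfolding \<psi>_def by (subst sums_Suc_iff) simp
      moreover have "fd (iter v 0 a) z (P (z - z0)) = 0"
        unfolding iter_0 by (rule fd_eqI[THEN trans]) auto
      ultimately have 1: "(\<lambda>k. \<Sum>i\<in>UNIV. \<pi> i (z - z0) * g k i a z) sums fd (\<psi> a) z (P (z - z0))"
        by (simp add: fd_I[OF zR] del: iter.simps)
      have 2: "(\<lambda>k. g k i a z) sums (- (fd (\<psi> a) z (f i z) + (\<Sum>c\<in>UNIV. b i a c z * \<psi> c z)))" for i
        unfolding g_def \<psi>_def
        by (intro sums_minus sums_add sums_sum sums_mult summable_sums ser(3) ser(2) z)
      have "(\<lambda>k. \<Sum>i\<in>UNIV. \<pi> i (z - z0) * g k i a z) sums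
          (\<Sum>i\<in>UNIV. \<pi> i (z - z0) * (- (fd (\<psi> a) z (f i z) + (\<Sum>c\<in>UNIV. b i a c z * \<psi> c z))))"
        by (intro sums_sum sums_mult 2)
      from sums_unique2[OF 1 this] show ?thesis
        unfolding fd_displacement[OF psi_holo oN1 z] nabla_def
        using split_sum[of "\<lambda>i. \<pi> i (z - z0)" "\<lambda>i. fd (\<psi> a) z (X i z)" "\<lambda>i. fd (\<psi> a) z (f i z)" "\<lambda>i. \<Sum>c\<in>UNIV. b i a c z * \<psi> c z"]
        by simp
    qed
    have nab_holo: "holo sc N1 (nabla j \<psi> a)" for j a by (rule holo_nabla[OF oN1 N1S psi_holo])
    \<comment> \<open>Differentiating the radial equation along \<open>X j\<close> reproduces
      \<open>nabla j \<psi>\<close>, because \<open>\<pi> i (X j z)\<close> is 1 or 0;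
      \<open>nabla_commute\<close> then exchanges the order of the two derivatives.\<close>
    have nab_eq: "nabla j \<psi> a z + (\<Sum>i\<in>UNIV. \<pi> i (z - z0) * nabla i (nabla j \<psi>) a z) = 0" if z: "z \<in> N1" for j a z
    proof -
      have zS: "z \<in> S" using z N1S by auto
      let ?h = "\<lambda>z. \<Sum>i\<in>UNIV. \<pi> i (z - z0) * nabla i \<psi> a z"
      have "fd ?h z (X j z) = fd (\<lambda>z. 0) z (X j z)"
      proof -
        have "(?h has_derivative (\<lambda>w. 0)) (at z)"
          by (rule has_derivative_transform_within_open[OF has_derivative_const oN1 z]) (simp add: radial_eq)
        then show ?thesis by (simp add: fd_eqI)
      qed
      moreover have "fd ?h z (X j z) = (\<Sum>i\<in>UNIV. \<pi> i (z - z0) * fd (nabla i \<psi> a) z (X j z) + \<pi> i (X j z) * nabla i \<psi> a z)"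
        by (rule fd_eqI[OF has_derivative_sum[OF has_derivative_mult], THEN trans])
          (use holoD(1)[OF holo_\<pi> oN1 z] holoD(1)[OF nab_holo oN1 z] in \<open>auto simp: fd_\<pi>\<close>)
      ultimately have 1: "(\<Sum>i\<in>UNIV. \<pi> i (z - z0) * fd (nabla i \<psi> a) z (X j z)) + nabla j \<psi> a z = 0"
        by (simp add: \<pi>_X[OF zS] sum.distrib if_distrib[of "\<lambda>x. x * _"] cong: if_cong)
      have 2: "(\<Sum>i\<in>UNIV. \<pi> i (z - z0) * (\<Sum>c\<in>UNIV. b j a c z * nabla i \<psi> c z)) = 0"
      proof -
        have "(\<Sum>i\<in>UNIV. \<pi> i (z - z0) * (\<Sum>c\<in>UNIV. b j a c z * nabla i \<psi> c z))
          = (\<Sum>c\<in>UNIV. b j a c z * (\<Sum>i\<in>UNIV. \<pi> i (z - z0) * nabla i \<psi> c z))"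
          unfolding sum_distrib_left by (subst sum.swap) (simp add: mult_ac)
        then show ?thesis by (simp add: radial_eq[OF z])
      qed
      have "nabla i (nabla j \<psi>) a z = fd (nabla i \<psi> a) z (X j z) + (\<Sum>c\<in>UNIV. b j a c z * nabla i \<psi> c z)" for i
        unfolding nabla_commute[OF oN1 N1S psi_holo z, of i j] by (subst nabla_def) simp
      then show ?thesis using 1 2 by (simp add: distrib_left sum.distrib add.commute)
    qed
    have box2: "box R2 \<subseteq> N1" using R2 by auto
    \<comment> \<open>The function itself solves the homogeneous Euler equation, so its bound of
      order k implies the one of order k + 1; letting k tend to infinity gives 0.\<close>
    have zero: "nabla j \<psi> a z = 0" if z: "z \<in> N" for j a z
    proof -
      have "bounded (nabla j \<psi> a ` cball z0 r2)" for a
        by (intro compact_imp_bounded compact_continuous_image continuous_on_subset[OF holo_continuous_on[OF nab_holo] R2(4)]) auto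
      then have "bounded (\<Union>a. nabla j \<psi> a ` cball z0 r2)" by (intro bounded_UN ballI finite)
      then obtain V2 where V2: "V2 > 0" "\<forall>w\<in>(\<Union>a. nabla j \<psi> a ` cball z0 r2). norm w \<le> V2"
        unfolding bounded_pos by (elim exE conjE) (rule that)
      have V2': "norm (nabla j \<psi> a z) \<le> V2" if "z \<in> box R2" for a z
        using V2(2) subsetD[OF R2(3) that] by (metis (no_types, lifting) UN_I UNIV_I imageI)
      have holo2: "holo sc (box R2) (nabla j \<psi> a)" for a by (rule holo_subset[OF nab_holo box2])
      have F2: "norm (f i z) \<le> F" and F3: "norm (b i a c z) \<le> F" if "z \<in> box R2" for i a c z
        using F(2,3) subsetD[OF sub2 that] by auto
      have main: "norm (nabla j \<psi> a z) \<le> V2 * (C * p z / (R2 - q z)) ^ k" if "z \<in> box R2" for k a z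
        using that
      proof (induction k arbitrary: a z)
        case 0
        then show ?case using V2' by simp
      next
        case (Suc k)
        let ?Q = "p z * ((real k + 1) * C / (R2 - q z) * (V2 * (C * p z / (R2 - q z)) ^ k))"
        let ?G = "\<lambda>z. \<Sum>i\<in>UNIV. \<pi> i (z - z0) * - (fd (nabla j \<psi> a) z (f i z) + (\<Sum>c\<in>UNIV. b i a c z * nabla j \<psi> c z))"
        have "norm (nabla j \<psi> a z) \<le> ?Q / (k + 1)"
        proof (rule euler_bound[OF holo2 star_shaped_box Suc.prems])
          fix y assume y: "y \<in> box R2"
          then have yN: "y \<in> N1" using box2 by auto
          show "nabla j \<psi> a y + fd (nabla j \<psi> a) y (P (y - z0)) = ?G y"
            unfolding fd_displacement[OF nab_holo oN1 yN]
            by (rule add_shift[OF nab_eq[OF yN, of j a, unfolded nabla_def[of _ "nabla j \<psi>"]] split_sum])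
        next
          fix s :: real assume s: "s \<in> {0..1}"
          let ?y = "ray s z"
          have y: "?y \<in> box R2" using star_shaped_box Suc.prems s by (auto simp: star_shaped_def)
          have q2: "R2 - q z > 0" using Suc.prems by (simp add: box_def)
          let ?B = "(real k + 1) * C / (R2 - q ?y) * (V2 * (C * p ?y / (R2 - q ?y)) ^ k)"
          have "norm (fd (nabla j \<psi> a) ?y (f i ?y) + (\<Sum>c\<in>UNIV. b i a c ?y * nabla j \<psi> c ?y)) \<le> ?B" for i
            by (rule nagumo_step[where J = "nabla j \<psi>", OF holo2 R2(2) order.trans[OF sub2 sub] F(1) _ _ C_def less_imp_le[OF V2(1)] _ y])
              (fact F2 F3 Suc.IH)+
          then have "norm (?G ?y) \<le> (\<Sum>i\<in>UNIV. norm (\<pi> i (?y - z0)) * ?B)"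
            by (intro order.trans[OF norm_sum sum_mono]) (simp only: norm_mult norm_minus_cancel mult_left_mono norm_ge_zero)
          also have "\<dots> = p ?y * ?B" by (rule p_sum)
          also have "\<dots> = s * (?Q * s ^ k)" using s by (simp add: p_ray q_ray power_mult_distrib power_divide)
          also have "\<dots> \<le> 1 * (?Q * s ^ k)"
            using s C V2 q2 p_nonneg by (intro mult_right_mono) auto
          finally show "norm (?G ?y) \<le> ?Q * s ^ k" by simp
        qed
        also have "\<dots> = V2 * (C * p z / (R2 - q z)) ^ Suc k" by (rule regain_factor)
        finally show ?case .
      qed
      have zR: "z \<in> box R2" "C * p z < R2 - q z" using z by (auto simp: N_def)
      have q2: "R2 - q z > 0" using zR by (simp add: box_def)
      then have lt: "C * p z / (R2 - q z) < 1" "C * p z / (R2 - q z) \<ge> 0"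
        using zR C p_nonneg by auto
      have "(\<lambda>k. V2 * (C * p z / (R2 - q z)) ^ k) \<longlonglongrightarrow> V2 * 0"
        using lt by (intro tendsto_mult tendsto_const LIMSEQ_realpow_zero)
      then have "norm (nabla j \<psi> a z) \<le> 0"
        using main[OF zR(1)] by (intro LIMSEQ_le_const) auto
      then show ?thesis by simp
    qed
    show "\<exists>\<psi>. (\<forall>a. holo sc N (\<psi> a)) \<and> (\<forall>a. \<psi> a z0 = v a) \<and>
       (\<forall>z\<in>N. \<forall>i a. fd (\<psi> a) z (X i z) + (\<Sum>c\<in>UNIV. b i a c z * \<psi> c z) = 0)"
    proof (intro exI[of _ \<psi>] conjI allI ballI)
      show "holo sc N (\<psi> a)" for a by (rule holo_subset[OF psi_holo NN1])
      show "\<psi> a z0 = v a" for a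
      proof -
        have "\<pi> i (z0 - z0) = 0" for i using \<pi>_lin by (simp add: linear_simps)
        then have "iter v k a z0 = (if k = 0 then v a else 0)" for k by (cases k) auto
        then show ?thesis using sums_unique[OF sums_single[of 0 "\<lambda>_. v a"]] by (simp only: \<psi>_def)
      qed
      show "fd (\<psi> a) z (X i z) + (\<Sum>c\<in>UNIV. b i a c z * \<psi> c z) = 0" if "z \<in> N" for z i a
        using zero[OF that, of i a] by (simp add: nabla_def)
    qed
  qed
qed

end

section \<open>Holomorphic matrices\<close>

lemma matrix_nth: "(A ** B) $ i $ j = (\<Sum>k\<in>UNIV. A $ i $ k * B $ k $ j)"
  by (simp add: matrix_matrix_mult_def)

lemma mat_mult_nth: "(mat c ** A) $ i $ j = c * A $ i $ j" for c :: complex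
  by (simp add: matrix_nth mat_def if_distrib[of "\<lambda>x. x * _"] cong: if_cong)

lemma bounded_bilinear_matrix_mult:
  "bounded_bilinear ((**) :: complex^'k^'l \<Rightarrow> complex^'m^'k \<Rightarrow> complex^'m^'l)"
proof -
  have "bilinear ((**) :: complex^'k^'l \<Rightarrow> complex^'m^'k \<Rightarrow> complex^'m^'l)"
    unfolding bilinear_def linear_iff
    by (auto simp: vec_eq_iff matrix_nth sum.distrib algebra_simps scaleR_sum_right)
  then show ?thesis by (simp add: bilinear_conv_bounded_bilinear)
qed

interpretation mm: bounded_bilinear "(**) :: complex^'k^'l \<Rightarrow> complex^'m^'k \<Rightarrow> complex^'m^'l"
  by (rule bounded_bilinear_matrix_mult)

lemma matrix_inv_left: "invertible A \<Longrightarrow> matrix_inv A ** A = mat 1"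
  and matrix_inv_right: "invertible A \<Longrightarrow> A ** matrix_inv A = mat 1"
  for A :: "complex^'r^'r"
  unfolding invertible_def matrix_inv_def by (metis (mono_tags, lifting) someI_ex)+

context complex_scaling
begin

lemma holo_matI: "(\<And>i j. holo sc S (\<lambda>z. f z $ i $ j)) \<Longrightarrow> holo_mat sc S f"
  by (simp add: holo_mat_def)

lemma holo_matD: "holo_mat sc S f \<Longrightarrow> holo sc S (\<lambda>z. f z $ i $ j)"
  by (simp add: holo_mat_def)

lemma holo_mat_subset: "holo_mat sc S f \<Longrightarrow> T \<subseteq> S \<Longrightarrow> holo_mat sc T f"
  unfolding holo_mat_def using holo_subset by blast

lemma holo_mat_cong: "holo_mat sc S f \<Longrightarrow> (\<And>z. z \<in> S \<Longrightarrow> f z = g z) \<Longrightarrow> holo_mat sc S g"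
  unfolding holo_mat_def by (metis (mono_tags, lifting) holo_cong_imp)

lemma holo_mat_const [simp]: "holo_mat sc S (\<lambda>_. k)"
  by (simp add: holo_mat_def)

lemma holo_mat_add: "holo_mat sc S f \<Longrightarrow> holo_mat sc S g \<Longrightarrow> holo_mat sc S (\<lambda>z. f z + g z)"
  unfolding holo_mat_def by (auto intro: holo_add)

lemma holo_mat_minus: "holo_mat sc S f \<Longrightarrow> holo_mat sc S (\<lambda>z. - f z)"
  unfolding holo_mat_def by (auto intro: holo_minus)

lemma holo_mat_mult: "holo_mat sc S f \<Longrightarrow> holo_mat sc S g \<Longrightarrow> holo_mat sc S (\<lambda>z. f z ** g z)"
  unfolding holo_mat_def matrix_nth by (auto intro!: holo_sum holo_mult)

lemma holo_mat_smult: "holo sc S f \<Longrightarrow> holo_mat sc S g \<Longrightarrow> holo_mat sc S (\<lambda>z. mat (f z) ** g z)"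
proof (rule holo_mat_mult[OF holo_matI])
  show "holo sc S (\<lambda>z. mat (f z) $ i $ j)" if "holo sc S f" for i j
    using that by (cases "i = j") (simp_all add: mat_def)
qed

lemma holo_mat_scaleR: "holo_mat sc S f \<Longrightarrow> holo_mat sc S (\<lambda>z. r *\<^sub>R f z)"
  unfolding holo_mat_def by (auto simp: scaleR_conv_of_real intro!: holo_mult)

lemma holo_mat_sum: "(\<And>i. i \<in> A \<Longrightarrow> holo_mat sc S (f i)) \<Longrightarrow> holo_mat sc S (\<lambda>z. \<Sum>i\<in>A. f i z)"
  by (induction A rule: infinite_finite_induct) (auto intro: holo_mat_add)

lemma holo_mat_compose_fld:
  "holo_mat sc T f \<Longrightarrow> holo_fld S X \<Longrightarrow> X ` S \<subseteq> T \<Longrightarrow> holo_mat sc S (\<lambda>z. f (X z))"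
  by (rule holo_matI) (rule holo_compose_fld[OF holo_matD])

lemma holo_det:
  assumes "holo_mat sc S f" shows "holo sc S (\<lambda>z. det (f z))"
  unfolding det_def by (intro holo_sum holo_mult holo_prod holo_const holo_matD assms)

text \<open>By Cramer's rule the entries of the inverse are quotients of determinants.\<close>

lemma holo_matrix_inv:
  fixes f :: "'a \<Rightarrow> complex^'k^'k"
  assumes f: "holo_mat sc S f" and inv: "\<And>z. z \<in> S \<Longrightarrow> invertible (f z)"
  shows "holo_mat sc S (\<lambda>z. matrix_inv (f z))"
proof (rule holo_mat_cong)
  let ?g = "\<lambda>z. (\<chi> k l. det (\<chi> i j. if j = k then axis l 1 $ i else f z $ i $ j) / det (f z))"
  have "holo_mat sc S (\<lambda>z. \<chi> i j. if j = k then axis l (1::complex) $ i else f z $ i $ j)" for k l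
  proof (rule holo_matI)
    fix i j show "holo sc S (\<lambda>z. (\<chi> i j. if j = k then axis l 1 $ i else f z $ i $ j) $ i $ j)"
      by (cases "j = k") (auto intro: holo_matD f)
  qed
  then show "holo_mat sc S ?g"
    by (intro holo_matI) (simp add: holo_divide holo_det f inv invertible_det_nz[symmetric])
  fix z assume z: "z \<in> S"
  then have d: "det (f z) \<noteq> 0" using inv invertible_det_nz by blast
  have "column l (matrix_inv (f z)) = (\<chi> k. det (\<chi> i j. if j = k then axis l 1 $ i else f z $ i $ j) / det (f z))" for l
    unfolding cramer[OF d, symmetric]
    using matrix_inv_right[OF inv[OF z]]
    by (simp add: vec_eq_iff matrix_nth matrix_vector_mult_def column_def mat_def axis_def)
  then show "?g z = matrix_inv (f z)"
    by (simp add: vec_eq_iff column_def)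
qed

lemma holo_matD_fd:
  assumes "holo_mat sc S f" "open S" "z \<in> S"
  shows "(f has_derivative fd f z) (at z)" "fd f z w $ i $ j = fd (\<lambda>z. f z $ i $ j) z w"
proof -
  have 1: "(f has_derivative (\<lambda>w. \<chi> i j. fd (\<lambda>z. f z $ i $ j) z w)) (at z)"
    by (rule has_derivative_vec, rule has_derivative_vec) (simp add: holoD(1)[OF holo_matD[OF assms(1)] assms(2,3)])
  show "fd f z w $ i $ j = fd (\<lambda>z. f z $ i $ j) z w"
    using fd_eqI[OF 1] by simp
  show "(f has_derivative fd f z) (at z)"
    using 1 frechet_derivative_at[OF 1] by simp
qed

lemma holo_mat_fd_fld:
  assumes "holo_mat sc S f" "open S" "holo_fld S X"
  shows "holo_mat sc S (\<lambda>z. fd f z (X z))"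
proof (rule holo_matI)
  fix i j
  show "holo sc S (\<lambda>z. fd f z (X z) $ i $ j)"
    by (rule holo_cong_imp[OF holo_fd_fld[OF holo_matD[OF assms(1)] assms(2,3)]])
      (simp add: holo_matD_fd(2)[OF assms(1,2)])
qed

lemma fd_mat_sc:
  assumes "holo_mat sc S f" "open S" "z \<in> S"
  shows "fd f z (sc c w) = mat c ** fd f z w"
  using holoD(2)[OF holo_matD[OF assms(1)] assms(2,3)]
  by (simp add: vec_eq_iff holo_matD_fd(2)[OF assms] matrix_nth mat_def if_distrib[of "\<lambda>x. x * _"] cong: if_cong)

end

context radial
begin

text \<open>Invertibility everywhere comes from a solution \<Theta> of the adjoint equation:
  \<Theta> \<Psi> is constant along rays, and it is the identity where t(z - z0) = 0.\<close>

theorem ode_matrix: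
  fixes b :: "'a \<Rightarrow> complex^'r^'r"
  assumes S: "star_shaped S" and b: "holo_mat sc S b"
    and t: "bounded_linear t" "\<And>c w. t (sc c w) = c * t w" and P: "\<And>w. P w = sc (t w) e" and te: "t e = 1"
  shows "\<exists>\<Psi> :: 'a \<Rightarrow> complex^'r^'r. holo_mat sc S \<Psi> \<and> (\<forall>z\<in>S. invertible (\<Psi> z) \<and> fd \<Psi> z e = b z ** \<Psi> z)"
proof -
  have o: "open S" using S by (simp add: star_shaped_def)
  have "\<forall>d. \<exists>\<psi>. (\<forall>a. holo sc S (\<psi> a)) \<and> (\<forall>z\<in>S. \<forall>a. fd (\<psi> a) z e = (\<Sum>c\<in>UNIV. b z $ a $ c * \<psi> c z)) \<and>
    (\<forall>z\<in>S. \<forall>a. t (z - z0) = 0 \<longrightarrow> \<psi> a z = axis d 1 $ a)"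
    by (intro allI ode_exists[OF S _ t P te] holo_matD[OF b])
  then obtain \<psi> where \<psi>: "\<And>d a. holo sc S (\<psi> d a)"
    "\<And>d z a. z \<in> S \<Longrightarrow> fd (\<psi> d a) z e = (\<Sum>c\<in>UNIV. b z $ a $ c * \<psi> d c z)"
    "\<And>d z a. z \<in> S \<Longrightarrow> t (z - z0) = 0 \<Longrightarrow> \<psi> d a z = axis d 1 $ a"
    by metis
  have ex: "\<forall>d. \<exists>\<theta>. (\<forall>a. holo sc S (\<theta> a)) \<and> (\<forall>z\<in>S. \<forall>a. fd (\<theta> a) z e = (\<Sum>c\<in>UNIV. - (b z $ c $ a) * \<theta> c z)) \<and>
    (\<forall>z\<in>S. \<forall>a. t (z - z0) = 0 \<longrightarrow> \<theta> a z = axis d 1 $ a)"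
    by (intro allI ode_exists[OF S _ t P te] holo_minus holo_matD[OF b])
  from choice[OF ex] obtain \<theta> where "\<forall>d. (\<forall>a. holo sc S (\<theta> d a)) \<and> (\<forall>z\<in>S. \<forall>a. fd (\<theta> d a) z e = (\<Sum>c\<in>UNIV. - (b z $ c $ a) * \<theta> d c z)) \<and>
    (\<forall>z\<in>S. \<forall>a. t (z - z0) = 0 \<longrightarrow> \<theta> d a z = axis d 1 $ a)" ..
  then have \<theta>: "\<And>d a. holo sc S (\<theta> d a)"
    "\<And>d z a. z \<in> S \<Longrightarrow> fd (\<theta> d a) z e = (\<Sum>c\<in>UNIV. - (b z $ c $ a) * \<theta> d c z)"
    "\<And>d z a. z \<in> S \<Longrightarrow> t (z - z0) = 0 \<Longrightarrow> \<theta> d a z = axis d 1 $ a"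
    by blast+
  define \<Psi> where "\<Psi> z = (\<chi> a d. \<psi> d a z)" for z
  define \<Theta> where "\<Theta> z = (\<chi> d a. \<theta> d a z)" for z
  have h: "holo_mat sc S \<Psi>" "holo_mat sc S \<Theta>"
    by (auto simp: \<Psi>_def \<Theta>_def intro!: holo_matI \<psi> \<theta>)
  have fdP: "fd \<Psi> z e = b z ** \<Psi> z" if "z \<in> S" for z
    by (simp add: vec_eq_iff holo_matD_fd(2)[OF h(1) o that] matrix_nth) (simp add: \<Psi>_def \<psi>(2)[OF that])
  have fdT: "fd \<Theta> z e = - (\<Theta> z ** b z)" if "z \<in> S" for z
    by (simp add: vec_eq_iff holo_matD_fd(2)[OF h(2) o that] matrix_nth)
      (simp add: \<Theta>_def \<theta>(2)[OF that] sum_negf mult.commute)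
  have inv: "\<Theta> z ** \<Psi> z = mat 1" if z: "z \<in> S" for z
  proof -
    have hp: "holo_mat sc S (\<lambda>z. \<Theta> z ** \<Psi> z)" by (rule holo_mat_mult[OF h(2,1)])
    have zero: "fd (\<lambda>z. \<Theta> z ** \<Psi> z) y e = 0" if y: "y \<in> S" for y
      by (rule fd_eqI[OF mm.FDERIV, THEN trans])
        (use holo_matD_fd(1)[OF h(2) o y] holo_matD_fd(1)[OF h(1) o y] in \<open>auto simp: fdP[OF y] fdT[OF y] mm.minus_left matrix_mul_assoc\<close>)
    have r0: "ray 0 z \<in> S" using S z by (simp add: star_shaped_def)
    have "(\<Theta> z ** \<Psi> z) $ i $ j = (\<Theta> (ray 0 z) ** \<Psi> (ray 0 z)) $ i $ j" for i j
    proof (rule constant_along_ray[OF holo_matD[OF hp] S z])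
      fix y assume y: "y \<in> S"
      have "fd (\<lambda>z. (\<Theta> z ** \<Psi> z) $ i $ j) y e = 0"
        using zero[OF y] holo_matD_fd(2)[OF hp o y, of e i j] by simp
      then show "fd (\<lambda>z. (\<Theta> z ** \<Psi> z) $ i $ j) y (P (z - z0)) = 0"
        by (simp add: P holoD(2)[OF holo_matD[OF hp] o y])
    qed
    moreover have "t (ray 0 z - z0) = 0"
    proof -
      have "t (ray 0 z - z0) = t (P (ray 0 z - z0))" using P te t(2) by simp
      then show ?thesis using t(1) by (simp add: P_ray linear_simps)
    qed
    then have "\<Psi> (ray 0 z) = mat 1" "\<Theta> (ray 0 z) = mat 1"
      by (auto simp: \<Psi>_def \<Theta>_def \<psi>(3)[OF r0] \<theta>(3)[OF r0] vec_eq_iff mat_def axis_def)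
    ultimately show ?thesis by (simp add: vec_eq_iff)
  qed
  have "invertible (\<Psi> z)" if "z \<in> S" for z
    using inv[OF that] by (metis invertible_left_inverse)
  then show ?thesis using h(1) fdP by (intro exI[of _ \<Psi>]) simp
qed

end

section \<open>Parallel frames along involutive distributions\<close>

text \<open>The antisymmetrised product rule for combinations of \<beta> with coefficients g. It is
  applied to the fields, to functionals of the fields and to connection coefficients;
  \<open>prd\<close> is the scalar action in each case.\<close>

lemma antisymmetric_derivative:
  fixes Y :: "'q::finite \<Rightarrow> 'v" and prd :: "complex \<Rightarrow> 'b::real_normed_vector \<Rightarrow> 'b"
  assumes prd: "bounded_bilinear prd" "\<And>a c x. prd a (prd c x) = prd (a * c) x"
    and B: "\<And>k i. B k (w i) = (\<Sum>l\<in>UNIV. prd (g l i) (B k (Y l)))"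
  shows "(\<Sum>k\<in>UNIV. prd (g k j) (B k (w i)) + prd (g' k j (w i)) (\<beta> k)) - (\<Sum>k\<in>UNIV. prd (g k i) (B k (w j)) + prd (g' k i (w j)) (\<beta> k))
    = (\<Sum>k\<in>UNIV. \<Sum>l\<in>UNIV. prd (g k j * g l i) (B k (Y l) - B l (Y k))) + (\<Sum>k\<in>UNIV. prd (g' k j (w i) - g' k i (w j)) (\<beta> k))"
proof -
  interpret bounded_bilinear prd by fact
  have 1: "(\<Sum>k\<in>UNIV. prd (g k j) (B k (w i))) = (\<Sum>k\<in>UNIV. \<Sum>l\<in>UNIV. prd (g k j * g l i) (B k (Y l)))" for i j
    by (simp add: B sum_right prd(2))
  have 2: "(\<Sum>k\<in>UNIV. \<Sum>l\<in>UNIV. prd (g k i * g l j) (B k (Y l))) = (\<Sum>k\<in>UNIV. \<Sum>l\<in>UNIV. prd (g k j * g l i) (B l (Y k)))"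
    by (subst sum.swap) (simp add: mult.commute)
  show ?thesis
    by (simp add: sum.distrib 1 2 diff_right diff_left sum_subtractf)
qed

lemma sum_rotate: "(\<Sum>k\<in>A. \<Sum>l\<in>B. \<Sum>m\<in>C. a k l m) = (\<Sum>m\<in>C. \<Sum>k\<in>A. \<Sum>l\<in>B. a k l m)"
proof -
  have "(\<Sum>k\<in>A. \<Sum>l\<in>B. \<Sum>m\<in>C. a k l m) = (\<Sum>k\<in>A. \<Sum>m\<in>C. \<Sum>l\<in>B. a k l m)"
    by (intro sum.cong refl sum.swap)
  also have "\<dots> = (\<Sum>m\<in>C. \<Sum>k\<in>A. \<Sum>l\<in>B. a k l m)" by (rule sum.swap)
  finally show ?thesis .
qed

text \<open>Both parts of \<open>involutive\<close> use the same coefficients c: flatness says that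
  the derivative and commutator terms of b give the connection form on the bracket, which is the
  same combination of the \<open>b m\<close> as the bracket is of the \<open>Y m\<close>.\<close>

locale involutive_frame = complex_scaling sc for sc :: "complex \<Rightarrow> 'a::euclidean_space \<Rightarrow> 'a" +
  fixes S :: "'a set" and z0 :: 'a and Y :: "'q::finite \<Rightarrow> 'a \<Rightarrow> 'a" and \<pi> :: "'q \<Rightarrow> 'a \<Rightarrow> complex"
    and b :: "'q \<Rightarrow> 'a \<Rightarrow> complex^'r^'r"
  assumes S: "open S" "z0 \<in> S" and Y: "holo_fld S (Y i)"
    and \<pi>_lin: "bounded_linear (\<pi> i)" and \<pi>_sc: "\<pi> i (sc k w) = k * \<pi> i w"
    and det: "det (\<chi> i j. \<pi> i (Y j z0)) \<noteq> 0"
    and b: "holo_mat sc S (b i)"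
    and involutive: "z \<in> S \<Longrightarrow> \<exists>c. fd (Y j) z (Y i z) - fd (Y i) z (Y j z) = (\<Sum>m\<in>UNIV. sc (c m) (Y m z)) \<and>
        fd (b j) z (Y i z) - fd (b i) z (Y j z) + (b i z ** b j z - b j z ** b i z) = (\<Sum>m\<in>UNIV. mat (c m) ** b m z)"
begin

text \<open>The frame \<open>X\<close> is \<open>Y\<close> times the inverse of this matrix. It
  spans the same distribution and is dual to constant functionals, which forces an involutive frame
  to commute.\<close>

definition G :: "'a \<Rightarrow> complex^'q^'q" where "G z = (\<chi> i j. \<pi> i (Y j z))"
definition S' :: "'a set" where "S' = {z\<in>S. det (G z) \<noteq> 0}"
definition g :: "'a \<Rightarrow> complex^'q^'q" where "g z = matrix_inv (G z)"
definition X :: "'q \<Rightarrow> 'a \<Rightarrow> 'a" where "X j z = (\<Sum>k\<in>UNIV. sc (g z $ k $ j) (Y k z))"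
definition b' :: "'q \<Rightarrow> 'r \<Rightarrow> 'r \<Rightarrow> 'a \<Rightarrow> complex" where
  "b' j a d z = (\<Sum>k\<in>UNIV. g z $ k $ j * b k z $ a $ d)"

lemma \<pi>_fd_Y: 
  assumes "z \<in> S" shows "((\<lambda>z. \<pi> i (Y j z)) has_derivative (\<lambda>w. \<pi> i (fd (Y j) z w))) (at z)"
  by (rule bounded_linear.has_derivative[OF \<pi>_lin holo_fldD(1)[OF Y S(1) assms]])

lemma holo_G: "holo_mat sc S G"
  unfolding G_def[abs_def]
proof (rule holo_matI, simp, rule holoI)
  show "((\<lambda>z. \<pi> i (Y j z)) has_derivative (\<lambda>w. \<pi> i (fd (Y j) z w))) (at z within S)" if "z \<in> S" for i j z
    by (rule has_derivative_at_withinI[OF \<pi>_fd_Y[OF that]])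
  show "\<pi> i (fd (Y j) z (sc c w)) = c * \<pi> i (fd (Y j) z w)" if "z \<in> S" for i j z c w
    by (simp add: holo_fldD(2)[OF Y S(1) that] \<pi>_sc)
qed

lemma S': "open S'" "z0 \<in> S'" "S' \<subseteq> S"
proof -
  have "open ((\<lambda>z. det (G z)) -` (- {0}) \<inter> S)"
    by (rule continuous_open_preimage[OF holo_continuous_on[OF holo_det[OF holo_G]] S(1), of "- {0}", unfolded Int_commute[of S]]) auto
  moreover have "S' = (\<lambda>z. det (G z)) -` (- {0}) \<inter> S" by (auto simp: S'_def)
  ultimately show "open S'" by simp
  show "z0 \<in> S'" "S' \<subseteq> S" using S det by (auto simp: S'_def G_def)
qed

lemma G_inv: assumes "z \<in> S'" shows "G z ** g z = mat 1" "g z ** G z = mat 1"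
  using assms matrix_inv_left matrix_inv_right unfolding S'_def g_def
  by (auto simp: invertible_det_nz)

lemma holo_g: "holo_mat sc S' g"
  unfolding g_def[abs_def]
  by (rule holo_matrix_inv[OF holo_mat_subset[OF holo_G S'(3)]]) (simp add: S'_def invertible_det_nz)

lemma \<pi>_sum: "\<pi> i (\<Sum>j\<in>A. f j) = (\<Sum>j\<in>A. \<pi> i (f j))"
  using bounded_linear.linear[OF \<pi>_lin] by (rule linear_sum)

lemma \<pi>_X: "z \<in> S' \<Longrightarrow> \<pi> i (X j z) = (if i = j then 1 else 0)"
  using G_inv(1)[of z] by (simp add: X_def \<pi>_sum \<pi>_sc vec_eq_iff matrix_nth mat_def G_def mult.commute)

lemma holo_X: "holo_fld S' (X j)"
  unfolding X_def[abs_def]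
  by (intro holo_fld_sum holo_fld_sc holo_matD[OF holo_g] holo_fld_subset[OF Y S'(3)])

lemma holo_b': "holo sc S' (b' j a d)"
  unfolding b'_def[abs_def]
  by (intro holo_sum holo_mult holo_matD[OF holo_g] holo_subset[OF holo_matD[OF b] S'(3)])

text \<open>The expression is the coefficient at \<open>Y m\<close> of the bracket of
  \<open>X i\<close> and \<open>X j\<close>. Every functional \<open>\<pi> n\<close> annihilates
  that bracket, because \<open>\<pi> n (X j)\<close> is constant, and the matrix of the functionals
  on the \<open>Y m\<close> is invertible.\<close>

lemma structure_vanishes:
  assumes z: "z \<in> S'"
    and c: "\<And>k l. fd (Y k) z (Y l z) - fd (Y l) z (Y k z) = (\<Sum>m\<in>UNIV. sc (c l k m) (Y m z))"
  shows "(\<Sum>k\<in>UNIV. \<Sum>l\<in>UNIV. g z $ k $ j * g z $ l $ i * c l k m)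
    + (fd (\<lambda>z. g z $ m $ j) z (X i z) - fd (\<lambda>z. g z $ m $ i) z (X j z)) = 0"
proof -
  have zS: "z \<in> S" using z S' by auto
  let ?M = "\<lambda>m. (\<Sum>k\<in>UNIV. \<Sum>l\<in>UNIV. g z $ k $ j * g z $ l $ i * c l k m)
    + (fd (\<lambda>z. g z $ m $ j) z (X i z) - fd (\<lambda>z. g z $ m $ i) z (X j z))"
  have dg: "((\<lambda>z. g z $ k $ j) has_derivative fd (\<lambda>z. g z $ k $ j) z) (at z)" for k j
    by (rule holoD(1)[OF holo_matD[OF holo_g] S'(1) z])
  have "(\<Sum>m\<in>UNIV. ?M m * \<pi> n (Y m z)) = 0" for n
  proof -
    have fdd: "(\<Sum>k\<in>UNIV. g z $ k $ j * \<pi> n (fd (Y k) z w) + fd (\<lambda>z. g z $ k $ j) z w * \<pi> n (Y k z)) = 0" for j w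
    proof -
      have 1: "((\<lambda>z. \<Sum>k\<in>UNIV. g z $ k $ j * \<pi> n (Y k z)) has_derivative
          (\<lambda>w. \<Sum>k\<in>UNIV. g z $ k $ j * \<pi> n (fd (Y k) z w) + fd (\<lambda>z. g z $ k $ j) z w * \<pi> n (Y k z))) (at z)"
        by (intro has_derivative_sum has_derivative_mult dg \<pi>_fd_Y zS)
      have 2: "((\<lambda>z. \<Sum>k\<in>UNIV. g z $ k $ j * \<pi> n (Y k z)) has_derivative (\<lambda>w. 0)) (at z)"
      proof (rule has_derivative_transform_within_open[OF has_derivative_const S'(1) z])
        fix y assume "y \<in> S'"
        then show "(if n = j then 1 else 0) = (\<Sum>k\<in>UNIV. g y $ k $ j * \<pi> n (Y k y))"
          using \<pi>_X[of y n j] by (simp add: X_def \<pi>_sum \<pi>_sc)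
      qed
      show ?thesis using has_derivative_unique[OF 1 2] by meson
    qed
    have B: "\<pi> n (fd (Y k) z (X i z)) = (\<Sum>l\<in>UNIV. g z $ l $ i * \<pi> n (fd (Y k) z (Y l z)))" for k i
      using bounded_linear.linear[OF has_derivative_bounded_linear[OF holo_fldD(1)[OF Y S(1) zS]]]
      by (simp add: X_def linear_sum holo_fldD(2)[OF Y S(1) zS] \<pi>_sum \<pi>_sc)
    have c': "\<pi> n (fd (Y k) z (Y l z)) - \<pi> n (fd (Y l) z (Y k z)) = (\<Sum>m\<in>UNIV. c l k m * \<pi> n (Y m z))" for k l
      using arg_cong[OF c[of k l], of "\<pi> n"] \<pi>_lin by (simp add: \<pi>_sum \<pi>_sc linear_simps)
    have "0 = (\<Sum>k\<in>UNIV. \<Sum>l\<in>UNIV. g z $ k $ j * g z $ l $ i * (\<pi> n (fd (Y k) z (Y l z)) - \<pi> n (fd (Y l) z (Y k z))))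
       + (\<Sum>k\<in>UNIV. (fd (\<lambda>z. g z $ k $ j) z (X i z) - fd (\<lambda>z. g z $ k $ i) z (X j z)) * \<pi> n (Y k z))"
      using antisymmetric_derivative[OF bounded_bilinear_mult mult.assoc[symmetric], of "\<lambda>k w. \<pi> n (fd (Y k) z w)" "\<lambda>i. X i z"
        "\<lambda>k j. g z $ k $ j" "\<lambda>l. Y l z" j i "\<lambda>k j w. fd (\<lambda>z. g z $ k $ j) z w" "\<lambda>k. \<pi> n (Y k z)", OF B]
      by (simp only: fdd diff_self)
    also have "(\<Sum>k\<in>UNIV. \<Sum>l\<in>UNIV. g z $ k $ j * g z $ l $ i * (\<pi> n (fd (Y k) z (Y l z)) - \<pi> n (fd (Y l) z (Y k z))))
       = (\<Sum>m\<in>UNIV. (\<Sum>k\<in>UNIV. \<Sum>l\<in>UNIV. g z $ k $ j * g z $ l $ i * c l k m) * \<pi> n (Y m z))"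
      unfolding c' sum_distrib_left sum_distrib_right
      by (subst sum_rotate) (simp add: mult.assoc)
    finally show ?thesis by (simp add: distrib_right sum.distrib)
  qed
  then have "G z *v (\<chi> m. ?M m) = 0"
    by (simp add: vec_eq_iff matrix_vector_mult_def G_def mult.commute)
  then have "g z *v (G z *v (\<chi> m. ?M m)) = 0" by simp
  then show ?thesis
    by (simp add: matrix_vector_mul_assoc G_inv[OF z] vec_eq_iff)
qed


lemma fd_Y_X:
  assumes "z \<in> S" shows "fd (Y k) z (X i z) = (\<Sum>l\<in>UNIV. sc (g z $ l $ i) (fd (Y k) z (Y l z)))"
  using bounded_linear.linear[OF has_derivative_bounded_linear[OF holo_fldD(1)[OF Y S(1) assms]]]
  by (simp add: X_def linear_sum holo_fldD(2)[OF Y S(1) assms])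

lemma fd_b_X:
  assumes "z \<in> S" shows "fd (\<lambda>z. b k z $ a $ d) z (X i z) = (\<Sum>l\<in>UNIV. g z $ l $ i * fd (\<lambda>z. b k z $ a $ d) z (Y l z))"
  using bounded_linear.linear[OF fd_linear[OF holo_matD[OF b] S(1) assms]]
  by (simp add: X_def linear_sum holoD(2)[OF holo_matD[OF b] S(1) assms])

text \<open>The bracket and the curvature in the new frame are combinations, with the same
  coefficients, of the fields \<open>Y m\<close> and of the matrices \<open>b m\<close>;
  \<open>structure_vanishes\<close> kills these coefficients.\<close>

lemma commuting_frame: "commuting_frame sc S' z0 X \<pi> b'"
proof (intro commuting_frame.intro commuting_frame_axioms.intro complex_scaling_axioms S'(1,2) holo_X holo_b' \<pi>_lin \<pi>_sc \<pi>_X)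
  fix z i j assume z: "z \<in> S'"
  have zS: "z \<in> S" using z S' by auto
  have "\<forall>l k. \<exists>c. fd (Y k) z (Y l z) - fd (Y l) z (Y k z) = (\<Sum>m\<in>UNIV. sc (c m) (Y m z)) \<and>
        fd (b k) z (Y l z) - fd (b l) z (Y k z) + (b l z ** b k z - b k z ** b l z) = (\<Sum>m\<in>UNIV. mat (c m) ** b m z)"
    using involutive[OF zS] by blast
  then obtain c where c: "\<And>l k. fd (Y k) z (Y l z) - fd (Y l) z (Y k z) = (\<Sum>m\<in>UNIV. sc (c l k m) (Y m z))"
    and cb: "\<And>l k. fd (b k) z (Y l z) - fd (b l) z (Y k z) + (b l z ** b k z - b k z ** b l z) = (\<Sum>m\<in>UNIV. mat (c l k m) ** b m z)"
    by metis
  note M = structure_vanishes[OF z c]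
  have dg: "((\<lambda>z. g z $ k $ j) has_derivative fd (\<lambda>z. g z $ k $ j) z) (at z)" for k j
    by (rule holoD(1)[OF holo_matD[OF holo_g] S'(1) z])
  have fdX: "fd (X j) z w = (\<Sum>k\<in>UNIV. sc (g z $ k $ j) (fd (Y k) z w) + sc (fd (\<lambda>z. g z $ k $ j) z w) (Y k z))" for j w
    unfolding X_def[abs_def]
    by (rule fd_eqI) (intro has_derivative_sum sc.FDERIV dg holo_fldD(1)[OF Y S(1) zS])
  have "fd (X j) z (X i z) - fd (X i) z (X j z)
      = (\<Sum>k\<in>UNIV. \<Sum>l\<in>UNIV. sc (g z $ k $ j * g z $ l $ i) (fd (Y k) z (Y l z) - fd (Y l) z (Y k z)))
      + (\<Sum>k\<in>UNIV. sc (fd (\<lambda>z. g z $ k $ j) z (X i z) - fd (\<lambda>z. g z $ k $ i) z (X j z)) (Y k z))"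
    unfolding fdX
    by (rule antisymmetric_derivative[OF bounded_bilinear_sc sc_sc, of "\<lambda>k w. fd (Y k) z w" "\<lambda>i. X i z"
        "\<lambda>k j. g z $ k $ j" "\<lambda>l. Y l z"]) (rule fd_Y_X[OF zS])
  also have "(\<Sum>k\<in>UNIV. \<Sum>l\<in>UNIV. sc (g z $ k $ j * g z $ l $ i) (fd (Y k) z (Y l z) - fd (Y l) z (Y k z)))
     = (\<Sum>m\<in>UNIV. sc (\<Sum>k\<in>UNIV. \<Sum>l\<in>UNIV. g z $ k $ j * g z $ l $ i * c l k m) (Y m z))"
    unfolding c sc.sum_right sc_sc sc.sum_left by (rule sum_rotate)
  also have "\<dots> + (\<Sum>k\<in>UNIV. sc (fd (\<lambda>z. g z $ k $ j) z (X i z) - fd (\<lambda>z. g z $ k $ i) z (X j z)) (Y k z)) = 0"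
    unfolding sum.distrib[symmetric] sc_add_left[symmetric] M by simp
  finally show "fd (X j) z (X i z) = fd (X i) z (X j z)" by simp
  fix a d
  have db: "((\<lambda>z. b k z $ a $ d) has_derivative fd (\<lambda>z. b k z $ a $ d) z) (at z)" for k
    by (rule holoD(1)[OF holo_matD[OF b] S(1) zS])
  have fdb: "fd (b' j a d) z w = (\<Sum>k\<in>UNIV. g z $ k $ j * fd (\<lambda>z. b k z $ a $ d) z w + fd (\<lambda>z. g z $ k $ j) z w * b k z $ a $ d)" for j w
    unfolding b'_def[abs_def]
    by (rule fd_eqI) (intro has_derivative_sum has_derivative_mult dg db)
  have 1: "fd (b' j a d) z (X i z) - fd (b' i a d) z (X j z)
      = (\<Sum>k\<in>UNIV. \<Sum>l\<in>UNIV. g z $ k $ j * g z $ l $ i * (fd (\<lambda>z. b k z $ a $ d) z (Y l z) - fd (\<lambda>z. b l z $ a $ d) z (Y k z)))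
      + (\<Sum>k\<in>UNIV. (fd (\<lambda>z. g z $ k $ j) z (X i z) - fd (\<lambda>z. g z $ k $ i) z (X j z)) * b k z $ a $ d)"
    unfolding fdb
    by (rule antisymmetric_derivative[OF bounded_bilinear_mult mult.assoc[symmetric], of "\<lambda>k w. fd (\<lambda>z. b k z $ a $ d) z w" "\<lambda>i. X i z"
        "\<lambda>k j. g z $ k $ j" "\<lambda>l. Y l z"]) (rule fd_b_X[OF zS])
  have quad: "(\<Sum>e\<in>UNIV. b' i a e z * b' j e d z) = (\<Sum>k\<in>UNIV. \<Sum>l\<in>UNIV. g z $ k $ j * g z $ l $ i * (b l z ** b k z) $ a $ d)" for i j
  proof -
    have "(\<Sum>e\<in>UNIV. b' i a e z * b' j e d z) = (\<Sum>e\<in>UNIV. \<Sum>k\<in>UNIV. \<Sum>l\<in>UNIV. g z $ k $ j * g z $ l $ i * (b l z $ a $ e * b k z $ e $ d))"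
      unfolding b'_def sum_product
      by (rule sum.cong[OF refl], rule trans[OF sum.swap]) (simp add: mult_ac)
    then show ?thesis
      unfolding matrix_nth sum_distrib_left by (rule trans) (rule sum_rotate[symmetric])
  qed
  have quad': "(\<Sum>e\<in>UNIV. b' j a e z * b' i e d z) = (\<Sum>k\<in>UNIV. \<Sum>l\<in>UNIV. g z $ k $ j * g z $ l $ i * (b k z ** b l z) $ a $ d)"
    unfolding quad by (subst sum.swap) (simp add: mult.commute)
  have cb': "(fd (\<lambda>z. b k z $ a $ d) z (Y l z) - fd (\<lambda>z. b l z $ a $ d) z (Y k z)) + ((b l z ** b k z) $ a $ d - (b k z ** b l z) $ a $ d)
      = (\<Sum>m\<in>UNIV. c l k m * b m z $ a $ d)" for k l
    using arg_cong[OF cb[of k l], of "\<lambda>A. A $ a $ d"]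
    by (simp add: holo_matD_fd(2)[OF b S(1) zS] mat_mult_nth)
  have "fd (b' j a d) z (X i z) - fd (b' i a d) z (X j z) + (\<Sum>e\<in>UNIV. b' i a e z * b' j e d z - b' j a e z * b' i e d z)
      = (\<Sum>k\<in>UNIV. \<Sum>l\<in>UNIV. g z $ k $ j * g z $ l $ i * ((fd (\<lambda>z. b k z $ a $ d) z (Y l z) - fd (\<lambda>z. b l z $ a $ d) z (Y k z))
          + ((b l z ** b k z) $ a $ d - (b k z ** b l z) $ a $ d)))
      + (\<Sum>k\<in>UNIV. (fd (\<lambda>z. g z $ k $ j) z (X i z) - fd (\<lambda>z. g z $ k $ i) z (X j z)) * b k z $ a $ d)"
    unfolding 1 sum_subtractf[of "\<lambda>e. b' i a e z * b' j e d z"] quad' quad[of i j]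
    by (simp add: distrib_left right_diff_distrib sum.distrib sum_subtractf)
  also have "(\<Sum>k\<in>UNIV. \<Sum>l\<in>UNIV. g z $ k $ j * g z $ l $ i * ((fd (\<lambda>z. b k z $ a $ d) z (Y l z) - fd (\<lambda>z. b l z $ a $ d) z (Y k z))
          + ((b l z ** b k z) $ a $ d - (b k z ** b l z) $ a $ d)))
    = (\<Sum>m\<in>UNIV. (\<Sum>k\<in>UNIV. \<Sum>l\<in>UNIV. g z $ k $ j * g z $ l $ i * c l k m) * b m z $ a $ d)"
    unfolding cb' sum_distrib_left sum_distrib_right mult.assoc by (rule sum_rotate)
  also have "\<dots> + (\<Sum>k\<in>UNIV. (fd (\<lambda>z. g z $ k $ j) z (X i z) - fd (\<lambda>z. g z $ k $ i) z (X j z)) * b k z $ a $ d) = 0"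
    unfolding sum.distrib[symmetric] distrib_right[symmetric] M by simp
  finally show "fd (b' j a d) z (X i z) - fd (b' i a d) z (X j z) + (\<Sum>e\<in>UNIV. b' i a e z * b' j e d z - b' j a e z * b' i e d z) = 0" .
qed

theorem parallel_frame:
  obtains N and \<Psi> :: "'a \<Rightarrow> complex^'r^'r" where "open N" "z0 \<in> N" "N \<subseteq> S" "holo_mat sc N \<Psi>" "\<And>z. z \<in> N \<Longrightarrow> invertible (\<Psi> z)"
    "\<And>z i. z \<in> N \<Longrightarrow> fd \<Psi> z (Y i z) + b i z ** \<Psi> z = 0"
proof -
  obtain N where N: "open N" "z0 \<in> N" "N \<subseteq> S'"
    "\<And>v. \<exists>\<psi>. (\<forall>a. holo sc N (\<psi> a)) \<and> (\<forall>a. \<psi> a z0 = v a) \<and>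
     (\<forall>z\<in>N. \<forall>i a. fd (\<psi> a) z (X i z) + (\<Sum>c\<in>UNIV. b' i a c z * \<psi> c z) = 0)"
    using commuting_frame.parallel_sections[OF commuting_frame] by blast
  have ex: "\<forall>d. \<exists>\<psi>. (\<forall>a. holo sc N (\<psi> a)) \<and> (\<forall>a. \<psi> a z0 = mat 1 $ a $ d) \<and>
     (\<forall>z\<in>N. \<forall>i a. fd (\<psi> a) z (X i z) + (\<Sum>c\<in>UNIV. b' i a c z * \<psi> c z) = 0)"
    by (intro allI N(4))
  from choice[OF ex] obtain \<psi> where "\<forall>d. (\<forall>a. holo sc N (\<psi> d a)) \<and> (\<forall>a. \<psi> d a z0 = mat 1 $ a $ d) \<and>
     (\<forall>z\<in>N. \<forall>i a. fd (\<psi> d a) z (X i z) + (\<Sum>c\<in>UNIV. b' i a c z * \<psi> d c z) = 0)" ..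
  then have \<psi>: "\<And>d a. holo sc N (\<psi> d a)" "\<And>d a. \<psi> d a z0 = mat 1 $ a $ d"
    "\<And>d z i a. z \<in> N \<Longrightarrow> fd (\<psi> d a) z (X i z) + (\<Sum>c\<in>UNIV. b' i a c z * \<psi> d c z) = 0"
    by blast+
  define \<Psi> where "\<Psi> z = (\<chi> a d. \<psi> d a z)" for z
  have h: "holo_mat sc N \<Psi>" by (auto simp: \<Psi>_def intro!: holo_matI \<psi>)
  \<comment> \<open>Sections with independent values at z0 remain a frame where the determinant is
    nonzero.\<close>
  define N' where "N' = (\<lambda>z. det (\<Psi> z)) -` (- {0}) \<inter> N"
  have N': "open N'"
    unfolding N'_def
    by (rule continuous_open_preimage[OF holo_continuous_on[OF holo_det[OF h]] N(1), of "- {0}", unfolded Int_commute[of N]]) auto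
  have "\<Psi> z0 = mat 1" by (simp add: \<Psi>_def \<psi>(2) vec_eq_iff)
  then have z0: "z0 \<in> N'" using N(2) by (simp add: N'_def)
  show ?thesis
  proof (rule that[OF N' z0])
    show "N' \<subseteq> S" using N(3) S'(3) by (auto simp: N'_def)
    show "holo_mat sc N' \<Psi>" by (rule holo_mat_subset[OF h]) (auto simp: N'_def)
    show "invertible (\<Psi> z)" if "z \<in> N'" for z using that by (simp add: N'_def invertible_det_nz)
    fix z i assume "z \<in> N'"
    then have z: "z \<in> N" by (simp add: N'_def)
    then have zS: "z \<in> S'" using N by auto
    have X: "fd \<Psi> z (X k z) = - (\<chi> a c. b' k a c z) ** \<Psi> z" for k
    proof -
      have "fd \<Psi> z (X k z) $ a $ d = - (\<Sum>c\<in>UNIV. b' k a c z * \<Psi> z $ c $ d)" for a d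
        using \<psi>(3)[OF z, of d a k] holo_matD_fd(2)[OF h N(1) z, of "X k z" a d] by (simp add: \<Psi>_def eq_neg_iff_add_eq_0)
      then show ?thesis by (simp add: vec_eq_iff matrix_nth sum_negf)
    qed
    have gG: "(\<Sum>j\<in>UNIV. g z $ k $ j * G z $ j $ i) = (if k = i then 1 else 0)" for k
      using G_inv(2)[OF zS] by (simp add: vec_eq_iff matrix_nth mat_def)
    have Yi: "Y i z = (\<Sum>j\<in>UNIV. sc (G z $ j $ i) (X j z))"
    proof -
      have "(\<Sum>j\<in>UNIV. sc (G z $ j $ i) (X j z)) = (\<Sum>k\<in>UNIV. sc (\<Sum>j\<in>UNIV. g z $ k $ j * G z $ j $ i) (Y k z))"
        unfolding X_def sc.sum_right sc_sc sc.sum_left by (subst sum.swap) (simp add: mult.commute)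
      also have "\<dots> = (\<Sum>k\<in>UNIV. if k = i then Y k z else 0)"
        unfolding gG by (intro sum.cong) auto
      finally show ?thesis by simp
    qed
    have bi: "b i z $ a $ c = (\<Sum>j\<in>UNIV. G z $ j $ i * b' j a c z)" for a c
    proof -
      have "(\<Sum>j\<in>UNIV. G z $ j $ i * b' j a c z) = (\<Sum>k\<in>UNIV. (\<Sum>j\<in>UNIV. g z $ k $ j * G z $ j $ i) * b k z $ a $ c)"
        unfolding b'_def sum_distrib_left sum_distrib_right by (subst sum.swap) (simp add: mult_ac)
      also have "\<dots> = (\<Sum>k\<in>UNIV. if k = i then b k z $ a $ c else 0)"
        unfolding gG by (intro sum.cong) auto
      finally show ?thesis by simp
    qed
    have "fd \<Psi> z (Y i z) = (\<Sum>j\<in>UNIV. mat (G z $ j $ i) ** fd \<Psi> z (X j z))"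
      using bounded_linear.linear[OF has_derivative_bounded_linear[OF holo_matD_fd(1)[OF h N(1) z]]]
      by (simp add: Yi linear_sum fd_mat_sc[OF h N(1) z])
    also have "\<dots> = - (\<Sum>j\<in>UNIV. mat (G z $ j $ i) ** (\<chi> a c. b' j a c z)) ** \<Psi> z"
      by (simp add: X mm.minus_left mm.minus_right matrix_mul_assoc mm.sum_left sum_negf)
    also have "(\<Sum>j\<in>UNIV. mat (G z $ j $ i) ** (\<chi> a c. b' j a c z)) = b i z"
      by (simp add: vec_eq_iff bi mat_mult_nth)
    finally show "fd \<Psi> z (Y i z) + b i z ** \<Psi> z = 0" by (simp add: mm.minus_left)
  qed
qed

end

section \<open>Calculus on harmonic space\<close>

lemma (in complex_scaling) holo_familyE:
  assumes "\<And>k. holo sc S (F k)" "z \<in> S"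
  obtains L where "\<And>k. (F k has_derivative L k) (at z within S)" "\<And>k c w. L k (sc c w) = c * L k w"
proof -
  have "\<forall>k. \<exists>L. (F k has_derivative L) (at z within S) \<and> (\<forall>c w. L (sc c w) = c * L w)"
    using assms by (simp add: holo_def)
  from choice[OF this] obtain L where "\<forall>k. (F k has_derivative L k) (at z within S) \<and> (\<forall>c w. L k (sc c w) = c * L k w)" ..
  then show ?thesis using that by blast
qed

lemma norm_smult_vec: "norm (c *s v) = norm c * norm v" for c :: complex and v :: "complex^'n"
  by (simp add: norm_vec_def L2_set_def norm_mult power_mult_distrib flip: sum_distrib_left)
    (simp add: real_sqrt_mult)

interpretation hs: complex_scaling hscale
proof
  show "hscale (a + b) w = hscale a w + hscale b w" for a b and w :: "'n::finite hpoint"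
    by (simp add: hscale_def prod_eq_iff vec_eq_iff algebra_simps)
  show "hscale a (v + w) = hscale a v + hscale a w" for a and v w :: "'n::finite hpoint"
    by (simp add: hscale_def prod_eq_iff vec_eq_iff algebra_simps)
  show "hscale a (hscale b w) = hscale (a * b) w" for a b and w :: "'n::finite hpoint"
    by (simp add: hscale_def)
  show "hscale (of_real r) w = r *\<^sub>R w" for r and w :: "'n::finite hpoint"
    by (simp add: hscale_def prod_eq_iff vec_eq_iff) (simp add: scaleR_conv_of_real)
  show "norm (hscale a w) = norm a * norm w" for a and w :: "'n::finite hpoint"
  proof -
    have "(norm a * x)\<^sup>2 + ((norm a * y)\<^sup>2 + (norm a * t)\<^sup>2) = (norm a)\<^sup>2 * (x\<^sup>2 + (y\<^sup>2 + t\<^sup>2))" for x y t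
      by (simp add: power_mult_distrib distrib_left)
    then show ?thesis
      by (cases w) (simp add: hscale_def norm_Pair norm_smult_vec real_sqrt_mult)
  qed
qed

lemma hscale_sel [simp]: "fst (hscale c w) = c *s fst w" "uplus (hscale c w) = c *s uplus w"
  "uminus' (hscale c w) = c *s uminus' w"
  by (simp_all add: hscale_def)

lemma bounded_linear_coord:
  "bounded_linear (\<lambda>w :: 'n::finite hpoint. fst w $ k)" "bounded_linear (\<lambda>w :: 'n::finite hpoint. uplus w $ a)"
  "bounded_linear (\<lambda>w :: 'n::finite hpoint. uminus' w $ a)"
  by (auto intro!: bounded_linear_intros bounded_linear_compose[OF bounded_linear_vec_nth]
      bounded_linear_compose[OF bounded_linear_fst] bounded_linear_compose[OF bounded_linear_snd] bounded_linear_fst bounded_linear_snd)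

lemma has_derivative_coord [derivative_intros]:
  assumes "(X has_derivative L) F"
  shows "((\<lambda>z. fst (X z) $ k) has_derivative (\<lambda>w. fst (L w) $ k)) F"
    "((\<lambda>z. uplus (X z) $ a) has_derivative (\<lambda>w. uplus (L w) $ a)) F"
    "((\<lambda>z. uminus' (X z) $ a) has_derivative (\<lambda>w. uminus' (L w) $ a)) F"
  using bounded_linear.has_derivative[OF bounded_linear_coord(1) assms]
    bounded_linear.has_derivative[OF bounded_linear_coord(2) assms]
    bounded_linear.has_derivative[OF bounded_linear_coord(3) assms] by auto

lemma holo_fld_coord:
  assumes "hs.holo_fld S X"
  shows "holo hscale S (\<lambda>z. fst (X z) $ k)" "holo hscale S (\<lambda>z. uplus (X z) $ a)"
    "holo hscale S (\<lambda>z. uminus' (X z) $ a)"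
proof -
  have *: "\<exists>L. (X has_derivative L) (at z within S) \<and> (\<forall>c w. L (hscale c w) = hscale c (L w))" if "z \<in> S" for z
    using assms that by (auto simp: hs.holo_fld_def)
  show "holo hscale S (\<lambda>z. fst (X z) $ k)"
    unfolding holo_def
  proof
    fix z assume "z \<in> S"
    from *[OF this] obtain L where L: "(X has_derivative L) (at z within S)" "\<forall>c w. L (hscale c w) = hscale c (L w)" by blast
    show "\<exists>L. ((\<lambda>z. fst (X z) $ k) has_derivative L) (at z within S) \<and> (\<forall>c w. L (hscale c w) = c * L w)"
      by (intro exI[of _ "\<lambda>w. fst (L w) $ k"] conjI has_derivative_coord L) (simp add: L)
  qed
  show "holo hscale S (\<lambda>z. uplus (X z) $ a)"
    unfolding holo_def
  proof
    fix z assume "z \<in> S"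
    from *[OF this] obtain L where L: "(X has_derivative L) (at z within S)" "\<forall>c w. L (hscale c w) = hscale c (L w)" by blast
    show "\<exists>L. ((\<lambda>z. uplus (X z) $ a) has_derivative L) (at z within S) \<and> (\<forall>c w. L (hscale c w) = c * L w)"
      by (intro exI[of _ "\<lambda>w. uplus (L w) $ a"] conjI has_derivative_coord L) (simp add: L)
  qed
  show "holo hscale S (\<lambda>z. uminus' (X z) $ a)"
    unfolding holo_def
  proof
    fix z assume "z \<in> S"
    from *[OF this] obtain L where L: "(X has_derivative L) (at z within S)" "\<forall>c w. L (hscale c w) = hscale c (L w)" by blast
    show "\<exists>L. ((\<lambda>z. uminus' (X z) $ a) has_derivative L) (at z within S) \<and> (\<forall>c w. L (hscale c w) = c * L w)"
      by (intro exI[of _ "\<lambda>w. uminus' (L w) $ a"] conjI has_derivative_coord L) (simp add: L)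
  qed
qed

lemmas holo_coord [simp] = holo_fld_coord[OF hs.holo_fld_id]

lemma holo_fldI:
  assumes "\<And>k. holo hscale S (\<lambda>z. fst (X z) $ k)" "\<And>a. holo hscale S (\<lambda>z. uplus (X z) $ a)"
    "\<And>a. holo hscale S (\<lambda>z. uminus' (X z) $ a)"
  shows "hs.holo_fld S X"
  unfolding hs.holo_fld_def
proof
  fix z assume z: "z \<in> S"
  obtain L1 where L1: "\<And>k. ((\<lambda>z. fst (X z) $ k) has_derivative L1 k) (at z within S)" "\<And>k c w. L1 k (hscale c w) = c * L1 k w"
    by (rule hs.holo_familyE[where F = "\<lambda>k z. fst (X z) $ k" and S = S and z = z]) (use assms z in auto)
  obtain L2 where L2: "\<And>a. ((\<lambda>z. uplus (X z) $ a) has_derivative L2 a) (at z within S)" "\<And>a c w. L2 a (hscale c w) = c * L2 a w"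
    by (rule hs.holo_familyE[where F = "\<lambda>a z. uplus (X z) $ a" and S = S and z = z]) (use assms z in auto)
  obtain L3 where L3: "\<And>a. ((\<lambda>z. uminus' (X z) $ a) has_derivative L3 a) (at z within S)" "\<And>a c w. L3 a (hscale c w) = c * L3 a w"
    by (rule hs.holo_familyE[where F = "\<lambda>a z. uminus' (X z) $ a" and S = S and z = z]) (use assms z in auto)
  have "((\<lambda>z. (fst (X z), uplus (X z), uminus' (X z))) has_derivative (\<lambda>w. (\<chi> k. L1 k w, \<chi> a. L2 a w, \<chi> a. L3 a w))) (at z within S)"
    by (intro has_derivative_Pair has_derivative_vec) (simp_all add: L1 L2 L3)
  then show "\<exists>L. (X has_derivative L) (at z within S) \<and> (\<forall>c w. L (hscale c w) = hscale c (L w))"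
    by (intro exI[of _ "\<lambda>w. (\<chi> k. L1 k w, \<chi> a. L2 a w, \<chi> a. L3 a w)"] conjI allI)
      (simp_all add: L1 L2 L3 prod_eq_iff vec_eq_iff)
qed

lemma tangent_field_iff: "tangent_field \<Omega> W \<longleftrightarrow> (\<forall>z\<in>\<Omega>. tangent z (W z)) \<and> hs.holo_fld \<Omega> W"
  unfolding tangent_field_def holo_vec_def using holo_fldI holo_fld_coord by blast

definition dt :: "'n::finite hpoint \<Rightarrow> complex" where
  "dt z = uplus z $ 1 * uminus' z $ 2 - uplus z $ 2 * uminus' z $ 1"

definition ddt :: "'n::finite hpoint \<Rightarrow> 'n hpoint \<Rightarrow> complex" where
  "ddt z w = uplus w $ 1 * uminus' z $ 2 + uplus z $ 1 * uminus' w $ 2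
           - uplus w $ 2 * uminus' z $ 1 - uplus z $ 2 * uminus' w $ 1"

lemma tangent_iff: "tangent z w \<longleftrightarrow> ddt z w = 0"
  by (simp add: tangent_def ddt_def)

lemma tangent_linear: "tangent z v \<Longrightarrow> tangent z w \<Longrightarrow> tangent z (v + w)"
  "tangent z v \<Longrightarrow> tangent z w \<Longrightarrow> tangent z (v - w)"
  "tangent z w \<Longrightarrow> tangent z (hscale c w)" "tangent z 0" "tangent z w \<Longrightarrow> tangent z (- w)"
proof -
  show "tangent z v \<Longrightarrow> tangent z w \<Longrightarrow> tangent z (v + w)" "tangent z v \<Longrightarrow> tangent z w \<Longrightarrow> tangent z (v - w)"
    "tangent z w \<Longrightarrow> tangent z (- w)" "tangent z 0"
    unfolding tangent_def by (simp_all add: algebra_simps)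
  assume "tangent z w"
  moreover have "ddt z (hscale c w) = c * ddt z w" by (simp add: ddt_def algebra_simps)
  ultimately show "tangent z (hscale c w)" by (simp add: tangent_iff)
qed

lemma tangent_sum: "(\<And>i. i \<in> A \<Longrightarrow> tangent z (f i)) \<Longrightarrow> tangent z (\<Sum>i\<in>A. f i)"
  by (induction A rule: infinite_finite_induct) (auto intro: tangent_linear)

lemma has_derivative_dt: "(dt has_derivative ddt z) (at z within S)"
  unfolding dt_def[abs_def] ddt_def[abs_def]
  by (rule derivative_eq_intros has_derivative_coord has_derivative_ident refl)+ (simp add: algebra_simps)

lemma holo_dt: "holo hscale S dt"
  unfolding dt_def[abs_def] by (intro hs.holo_diff hs.holo_mult holo_coord)

text \<open>Rescaling u_- retracts the open set where \<open>dt\<close> is nonzero onto the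
  hypersurface \<open>dt\<close> = 1, holomorphically. Composition with it extends functions from
  harmonic space to an open set.\<close>

definition rho :: "'n::finite hpoint \<Rightarrow> 'n hpoint" where
  "rho z = (fst z, uplus z, inverse (dt z) *s uminus' z)"

text \<open>The derivative of \<open>rho\<close>; at points with \<open>dt\<close> = 1 it is a
  projection onto the tangent space.\<close>

definition Drho :: "'n::finite hpoint \<Rightarrow> 'n hpoint \<Rightarrow> 'n hpoint" where
  "Drho z w = (fst w, uplus w, inverse (dt z) *s uminus' w - (inverse (dt z) * ddt z w * inverse (dt z)) *s uminus' z)"

lemma has_derivative_rho:
  assumes "dt z \<noteq> 0"
  shows "(rho has_derivative Drho z) (at z within S)"
proof -
  have fstd: "((\<lambda>z :: 'a hpoint. fst z) has_derivative fst) (at z within S)"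
    by (rule bounded_linear_imp_has_derivative[OF bounded_linear_fst])
  have upd: "((\<lambda>z :: 'a hpoint. uplus z) has_derivative uplus) (at z within S)"
    by (rule bounded_linear_imp_has_derivative)
      (intro bounded_linear_compose[OF bounded_linear_fst] bounded_linear_snd)
  have "((\<lambda>z. (fst z, uplus z, inverse (dt z) *s uminus' z)) has_derivative
    (\<lambda>w. (fst w, uplus w, inverse (dt z) *s uminus' w - (inverse (dt z) * ddt z w * inverse (dt z)) *s uminus' z))) (at z within S)"
  proof (intro has_derivative_Pair[OF fstd] has_derivative_Pair[OF upd], rule has_derivative_vec)
    fix i
    have "((\<lambda>z. inverse (dt z) * uminus' z $ i) has_derivative
        (\<lambda>w. inverse (dt z) * uminus' w $ i + (- (inverse (dt z) * ddt z w * inverse (dt z))) * uminus' z $ i)) (at z within S)"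
      by (intro has_derivative_mult Deriv.has_derivative_inverse has_derivative_dt assms has_derivative_coord has_derivative_ident)
    then show "((\<lambda>z. (inverse (dt z) *s uminus' z) $ i) has_derivative
        (\<lambda>w. (inverse (dt z) *s uminus' w - (inverse (dt z) * ddt z w * inverse (dt z)) *s uminus' z) $ i)) (at z within S)"
      by (simp add: algebra_simps)
  qed
  then show ?thesis by (simp add: rho_def[abs_def] Drho_def[abs_def])
qed

lemma Drho_hscale: "Drho z (hscale c w) = hscale c (Drho z w)"
  by (simp add: Drho_def hscale_def ddt_def vec_eq_iff algebra_simps)

lemma Drho_add: "Drho z (v + w) = Drho z v + Drho z w"
  by (simp add: Drho_def ddt_def vec_eq_iff algebra_simps)

lemma Drho_tangent: "dt z = 1 \<Longrightarrow> tangent z w \<Longrightarrow> Drho z w = w"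
  by (cases w) (simp add: Drho_def tangent_iff)

lemma tangent_Drho:
  assumes "dt z = 1" shows "tangent z (Drho z w)"
proof -
  have "ddt z (fst w, uplus w, uminus' w - c *s uminus' z) = ddt z w - c * dt z" for c
    by (simp add: ddt_def dt_def algebra_simps)
  moreover have "Drho z w = (fst w, uplus w, uminus' w - ddt z w *s uminus' z)"
    by (simp add: Drho_def assms)
  ultimately have "ddt z (Drho z w) = ddt z w - ddt z w * dt z" by simp
  then show ?thesis by (simp add: tangent_iff assms)
qed

lemma holo_fld_rho: "(\<And>z. z \<in> S \<Longrightarrow> dt z \<noteq> 0) \<Longrightarrow> hs.holo_fld S rho"
  unfolding hs.holo_fld_def using has_derivative_rho Drho_hscale by blast

lemma harmonic_space_iff: "z \<in> harmonic_space M \<longleftrightarrow> fst z \<in> M \<and> dt z = 1"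
  by (simp add: harmonic_space_def dt_def)

lemma rho_fixed: "dt z = 1 \<Longrightarrow> rho z = z"
  by (cases z) (simp add: rho_def)

lemma rho_harmonic: "fst z \<in> M \<Longrightarrow> dt z \<noteq> 0 \<Longrightarrow> rho z \<in> harmonic_space M"
proof -
  assume "fst z \<in> M" "dt z \<noteq> 0"
  moreover have "dt (rho z) = inverse (dt z) * dt z"
    by (simp add: rho_def) (simp add: dt_def algebra_simps)
  ultimately show ?thesis by (simp add: harmonic_space_iff) (simp add: rho_def)
qed

section \<open>Derivatives on relatively open subsets of harmonic space\<close>

locale harmonic_domain =
  fixes M :: "(complex^'n) set" and \<Omega> :: "('n hpoint) set"
  assumes M: "open M" and \<Omega>: "openin (top_of_set (harmonic_space M)) \<Omega>"
begin

definition ext :: "('n hpoint) set" where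
  "ext = {z. fst z \<in> M \<and> dt z \<noteq> 0 \<and> rho z \<in> \<Omega>}"

lemma \<Omega>_sub: "\<Omega> \<subseteq> harmonic_space M"
  using \<Omega> openin_imp_subset by blast

lemma dt_\<Omega>: "z \<in> \<Omega> \<Longrightarrow> dt z = 1"
  using \<Omega>_sub by (auto simp: harmonic_space_iff)

lemma fst_\<Omega>: "z \<in> \<Omega> \<Longrightarrow> fst z \<in> M"
  using \<Omega>_sub by (auto simp: harmonic_space_iff)

lemma open_ext: "open ext"
proof -
  obtain G where G: "open G" "\<Omega> = harmonic_space M \<inter> G" using \<Omega> unfolding openin_open by blast
  let ?D = "{z :: 'n hpoint. fst z \<in> M \<and> dt z \<noteq> 0}"
  have "?D = (fst -` M :: 'n hpoint set) \<inter> dt -` (- {0})" by auto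
  moreover have "open (fst -` M :: 'n hpoint set)" using M by (rule open_vimage_fst)
  moreover have "open (dt -` (- {0}) :: 'n hpoint set)"
    by (rule open_vimage) (auto intro: hs.holo_continuous_on holo_dt)
  ultimately have D: "open ?D" by (simp only: open_Int)
  have "open (rho -` G \<inter> ?D)"
    by (subst Int_commute, rule continuous_open_preimage[OF hs.holo_fld_continuous_on[OF holo_fld_rho] D G(1)]) auto
  moreover have "rho z \<in> \<Omega> \<longleftrightarrow> rho z \<in> G" if "fst z \<in> M" "dt z \<noteq> 0" for z
    using rho_harmonic[OF that] G(2) by auto
  then have "ext = rho -` G \<inter> ?D"
    unfolding ext_def by blast
  ultimately show ?thesis by simp
qed

lemma \<Omega>_ext: "\<Omega> \<subseteq> ext"
  using \<Omega>_sub by (auto simp: ext_def harmonic_space_iff rho_fixed)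

lemma rho_ext: "rho ` ext \<subseteq> \<Omega>" "z \<in> ext \<Longrightarrow> rho z \<in> \<Omega>" "z \<in> ext \<Longrightarrow> dt z \<noteq> 0"
  by (auto simp: ext_def)

lemma has_derivative_comp_rho:
  assumes "(f has_derivative L) (at (rho z) within \<Omega>)" "z \<in> ext"
  shows "((\<lambda>z. f (rho z)) has_derivative (\<lambda>w. L (Drho z w))) (at z)"
proof -
  have "((\<lambda>z. f (rho z)) has_derivative (\<lambda>w. L (Drho z w))) (at z within ext)"
    by (rule has_derivative_in_compose[OF has_derivative_rho[OF rho_ext(3)[OF assms(2)]]])
      (rule has_derivative_subset[OF assms(1) rho_ext(1)])
  then show ?thesis by (simp only: at_within_open[OF assms(2) open_ext])
qed

text \<open>\<open>der\<close> selects some derivative within \<Omega>, which is not unique on all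
  ambient vectors. Composition with \<open>rho\<close> gives a function on an open set, and
  \<open>Drho\<close> is the identity on tangent vectors, so the choice is immaterial there.\<close>

lemma der_eqI:
  assumes "(f has_derivative L) (at z within \<Omega>)" "z \<in> \<Omega>" "tangent z w"
  shows "der \<Omega> f z w = L w"
proof -
  have z: "rho z = z" "z \<in> ext" using rho_fixed[OF dt_\<Omega>[OF assms(2)]] assms(2) \<Omega>_ext by auto
  have "(f has_derivative der \<Omega> f z) (at z within \<Omega>)"
    using assms(1) unfolding der_def using frechet_derivative_works differentiable_def by blast
  from has_derivative_unique[OF has_derivative_comp_rho[of f _ z, unfolded z(1), OF this z(2)]
      has_derivative_comp_rho[of f _ z, unfolded z(1), OF assms(1) z(2)]]
  show ?thesis using Drho_tangent[OF dt_\<Omega>[OF assms(2)] assms(3)] by metis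
qed

lemma der_fd:
  assumes "(f has_derivative L) (at z within \<Omega>)" "z \<in> \<Omega>" "tangent z w"
  shows "der \<Omega> f z w = fd (\<lambda>z. f (rho z)) z w"
proof -
  have z: "rho z = z" "z \<in> ext" using rho_fixed[OF dt_\<Omega>[OF assms(2)]] assms(2) \<Omega>_ext by auto
  show ?thesis
    using der_eqI[OF assms] fd_eqI[OF has_derivative_comp_rho[of f _ z, unfolded z(1), OF assms(1) z(2)], of w]
      Drho_tangent[OF dt_\<Omega>[OF assms(2)] assms(3)] by simp
qed

lemma der_cong:
  assumes "\<And>z. z \<in> \<Omega> \<Longrightarrow> f z = g z" "(f has_derivative L) (at z within \<Omega>)" "z \<in> \<Omega>" "tangent z w"
  shows "der \<Omega> f z w = der \<Omega> g z w"
proof -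
  have "(g has_derivative L) (at z within \<Omega>)"
    by (rule has_derivative_transform[OF assms(3) _ assms(2)]) (simp add: assms(1))
  then show ?thesis using der_eqI assms by metis
qed

lemma has_derivative_holo:
  assumes "holo hscale \<Omega> f" "z \<in> \<Omega>"
  shows "(f has_derivative der \<Omega> f z) (at z within \<Omega>)"
  using assms unfolding der_def holo_def using frechet_derivative_works differentiable_def by blast

lemma has_derivative_holo_mat:
  assumes "holo_mat hscale \<Omega> f" "z \<in> \<Omega>"
  shows "(f has_derivative der \<Omega> f z) (at z within \<Omega>)"
proof -
  have L: "((\<lambda>z. f z $ i $ j) has_derivative der \<Omega> (\<lambda>z. f z $ i $ j) z) (at z within \<Omega>)" for i j
    by (rule has_derivative_holo[OF hs.holo_matD[OF assms(1)] assms(2)])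
  have "(f has_derivative (\<lambda>w. \<chi> i j. der \<Omega> (\<lambda>z. f z $ i $ j) z w)) (at z within \<Omega>)"
    by (rule has_derivative_vec, rule has_derivative_vec) (simp add: L)
  then show ?thesis unfolding der_def using frechet_derivative_works differentiable_def by blast
qed

lemma has_derivative_fld:
  assumes "hs.holo_fld \<Omega> f" "z \<in> \<Omega>"
  shows "(f has_derivative der \<Omega> f z) (at z within \<Omega>)"
  using assms unfolding der_def hs.holo_fld_def using frechet_derivative_works differentiable_def by blast

lemma holo_mat_comp_rho: "holo_mat hscale \<Omega> f \<Longrightarrow> holo_mat hscale ext (\<lambda>z. f (rho z))"
  by (rule hs.holo_mat_compose_fld[OF _ holo_fld_rho rho_ext(1)]) (auto simp: rho_ext)

lemma holo_fld_comp_rho: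
  assumes "hs.holo_fld \<Omega> X" shows "hs.holo_fld ext (\<lambda>z. X (rho z))"
  by (rule holo_fldI; rule hs.holo_compose_fld[OF _ holo_fld_rho rho_ext(1)])
    (use assms holo_fld_coord in \<open>auto simp: rho_ext\<close>)

lemma der_mat_fd:
  assumes "holo_mat hscale \<Omega> f" "z \<in> \<Omega>" "tangent z w"
  shows "der \<Omega> f z w = fd (\<lambda>z. f (rho z)) z w"
  by (rule der_fd[OF has_derivative_holo_mat[OF assms(1,2)] assms(2,3)])

lemma holo_mat_der:
  assumes f: "holo_mat hscale \<Omega> f" and X: "tangent_field \<Omega> X"
  shows "holo_mat hscale \<Omega> (\<lambda>z. der \<Omega> f z (X z))"
proof (rule hs.holo_mat_cong)
  have X': "hs.holo_fld \<Omega> X" "\<And>z. z \<in> \<Omega> \<Longrightarrow> tangent z (X z)" using X by (auto simp: tangent_field_iff)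
  show "holo_mat hscale \<Omega> (\<lambda>z. fd (\<lambda>z. f (rho z)) z (X (rho z)))"
    by (rule hs.holo_mat_subset[OF hs.holo_mat_fd_fld[OF holo_mat_comp_rho[OF f] open_ext holo_fld_comp_rho[OF X'(1)]] \<Omega>_ext])
  fix z assume z: "z \<in> \<Omega>"
  show "fd (\<lambda>z. f (rho z)) z (X (rho z)) = der \<Omega> f z (X z)"
    using der_mat_fd[OF f z X'(2)[OF z]] rho_fixed[OF dt_\<Omega>[OF z]] by simp
qed

lemma der_linear:
  assumes f: "holo_mat hscale \<Omega> f" and z: "z \<in> \<Omega>"
  shows "der \<Omega> f z (v + w) = der \<Omega> f z v + der \<Omega> f z w" "der \<Omega> f z (v - w) = der \<Omega> f z v - der \<Omega> f z w"
    "der \<Omega> f z 0 = 0" "der \<Omega> f z (- w) = - der \<Omega> f z w"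
  using has_derivative_bounded_linear[OF has_derivative_holo_mat[OF f z]] by (simp_all add: linear_simps)

text \<open>On tangent vectors the derivative agrees with that of the holomorphic extension; on
  other vectors the selected derivative is only known to be real linear.\<close>

lemma der_hscale:
  assumes f: "holo_mat hscale \<Omega> f" and z: "z \<in> \<Omega>" and w: "tangent z w"
  shows "der \<Omega> f z (hscale c w) = mat c ** der \<Omega> f z w"
proof -
  have ze: "z \<in> ext" using z \<Omega>_ext by auto
  show ?thesis
    using der_mat_fd[OF f z w] der_mat_fd[OF f z tangent_linear(3)[OF w, of c]]
      hs.fd_mat_sc[OF holo_mat_comp_rho[OF f] open_ext ze] by simp
qed

lemma der_mult:
  assumes "holo_mat hscale \<Omega> f" "holo_mat hscale \<Omega> g" "z \<in> \<Omega>" "tangent z w"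
  shows "der \<Omega> (\<lambda>z. f z ** g z) z w = f z ** der \<Omega> g z w + der \<Omega> f z w ** g z"
  by (rule der_eqI[OF mm.FDERIV[OF has_derivative_holo_mat[OF assms(1,3)] has_derivative_holo_mat[OF assms(2,3)]] assms(3,4)])

lemma der_add:
  assumes "holo_mat hscale \<Omega> f" "holo_mat hscale \<Omega> g" "z \<in> \<Omega>" "tangent z w"
  shows "der \<Omega> (\<lambda>z. f z + g z) z w = der \<Omega> f z w + der \<Omega> g z w"
  by (rule der_eqI[OF has_derivative_add[OF has_derivative_holo_mat[OF assms(1,3)] has_derivative_holo_mat[OF assms(2,3)]] assms(3,4)])

lemma der_minus:
  assumes "holo_mat hscale \<Omega> f" "z \<in> \<Omega>" "tangent z w"
  shows "der \<Omega> (\<lambda>z. - f z) z w = - der \<Omega> f z w"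
  by (rule der_eqI[OF has_derivative_minus[OF has_derivative_holo_mat[OF assms(1,2)]] assms(2,3)])

lemma der_scaleR:
  assumes "holo_mat hscale \<Omega> f" "z \<in> \<Omega>" "tangent z w"
  shows "der \<Omega> (\<lambda>z. r *\<^sub>R f z) z w = r *\<^sub>R der \<Omega> f z w"
  by (rule der_eqI[OF has_derivative_scaleR_right[OF has_derivative_holo_mat[OF assms(1,2)]] assms(2,3)])

lemma der_const: "z \<in> \<Omega> \<Longrightarrow> tangent z w \<Longrightarrow> der \<Omega> (\<lambda>_. k) z w = 0"
  by (rule der_eqI[OF has_derivative_const])

lemma der_cong_mat:
  assumes "holo_mat hscale \<Omega> f" "\<And>z. z \<in> \<Omega> \<Longrightarrow> f z = g z" "z \<in> \<Omega>" "tangent z w"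
  shows "der \<Omega> f z w = der \<Omega> g z w"
  by (rule der_cong[OF assms(2) has_derivative_holo_mat[OF assms(1,3)] assms(3,4)])

lemma der_zero:
  assumes "\<And>z. z \<in> \<Omega> \<Longrightarrow> f z = 0" "z \<in> \<Omega>" "tangent z w"
  shows "der \<Omega> f z w = 0"
proof -
  have "der \<Omega> (\<lambda>_. 0) z w = der \<Omega> f z w"
    by (rule der_cong[OF _ has_derivative_const assms(2,3)]) (simp add: assms(1))
  then show ?thesis by (simp add: der_const[OF assms(2,3)])
qed

text \<open>Differentiating the tangency equation of one field along the other gives a bilinear term
  in the two fields plus the normal part of the derivative. The bilinear term is symmetric and
  cancels in the bracket.\<close>

lemma tangent_bracket:
  assumes X: "tangent_field \<Omega> X" and Y: "tangent_field \<Omega> Y" and z: "z \<in> \<Omega>"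
  shows "tangent z (bracket \<Omega> X Y z)"
proof -
  have Xh: "hs.holo_fld \<Omega> X" "\<And>z. z \<in> \<Omega> \<Longrightarrow> tangent z (X z)" and Yh: "hs.holo_fld \<Omega> Y" "\<And>z. z \<in> \<Omega> \<Longrightarrow> tangent z (Y z)"
    using X Y by (auto simp: tangent_field_iff)
  define B where "B v w = uplus w $ 1 * uminus' v $ 2 + uplus v $ 1 * uminus' w $ 2
           - uplus w $ 2 * uminus' v $ 1 - uplus v $ 2 * uminus' w $ 1" for v w :: "'n hpoint"
  have *: "B v (Y z) + ddt z (der \<Omega> Y z v) = 0" if v: "tangent z v" and Yh: "hs.holo_fld \<Omega> Y" "\<And>z. z \<in> \<Omega> \<Longrightarrow> tangent z (Y z)" for v Y
  proof -
    have dY: "(Y has_derivative der \<Omega> Y z) (at z within \<Omega>)" by (rule has_derivative_fld[OF Yh(1) z])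
    have 1: "((\<lambda>z. ddt z (Y z)) has_derivative (\<lambda>v. B v (Y z) + ddt z (der \<Omega> Y z v))) (at z within \<Omega>)"
      unfolding ddt_def B_def
      by (rule derivative_eq_intros has_derivative_coord[OF dY] has_derivative_coord has_derivative_ident refl)+ (simp add: algebra_simps)
    have "der \<Omega> (\<lambda>z. ddt z (Y z)) z v = B v (Y z) + ddt z (der \<Omega> Y z v)"
      by (rule der_eqI[OF 1 z v])
    moreover have "der \<Omega> (\<lambda>z. ddt z (Y z)) z v = 0"
      using der_cong[of "\<lambda>z. ddt z (Y z)" "\<lambda>_. 0", OF _ 1 z v] Yh(2) der_const[OF z v] by (simp add: tangent_iff)
    ultimately show ?thesis by simp
  qed
  have sym: "B v w = B w v" for v w by (simp add: B_def)
  have "ddt z (bracket \<Omega> X Y z) = ddt z (der \<Omega> Y z (X z)) - ddt z (der \<Omega> X z (Y z))"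
    by (simp add: bracket_def ddt_def algebra_simps)
  then show ?thesis
    using *[OF Xh(2)[OF z] Yh] *[OF Yh(2)[OF z] Xh] sym[of "X z" "Y z"]
    by (simp add: tangent_iff add_eq_0_iff)
qed

text \<open>Reduced to \<open>fd_bracket\<close> on the open set \<open>ext\<close>, entry by entry,
  with every function and field composed with \<open>rho\<close>.\<close>

lemma der_bracket:
  assumes f: "holo_mat hscale \<Omega> f" and X: "tangent_field \<Omega> X" and Y: "tangent_field \<Omega> Y" and z: "z \<in> \<Omega>"
  shows "der \<Omega> (\<lambda>y. der \<Omega> f y (Y y)) z (X z) - der \<Omega> (\<lambda>y. der \<Omega> f y (X y)) z (Y z) = der \<Omega> f z (bracket \<Omega> X Y z)"
proof -
  have Xh: "hs.holo_fld \<Omega> X" "\<And>z. z \<in> \<Omega> \<Longrightarrow> tangent z (X z)" and Yh: "hs.holo_fld \<Omega> Y" "\<And>z. z \<in> \<Omega> \<Longrightarrow> tangent z (Y z)"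
    using X Y by (auto simp: tangent_field_iff)
  have ze: "z \<in> ext" and rz: "rho z = z" using rho_fixed[OF dt_\<Omega>[OF z]] z \<Omega>_ext by auto
  let ?f = "\<lambda>z. f (rho z)" and ?X = "\<lambda>z. X (rho z)" and ?Y = "\<lambda>z. Y (rho z)"
  note hf = holo_mat_comp_rho[OF f] and hX = holo_fld_comp_rho[OF Xh(1)] and hY = holo_fld_comp_rho[OF Yh(1)]
  have step: "der \<Omega> (\<lambda>y. der \<Omega> f y (Y y)) z v = fd (\<lambda>y. fd ?f y (Y (rho y))) z v"
    if v: "tangent z v" and Yh: "hs.holo_fld \<Omega> Y" "\<And>z. z \<in> \<Omega> \<Longrightarrow> tangent z (Y z)" for Y v
  proof -
    have h: "holo_mat hscale ext (\<lambda>y. fd ?f y (Y (rho y)))"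
      by (rule hs.holo_mat_fd_fld[OF hf open_ext holo_fld_comp_rho[OF Yh(1)]])
    have "der \<Omega> (\<lambda>y. der \<Omega> f y (Y y)) z v = der \<Omega> (\<lambda>y. fd ?f y (Y (rho y))) z v"
    proof (rule der_cong_mat[symmetric, OF hs.holo_mat_subset[OF h \<Omega>_ext] _ z v])
      fix y assume y: "y \<in> \<Omega>"
      show "fd ?f y (Y (rho y)) = der \<Omega> f y (Y y)"
        using der_mat_fd[OF f y Yh(2)[OF y]] rho_fixed[OF dt_\<Omega>[OF y]] by simp
    qed
    also have "\<dots> = fd (\<lambda>y. fd ?f y (Y (rho y))) z v"
      by (rule der_eqI[OF has_derivative_at_withinI[OF hs.holo_matD_fd(1)[OF h open_ext ze]] z v])
    finally show ?thesis .
  qed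
  have fdX: "fd (\<lambda>z. X (rho z)) z v = der \<Omega> X z v" if "tangent z v" "hs.holo_fld \<Omega> X" for X v
    using der_fd[OF has_derivative_fld[OF that(2) z] z that(1)] by simp
  have "(fd (\<lambda>y. fd ?f y (?Y y)) z (X z) - fd (\<lambda>y. fd ?f y (?X y)) z (Y z)) $ i $ j = fd ?f z (fd ?Y z (X z) - fd ?X z (Y z)) $ i $ j" for i j
  proof -
    have g: "holo_mat hscale ext (\<lambda>y. fd ?f y (W (rho y)))" if "hs.holo_fld \<Omega> W" for W
      by (rule hs.holo_mat_fd_fld[OF hf open_ext holo_fld_comp_rho[OF that]])
    have e: "fd (\<lambda>y. fd ?f y (W (rho y))) z v $ i $ j = fd (\<lambda>y. fd (\<lambda>x. f (rho x) $ i $ j) y (W (rho y))) z v" if W: "hs.holo_fld \<Omega> W" for W v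
    proof -
      have "fd (\<lambda>y. fd ?f y (W (rho y))) z v $ i $ j = fd (\<lambda>y. fd ?f y (W (rho y)) $ i $ j) z v"
        by (rule hs.holo_matD_fd(2)[OF g[OF W] open_ext ze])
      also have "\<dots> = fd (\<lambda>y. fd (\<lambda>x. f (rho x) $ i $ j) y (W (rho y))) z v"
      proof (rule fd_eqI)
        let ?h = "\<lambda>y. fd (\<lambda>x. f (rho x) $ i $ j) y (W (rho y))"
        have "(?h has_derivative fd ?h z) (at z)"
          by (rule hs.holoD(1)[OF hs.holo_fd_fld[OF hs.holo_matD[OF hf] open_ext holo_fld_comp_rho[OF W]] open_ext ze])
        then show "((\<lambda>y. fd ?f y (W (rho y)) $ i $ j) has_derivative fd ?h z) (at z)"
          by (rule has_derivative_transform_within_open[OF _ open_ext ze]) (simp add: hs.holo_matD_fd(2)[OF hf open_ext])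
      qed
      finally show ?thesis .
    qed
    show ?thesis
      using hs.fd_bracket[OF hs.holo_matD[OF hf] open_ext hX hY ze, of i j]
      by (simp add: e[OF Xh(1)] e[OF Yh(1)] rz hs.holo_matD_fd(2)[OF hf open_ext ze])
  qed
  then have "fd (\<lambda>y. fd ?f y (?Y y)) z (X z) - fd (\<lambda>y. fd ?f y (?X y)) z (Y z) = fd ?f z (fd ?Y z (X z) - fd ?X z (Y z))"
    by (simp add: vec_eq_iff)
  then show ?thesis
    using der_mat_fd[OF f z tangent_bracket[OF X Y z]]
    by (simp add: step[OF Xh(2)[OF z] Yh] step[OF Yh(2)[OF z] Xh] fdX[OF Xh(2)[OF z] Yh(1)] fdX[OF Yh(2)[OF z] Xh(1)] bracket_def)
qed

end

section \<open>Connections and their curvature\<close>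

lemmas mm_simps = mm.add_left mm.add_right mm.diff_left mm.diff_right mm.minus_left mm.minus_right
  mm.zero_left mm.zero_right mm.scaleR_left mm.scaleR_right mm.sum_left mm.sum_right

lemma mat_commute: "A ** mat c = mat c ** A" for A :: "complex^'r^'r"
  by (simp add: vec_eq_iff matrix_nth mat_def if_distrib[of "\<lambda>x. x * _"] if_distrib[of "\<lambda>x. _ * x"] mult.commute cong: if_cong)

lemma mult_mat_left: "A ** (mat c ** B) = mat c ** (A ** B)" for A B :: "complex^'r^'r"
  by (simp add: matrix_mul_assoc mat_commute)

lemma mat_simps: "mat (a + c) ** A = mat a ** A + mat c ** A" "mat (a - c) ** A = mat a ** A - mat c ** A"
  "mat (a * c) ** A = mat a ** (mat c ** A)" "mat (- c) ** A = - (mat c ** A)"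
  for A :: "complex^'r^'r"
  by (simp_all add: vec_eq_iff mat_mult_nth algebra_simps)

lemma mat_of_real: "mat (of_real x) ** A = x *\<^sub>R A" for A :: "complex^'r^'r"
  by (simp add: vec_eq_iff mat_mult_nth) (simp add: scaleR_conv_of_real)

lemma comm_simps: "comm (A + B) C = comm A C + comm B C" "comm A (B + C) = comm A B + comm A C"
  "comm (mat c ** A) B = mat c ** comm A B" "comm A (mat c ** B) = mat c ** comm A B" "comm A B = - comm B A"
  "comm 0 A = 0" "comm A 0 = 0" for A B C :: "complex^'r^'r"
  by (simp_all add: comm_def mm_simps mult_mat_left matrix_mul_assoc[symmetric])

definition hcoord :: "'n + (2 + 2) \<Rightarrow> 'n::finite hpoint \<Rightarrow> complex" where
  "hcoord j w = (case j of Inl k \<Rightarrow> fst w $ k | Inr (Inl a) \<Rightarrow> uplus w $ a | Inr (Inr a) \<Rightarrow> uminus' w $ a)"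

definition hbasis :: "'n + (2 + 2) \<Rightarrow> 'n::finite hpoint" where
  "hbasis j = (case j of Inl k \<Rightarrow> (axis k 1, 0, 0) | Inr (Inl a) \<Rightarrow> (0, axis a 1, 0) | Inr (Inr a) \<Rightarrow> (0, 0, axis a 1))"

lemma sum_UNIV_sum: "(\<Sum>j\<in>UNIV. f j) = (\<Sum>k\<in>UNIV. f (Inl k)) + (\<Sum>k\<in>UNIV. f (Inr k))"
  for f :: "'a::finite + 'b::finite \<Rightarrow> 'c::comm_monoid_add"
  using sum.Plus[of UNIV UNIV f] by (simp add: UNIV_Plus_UNIV o_def)

lemma hpoint_expand: "w = (\<Sum>j\<in>UNIV. hscale (hcoord j w) (hbasis j))"
proof -
  have axis_sum: "(\<Sum>k\<in>UNIV. x $ k *s axis k 1) = x" for x :: "complex^'k"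
    by (simp add: vec_eq_iff axis_def if_distrib[of "\<lambda>x. _ * x"] cong: if_cong)
  show ?thesis
    by (simp add: prod_eq_iff sum_UNIV_sum hcoord_def hbasis_def fst_sum snd_sum axis_sum)
qed

lemma hcoord_linear: "hcoord j (v + w) = hcoord j v + hcoord j w" "hcoord j (v - w) = hcoord j v - hcoord j w"
  "hcoord j (hscale c w) = c * hcoord j w"
  by (auto simp: hcoord_def split: sum.splits)

lemma has_derivative_hcoord:
  assumes "(X has_derivative L) F" shows "((\<lambda>z. hcoord j (X z)) has_derivative (\<lambda>w. hcoord j (L w))) F"
proof (cases j)
  case (Inl k)
  then show ?thesis using has_derivative_coord(1)[OF assms] by (simp add: hcoord_def)
next
  case (Inr i)
  then show ?thesis using has_derivative_coord(2,3)[OF assms] by (cases i) (simp_all add: hcoord_def)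
qed

lemma holo_hcoord: assumes "hs.holo_fld S X" shows "holo hscale S (\<lambda>z. hcoord j (X z))"
proof (cases j)
  case (Inl k)
  then show ?thesis using holo_fld_coord(1)[OF assms] by (simp add: hcoord_def)
next
  case (Inr i)
  then show ?thesis using holo_fld_coord(2,3)[OF assms] by (cases i) (simp_all add: hcoord_def)
qed

lemma has_derivative_mat: "(f has_derivative L) F \<Longrightarrow> ((\<lambda>z. mat (f z)) has_derivative (\<lambda>w. mat (L w))) F"
  for f :: "'a::real_normed_vector \<Rightarrow> complex"
proof (rule has_derivative_vec, rule has_derivative_vec)
  show "((\<lambda>z. mat (f z) $ i $ j) has_derivative (\<lambda>w. mat (L w) $ i $ j)) F" if "(f has_derivative L) F" for i j
    using that by (cases "i = j") (simp_all add: mat_def)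
qed

definition tangent_proj :: "'n::finite hpoint \<Rightarrow> 'n hpoint \<Rightarrow> 'n hpoint" where
  "tangent_proj w z = Drho z w"

lemma tangent_field_proj:
  assumes "\<And>z. z \<in> S \<Longrightarrow> dt z = 1" shows "tangent_field S (tangent_proj w)"
proof -
  have "holo hscale S (\<lambda>z. ddt z w)"
    unfolding ddt_def by (intro hs.holo_diff hs.holo_add hs.holo_mult hs.holo_const holo_coord)
  then have "hs.holo_fld S (tangent_proj w)"
    unfolding tangent_proj_def Drho_def
    by (intro holo_fldI) (auto intro!: hs.holo_diff hs.holo_mult hs.holo_inverse holo_dt simp: assms)
  then show ?thesis
    by (simp add: tangent_field_iff tangent_proj_def tangent_Drho assms)
qed

lemma tangent_proj_tangent: "dt z = 1 \<Longrightarrow> tangent z w \<Longrightarrow> tangent_proj w z = w"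
  by (simp add: tangent_proj_def Drho_tangent)

locale connection_on = harmonic_domain M \<Omega> for M :: "(complex^'n) set" and \<Omega> :: "('n hpoint) set" +
  fixes A :: "'n hpoint \<Rightarrow> 'n hpoint \<Rightarrow> complex^'r^'r"
  assumes conn: "connection \<Omega> A"
begin

lemma A_add: "z \<in> \<Omega> \<Longrightarrow> tangent z v \<Longrightarrow> tangent z w \<Longrightarrow> A z (v + w) = A z v + A z w"
  and A_hscale: "z \<in> \<Omega> \<Longrightarrow> tangent z w \<Longrightarrow> A z (hscale c w) = mat c ** A z w"
  and A_holo: "tangent_field \<Omega> W \<Longrightarrow> holo_mat hscale \<Omega> (\<lambda>z. A z (W z))"
  using conn unfolding connection_def by blast+

lemma A_0: "z \<in> \<Omega> \<Longrightarrow> A z 0 = 0"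
  using A_add[of z 0 0] by (simp add: tangent_linear)

lemma A_sum: "z \<in> \<Omega> \<Longrightarrow> (\<And>i. i \<in> I \<Longrightarrow> tangent z (f i)) \<Longrightarrow> A z (\<Sum>i\<in>I. f i) = (\<Sum>i\<in>I. A z (f i))"
  by (induction I rule: infinite_finite_induct) (simp_all add: A_0 A_add tangent_sum)

text \<open>Coefficients of the form on a hypersurface: the ambient basis vectors are first
  projected to the tangent space, where A is meaningful.\<close>

definition a :: "'n + (2 + 2) \<Rightarrow> 'n hpoint \<Rightarrow> complex^'r^'r" where
  "a j z = A z (tangent_proj (hbasis j) z)"

lemma holo_a: "holo_mat hscale \<Omega> (a j)"
  unfolding a_def[abs_def] by (rule A_holo[OF tangent_field_proj]) (rule dt_\<Omega>)

text \<open>A tangent vector equals its own projection, so its ambient coordinates may be used with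
  the projected basis, although the projected vectors are linearly dependent.\<close>

lemma A_expand:
  assumes z: "z \<in> \<Omega>" and w: "tangent z w"
  shows "A z w = (\<Sum>j\<in>UNIV. mat (hcoord j w) ** a j z)"
proof -
  have "w = Drho z (\<Sum>j\<in>UNIV. hscale (hcoord j w) (hbasis j))"
    using Drho_tangent[OF dt_\<Omega>[OF z] w] hpoint_expand[of w] by simp
  also have "\<dots> = (\<Sum>j\<in>UNIV. Drho z (hscale (hcoord j w) (hbasis j)))"
    by (rule sum_comp_morphism[symmetric, unfolded o_def]) (simp_all add: Drho_add, simp add: Drho_def ddt_def zero_prod_def)
  also have "\<dots> = (\<Sum>j\<in>UNIV. hscale (hcoord j w) (tangent_proj (hbasis j) z))"
    by (simp add: Drho_hscale tangent_proj_def)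
  finally have "A z w = A z (\<Sum>j\<in>UNIV. hscale (hcoord j w) (tangent_proj (hbasis j) z))" by (rule arg_cong)
  also have "\<dots> = (\<Sum>j\<in>UNIV. mat (hcoord j w) ** a j z)"
    using tangent_Drho[OF dt_\<Omega>[OF z]]
    by (simp add: A_sum[OF z] A_hscale[OF z] tangent_linear tangent_proj_def a_def)
  finally show ?thesis .
qed

text \<open>The curvature as a bilinear form at a point: the exterior derivative of the form with
  coefficients \<open>a j\<close>, plus the commutator. It takes vectors instead of fields, which
  allows checking it on spanning vectors.\<close>

definition curv :: "'n hpoint \<Rightarrow> 'n hpoint \<Rightarrow> 'n hpoint \<Rightarrow> complex^'r^'r" where
  "curv z v w = (\<Sum>j\<in>UNIV. mat (hcoord j w) ** der \<Omega> (a j) z v) - (\<Sum>j\<in>UNIV. mat (hcoord j v) ** der \<Omega> (a j) z w)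
     + comm (A z v) (A z w)"

lemma curv_antisym: "curv z v w = - curv z w v"
  unfolding curv_def comm_simps(5)[of "A z v"] by simp

lemma curv_add_left:
  assumes "z \<in> \<Omega>" "tangent z v" "tangent z v'"
  shows "curv z (v + v') w = curv z v w + curv z v' w"
  unfolding curv_def
  by (simp add: der_linear[OF holo_a assms(1)] hcoord_linear mat_simps mm_simps sum.distrib A_add[OF assms] comm_simps(1))

lemma curv_hscale_left:
  assumes "z \<in> \<Omega>" "tangent z v"
  shows "curv z (hscale c v) w = mat c ** curv z v w"
  unfolding curv_def
  by (simp add: der_hscale[OF holo_a assms] hcoord_linear mat_simps mm.diff_right mm.add_right mm.sum_right A_hscale[OF assms] comm_simps(3) mult_mat_left[of "mat (hcoord j w)" c for j])

lemma curv_add_right: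
  assumes "z \<in> \<Omega>" "tangent z v" "tangent z v'"
  shows "curv z w (v + v') = curv z w v + curv z w v'"
  using curv_add_left[OF assms, of w] curv_antisym[of z w] by simp

lemma curv_hscale_right:
  assumes "z \<in> \<Omega>" "tangent z v"
  shows "curv z w (hscale c v) = mat c ** curv z w v"
  using curv_hscale_left[OF assms, of c w] curv_antisym[of z w] by (simp add: mm.minus_right)

lemma der_restrict:
  assumes sub: "harmonic_domain M \<Omega>'" "\<Omega>' \<subseteq> \<Omega>" and f: "holo_mat hscale \<Omega> f" and z: "z \<in> \<Omega>'" and w: "tangent z w"
  shows "der \<Omega>' f z w = der \<Omega> f z w"
  by (rule harmonic_domain.der_eqI[OF sub(1) has_derivative_subset[OF has_derivative_holo_mat[OF f] sub(2)] z w])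
    (use z sub in auto)

lemma connection_restrict:
  assumes sub: "harmonic_domain M \<Omega>'" "\<Omega>' \<subseteq> \<Omega>" shows "connection \<Omega>' A"
  unfolding connection_def
proof (intro conjI allI impI ballI)
  show "A z (v + w) = A z v + A z w" if "z \<in> \<Omega>'" "tangent z v \<and> tangent z w" for z v w
    using A_add[of z v w] that sub(2) by blast
  show "A z (hscale c w) = mat c ** A z w" if "z \<in> \<Omega>'" "tangent z w" for z c w
    using A_hscale[of z w c] that sub(2) by blast
  fix W assume W: "tangent_field \<Omega>' W"
  have "holo_mat hscale \<Omega>' (\<lambda>z. \<Sum>j\<in>UNIV. mat (hcoord j (W z)) ** a j z)"
    using W by (intro hs.holo_mat_sum hs.holo_mat_smult holo_hcoord hs.holo_mat_subset[OF holo_a sub(2)]) (simp add: tangent_field_iff)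
  then show "holo_mat hscale \<Omega>' (\<lambda>z. A z (W z))"
  proof (rule hs.holo_mat_cong)
    fix z assume "z \<in> \<Omega>'"
    then have "z \<in> \<Omega>" "tangent z (W z)" using W sub(2) by (auto simp only: tangent_field_iff)
    then show "(\<Sum>j\<in>UNIV. mat (hcoord j (W z)) ** a j z) = A z (W z)" by (rule A_expand[symmetric])
  qed
qed

lemma der_A:
  assumes sub: "harmonic_domain M \<Omega>'" "\<Omega>' \<subseteq> \<Omega>" and Y: "tangent_field \<Omega>' Y" and z: "z \<in> \<Omega>'" and v: "tangent z v"
  shows "der \<Omega>' (\<lambda>y. A y (Y y)) z v = (\<Sum>j\<in>UNIV. mat (hcoord j (Y z)) ** der \<Omega> (a j) z v + mat (hcoord j (der \<Omega>' Y z v)) ** a j z)"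
proof -
  interpret sub: harmonic_domain M \<Omega>' by fact
  have Yh: "hs.holo_fld \<Omega>' Y" "\<And>z. z \<in> \<Omega>' \<Longrightarrow> tangent z (Y z)" using Y by (auto simp: tangent_field_iff)
  have d: "((\<lambda>z. \<Sum>j\<in>UNIV. mat (hcoord j (Y z)) ** a j z) has_derivative
      (\<lambda>v. \<Sum>j\<in>UNIV. mat (hcoord j (Y z)) ** der \<Omega> (a j) z v + mat (hcoord j (der \<Omega>' Y z v)) ** a j z)) (at z within \<Omega>')"
    using z sub(2) by (intro has_derivative_sum mm.FDERIV has_derivative_mat has_derivative_hcoord sub.has_derivative_fld[OF Yh(1) z]
        has_derivative_subset[OF has_derivative_holo_mat[OF holo_a] sub(2)]) auto
  have eq: "A y (Y y) = (\<Sum>j\<in>UNIV. mat (hcoord j (Y y)) ** a j y)" if "y \<in> \<Omega>'" for y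
    using A_expand[of y "Y y"] that sub(2) Yh(2) by blast
  have "((\<lambda>y. A y (Y y)) has_derivative
      (\<lambda>v. \<Sum>j\<in>UNIV. mat (hcoord j (Y z)) ** der \<Omega> (a j) z v + mat (hcoord j (der \<Omega>' Y z v)) ** a j z)) (at z within \<Omega>')"
    by (rule has_derivative_transform[OF z eq d])
  then show ?thesis by (rule sub.der_eqI[OF _ z v])
qed

text \<open>The derivatives of the fields add up to the form on the bracket and cancel. The fields
  may live on a smaller set \<Omega>' while the coefficients are differentiated on \<Omega>; this is
  what compares curvatures under restriction.\<close>

lemma curvature_eq_curv:
  assumes sub: "harmonic_domain M \<Omega>'" "\<Omega>' \<subseteq> \<Omega>" and X: "tangent_field \<Omega>' X" and Y: "tangent_field \<Omega>' Y" and z: "z \<in> \<Omega>'"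
  shows "curvature \<Omega>' A X Y z = curv z (X z) (Y z)"
proof -
  interpret sub: harmonic_domain M \<Omega>' by fact
  have zO: "z \<in> \<Omega>" using z sub by auto
  have t: "tangent z (X z)" "tangent z (Y z)" using X Y z by (auto simp: tangent_field_iff)
  have "A z (bracket \<Omega>' X Y z) = (\<Sum>j\<in>UNIV. mat (hcoord j (der \<Omega>' Y z (X z))) ** a j z) - (\<Sum>j\<in>UNIV. mat (hcoord j (der \<Omega>' X z (Y z))) ** a j z)"
    using A_expand[OF zO sub.tangent_bracket[OF X Y z]]
    by (simp add: bracket_def hcoord_linear mat_simps sum_subtractf)
  then show ?thesis
    unfolding curvature_def curv_def der_A[OF sub Y z t(1)] der_A[OF sub X z t(2)] by (simp add: sum.distrib)
qed

lemma curvature_eq: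
  "tangent_field \<Omega> X \<Longrightarrow> tangent_field \<Omega> Y \<Longrightarrow> z \<in> \<Omega> \<Longrightarrow> curvature \<Omega> A X Y z = curv z (X z) (Y z)"
  by (rule curvature_eq_curv[OF harmonic_domain_axioms order_refl])

lemma curv_curvature:
  assumes "z \<in> \<Omega>" "tangent z v" "tangent z w"
  shows "curv z v w = curvature \<Omega> A (tangent_proj v) (tangent_proj w) z"
  using curvature_eq[OF tangent_field_proj[OF dt_\<Omega>] tangent_field_proj[OF dt_\<Omega>] assms(1), of v w]
  by (simp add: tangent_proj_tangent[OF dt_\<Omega>[OF assms(1)]] assms)

end

section \<open>Change of frame\<close>

context connection_on
begin

context
  fixes \<psi> :: "'n hpoint \<Rightarrow> complex^'r^'r"
  assumes \<psi>: "frame \<Omega> \<psi>"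
begin

lemma psi_holo: "holo_mat hscale \<Omega> \<psi>" and psi_inv: "z \<in> \<Omega> \<Longrightarrow> invertible (\<psi> z)"
  using \<psi> by (auto simp: frame_def)

lemma inv_holo: "holo_mat hscale \<Omega> (\<lambda>z. matrix_inv (\<psi> z))"
  by (rule hs.holo_matrix_inv[OF psi_holo psi_inv])

lemma potential_eq: "z \<in> \<Omega> \<Longrightarrow> \<psi> z ** potential \<Omega> \<psi> A z w = A z w ** \<psi> z + der \<Omega> \<psi> z w"
  using matrix_inv_right[OF psi_inv] by (simp add: potential_def mm.add_right matrix_mul_assoc)

lemma connection_potential: "connection \<Omega> (potential \<Omega> \<psi> A)"
  unfolding connection_def
proof (intro conjI allI impI ballI)
  show "potential \<Omega> \<psi> A z (v + w) = potential \<Omega> \<psi> A z v + potential \<Omega> \<psi> A z w" if "z \<in> \<Omega>" "tangent z v \<and> tangent z w" for z v w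
    using that by (simp add: potential_def A_add der_linear[OF psi_holo] mm_simps)
  show "potential \<Omega> \<psi> A z (hscale c w) = mat c ** potential \<Omega> \<psi> A z w" if "z \<in> \<Omega>" "tangent z w" for z c w
    using that by (simp add: potential_def A_hscale der_hscale[OF psi_holo] mm_simps mult_mat_left matrix_mul_assoc[symmetric])
  show "holo_mat hscale \<Omega> (\<lambda>z. potential \<Omega> \<psi> A z (W z))" if "tangent_field \<Omega> W" for W
    unfolding potential_def
    by (intro hs.holo_mat_add hs.holo_mat_mult inv_holo psi_holo A_holo holo_mat_der that)
qed

text \<open>Gauge covariance, obtained by differentiating \<psi> B = A \<psi> + d\<psi> along X and
  Y, where B is the new potential; the second derivatives of \<psi> combine by
  \<open>der_bracket\<close>. With \<psi> on the left no derivative of its inverse occurs.\<close>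

lemma curvature_potential:
  assumes X: "tangent_field \<Omega> X" and Y: "tangent_field \<Omega> Y" and z: "z \<in> \<Omega>"
  shows "\<psi> z ** curvature \<Omega> (potential \<Omega> \<psi> A) X Y z = curvature \<Omega> A X Y z ** \<psi> z"
proof -
  interpret P: connection_on M \<Omega> "potential \<Omega> \<psi> A"
    by unfold_locales (rule connection_potential)
  let ?B = "potential \<Omega> \<psi> A"
  have tX: "tangent z (X z)" and tY: "tangent z (Y z)" using X Y z by (auto simp: tangent_field_iff)
  have step: "der \<Omega> \<psi> z v ** ?B z (Y z) + \<psi> z ** der \<Omega> (\<lambda>y. ?B y (Y y)) z v
      = der \<Omega> (\<lambda>y. A y (Y y)) z v ** \<psi> z + A z (Y z) ** der \<Omega> \<psi> z v + der \<Omega> (\<lambda>y. der \<Omega> \<psi> y (Y y)) z v"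
    if Y: "tangent_field \<Omega> Y" and v: "tangent z v" for Y v
  proof -
    have "der \<Omega> (\<lambda>y. \<psi> y ** ?B y (Y y)) z v = der \<Omega> (\<lambda>y. A y (Y y) ** \<psi> y + der \<Omega> \<psi> y (Y y)) z v"
      by (rule der_cong_mat[OF hs.holo_mat_mult[OF psi_holo P.A_holo[OF Y]] potential_eq z v])
    then show ?thesis
      unfolding der_mult[OF psi_holo P.A_holo[OF Y] z v]
        der_add[OF hs.holo_mat_mult[OF A_holo[OF Y] psi_holo] holo_mat_der[OF psi_holo Y] z v]
        der_mult[OF A_holo[OF Y] psi_holo z v]
      by (simp add: add_ac)
  qed
  let ?BX = "?B z (X z)" and ?BY = "?B z (Y z)" and ?AX = "A z (X z)" and ?AY = "A z (Y z)"
  let ?pX = "der \<Omega> \<psi> z (X z)" and ?pY = "der \<Omega> \<psi> z (Y z)"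
  let ?XBY = "der \<Omega> (\<lambda>y. ?B y (Y y)) z (X z)" and ?YBX = "der \<Omega> (\<lambda>y. ?B y (X y)) z (Y z)"
  let ?XAY = "der \<Omega> (\<lambda>y. A y (Y y)) z (X z)" and ?YAX = "der \<Omega> (\<lambda>y. A y (X y)) z (Y z)"
  let ?XY = "der \<Omega> (\<lambda>y. der \<Omega> \<psi> y (Y y)) z (X z)" and ?YX = "der \<Omega> (\<lambda>y. der \<Omega> \<psi> y (X y)) z (Y z)"
  have e1: "\<psi> z ** ?XBY = ?XAY ** \<psi> z + ?AY ** ?pX + ?XY - ?pX ** ?BY"
    using step[OF Y tX] by (simp add: eq_diff_eq add.commute)
  have e2: "\<psi> z ** ?YBX = ?YAX ** \<psi> z + ?AX ** ?pY + ?YX - ?pY ** ?BX"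
    using step[OF X tY] by (simp add: eq_diff_eq add.commute)
  have c1: "\<psi> z ** (?BX ** ?BY) = ?AX ** (?AY ** \<psi> z) + ?AX ** ?pY + ?pX ** ?BY"
    by (simp add: matrix_mul_assoc[of "\<psi> z"] potential_eq[OF z] mm.add_left matrix_mul_assoc[symmetric])
      (simp add: potential_eq[OF z] mm.add_right)
  have c2: "\<psi> z ** (?BY ** ?BX) = ?AY ** (?AX ** \<psi> z) + ?AY ** ?pX + ?pY ** ?BX"
    by (simp add: matrix_mul_assoc[of "\<psi> z"] potential_eq[OF z] mm.add_left matrix_mul_assoc[symmetric])
      (simp add: potential_eq[OF z] mm.add_right)
  have b: "\<psi> z ** ?B z (bracket \<Omega> X Y z) = A z (bracket \<Omega> X Y z) ** \<psi> z + (?XY - ?YX)"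
    by (simp add: potential_eq[OF z] der_bracket[OF psi_holo X Y z])
  have "\<psi> z ** curvature \<Omega> ?B X Y z = \<psi> z ** ?XBY - \<psi> z ** ?YBX + (\<psi> z ** (?BX ** ?BY) - \<psi> z ** (?BY ** ?BX)) - \<psi> z ** ?B z (bracket \<Omega> X Y z)"
    by (simp add: curvature_def comm_def mm.add_right mm.diff_right)
  also have "\<dots> = curvature \<Omega> A X Y z ** \<psi> z"
    unfolding e1 e2 c1 c2 b
    by (simp add: curvature_def comm_def mm.add_left mm.diff_left matrix_mul_assoc[symmetric])
  finally show ?thesis .
qed

lemma curv_potential_zero:
  assumes "tangent z v" "tangent z w" "z \<in> \<Omega>" "curv z v w = 0"
  shows "connection_on.curv \<Omega> (potential \<Omega> \<psi> A) z v w = 0"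
proof -
  interpret P: connection_on M \<Omega> "potential \<Omega> \<psi> A"
    by unfold_locales (rule connection_potential)
  have t: "tangent_field \<Omega> (tangent_proj v)" "tangent_field \<Omega> (tangent_proj w)"
    by (rule tangent_field_proj, erule dt_\<Omega>)+
  have "\<psi> z ** P.curv z v w = 0"
    using curvature_potential[OF t assms(3)] assms
    by (simp add: P.curv_curvature[OF assms(3,1,2), symmetric] curv_curvature[OF assms(3,1,2), symmetric])
  then have "matrix_inv (\<psi> z) ** (\<psi> z ** P.curv z v w) = 0" by simp
  then show ?thesis by (simp add: matrix_mul_assoc matrix_inv_left[OF psi_inv[OF assms(3)]])
qed

end

end

section \<open>The distributions of a spin 3/2 Grassmann manifold\<close>

interpretation vs: complex_scaling "(*s) :: complex \<Rightarrow> complex^'n \<Rightarrow> complex^'n"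
proof
  show "of_real r *s w = r *\<^sub>R w" for r and w :: "complex^'n"
    by (simp add: vec_eq_iff) (simp add: scaleR_conv_of_real)
qed (simp_all add: norm_smult_vec algebra_simps vec_eq_iff)

lemma holo_fst:
  assumes "holo (*s) (fst ` S) f"
  shows "holo hscale S (\<lambda>z :: 'n::finite hpoint. f (fst z))"
  unfolding holo_def
proof
  fix z assume z: "z \<in> S"
  then have "fst z \<in> fst ` S" by (rule imageI)
  then obtain L where L: "(f has_derivative L) (at (fst z) within fst ` S)" "\<And>c w. L (c *s w) = c * L w"
    using vs.holoE[OF assms] by blast
  have fstd: "(fst has_derivative fst) (at z within S)"
    by (rule bounded_linear_imp_has_derivative[OF bounded_linear_fst])
  have "((\<lambda>z. f (fst z)) has_derivative (\<lambda>w. L (fst w))) (at z within S)"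
    by (rule has_derivative_in_compose[OF fstd L(1)])
  then show "\<exists>L. ((\<lambda>z. f (fst z)) has_derivative L) (at z within S) \<and> (\<forall>c w. L (hscale c w) = c * L w)"
    by (intro exI[of _ "\<lambda>w. L (fst w)"]) (simp add: L)
qed

lemma pairing_linear: "pairing s (t + t') = pairing s t + pairing s t'"
  "pairing s (\<chi> i a b c. k * t $ i $ a $ b $ c) = k * pairing s t"
  by (simp_all add: pairing_def sum.distrib sum_distrib_left algebra_simps)

lemma cotangent_iso_axis: "cotangent_iso \<sigma> x (axis k 1) = \<sigma> x $ k"
  by (simp add: cotangent_iso_def vec_eq_iff axis_def if_distrib[of "\<lambda>x. x * _"] cong: if_cong)

lemma tvec_nth: "tvec \<sigma> x t $ k = pairing (\<sigma> x $ k) t"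
  by (simp add: tvec_def cotangent_iso_axis)

lemma tvec_add: "tvec \<sigma> x (s + t) = tvec \<sigma> x s + tvec \<sigma> x t"
  and tvec_smult: "tvec \<sigma> x (\<chi> i a b c. k * t $ i $ a $ b $ c) = k *s tvec \<sigma> x t"
  by (simp_all add: vec_eq_iff tvec_nth pairing_linear)

definition T :: "(complex^'n \<Rightarrow> complex^2^2^2^'p^'n) \<Rightarrow> complex^'n \<Rightarrow> complex^'p \<Rightarrow> complex^2 \<Rightarrow> complex^2 \<Rightarrow> complex^2 \<Rightarrow> complex^'n" where
  "T \<sigma> x e p q r = tvec \<sigma> x (tens e (sprod p q r))"

lemma sprod_commute: "sprod p q r = sprod q p r" "sprod p q r = sprod p r q"
  by (simp_all add: sprod_def vec_eq_iff algebra_simps)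

lemma T_commute: "T \<sigma> x e p q r = T \<sigma> x e q p r" "T \<sigma> x e p q r = T \<sigma> x e p r q"
  unfolding T_def using sprod_commute by metis+

lemma T_linear1: "T \<sigma> x e (p + p') q r = T \<sigma> x e p q r + T \<sigma> x e p' q r" "T \<sigma> x e (k *s p) q r = k *s T \<sigma> x e p q r"
proof -
  have "tens e (sprod (p + p') q r) = tens e (sprod p q r) + tens e (sprod p' q r)"
    by (simp add: tens_def sprod_def vec_eq_iff add_divide_distrib algebra_simps)
  then show "T \<sigma> x e (p + p') q r = T \<sigma> x e p q r + T \<sigma> x e p' q r"
    by (simp only: T_def tvec_add)
  have "tens e (sprod (k *s p) q r) = (\<chi> i a b c. k * tens e (sprod p q r) $ i $ a $ b $ c)"
    by (simp add: tens_def sprod_def vec_eq_iff add_divide_distrib algebra_simps)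
  then show "T \<sigma> x e (k *s p) q r = k *s T \<sigma> x e p q r"
    by (simp only: T_def tvec_smult)
qed

lemma T_linear_e: "T \<sigma> x (e + e') p q r = T \<sigma> x e p q r + T \<sigma> x e' p q r" "T \<sigma> x (k *s e) p q r = k *s T \<sigma> x e p q r"
proof -
  have "tens (e + e') f = tens e f + tens e' f" for f
    by (simp add: tens_def vec_eq_iff algebra_simps)
  then show "T \<sigma> x (e + e') p q r = T \<sigma> x e p q r + T \<sigma> x e' p q r"
    by (simp only: T_def tvec_add)
  have "tens (k *s e) f = (\<chi> i a b c. k * tens e f $ i $ a $ b $ c)" for f
    by (simp add: tens_def vec_eq_iff algebra_simps)
  then show "T \<sigma> x (k *s e) p q r = k *s T \<sigma> x e p q r"
    by (simp only: T_def tvec_smult)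
qed

lemma T_linear2: "T \<sigma> x e q (p + p') r = T \<sigma> x e q p r + T \<sigma> x e q p' r" "T \<sigma> x e q (k *s p) r = k *s T \<sigma> x e q p r"
  using T_linear1[of \<sigma> x e] T_commute(1)[of \<sigma> x e q] by simp_all

lemma T_linear3: "T \<sigma> x e q r (p + p') = T \<sigma> x e q r p + T \<sigma> x e q r p'" "T \<sigma> x e q r (k *s p) = k *s T \<sigma> x e q r p"
  using T_linear2[of \<sigma> x e q] T_commute(2)[of \<sigma> x e q r] by simp_all

lemmas T_linear = T_linear1 T_linear2 T_linear3

definition hv :: "(2 \<Rightarrow> complex^'n \<Rightarrow> complex^2) \<Rightarrow> complex^'n \<Rightarrow> complex^2 \<Rightarrow> complex^2" where
  "hv h x p = p $ 1 *s h 1 x + p $ 2 *s h 2 x"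

lemma hv_linear: "hv h x (p + q) = hv h x p + hv h x q" "hv h x (k *s p) = k *s hv h x p" "hv h x 0 = 0" "hv h x (- p) = - hv h x p"
  by (simp_all add: hv_def vec_eq_iff algebra_simps)

lemma hlift_linear: "hlift (v + w) = hlift v + hlift w" "hlift (k *s v) = hscale k (hlift v)"
  "hlift 0 = 0" "fst (hlift v) = v" "uplus (hlift v) = 0" "uminus' (hlift v) = 0"
  by (simp_all add: hlift_def hscale_def zero_prod_def)

text \<open>All four families become values of the symmetric trilinear \<open>T\<close> on the
  vectors h_+ and h_-; different orderings of the factors are identified through this form.\<close>

lemma Xuuu_eq: "Xuuu \<sigma> h e p q r x = hlift (T \<sigma> x (e x) (hv h x p) (hv h x q) (hv h x r))"
proof -
  have "Xabc \<sigma> h e \<alpha> \<beta> \<gamma> x = T \<sigma> x (e x) (h \<alpha> x) (h \<beta> x) (h \<gamma> x)" for \<alpha> \<beta> \<gamma>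
    by (simp add: Xabc_def T_def)
  then show ?thesis
    by (simp add: Xuuu_def sum_2 hv_def T_linear hlift_linear[symmetric] vec.scale_right_distrib mult_ac add_ac)
qed

text \<open>The index m counts the factors u_-. The four families thus form one ladder, on which
  \<open>dmm\<close> raises m, \<open>dpp\<close> lowers it, and \<open>d0\<close> has the
  eigenvalue 3 - 2 m.\<close>

definition Y :: "(complex^'n \<Rightarrow> complex^2^2^2^'p^'n) \<Rightarrow> (2 \<Rightarrow> complex^'n \<Rightarrow> complex^2) \<Rightarrow> nat \<Rightarrow>
    (complex^'n \<Rightarrow> complex^'p) \<Rightarrow> 'n hpoint \<Rightarrow> 'n hpoint" where
  "Y \<sigma> h m e z = (if m = 0 then Xppp \<sigma> h e z else if m = 1 then Xp \<sigma> h e z else if m = 2 then Xm \<sigma> h e z else Xmmm \<sigma> h e z)"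

lemma Y_simps [simp]: "Y \<sigma> h 0 = Xppp \<sigma> h" "Y \<sigma> h 1 = Xp \<sigma> h" "Y \<sigma> h (Suc 0) = Xp \<sigma> h" "Y \<sigma> h 2 = Xm \<sigma> h" "Y \<sigma> h 3 = Xmmm \<sigma> h"
  by (simp_all add: Y_def fun_eq_iff)

lemma nat_le_3_cases: "m \<le> 3 \<Longrightarrow> (m = 0 \<Longrightarrow> P) \<Longrightarrow> (m = 1 \<Longrightarrow> P) \<Longrightarrow> (m = 2 \<Longrightarrow> P) \<Longrightarrow> (m = 3 \<Longrightarrow> P) \<Longrightarrow> P" for m :: nat
  by (cases m) (auto simp: le_Suc_eq numeral_eq_Suc)

lemma Y_eq_const: "Y \<sigma> h m e z = Y \<sigma> h m (\<lambda>_. e (fst z)) z"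
  by (simp add: Y_def Xppp_def Xp_def Xm_def Xmmm_def Xuuu_eq)

lemma Y_linear: "Y \<sigma> h m (\<lambda>_. c + d) z = Y \<sigma> h m (\<lambda>_. c) z + Y \<sigma> h m (\<lambda>_. d) z"
  "Y \<sigma> h m (\<lambda>_. k *s c) z = hscale k (Y \<sigma> h m (\<lambda>_. c) z)"
  by (simp_all add: Y_def Xppp_def Xp_def Xm_def Xmmm_def Xuuu_eq T_linear_e hlift_linear)

lemma Y_horizontal: "uplus (Y \<sigma> h m e z) = 0" "uminus' (Y \<sigma> h m e z) = 0"
  by (simp_all add: Y_def Xppp_def Xp_def Xm_def Xmmm_def Xuuu_eq hlift_linear)

lemma tangent_Y: "tangent z (Y \<sigma> h m e z)"
  by (simp add: tangent_def Y_horizontal)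

lemma tangent_vertical: "tangent z (dpp z)" "tangent z (dmm z)" "tangent z (d0 z)"
  by (simp_all add: tangent_def dpp_def dmm_def d0_def mult.commute)

locale spin_manifold =
  fixes M :: "(complex^'n) set" and aE :: "complex^'n \<Rightarrow> complex^'p^'p^'n" and aH \<omega>
    and \<sigma> :: "complex^'n \<Rightarrow> complex^2^2^2^'p^'n" and h :: "2 \<Rightarrow> complex^'n \<Rightarrow> complex^2"
  assumes hf: "half_flat_grassmann M aE aH \<omega> \<sigma>" and sf: "symplectic_frame M aH \<omega> h"
    and adm: "zero_admissible M aE aH \<sigma> h"
begin

lemma open_M: "open M" using hf by (simp add: half_flat_grassmann_def)

lemma holo_\<sigma>: "S \<subseteq> M \<Longrightarrow> holo (*s) S (\<lambda>x. \<sigma> x $ k $ i $ a $ b $ c)"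
proof (rule vs.holo_subset)
  show "holo (*s) M (\<lambda>x. \<sigma> x $ k $ i $ a $ b $ c)"
    using hf by (simp add: half_flat_grassmann_def holo_vec_def)
qed

lemma holo_h: "S \<subseteq> M \<Longrightarrow> holo (*s) S (\<lambda>x. h \<alpha> x $ a)"
proof (rule vs.holo_subset)
  show "holo (*s) M (\<lambda>x. h \<alpha> x $ a)"
    using sf by (simp add: symplectic_frame_def holo_vec_def)
qed

lemma iso: "x \<in> M \<Longrightarrow> bij_betw (cotangent_iso \<sigma> x) UNIV sym_tensors"
  using hf by (simp add: half_flat_grassmann_def)

text \<open>A skew form in two dimensions is a multiple of the determinant, so \<omega>(h_1, h_2) =
  1 keeps the determinant of the frame away from zero.\<close>

lemma frame_det:
  assumes "x \<in> M"
  shows "hv h x p $ 1 * hv h x q $ 2 - hv h x p $ 2 * hv h x q $ 1 = (h 1 x $ 1 * h 2 x $ 2 - h 1 x $ 2 * h 2 x $ 1) * (p $ 1 * q $ 2 - p $ 2 * q $ 1)"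
    "h 1 x $ 1 * h 2 x $ 2 - h 1 x $ 2 * h 2 x $ 1 \<noteq> 0"
proof -
  show "hv h x p $ 1 * hv h x q $ 2 - hv h x p $ 2 * hv h x q $ 1 = (h 1 x $ 1 * h 2 x $ 2 - h 1 x $ 2 * h 2 x $ 1) * (p $ 1 * q $ 2 - p $ 2 * q $ 1)"
    by (simp add: hv_def algebra_simps)
  have tr: "transpose (\<omega> x) = - \<omega> x" using hf assms by (simp add: half_flat_grassmann_def parallel_symplectic_def)
  have t: "\<omega> x $ j $ i = - (\<omega> x $ i $ j)" for i j
    using arg_cong[OF tr, of "\<lambda>A. A $ i $ j"]
    by (simp only: transpose_def vec_lambda_beta vector_uminus_component)
  have c0: "c = 0" if "c = - c" for c :: complex using that by simp
  have \<omega>: "\<omega> x $ 1 $ 1 = 0" "\<omega> x $ 2 $ 2 = 0" by (rule c0[OF t])+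
  have \<omega>21: "\<omega> x $ 2 $ 1 = - (\<omega> x $ 1 $ 2)" by (rule t)
  have "omega \<omega> x (h 1 x) (h 2 x) = 1" using sf assms by (simp add: symplectic_frame_def)
  then have "\<omega> x $ 1 $ 2 * (h 1 x $ 1 * h 2 x $ 2 - h 1 x $ 2 * h 2 x $ 1) = 1"
    unfolding omega_def sum_2 \<omega> \<omega>21 by (simp add: algebra_simps)
  then show "h 1 x $ 1 * h 2 x $ 2 - h 1 x $ 2 * h 2 x $ 1 \<noteq> 0" by (metis mult_zero_right zero_neq_one)
qed

lemma pairing_iso: "pairing (cotangent_iso \<sigma> x \<xi>) t = (\<Sum>k\<in>UNIV. \<xi> $ k * tvec \<sigma> x t $ k)"
proof -
  have "pairing (cotangent_iso \<sigma> x \<xi>) t = (\<Sum>i\<in>UNIV. \<Sum>a\<in>UNIV. \<Sum>b\<in>UNIV. \<Sum>c\<in>UNIV. \<Sum>k\<in>UNIV. \<xi> $ k * (\<sigma> x $ k $ i $ a $ b $ c * t $ i $ a $ b $ c))"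
    by (simp add: pairing_def cotangent_iso_def sum_distrib_right mult.assoc)
  also have "\<dots> = (\<Sum>k\<in>UNIV. \<Sum>i\<in>UNIV. \<Sum>a\<in>UNIV. \<Sum>b\<in>UNIV. \<Sum>c\<in>UNIV. \<xi> $ k * (\<sigma> x $ k $ i $ a $ b $ c * t $ i $ a $ b $ c))"
    by (simp only: sum.swap[of _ "UNIV :: 'n set" "UNIV :: 2 set"] sum.swap[of _ "UNIV :: 'n set" "UNIV :: 'p set"])
  finally show ?thesis
    by (simp add: tvec_nth pairing_def sum_distrib_left)
qed

text \<open>The tensor is paired with its complex conjugate. The conjugate is symmetric as well,
  hence in the image of \<open>cotangent_iso\<close>, so the pairing vanishes; but it is a sum of
  squared absolute values.\<close>

lemma tvec_inj:
  assumes x: "x \<in> M" and t: "t \<in> sym_tensors" and 0: "tvec \<sigma> x t = 0"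
  shows "t = 0"
proof -
  let ?ct = "\<chi> i a b c. cnj (t $ i $ a $ b $ c)"
  have "?ct \<in> sym_tensors" using t by (simp add: sym_tensors_def sym3_def)
  then obtain \<xi> where "?ct = cotangent_iso \<sigma> x \<xi>"
    using iso[OF x] unfolding bij_betw_def by blast
  then have "pairing ?ct t = 0" using pairing_iso[of x \<xi> t] 0 by simp
  moreover have "pairing ?ct t = (\<Sum>i\<in>UNIV. \<Sum>a\<in>UNIV. \<Sum>b\<in>UNIV. \<Sum>c\<in>UNIV. of_real ((norm (t $ i $ a $ b $ c))\<^sup>2))"
    unfolding complex_norm_square pairing_def by (simp add: mult.commute)
  ultimately have "(\<Sum>i\<in>UNIV. \<Sum>a\<in>UNIV. \<Sum>b\<in>UNIV. \<Sum>c\<in>UNIV. of_real ((norm (t $ i $ a $ b $ c))\<^sup>2)) = (0::complex)"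
    by (rule trans[OF sym, rotated])
  then have "(\<Sum>i\<in>UNIV. \<Sum>a\<in>UNIV. \<Sum>b\<in>UNIV. \<Sum>c\<in>UNIV. (norm (t $ i $ a $ b $ c))\<^sup>2) = 0"
    by (simp only: of_real_sum[symmetric] of_real_eq_0_iff)
  then show ?thesis
    by (simp add: sum_nonneg_eq_0_iff sum_nonneg vec_eq_iff)
qed

text \<open>\<open>tvec\<close> at x, read on symmetric tensors through the isomorphism at a fixed
  point x0: a square matrix that depends holomorphically on x. Its inverse exhibits
  \<open>tvec_inv\<close> as holomorphic.\<close>

definition G :: "complex^'n \<Rightarrow> complex^'n \<Rightarrow> complex^'n^'n" where
  "G x0 x = (\<chi> k l. pairing (\<sigma> x $ k) (\<sigma> x0 $ l))"

lemma tvec_linear: "tvec \<sigma> x (s + t) = tvec \<sigma> x s + tvec \<sigma> x t" "tvec \<sigma> x (s - t) = tvec \<sigma> x s - tvec \<sigma> x t"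
  by (simp_all add: vec_eq_iff tvec_nth pairing_def sum.distrib sum_subtractf algebra_simps)

lemma G_mult: "G x0 x *v \<eta> = tvec \<sigma> x (cotangent_iso \<sigma> x0 \<eta>)"
proof -
  have "pairing (\<sigma> x $ k) (cotangent_iso \<sigma> x0 \<eta>) = (\<Sum>l\<in>UNIV. pairing (\<sigma> x $ k) (\<sigma> x0 $ l) * \<eta> $ l)" for k
  proof -
    have comm: "pairing s t = pairing t s" for s t :: "complex^2^2^2^'p" by (simp add: pairing_def mult.commute)
    show ?thesis
      unfolding comm[of "\<sigma> x $ k"] pairing_iso tvec_nth by (simp add: mult.commute)
  qed
  then show ?thesis
    by (simp add: vec_eq_iff matrix_vector_mult_def G_def tvec_nth)
qed

lemma iso_sym: "x \<in> M \<Longrightarrow> cotangent_iso \<sigma> x \<xi> \<in> sym_tensors"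
  using iso bij_betwE by blast

lemma sym_tensorsD: "t \<in> sym_tensors \<Longrightarrow> t $ i $ a $ b $ c = t $ i $ b $ a $ c"
  "t \<in> sym_tensors \<Longrightarrow> t $ i $ a $ b $ c = t $ i $ a $ c $ b"
  unfolding sym_tensors_def sym3_def by blast+

lemma sym_diff:
  assumes "s \<in> sym_tensors" "t \<in> sym_tensors" shows "s - t \<in> sym_tensors"
proof -
  have "(s - t) $ i $ a $ b $ c = (s - t) $ i $ b $ a $ c \<and> (s - t) $ i $ a $ b $ c = (s - t) $ i $ a $ c $ b" for i a b c
    using sym_tensorsD[OF assms(1), of i a b c] sym_tensorsD[OF assms(2), of i a b c] by simp
  then show ?thesis unfolding sym_tensors_def sym3_def by blast
qed

lemma invertible_G:
  assumes "x0 \<in> M" "x \<in> M" shows "invertible (G x0 x)"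
proof -
  have "inj ((*v) (G x0 x))"
  proof (rule injI)
    fix \<eta> \<eta>' assume "G x0 x *v \<eta> = G x0 x *v \<eta>'"
    then have "tvec \<sigma> x (cotangent_iso \<sigma> x0 \<eta> - cotangent_iso \<sigma> x0 \<eta>') = 0"
      by (simp add: G_mult tvec_linear)
    then have "cotangent_iso \<sigma> x0 \<eta> - cotangent_iso \<sigma> x0 \<eta>' = 0"
      by (intro tvec_inj[OF assms(2)] sym_diff iso_sym assms(1))
    then show "\<eta> = \<eta>'" using iso[OF assms(1)] by (simp add: bij_betw_def inj_eq)
  qed
  then show ?thesis
    by (metis invertible_left_inverse matrix_left_invertible_injective)
qed

lemma tvec_inv_eq:
  assumes "x0 \<in> M" "x \<in> M"
  shows "tvec_inv \<sigma> x v = cotangent_iso \<sigma> x0 (matrix_inv (G x0 x) *v v)"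
  unfolding tvec_inv_def
proof (rule inv_into_f_eq)
  show "inj_on (tvec \<sigma> x) sym_tensors"
  proof (rule inj_onI)
    fix s t assume st: "s \<in> sym_tensors" "t \<in> sym_tensors" "tvec \<sigma> x s = tvec \<sigma> x t"
    then have "s - t = 0" by (intro tvec_inj[OF assms(2)] sym_diff) (simp_all add: tvec_linear)
    then show "s = t" by simp
  qed
  show "cotangent_iso \<sigma> x0 (matrix_inv (G x0 x) *v v) \<in> sym_tensors" by (rule iso_sym[OF assms(1)])
  show "tvec \<sigma> x (cotangent_iso \<sigma> x0 (matrix_inv (G x0 x) *v v)) = v"
    by (simp add: G_mult[symmetric] matrix_vector_mul_assoc matrix_inv_right[OF invertible_G[OF assms]])
qed

lemma tvec_tvec_inv: "x \<in> M \<Longrightarrow> tvec \<sigma> x (tvec_inv \<sigma> x v) = v"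
  by (simp add: tvec_inv_eq G_mult[symmetric] matrix_vector_mul_assoc matrix_inv_right invertible_G)

lemma tvec_inv_sym: "x \<in> M \<Longrightarrow> tvec_inv \<sigma> x v \<in> sym_tensors"
  by (simp add: tvec_inv_eq iso_sym)

lemma tvec_inv_tvec:
  assumes "x \<in> M" "t \<in> sym_tensors" shows "tvec_inv \<sigma> x (tvec \<sigma> x t) = t"
proof -
  have "tvec_inv \<sigma> x (tvec \<sigma> x t) - t = 0"
    by (intro tvec_inj[OF assms(1)] sym_diff tvec_inv_sym assms) (simp add: tvec_linear tvec_tvec_inv assms)
  then show ?thesis by simp
qed

lemma tvec_inv_nth: "x0 \<in> M \<Longrightarrow> x \<in> M \<Longrightarrow> tvec_inv \<sigma> x v $ i $ a $ b $ c
    = (\<Sum>l\<in>UNIV. (\<Sum>k\<in>UNIV. matrix_inv (G x0 x) $ l $ k * v $ k) * \<sigma> x0 $ l $ i $ a $ b $ c)"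
  by (simp add: tvec_inv_eq cotangent_iso_def matrix_vector_mult_def)

lemma holo_inv_G: "x0 \<in> M \<Longrightarrow> holo_mat (*s) M (\<lambda>x. matrix_inv (G x0 x))"
proof (rule vs.holo_matrix_inv)
  show "holo_mat (*s) M (G x0)"
    unfolding G_def pairing_def
    by (rule vs.holo_matI) (simp, intro vs.holo_sum vs.holo_mult vs.holo_const holo_\<sigma> order_refl)
qed (rule invertible_G)

lemma sym_tens: "tens e (sprod p q r) \<in> sym_tensors"
  by (simp add: sym_tensors_def sym3_def tens_def sprod_def algebra_simps)

lemma holo_hv: "S \<subseteq> M \<Longrightarrow> holo (*s) S (\<lambda>x. hv h x u $ a)"
  unfolding hv_def by (simp, intro vs.holo_add vs.holo_mult vs.holo_const holo_h)

lemma holo_T: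
  assumes "S \<subseteq> M" "\<And>i. holo (*s) S (\<lambda>x. e x $ i)" "\<And>a. holo (*s) S (\<lambda>x. p x $ a)" "\<And>a. holo (*s) S (\<lambda>x. q x $ a)" "\<And>a. holo (*s) S (\<lambda>x. r x $ a)"
  shows "holo (*s) S (\<lambda>x. T \<sigma> x (e x) (p x) (q x) (r x) $ k)"
  unfolding T_def tvec_nth pairing_def tens_def sprod_def
  by (simp, intro vs.holo_sum vs.holo_mult vs.holo_divide vs.holo_add vs.holo_const holo_\<sigma> assms) simp

subsection \<open>Involutivity\<close>

text \<open>The field \<open>Xppp\<close> as a field on M for a frozen u_+; the torsion is computed
  from vector fields on M.\<close>

definition Fu :: "complex^2 \<Rightarrow> complex^'p \<Rightarrow> complex^'n \<Rightarrow> complex^'n" where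
  "Fu u c x = T \<sigma> x c (hv h x u) (hv h x u) (hv h x u)"

lemma has_derivative_Fu:
  assumes "x \<in> M" shows "(Fu u c has_derivative fd (Fu u c) x) (at x)"
proof -
  have hol: "holo (*s) M (\<lambda>x. Fu u c x $ k)" for k
    unfolding Fu_def by (rule holo_T) (auto intro: holo_hv)
  have "(Fu u c has_derivative (\<lambda>w. \<chi> k. fd (\<lambda>x. Fu u c x $ k) x w)) (at x)"
    by (rule has_derivative_vec) (simp add: vs.holoD(1)[OF hol open_M assms])
  then show ?thesis using frechet_derivative_at by metis
qed

lemma fd_hv:
  assumes "x \<in> M"
  shows "((\<lambda>x. hv h x u $ a) has_derivative (\<lambda>v. \<Sum>b\<in>UNIV. form aH x v $ b $ a * hv h x u $ b)) (at x)"
proof -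
  have dh: "((\<lambda>x. h \<alpha> x $ a) has_derivative (\<lambda>v. \<Sum>b\<in>UNIV. form aH x v $ b $ a * h \<alpha> x $ b)) (at x)" for \<alpha> a
  proof -
    have "((\<lambda>x. h \<alpha> x $ a) has_derivative fd (\<lambda>x. h \<alpha> x $ a) x) (at x)" for a
      by (rule vs.holoD(1)[OF holo_h[OF order_refl] open_M assms])
    then have "(h \<alpha> has_derivative (\<lambda>v. \<chi> a. fd (\<lambda>x. h \<alpha> x $ a) x v)) (at x)"
      by (intro has_derivative_vec) simp
    then have "(h \<alpha> has_derivative fd (h \<alpha>) x) (at x)" using frechet_derivative_at by metis
    moreover have "fd (h \<alpha>) x = (\<lambda>v. transpose (form aH x v) *v h \<alpha> x)"
      using sf assms by (simp add: symplectic_frame_def fun_eq_iff)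
    ultimately have "(h \<alpha> has_derivative (\<lambda>v. transpose (form aH x v) *v h \<alpha> x)) (at x)" by simp
    from has_derivative_vec_nth[OF this, of a] show ?thesis
      by (simp only: matrix_vector_mult_def transpose_def vec_lambda_beta)
  qed
  have "((\<lambda>x. u $ 1 * h 1 x $ a + u $ 2 * h 2 x $ a) has_derivative
      (\<lambda>v. u $ 1 * (\<Sum>b\<in>UNIV. form aH x v $ b $ a * h 1 x $ b) + u $ 2 * (\<Sum>b\<in>UNIV. form aH x v $ b $ a * h 2 x $ b))) (at x)"
    by (intro has_derivative_add has_derivative_mult_right dh)
  then show ?thesis by (simp add: hv_def sum_distrib_left distrib_left sum.distrib mult.left_commute)
qed

text \<open>The torsion is defined by constant fields. The constant field agrees at x with
  \<open>Fu u c\<close>, whose covariant derivative has only the part from E because h is parallel;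
  the difference is the ordinary derivative of \<open>Fu u c\<close>.\<close>

lemma covTM_const:
  assumes x: "x \<in> M"
  shows "covTM aE aH \<sigma> v (\<lambda>_. Fu u c x) x = Fu u (- transpose (form aE x v) *v c) x - fd (Fu u c) x v"
proof -
  let ?t = "\<lambda>y. tens c (sprod (hv h y u) (hv h y u) (hv h y u))"
  let ?W = "\<lambda>v a. \<Sum>b\<in>UNIV. form aH x v $ b $ a * hv h x u $ b"
  let ?p = "hv h x u"
  define dt where "dt v = (\<chi> i a b d. c $ i * (?W v a * ?p $ b * ?p $ d + ?p $ a * ?W v b * ?p $ d + ?p $ a * ?p $ b * ?W v d))" for v
  have t_nth: "?t y $ i $ a $ b $ d = c $ i * (hv h y u $ a * hv h y u $ b * hv h y u $ d)" for y i a b d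
    by (simp add: tens_def sprod_def)
  have 1: "((\<lambda>y. ?t y $ i $ a $ b $ d) has_derivative (\<lambda>v. dt v $ i $ a $ b $ d)) (at x)" for i a b d
  proof -
    have "((\<lambda>y. c $ i * (hv h y u $ a * hv h y u $ b * hv h y u $ d)) has_derivative
        (\<lambda>v. c $ i * (?p $ a * ?p $ b * ?W v d + (?p $ a * ?W v b + ?W v a * ?p $ b) * ?p $ d))) (at x)"
      by (intro has_derivative_mult_right has_derivative_mult fd_hv[OF x])
    then show ?thesis
      unfolding t_nth by (rule has_derivative_eq_rhs) (simp add: dt_def fun_eq_iff algebra_simps)
  qed
  let ?N = "\<lambda>k y. tvec_inv \<sigma> y (axis k 1)"
  have Nh: "holo (*s) M (\<lambda>y. ?N k y $ i $ a $ b $ d)" for k i a b d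
  proof -
    have "holo (*s) M (\<lambda>y. \<Sum>l\<in>UNIV. (\<Sum>j\<in>UNIV. matrix_inv (G x y) $ l $ j * axis k 1 $ j) * \<sigma> x $ l $ i $ a $ b $ d)"
      by (intro vs.holo_sum vs.holo_mult vs.holo_const vs.holo_matD[OF holo_inv_G[OF x]])
    then show ?thesis by (rule vs.holo_cong_imp) (simp add: tvec_inv_nth[OF x])
  qed
  have expand: "tvec_inv \<sigma> y w $ i $ a $ b $ d = (\<Sum>k\<in>UNIV. w $ k * ?N k y $ i $ a $ b $ d)" if "y \<in> M" for y w i a b d
  proof -
    have "tvec_inv \<sigma> y w $ i $ a $ b $ d = (\<Sum>l\<in>UNIV. \<Sum>k\<in>UNIV. w $ k * (matrix_inv (G x y) $ l $ k * \<sigma> x $ l $ i $ a $ b $ d))"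
      unfolding tvec_inv_nth[OF x that] sum_distrib_right by (intro sum.cong refl) (simp only: mult_ac)
    also have "\<dots> = (\<Sum>k\<in>UNIV. w $ k * (\<Sum>l\<in>UNIV. matrix_inv (G x y) $ l $ k * \<sigma> x $ l $ i $ a $ b $ d))"
      by (subst sum.swap) (simp add: sum_distrib_left)
    finally show ?thesis
      by (simp add: tvec_inv_nth[OF x that] axis_def if_distrib[of "\<lambda>x. _ * x"] cong: if_cong)
  qed
  let ?w = "Fu u c x"
  define DN where "DN v = (\<chi> i a b d. \<Sum>k\<in>UNIV. ?w $ k * fd (\<lambda>y. ?N k y $ i $ a $ b $ d) x v)" for v
  have dN: "((\<lambda>y. ?N k y $ i $ a $ b $ d) has_derivative fd (\<lambda>y. ?N k y $ i $ a $ b $ d) x) (at x)" for k i a b d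
    by (rule vs.holoD(1)[OF Nh open_M x])
  have 2: "((\<lambda>y. tvec_inv \<sigma> y ?w) has_derivative DN) (at x)"
  proof (intro has_derivative_vec)
    fix i a b d
    have "((\<lambda>y. \<Sum>k\<in>UNIV. ?w $ k * ?N k y $ i $ a $ b $ d) has_derivative (\<lambda>v. DN v $ i $ a $ b $ d)) (at x)"
      unfolding DN_def by (simp, intro has_derivative_sum has_derivative_mult_right dN)
    then show "((\<lambda>y. tvec_inv \<sigma> y ?w $ i $ a $ b $ d) has_derivative (\<lambda>v. DN v $ i $ a $ b $ d)) (at x)"
      by (rule has_derivative_transform_within_open[OF _ open_M x]) (simp add: expand)
  qed
  \<comment> \<open>Product rule for the identity that \<open>tvec_inv\<close> maps
    \<open>Fu u c\<close> to \<open>?t\<close>: it separates the derivative of the field from that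
    of the isomorphism.\<close>
  have 3: "dt v = tvec_inv \<sigma> x (fd (Fu u c) x v) + DN v"
  proof -
    have "((\<lambda>y. \<Sum>k\<in>UNIV. Fu u c y $ k * ?N k y $ i $ a $ b $ d) has_derivative
        (\<lambda>v. \<Sum>k\<in>UNIV. ?w $ k * fd (\<lambda>y. ?N k y $ i $ a $ b $ d) x v + fd (Fu u c) x v $ k * ?N k x $ i $ a $ b $ d)) (at x)" for i a b d
      by (intro has_derivative_sum has_derivative_mult has_derivative_vec_nth[OF has_derivative_Fu[OF x]] dN)
    then have D: "((\<lambda>y. ?t y $ i $ a $ b $ d) has_derivative
        (\<lambda>v. \<Sum>k\<in>UNIV. ?w $ k * fd (\<lambda>y. ?N k y $ i $ a $ b $ d) x v + fd (Fu u c) x v $ k * ?N k x $ i $ a $ b $ d)) (at x)" for i a b d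
    proof (rule has_derivative_transform_within_open[OF _ open_M x])
      fix y assume y: "y \<in> M"
      show "(\<Sum>k\<in>UNIV. Fu u c y $ k * ?N k y $ i $ a $ b $ d) = ?t y $ i $ a $ b $ d"
        unfolding expand[OF y, symmetric] Fu_def T_def by (simp only: tvec_inv_tvec[OF y sym_tens])
    qed
    have c1: "dt v $ i $ a $ b $ d = (\<Sum>k\<in>UNIV. ?w $ k * fd (\<lambda>y. ?N k y $ i $ a $ b $ d) x v + fd (Fu u c) x v $ k * ?N k x $ i $ a $ b $ d)" for i a b d
      by (rule has_derivative_unique[OF 1 D, THEN fun_cong])
    have "dt v $ i $ a $ b $ d = (tvec_inv \<sigma> x (fd (Fu u c) x v) + DN v) $ i $ a $ b $ d" for i a b d
      unfolding c1 vector_add_component expand[OF x, of "fd (Fu u c) x v"]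
      by (simp only: DN_def vec_lambda_beta sum.distrib add.commute)
    then show ?thesis by (simp only: vec_eq_iff) simp
  qed
  have val: "tvec_inv \<sigma> x ?w = ?t x"
    unfolding Fu_def T_def by (rule tvec_inv_tvec[OF x sym_tens])
  \<comment> \<open>Parallelism of h: the connection term of H cancels the derivative of the cubic
    tensor.\<close>
  have H: "dt v + (\<chi> i. act3 (- transpose (form aH x v)) (?t x $ i)) = 0"
    by (simp add: vec_eq_iff act3_def t_nth dt_def transpose_def sum_2 algebra_simps)
  have E: "(\<chi> i a b d. \<Sum>j\<in>UNIV. (- transpose (form aE x v)) $ i $ j * ?t x $ j $ a $ b $ d)
      = tens (- transpose (form aE x v) *v c) (sprod ?p ?p ?p)"
    by (simp add: vec_eq_iff tens_def matrix_vector_mult_def sum_distrib_right mult.assoc)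
  have "cov_tensor aE aH v (\<lambda>y. tvec_inv \<sigma> y ?w) x
     = DN v + tens (- transpose (form aE x v) *v c) (sprod ?p ?p ?p) + (\<chi> i. act3 (- transpose (form aH x v)) (?t x $ i))"
    unfolding cov_tensor_def val E fd_eqI[OF 2] by simp
  also have "\<dots> = tens (- transpose (form aE x v) *v c) (sprod ?p ?p ?p) - tvec_inv \<sigma> x (fd (Fu u c) x v)"
  proof -
    have "DN v = dt v - tvec_inv \<sigma> x (fd (Fu u c) x v)" using 3 by simp
    moreover have "(\<chi> i. act3 (- transpose (form aH x v)) (?t x $ i)) = - dt v"
      using H by (simp add: add_eq_0_iff)
    ultimately show ?thesis by simp
  qed
  finally show ?thesis
    by (simp add: covTM_def tvec_linear tvec_tvec_inv[OF x] Fu_def T_def)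
qed

lemma Fu_diff: "Fu u c x - Fu u d x = Fu u (c - d) x"
  using T_linear_e(1)[of \<sigma> x "c - d" d] by (simp add: Fu_def)

text \<open>By \<open>covTM_const\<close> the torsion is minus the bracket up to terms from the
  connection on E, and those terms are again values of \<open>Fu u\<close>; so the bracket lies in
  the distribution because the torsion does.\<close>

lemma involutive_Fu:
  assumes z: "z \<in> harmonic_space M" and x: "x = fst z" and u: "u = uplus z"
  shows "\<exists>d. fd (Fu u c') x (Fu u c x) - fd (Fu u c) x (Fu u c' x) = Fu u d x"
proof -
  have xM: "x \<in> M" using z x by (simp add: harmonic_space_iff)
  have X: "Xppp \<sigma> h (\<lambda>_. c) z = hlift (Fu u c x)" for c
    by (simp add: Xppp_def Xuuu_eq Fu_def x u)
  have D: "D3p \<sigma> h z = range (\<lambda>c. hlift (Fu u c x))" by (simp add: D3p_def X)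
  have "\<forall>v\<in>D3p \<sigma> h z. \<forall>w\<in>D3p \<sigma> h z. hlift (torsion aE aH \<sigma> (fst z) (fst v) (fst w)) \<in> D3p \<sigma> h z"
    using adm z unfolding zero_admissible_def by blast
  then have "hlift (torsion aE aH \<sigma> (fst z) (fst (hlift (Fu u c x))) (fst (hlift (Fu u c' x)))) \<in> D3p \<sigma> h z"
    unfolding D by blast
  then obtain d where "hlift (torsion aE aH \<sigma> x (Fu u c x) (Fu u c' x)) = hlift (Fu u d x)"
    unfolding D by (auto simp: hlift_linear x)
  then have d: "torsion aE aH \<sigma> x (Fu u c x) (Fu u c' x) = Fu u d x" by (metis hlift_linear(4))
  let ?a = "- transpose (form aE x (Fu u c x)) *v c'" and ?b = "- transpose (form aE x (Fu u c' x)) *v c"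
  have "Fu u d x = (Fu u ?a x - fd (Fu u c') x (Fu u c x)) - (Fu u ?b x - fd (Fu u c) x (Fu u c' x))"
    using d by (simp add: torsion_def covTM_const[OF xM])
  then have "fd (Fu u c') x (Fu u c x) - fd (Fu u c) x (Fu u c' x) = Fu u ?a x - Fu u ?b x - Fu u d x"
    by (simp add: algebra_simps)
  then show ?thesis unfolding Fu_diff by blast
qed

end

lemma vertical_sel: "fst (dpp z) = 0" "uplus (dpp z) = 0" "uminus' (dpp z) = uplus z"
  "fst (dmm z) = 0" "uplus (dmm z) = uminus' z" "uminus' (dmm z) = 0"
  "fst (d0 z) = 0" "uplus (d0 z) = uplus z" "uminus' (d0 z) = - uminus' z"
  by (simp_all add: dpp_def dmm_def d0_def)

locale spin_domain = spin_manifold M aE aH \<omega> \<sigma> h + harmonic_domain M \<Omega>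
  for M :: "(complex^'n) set" and aE :: "complex^'n \<Rightarrow> complex^'p^'p^'n" and aH \<omega>
    and \<sigma> :: "complex^'n \<Rightarrow> complex^2^2^2^'p^'n" and h :: "2 \<Rightarrow> complex^'n \<Rightarrow> complex^2" and \<Omega> :: "('n hpoint) set"
begin

subsection \<open>Brackets with vertical fields\<close>

lemma fst_sub: "fst ` \<Omega> \<subseteq> M" using fst_\<Omega> by blast

lemma holo_fst_M: "holo (*s) M f \<Longrightarrow> holo hscale \<Omega> (\<lambda>z. f (fst z))"
  by (rule holo_fst[OF vs.holo_subset[OF _ fst_sub]])

lemma holo_hv_z:
  assumes "\<And>a. holo hscale \<Omega> (\<lambda>z. p z $ a)" shows "holo hscale \<Omega> (\<lambda>z. hv h (fst z) (p z) $ a)"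
  unfolding hv_def
  by (simp, intro hs.holo_add hs.holo_mult assms holo_fst_M[OF holo_h[OF order_refl]])

lemma holo_T_z:
  assumes "\<And>i. holo hscale \<Omega> (\<lambda>z. e z $ i)" "\<And>a. holo hscale \<Omega> (\<lambda>z. p z $ a)" "\<And>a. holo hscale \<Omega> (\<lambda>z. q z $ a)" "\<And>a. holo hscale \<Omega> (\<lambda>z. r z $ a)"
  shows "holo hscale \<Omega> (\<lambda>z. T \<sigma> (fst z) (e z) (p z) (q z) (r z) $ k)"
  unfolding T_def tvec_nth pairing_def tens_def sprod_def
  by (simp, intro hs.holo_sum hs.holo_mult hs.holo_divide hs.holo_add hs.holo_const holo_fst_M[OF holo_\<sigma>[OF order_refl]] assms) simp

lemma tangent_field_Y:
  assumes "sectionE (fst ` \<Omega>) e" shows "tangent_field \<Omega> (Y \<sigma> h m e)"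
proof -
  have e: "holo hscale \<Omega> (\<lambda>z. e (fst z) $ i)" for i
    using assms holo_fst unfolding sectionE_def holo_vec_def by blast
  have *: "holo hscale \<Omega> (\<lambda>z. T \<sigma> (fst z) (e (fst z)) (hv h (fst z) (p z)) (hv h (fst z) (q z)) (hv h (fst z) (r z)) $ k)"
    if "\<And>a. holo hscale \<Omega> (\<lambda>z. p z $ a)" "\<And>a. holo hscale \<Omega> (\<lambda>z. q z $ a)" "\<And>a. holo hscale \<Omega> (\<lambda>z. r z $ a)" for p q r k
    by (intro holo_T_z holo_hv_z e that)
  have "hs.holo_fld \<Omega> (Y \<sigma> h m e)"
  proof (rule holo_fldI)
    show "holo hscale \<Omega> (\<lambda>z. fst (Y \<sigma> h m e z) $ k)" for k
      unfolding Y_def Xppp_def Xp_def Xm_def Xmmm_def Xuuu_eq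
      by (cases "m = 0"; cases "m = 1"; cases "m = 2") (simp_all add: hlift_linear *)
  qed (simp_all add: Y_horizontal)
  then show ?thesis by (simp add: tangent_field_iff tangent_Y)
qed

lemma sectionE_const: "sectionE B (\<lambda>_. c)"
  by (simp add: sectionE_def holo_vec_def)

lemma holo_fld_vertical: "hs.holo_fld S dpp" "hs.holo_fld S dmm" "hs.holo_fld S d0"
  by (rule holo_fldI; simp add: dpp_def dmm_def d0_def hs.holo_minus)+

lemma tangent_field_vertical: "tangent_field \<Omega> dpp" "tangent_field \<Omega> dmm" "tangent_field \<Omega> d0"
  by (simp_all add: tangent_field_iff holo_fld_vertical tangent_vertical)

lemma der_vertical:
  assumes "z \<in> \<Omega>" "tangent z w"
  shows "der \<Omega> dpp z w = dpp w" "der \<Omega> dmm z w = dmm w" "der \<Omega> d0 z w = d0 w"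
proof -
  have fs: "bounded_linear (\<lambda>z :: 'n hpoint. uplus z)" and ss: "bounded_linear (\<lambda>z :: 'n hpoint. uminus' z)"
    by (intro bounded_linear_compose[OF bounded_linear_fst] bounded_linear_compose[OF bounded_linear_snd] bounded_linear_snd)+
  have "bounded_linear (dpp :: 'n hpoint \<Rightarrow> _)" "bounded_linear (dmm :: 'n hpoint \<Rightarrow> _)" "bounded_linear (d0 :: 'n hpoint \<Rightarrow> _)"
    unfolding dpp_def[abs_def] dmm_def[abs_def] d0_def[abs_def]
    by (intro bounded_linear_Pair bounded_linear_zero bounded_linear_minus fs ss)+
  then show "der \<Omega> dpp z w = dpp w" "der \<Omega> dmm z w = dmm w" "der \<Omega> d0 z w = d0 w"
    using der_eqI[OF bounded_linear_imp_has_derivative assms] by blast+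
qed

lemma der_Xuuu:
  assumes e: "sectionE (fst ` \<Omega>) e" and z: "z \<in> \<Omega>" and w: "tangent z w" "fst w = 0"
    and P: "\<And>\<alpha>. ((\<lambda>z. P z $ \<alpha>) has_derivative (\<lambda>w. P w $ \<alpha>)) (at z within \<Omega>)"
    and Q: "\<And>\<alpha>. ((\<lambda>z. Q z $ \<alpha>) has_derivative (\<lambda>w. Q w $ \<alpha>)) (at z within \<Omega>)"
    and R: "\<And>\<alpha>. ((\<lambda>z. R z $ \<alpha>) has_derivative (\<lambda>w. R w $ \<alpha>)) (at z within \<Omega>)"
  shows "der \<Omega> (\<lambda>z. Xuuu \<sigma> h e (P z) (Q z) (R z) (fst z)) z w
    = Xuuu \<sigma> h e (P w) (Q z) (R z) (fst z) + Xuuu \<sigma> h e (P z) (Q w) (R z) (fst z) + Xuuu \<sigma> h e (P z) (Q z) (R w) (fst z)"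
proof -
  let ?K = "\<lambda>\<alpha> \<beta> \<gamma> z. hlift (Xabc \<sigma> h e \<alpha> \<beta> \<gamma> (fst z))"
  have eh: "holo (*s) (fst ` \<Omega>) (\<lambda>x. e x $ i)" for i using e by (simp add: sectionE_def holo_vec_def)
  have Xh: "holo (*s) (fst ` \<Omega>) (\<lambda>x. Xabc \<sigma> h e \<alpha> \<beta> \<gamma> x $ k)" for \<alpha> \<beta> \<gamma> k
    unfolding Xabc_def T_def[symmetric] by (intro holo_T fst_sub eh holo_h)
  define L where "L \<alpha> \<beta> \<gamma> k = frechet_derivative (\<lambda>x. Xabc \<sigma> h e \<alpha> \<beta> \<gamma> x $ k) (at (fst z) within fst ` \<Omega>)" for \<alpha> \<beta> \<gamma> k
  have L: "((\<lambda>x. Xabc \<sigma> h e \<alpha> \<beta> \<gamma> x $ k) has_derivative L \<alpha> \<beta> \<gamma> k) (at (fst z) within fst ` \<Omega>)" for \<alpha> \<beta> \<gamma> k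
  proof -
    have "fst z \<in> fst ` \<Omega>" using z by (rule imageI)
    then obtain L' where "((\<lambda>x. Xabc \<sigma> h e \<alpha> \<beta> \<gamma> x $ k) has_derivative L') (at (fst z) within fst ` \<Omega>)"
      using vs.holoE[OF Xh] by blast
    then show ?thesis unfolding L_def using frechet_derivative_works differentiable_def by blast
  qed
  have L0: "L \<alpha> \<beta> \<gamma> k 0 = 0" for \<alpha> \<beta> \<gamma> k
    using has_derivative_bounded_linear[OF L] by (simp add: linear_simps)
  have fstd: "(fst has_derivative fst) (at z within \<Omega>)"
    by (rule bounded_linear_imp_has_derivative[OF bounded_linear_fst])
  have K: "(?K \<alpha> \<beta> \<gamma> has_derivative (\<lambda>w. hlift (\<chi> k. L \<alpha> \<beta> \<gamma> k (fst w)))) (at z within \<Omega>)" for \<alpha> \<beta> \<gamma>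
  proof -
    have "((\<lambda>z. Xabc \<sigma> h e \<alpha> \<beta> \<gamma> (fst z)) has_derivative (\<lambda>w. \<chi> k. L \<alpha> \<beta> \<gamma> k (fst w))) (at z within \<Omega>)"
      by (rule has_derivative_vec) (simp add: has_derivative_in_compose[OF fstd L])
    then show ?thesis unfolding hlift_def by (intro has_derivative_Pair has_derivative_const)
  qed
  have "((\<lambda>z. Xuuu \<sigma> h e (P z) (Q z) (R z) (fst z)) has_derivative (\<lambda>w. \<Sum>\<alpha>\<in>UNIV. \<Sum>\<beta>\<in>UNIV. \<Sum>\<gamma>\<in>UNIV.
      hscale (P z $ \<alpha> * Q z $ \<beta> * R z $ \<gamma>) (hlift (\<chi> k. L \<alpha> \<beta> \<gamma> k (fst w)))
    + hscale (P z $ \<alpha> * Q z $ \<beta> * R w $ \<gamma> + (P z $ \<alpha> * Q w $ \<beta> + P w $ \<alpha> * Q z $ \<beta>) * R z $ \<gamma>) (?K \<alpha> \<beta> \<gamma> z))) (at z within \<Omega>)"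
    unfolding Xuuu_def
    by (intro has_derivative_sum hs.sc.FDERIV has_derivative_mult P Q R K)
  from der_eqI[OF this z w(1)] have "der \<Omega> (\<lambda>z. Xuuu \<sigma> h e (P z) (Q z) (R z) (fst z)) z w
    = (\<Sum>\<alpha>\<in>UNIV. \<Sum>\<beta>\<in>UNIV. \<Sum>\<gamma>\<in>UNIV. hscale (P z $ \<alpha> * Q z $ \<beta> * R w $ \<gamma> + (P z $ \<alpha> * Q w $ \<beta> + P w $ \<alpha> * Q z $ \<beta>) * R z $ \<gamma>) (?K \<alpha> \<beta> \<gamma> z))"
    by (simp add: w(2) L0 hlift_def hscale_def zero_prod_def[symmetric] zero_vec_def[symmetric])
  then show ?thesis
    unfolding Xuuu_def sum.distrib[symmetric] hs.sc_add_left[symmetric]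
    by (rule trans) (intro sum.cong refl arg_cong2[where f = hscale], simp add: algebra_simps)
qed

lemma T_zero: "T \<sigma> x e 0 q r = 0" "T \<sigma> x e q 0 r = 0" "T \<sigma> x e q r 0 = 0" "T \<sigma> x 0 p q r = 0"
  using T_linear1(2)[of \<sigma> x e 0 0] T_linear2(2)[of \<sigma> x e q 0 0] T_linear3(2)[of \<sigma> x e q r 0 0] T_linear_e(2)[of \<sigma> x 0 0] by simp_all

lemma T_minus: "T \<sigma> x e (- p) q r = - T \<sigma> x e p q r" "T \<sigma> x e q (- p) r = - T \<sigma> x e q p r" "T \<sigma> x e q r (- p) = - T \<sigma> x e q r p"
  using T_linear1(1)[of \<sigma> x e p "- p"] T_linear2(1)[of \<sigma> x e q p "- p"] T_linear3(1)[of \<sigma> x e q r p "- p"]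
  by (simp_all add: T_zero eq_neg_iff_add_eq_0 add.commute)

text \<open>Slot i of the cubic expression holds u_+ for i < 3 - m and u_- otherwise; a vertical
  vector differentiates one slot at a time and leaves the base factor alone.\<close>

lemma der_Y_vertical:
  assumes e: "sectionE (fst ` \<Omega>) e" and z: "z \<in> \<Omega>" and w: "tangent z w" "fst w = 0" and m: "m \<le> 3"
  shows "der \<Omega> (Y \<sigma> h m e) z w =
    (let p = (\<lambda>i. if i < 3 - m then uplus else uminus') in
     Xuuu \<sigma> h e (p 0 w) (p 1 z) (p 2 z) (fst z) + Xuuu \<sigma> h e (p 0 z) (p 1 w) (p 2 z) (fst z) + Xuuu \<sigma> h e (p 0 z) (p 1 z) (p 2 w) (fst z))"
proof -
  have u: "((\<lambda>z. uplus z $ \<alpha>) has_derivative (\<lambda>w. uplus w $ \<alpha>)) (at z within \<Omega>)"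
    "((\<lambda>z. uminus' z $ \<alpha>) has_derivative (\<lambda>w. uminus' w $ \<alpha>)) (at z within \<Omega>)" for \<alpha>
    by (intro has_derivative_coord has_derivative_ident)+
  \<comment> \<open>\<open>Xm\<close> is defined with u_+ in the last slot; symmetry moves it to the
    first.\<close>
  have Xm: "Xm \<sigma> h e = (\<lambda>z. Xuuu \<sigma> h e (uplus z) (uminus' z) (uminus' z) (fst z))"
    unfolding Xm_def[abs_def] Xuuu_eq by (rule ext, rule arg_cong[of _ _ hlift], rule trans[OF T_commute(2) T_commute(1)])
  from m show ?thesis
    by (rule nat_le_3_cases)
      (simp_all add: Xm Xppp_def[abs_def] Xp_def[abs_def] Xmmm_def[abs_def] der_Xuuu[OF e z w u(1) u(1) u(1)] der_Xuuu[OF e z w u(1) u(1) u(2)]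
        der_Xuuu[OF e z w u(1) u(2) u(2)] der_Xuuu[OF e z w u(2) u(2) u(2)])
qed

lemma hlift_scaleR: "hlift (r *\<^sub>R v) = r *\<^sub>R hlift v" "hlift (- v) = - hlift v"
  by (simp_all add: hlift_def)

text \<open>\<open>dmm\<close> turns one of the 3 - m factors u_+ into u_-, and \<open>dpp\<close>
  one of the m factors u_- into u_+. For m = 0 the truncated index m - 1 comes with the coefficient
  0. The vertical fields have no derivative along the horizontal \<open>Y m\<close>, so only one
  term of the bracket survives.\<close>

lemma bracket_Y:
  assumes e: "sectionE (fst ` \<Omega>) e" and z: "z \<in> \<Omega>" and m: "m \<le> 3"
  shows "m < 3 \<Longrightarrow> bracket \<Omega> dmm (Y \<sigma> h m e) z = real (3 - m) *\<^sub>R Y \<sigma> h (Suc m) e z"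
    "bracket \<Omega> dpp (Y \<sigma> h m e) z = real m *\<^sub>R Y \<sigma> h (m - 1) e z"
    "bracket \<Omega> d0 (Y \<sigma> h m e) z = (3 - 2 * real m) *\<^sub>R Y \<sigma> h m e z"
proof -
  have v: "dpp (Y \<sigma> h m e z) = 0" "dmm (Y \<sigma> h m e z) = 0" "d0 (Y \<sigma> h m e z) = 0"
    by (simp_all add: dpp_def dmm_def d0_def Y_horizontal zero_prod_def)
  note b = bracket_def der_vertical[OF z tangent_Y] v diff_zero
  note D = der_Y_vertical[OF e z tangent_vertical(1) vertical_sel(1) m]
    der_Y_vertical[OF e z tangent_vertical(2) vertical_sel(4) m] der_Y_vertical[OF e z tangent_vertical(3) vertical_sel(7) m]
  have Y_Suc: "Y \<sigma> h (Suc (Suc 0)) = Xm \<sigma> h" "Y \<sigma> h (Suc 2) = Xmmm \<sigma> h"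
    by (simp_all add: Y_def fun_eq_iff)
  note S = Let_def Xuuu_eq hv_linear T_zero T_minus T_commute hlift_linear(1)[symmetric] hlift_scaleR[symmetric] hlift_linear(3)
    Xppp_def Xp_def Xm_def Xmmm_def vertical_sel Y_Suc
  have two: "x + x = 2 *\<^sub>R x" "x + 2 *\<^sub>R x = 3 *\<^sub>R x" "2 *\<^sub>R x + x = 3 *\<^sub>R x"
    "2 *\<^sub>R x - x = x" "- (2 *\<^sub>R x) - x = - (3 *\<^sub>R x)" for x :: "complex^'n"
    using scaleR_left_distrib[of 1 2 x] scaleR_left_distrib[of 2 1 x] by (simp_all add: scaleR_2)
  from m show "bracket \<Omega> dmm (Y \<sigma> h m e) z = real (3 - m) *\<^sub>R Y \<sigma> h (Suc m) e z" if "m < 3"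
    unfolding b D(2) using that by (elim nat_le_3_cases) (simp_all add: S two)
  from m show "bracket \<Omega> dpp (Y \<sigma> h m e) z = real m *\<^sub>R Y \<sigma> h (m - 1) e z"
    unfolding b D(1) by (elim nat_le_3_cases) (simp_all add: S two)
  from m show "bracket \<Omega> d0 (Y \<sigma> h m e) z = (3 - 2 * real m) *\<^sub>R Y \<sigma> h m e z"
    unfolding b D(3) by (elim nat_le_3_cases) (simp_all add: S two)
qed

lemma bracket_vertical:
  assumes "z \<in> \<Omega>"
  shows "bracket \<Omega> dpp dmm z = d0 z" "bracket \<Omega> d0 dpp z = 2 *\<^sub>R dpp z" "bracket \<Omega> d0 dmm z = - (2 *\<^sub>R dmm z)"
  by (simp_all add: bracket_def der_vertical[OF assms] tangent_vertical)
    (simp_all add: dpp_def dmm_def d0_def scaleR_2)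

subsection \<open>A holomorphic coframe\<close>

definition hs :: "2 \<Rightarrow> 'n hpoint \<Rightarrow> complex^2" where
  "hs s z = hv h (fst z) (if s = 1 then uplus z else uminus' z)"

definition hdet :: "'n hpoint \<Rightarrow> complex" where
  "hdet z = hs 1 z $ 1 * hs 2 z $ 2 - hs 1 z $ 2 * hs 2 z $ 1"

text \<open>The basis dual to h_+, h_-, written with cofactors over the determinant.\<close>

definition hd :: "2 \<Rightarrow> 'n hpoint \<Rightarrow> complex^2" where
  "hd s z = (\<chi> a. (if s = 1 then (if a = 1 then hs 2 z $ 2 else - hs 2 z $ 1) else (if a = 1 then - hs 1 z $ 2 else hs 1 z $ 1)) / hdet z)"

lemma hdet_nz: "z \<in> \<Omega> \<Longrightarrow> hdet z \<noteq> 0"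
  using frame_det(1)[OF fst_\<Omega>[of z], of "uplus z" "uminus' z"] frame_det(2)[OF fst_\<Omega>[of z]] dt_\<Omega>[of z]
  by (simp add: hdet_def hs_def dt_def)

lemma hd_nth: "hd 1 z $ 1 = hs 2 z $ 2 / hdet z" "hd 1 z $ 2 = - hs 2 z $ 1 / hdet z"
  "hd 2 z $ 1 = - hs 1 z $ 2 / hdet z" "hd 2 z $ 2 = hs 1 z $ 1 / hdet z"
  by (simp_all add: hd_def)

lemma frac_sum: "a / d * x + b / d * y = (a * x + b * y) / d" "x * (a / d) + y * (b / d) = (x * a + y * b) / d" for a b d x y :: complex
  by (simp_all add: add_divide_distrib)

lemma hd_hs:
  assumes "z \<in> \<Omega>"
  shows "hd 1 z $ 1 * hs 1 z $ 1 + hd 1 z $ 2 * hs 1 z $ 2 = 1" "hd 1 z $ 1 * hs 2 z $ 1 + hd 1 z $ 2 * hs 2 z $ 2 = 0"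
    "hd 2 z $ 1 * hs 1 z $ 1 + hd 2 z $ 2 * hs 1 z $ 2 = 0" "hd 2 z $ 1 * hs 2 z $ 1 + hd 2 z $ 2 * hs 2 z $ 2 = 1"
proof -
  have *: "n = hdet z \<Longrightarrow> n / hdet z = 1" for n using hdet_nz[OF assms] by simp
  show "hd 1 z $ 1 * hs 1 z $ 1 + hd 1 z $ 2 * hs 1 z $ 2 = 1" "hd 2 z $ 1 * hs 2 z $ 1 + hd 2 z $ 2 * hs 2 z $ 2 = 1"
    unfolding hd_nth frac_sum by (rule *, simp add: hdet_def)+
  show "hd 1 z $ 1 * hs 2 z $ 1 + hd 1 z $ 2 * hs 2 z $ 2 = 0" "hd 2 z $ 1 * hs 1 z $ 1 + hd 2 z $ 2 * hs 1 z $ 2 = 0"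
    unfolding hd_nth frac_sum by simp_all
qed

lemma resolution:
  fixes f :: "2 \<Rightarrow> complex"
  assumes "z \<in> \<Omega>"
  shows "(\<Sum>s\<in>UNIV. hs s z $ a * (\<Sum>d\<in>UNIV. hd s z $ d * f d)) = f a"
proof -
  have *: "n = hdet z \<Longrightarrow> n / hdet z = 1" for n using hdet_nz[OF assms] by simp
  have "hs 1 z $ 1 * hd 1 z $ 1 + hs 2 z $ 1 * hd 2 z $ 1 = 1" "hs 1 z $ 2 * hd 1 z $ 2 + hs 2 z $ 2 * hd 2 z $ 2 = 1"
    unfolding hd_nth frac_sum by (rule *, simp add: hdet_def)+
  moreover have "hs 1 z $ 1 * hd 1 z $ 2 + hs 2 z $ 1 * hd 2 z $ 2 = 0" "hs 1 z $ 2 * hd 1 z $ 1 + hs 2 z $ 2 * hd 2 z $ 1 = 0"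
    unfolding hd_nth frac_sum by simp_all
  moreover have "(\<Sum>s\<in>UNIV. hs s z $ a * (\<Sum>d\<in>UNIV. hd s z $ d * f d))
    = (hs 1 z $ a * hd 1 z $ 1 + hs 2 z $ a * hd 2 z $ 1) * f 1 + (hs 1 z $ a * hd 1 z $ 2 + hs 2 z $ a * hd 2 z $ 2) * f 2"
    by (simp add: sum_2 algebra_simps)
  ultimately show ?thesis using exhaust_2[of a] by auto
qed

definition contr :: "2 \<Rightarrow> 2 \<Rightarrow> 2 \<Rightarrow> 'n hpoint \<Rightarrow> (2 \<Rightarrow> 2 \<Rightarrow> 2 \<Rightarrow> complex) \<Rightarrow> complex" where
  "contr s1 s2 s3 z f = (\<Sum>a\<in>UNIV. hd s1 z $ a * (\<Sum>b\<in>UNIV. hd s2 z $ b * (\<Sum>c\<in>UNIV. hd s3 z $ c * f a b c)))"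

text \<open>Components of the horizontal part with respect to h_+ and h_-, indexed by all eight
  ordered triples instead of by m.\<close>

definition coef :: "2 \<Rightarrow> 2 \<Rightarrow> 2 \<Rightarrow> 'n hpoint \<Rightarrow> 'n hpoint \<Rightarrow> complex^'p" where
  "coef s1 s2 s3 z w = (\<chi> i. contr s1 s2 s3 z (\<lambda>a b c. tvec_inv \<sigma> (fst z) (fst w) $ i $ a $ b $ c))"

lemma contr_resolution:
  assumes "z \<in> \<Omega>"
  shows "(\<Sum>s1\<in>UNIV. \<Sum>s2\<in>UNIV. \<Sum>s3\<in>UNIV. contr s1 s2 s3 z f * (hs s1 z $ a * hs s2 z $ b * hs s3 z $ c)) = f a b c"
proof -
  have 1: "(\<Sum>s3\<in>UNIV. contr s1 s2 s3 z f * (hs s1 z $ a * hs s2 z $ b * hs s3 z $ c))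
      = hs s1 z $ a * (hs s2 z $ b * (\<Sum>d\<in>UNIV. hd s1 z $ d * (\<Sum>e\<in>UNIV. hd s2 z $ e * f d e c)))" for s1 s2
  proof -
    have "(\<Sum>s3\<in>UNIV. contr s1 s2 s3 z f * (hs s1 z $ a * hs s2 z $ b * hs s3 z $ c))
      = hs s1 z $ a * (hs s2 z $ b * (\<Sum>d\<in>UNIV. hd s1 z $ d * (\<Sum>e\<in>UNIV. hd s2 z $ e * (\<Sum>s3\<in>UNIV. hs s3 z $ c * (\<Sum>g\<in>UNIV. hd s3 z $ g * f d e g)))))"
      by (simp only: contr_def sum_2) algebra
    then show ?thesis by (simp only: resolution[OF assms])
  qed
  have 2: "(\<Sum>s2\<in>UNIV. hs s1 z $ a * (hs s2 z $ b * (\<Sum>d\<in>UNIV. hd s1 z $ d * (\<Sum>e\<in>UNIV. hd s2 z $ e * f d e c))))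
      = hs s1 z $ a * (\<Sum>d\<in>UNIV. hd s1 z $ d * f d b c)" for s1
  proof -
    have "(\<Sum>s2\<in>UNIV. hs s1 z $ a * (hs s2 z $ b * (\<Sum>d\<in>UNIV. hd s1 z $ d * (\<Sum>e\<in>UNIV. hd s2 z $ e * f d e c))))
      = hs s1 z $ a * (\<Sum>d\<in>UNIV. hd s1 z $ d * (\<Sum>s2\<in>UNIV. hs s2 z $ b * (\<Sum>e\<in>UNIV. hd s2 z $ e * f d e c)))"
      by (simp only: sum_2) algebra
    then show ?thesis by (simp only: resolution[OF assms])
  qed
  show ?thesis by (simp only: 1 2 resolution[OF assms])
qed

definition cnt :: "2 \<Rightarrow> 2 \<Rightarrow> 2 \<Rightarrow> nat" where
  "cnt s1 s2 s3 = (if s1 = 1 then 0 else 1) + (if s2 = 1 then 0 else 1) + (if s3 = 1 then 0 else 1)"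

lemma cnt_le: "cnt s1 s2 s3 \<le> 3" by (simp add: cnt_def)

lemma one_neq_two: "(1::2) \<noteq> 2" "(2::2) \<noteq> 1" by simp_all

lemma hlift_T: "hlift (T \<sigma> (fst z) c (hs s1 z) (hs s2 z) (hs s3 z)) = Y \<sigma> h (cnt s1 s2 s3) (\<lambda>_. c) z"
  using exhaust_2[of s1] exhaust_2[of s2] exhaust_2[of s3]
  by (elim disjE) (simp_all add: cnt_def hs_def one_neq_two Xppp_def Xp_def Xm_def Xmmm_def Xuuu_eq T_commute numeral_2_eq_2[symmetric] numeral_3_eq_3[symmetric])

text \<open>The symmetric tensor of w is expanded in the frame h_+, h_-. The sum runs over ordered
  triples, so \<open>Y m\<close> appears binom(3, m) times.\<close>

lemma horizontal_expand:
  assumes z: "z \<in> \<Omega>"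
  shows "hlift (fst w) = (\<Sum>s1\<in>UNIV. \<Sum>s2\<in>UNIV. \<Sum>s3\<in>UNIV. Y \<sigma> h (cnt s1 s2 s3) (\<lambda>_. coef s1 s2 s3 z w) z)"
proof -
  let ?t = "tvec_inv \<sigma> (fst z) (fst w)"
  have s: "?t \<in> sym_tensors" by (rule tvec_inv_sym[OF fst_\<Omega>[OF z]])
  let ?S = "\<lambda>i a b c. \<Sum>s1\<in>UNIV. \<Sum>s2\<in>UNIV. \<Sum>s3\<in>UNIV. coef s1 s2 s3 z w $ i * (hs s1 z $ a * hs s2 z $ b * hs s3 z $ c)"
  have S: "?S i a b c = ?t $ i $ a $ b $ c" for i a b c
    using contr_resolution[OF z, of "\<lambda>a b c. ?t $ i $ a $ b $ c" a b c] by (simp only: coef_def vec_lambda_beta)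
  have "(\<Sum>s1\<in>UNIV. \<Sum>s2\<in>UNIV. \<Sum>s3\<in>UNIV. tens (coef s1 s2 s3 z w) (sprod (hs s1 z) (hs s2 z) (hs s3 z))) $ i $ a $ b $ c = ?t $ i $ a $ b $ c" for i a b c
  proof -
    have "(\<Sum>s1\<in>UNIV. \<Sum>s2\<in>UNIV. \<Sum>s3\<in>UNIV. tens (coef s1 s2 s3 z w) (sprod (hs s1 z) (hs s2 z) (hs s3 z))) $ i $ a $ b $ c
       = (?S i a b c + ?S i a c b + ?S i b a c + ?S i b c a + ?S i c a b + ?S i c b a) / 6"
      unfolding sum.distrib[symmetric] sum_divide_distrib sum_component tens_def sprod_def vec_lambda_beta
      by (intro sum.cong refl) (simp add: add_divide_distrib algebra_simps)
    also have "\<dots> = ?t $ i $ a $ b $ c"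
    proof -
      have 1: "?t $ i $ a $ c $ b = ?t $ i $ a $ b $ c" by (rule sym_tensorsD(2)[OF s])
      have 2: "?t $ i $ b $ a $ c = ?t $ i $ a $ b $ c" by (rule sym_tensorsD(1)[OF s])
      have 3: "?t $ i $ b $ c $ a = ?t $ i $ a $ b $ c" by (rule trans[OF sym_tensorsD(2)[OF s] 2])
      have 4: "?t $ i $ c $ a $ b = ?t $ i $ a $ b $ c" by (rule trans[OF sym_tensorsD(1)[OF s] 1])
      have 5: "?t $ i $ c $ b $ a = ?t $ i $ a $ b $ c" by (rule trans[OF sym_tensorsD(2)[OF s] 4])
      show ?thesis unfolding S 1 2 3 4 5 by simp
    qed
    finally show ?thesis .
  qed
  then have t: "(\<Sum>s1\<in>UNIV. \<Sum>s2\<in>UNIV. \<Sum>s3\<in>UNIV. tens (coef s1 s2 s3 z w) (sprod (hs s1 z) (hs s2 z) (hs s3 z))) = ?t"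
    by (simp add: vec_eq_iff)
  have "fst w = tvec \<sigma> (fst z) ?t" by (simp add: tvec_tvec_inv[OF fst_\<Omega>[OF z]])
  also have "\<dots> = (\<Sum>s1\<in>UNIV. \<Sum>s2\<in>UNIV. \<Sum>s3\<in>UNIV. T \<sigma> (fst z) (coef s1 s2 s3 z w) (hs s1 z) (hs s2 z) (hs s3 z))"
    unfolding t[symmetric] T_def by (simp only: sum_2 tvec_add)
  finally have "hlift (fst w) = hlift (\<Sum>s1\<in>UNIV. \<Sum>s2\<in>UNIV. \<Sum>s3\<in>UNIV. T \<sigma> (fst z) (coef s1 s2 s3 z w) (hs s1 z) (hs s2 z) (hs s3 z))"
    by (rule arg_cong)
  then show ?thesis by (simp only: sum_2 hlift_linear(1) hlift_T)
qed

text \<open>Components along \<open>d0\<close>, \<open>dmm\<close> and \<open>dpp\<close> of the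
  vertical part, by Cramer's rule in the basis u_+, u_- of determinant 1.\<close>

definition v0 :: "'n hpoint \<Rightarrow> 'n hpoint \<Rightarrow> complex" where "v0 z w = uplus w $ 1 * uminus' z $ 2 - uplus w $ 2 * uminus' z $ 1"
definition vmm :: "'n hpoint \<Rightarrow> 'n hpoint \<Rightarrow> complex" where "vmm z w = uplus z $ 1 * uplus w $ 2 - uplus z $ 2 * uplus w $ 1"
definition vpp :: "'n hpoint \<Rightarrow> 'n hpoint \<Rightarrow> complex" where "vpp z w = uminus' w $ 1 * uminus' z $ 2 - uminus' w $ 2 * uminus' z $ 1"

lemma tangent_expand:
  assumes z: "z \<in> \<Omega>" and w: "tangent z w"
  shows "w = hlift (fst w) + hscale (v0 z w) (d0 z) + hscale (vmm z w) (dmm z) + hscale (vpp z w) (dpp z)"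
proof -
  have d: "uplus z $ 1 * uminus' z $ 2 - uplus z $ 2 * uminus' z $ 1 = 1" using dt_\<Omega>[OF z] by (simp add: dt_def)
  have t: "uplus w $ 1 * uminus' z $ 2 + uplus z $ 1 * uminus' w $ 2 - uplus w $ 2 * uminus' z $ 1 - uplus z $ 2 * uminus' w $ 1 = 0"
    using w by (simp add: tangent_def)
  have "uplus w $ 1 = v0 z w * uplus z $ 1 + vmm z w * uminus' z $ 1" "uplus w $ 2 = v0 z w * uplus z $ 2 + vmm z w * uminus' z $ 2"
    unfolding v0_def vmm_def using d by algebra+
  moreover have "uminus' w $ 1 = vpp z w * uplus z $ 1 - v0 z w * uminus' z $ 1" "uminus' w $ 2 = vpp z w * uplus z $ 2 - v0 z w * uminus' z $ 2"
    unfolding v0_def vpp_def using d t by algebra+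
  ultimately show ?thesis
    by (simp add: prod_eq_iff hlift_linear vertical_sel vec_eq_iff forall_2)
qed

end

context spin_domain
begin

lemma holo_hs: "holo hscale \<Omega> (\<lambda>z. hs s z $ a)"
  unfolding hs_def by (rule holo_hv_z) (cases "s = 1"; simp)

lemma holo_hd: "holo hscale \<Omega> (\<lambda>z. hd s z $ a)"
proof -
  have hh: "holo hscale \<Omega> hdet"
    unfolding hdet_def[abs_def] by (intro hs.holo_diff hs.holo_mult holo_hs)
  have *: "holo hscale \<Omega> (\<lambda>z. f z / hdet z)" if "holo hscale \<Omega> f" for f
    by (rule hs.holo_divide[OF that hh hdet_nz])
  show ?thesis
    using exhaust_2[of s] exhaust_2[of a]
    by (elim disjE) (simp_all only: hd_nth, (intro * hs.holo_minus holo_hs)+)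
qed

lemma holo_tvec_inv:
  assumes "hs.holo_fld \<Omega> W"
  shows "holo hscale \<Omega> (\<lambda>z. tvec_inv \<sigma> (fst z) (fst (W z)) $ i $ a $ b $ c)"
proof (cases "\<Omega> = {}")
  case True
  then show ?thesis by (simp add: holo_def)
next
  case False
  then obtain z0 where z0: "z0 \<in> \<Omega>" by blast
  have x0: "fst z0 \<in> M" by (rule fst_\<Omega>[OF z0])
  have "holo hscale \<Omega> (\<lambda>z. \<Sum>l\<in>UNIV. (\<Sum>k\<in>UNIV. matrix_inv (G (fst z0) (fst z)) $ l $ k * fst (W z) $ k) * \<sigma> (fst z0) $ l $ i $ a $ b $ c)"
    by (intro hs.holo_sum hs.holo_mult hs.holo_const holo_fst_M[OF vs.holo_matD[OF holo_inv_G[OF x0]]] holo_fld_coord(1)[OF assms])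
  then show ?thesis
    by (rule hs.holo_cong_imp) (simp only: tvec_inv_nth[OF x0 fst_\<Omega>])
qed

lemma holo_coef:
  assumes "hs.holo_fld \<Omega> W" shows "holo hscale \<Omega> (\<lambda>z. coef s1 s2 s3 z (W z) $ i)"
  unfolding coef_def contr_def vec_lambda_beta
  by (intro hs.holo_sum hs.holo_mult holo_hd holo_tvec_inv[OF assms])

lemma coef_linear:
  assumes z: "z \<in> \<Omega>"
  shows "coef s1 s2 s3 z (v + w) = coef s1 s2 s3 z v + coef s1 s2 s3 z w" "coef s1 s2 s3 z (hscale k w) = k *s coef s1 s2 s3 z w"
    "fst w = 0 \<Longrightarrow> coef s1 s2 s3 z w = 0"
proof -
  note x = fst_\<Omega>[OF z]
  have 1: "tvec_inv \<sigma> (fst z) (v + w) $ i $ a $ b $ c = tvec_inv \<sigma> (fst z) v $ i $ a $ b $ c + tvec_inv \<sigma> (fst z) w $ i $ a $ b $ c" for v w i a b c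
    by (simp add: tvec_inv_nth[OF x x] sum.distrib distrib_left distrib_right)
  have 2: "tvec_inv \<sigma> (fst z) (k *s w) $ i $ a $ b $ c = k * tvec_inv \<sigma> (fst z) w $ i $ a $ b $ c" for k w i a b c
    by (simp add: tvec_inv_nth[OF x x] sum_distrib_left mult_ac)
  show "coef s1 s2 s3 z (v + w) = coef s1 s2 s3 z v + coef s1 s2 s3 z w"
    by (simp add: vec_eq_iff coef_def contr_def 1 sum.distrib distrib_left)
  show s: "coef s1 s2 s3 z (hscale k w) = k *s coef s1 s2 s3 z w" for k w
    by (simp add: vec_eq_iff coef_def contr_def 2 sum_distrib_left mult_ac)
  have "tvec_inv \<sigma> (fst z) 0 $ i $ a $ b $ c = 0" for i a b c
    by (simp add: tvec_inv_nth[OF x x])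
  then show "coef s1 s2 s3 z w = 0" if "fst w = 0"
    unfolding coef_def contr_def that by (simp add: vec_eq_iff)
qed

section \<open>The coframe evaluated on the fields\<close>

definition dual :: "2 \<Rightarrow> 'n hpoint \<Rightarrow> complex^2 \<Rightarrow> complex" where "dual s z p = hd s z $ 1 * p $ 1 + hd s z $ 2 * p $ 2"

lemma dual_hs: "z \<in> \<Omega> \<Longrightarrow> dual s z (hs t z) = (if s = t then 1 else 0)"
  using exhaust_2[of s] exhaust_2[of t] hd_hs[of z] by (elim disjE) (simp_all add: dual_def)

lemma contr_prod: "contr s1 s2 s3 z (\<lambda>a b d. p $ a * q $ b * r $ d) = dual s1 z p * dual s2 z q * dual s3 z r"
  unfolding contr_def sum_2 dual_def by algebra

lemma contr_linear: "contr s1 s2 s3 z (\<lambda>a b d. f a b d + g a b d) = contr s1 s2 s3 z f + contr s1 s2 s3 z g"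
  "contr s1 s2 s3 z (\<lambda>a b d. k * f a b d) = k * contr s1 s2 s3 z f"
  by (simp_all add: contr_def sum.distrib distrib_left sum_distrib_left mult_ac)

lemma contr_sprod: "contr s1 s2 s3 z (\<lambda>a b d. k * sprod p q r $ a $ b $ d) =
  k * (1/6 * (dual s1 z p * dual s2 z q * dual s3 z r + dual s1 z p * dual s2 z r * dual s3 z q + dual s1 z q * dual s2 z p * dual s3 z r
    + dual s1 z q * dual s2 z r * dual s3 z p + dual s1 z r * dual s2 z p * dual s3 z q + dual s1 z r * dual s2 z q * dual s3 z p))"
proof -
  have "sprod p q r $ a $ b $ d = 1/6 * (p$a * q$b * r$d + p$a * r$b * q$d + q$a * p$b * r$d
                         + q$a * r$b * p$d + r$a * p$b * q$d + r$a * q$b * p$d)" for a b d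
    by (simp add: sprod_def)
  then show ?thesis by (simp only: contr_linear contr_prod)
qed

text \<open>The value 1 / binom(3, m): there are binom(3, m) triples with \<open>cnt\<close> equal
  to m, and the component of \<open>Y m\<close> is shared among them.\<close>

definition wt :: "nat \<Rightarrow> complex" where "wt m = (if m = 0 \<or> m = 3 then 1 else 1/3)"

lemma coef_hs:
  assumes z: "z \<in> \<Omega>"
  shows "coef s1 s2 s3 z (hlift (T \<sigma> (fst z) c (hs t1 z) (hs t2 z) (hs t3 z))) = (if cnt s1 s2 s3 = cnt t1 t2 t3 then wt (cnt t1 t2 t3) else 0) *s c"
proof -
  have "coef s1 s2 s3 z (hlift (T \<sigma> (fst z) c (hs t1 z) (hs t2 z) (hs t3 z))) $ i
    = contr s1 s2 s3 z (\<lambda>a b d. c $ i * sprod (hs t1 z) (hs t2 z) (hs t3 z) $ a $ b $ d)" for i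
    by (simp only: coef_def vec_lambda_beta hlift_linear T_def tvec_inv_tvec[OF fst_\<Omega>[OF z] sym_tens]) (simp add: tens_def vec_lambda_inverse)
  moreover have "contr s1 s2 s3 z (\<lambda>a b d. k * sprod (hs t1 z) (hs t2 z) (hs t3 z) $ a $ b $ d)
    = (if cnt s1 s2 s3 = cnt t1 t2 t3 then wt (cnt t1 t2 t3) else 0) * k" for k
    unfolding contr_sprod dual_hs[OF z]
    using exhaust_2[of s1] exhaust_2[of s2] exhaust_2[of s3] exhaust_2[of t1] exhaust_2[of t2] exhaust_2[of t3]
    by (elim disjE) (simp_all add: cnt_def wt_def)
  ultimately show ?thesis by (simp add: vec_eq_iff)
qed

lemma coef_Y:
  assumes z: "z \<in> \<Omega>" and m: "m \<le> 3"
  shows "coef s1 s2 s3 z (Y \<sigma> h m (\<lambda>_. c) z) = (if cnt s1 s2 s3 = m then wt m else 0) *s c"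
proof -
  obtain t1 t2 t3 where t: "cnt t1 t2 t3 = m"
  proof -
    have "cnt 1 1 1 = 0" "cnt 1 1 2 = 1" "cnt 1 2 2 = 2" "cnt 2 2 2 = 3" by (simp_all add: cnt_def)
    then show ?thesis using that m by (elim nat_le_3_cases) metis+
  qed
  show ?thesis using coef_hs[OF z, of s1 s2 s3 c t1 t2 t3] unfolding hlift_T t .
qed

text \<open>A horizontal vector keeps u fixed, so the derivative can be computed on the slice
  through z with constant u, which is an open piece of M mapped into \<Omega>.\<close>

lemma der_Y0_horizontal:
  assumes z: "z \<in> \<Omega>"
  shows "der \<Omega> (Y \<sigma> h 0 (\<lambda>_. c)) z (hlift v) = hlift (fd (Fu (uplus z) c) (fst z) v)"
proof -
  let ?f = "Y \<sigma> h 0 (\<lambda>_. c)"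
  let ?g = "\<lambda>x. (x, uplus z, uminus' z)"
  obtain O1 where O1: "open O1" "\<Omega> = harmonic_space M \<inter> O1" using \<Omega> unfolding openin_open by blast
  let ?N = "M \<inter> ?g -` O1"
  have g: "continuous_on UNIV ?g" by (intro continuous_intros)
  have N: "open ?N" by (intro open_Int M open_vimage[OF O1(1) g])
  have gz: "?g (fst z) = z" by (cases z) simp
  have zN: "fst z \<in> ?N" using z fst_\<Omega>[OF z] gz O1(2) by simp
  have gN: "?g ` ?N \<subseteq> \<Omega>"
    using dt_\<Omega>[OF z] by (auto simp: O1(2) harmonic_space_iff dt_def)
  have f: "(?f has_derivative der \<Omega> ?f z) (at z within \<Omega>)"
    using tangent_field_Y[OF sectionE_const, of 0 c] by (intro has_derivative_fld[OF _ z]) (simp only: tangent_field_iff)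
  have dg: "(?g has_derivative hlift) (at (fst z) within ?N)"
    unfolding hlift_def by (intro has_derivative_Pair has_derivative_ident has_derivative_const)
  have f': "(?f has_derivative der \<Omega> ?f z) (at (?g (fst z)) within ?g ` ?N)"
    unfolding gz by (rule has_derivative_subset[OF f gN])
  have 1: "((\<lambda>x. ?f (?g x)) has_derivative (\<lambda>v. der \<Omega> ?f z (hlift v))) (at (fst z) within ?N)"
    by (rule has_derivative_in_compose[OF dg f'])
  have e: "?f (?g x) = hlift (Fu (uplus z) c x)" for x
    by (simp add: Xppp_def Xuuu_eq Fu_def)
  have "bounded_linear (hlift :: complex^'n \<Rightarrow> 'n hpoint)"
    unfolding hlift_def by (intro bounded_linear_Pair bounded_linear_ident bounded_linear_zero)
  then have 2: "((\<lambda>x. hlift (Fu (uplus z) c x)) has_derivative (\<lambda>v. hlift (fd (Fu (uplus z) c) (fst z) v))) (at (fst z))"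
    by (rule bounded_linear.has_derivative) (rule has_derivative_Fu[OF fst_\<Omega>[OF z]])
  have 3: "((\<lambda>x. hlift (Fu (uplus z) c x)) has_derivative (\<lambda>v. der \<Omega> ?f z (hlift v))) (at (fst z))"
    using 1 unfolding e by (simp only: at_within_open[OF zN N])
  show ?thesis by (rule has_derivative_unique[OF 3 2, THEN fun_cong])
qed

lemma Y0_eq: "Y \<sigma> h 0 (\<lambda>_. c) z = hlift (Fu (uplus z) c (fst z))"
  by (simp add: Xppp_def Xuuu_eq Fu_def)

lemma bracket_Y0:
  assumes z: "z \<in> \<Omega>"
  shows "\<exists>d. bracket \<Omega> (Y \<sigma> h 0 (\<lambda>_. c)) (Y \<sigma> h 0 (\<lambda>_. c')) z = Y \<sigma> h 0 (\<lambda>_. d) z"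
proof -
  have zM: "z \<in> harmonic_space M" using z \<Omega>_sub by (rule rev_subsetD)
  obtain d where "fd (Fu (uplus z) c') (fst z) (Fu (uplus z) c (fst z)) - fd (Fu (uplus z) c) (fst z) (Fu (uplus z) c' (fst z)) = Fu (uplus z) d (fst z)"
    using involutive_Fu[OF zM refl refl, of c' c] by (elim exE)
  moreover have "hlift (v - w) = hlift v - hlift w" for v w :: "complex^'n" by (simp add: prod_eq_iff hlift_linear)
  ultimately have "bracket \<Omega> (Y \<sigma> h 0 (\<lambda>_. c)) (Y \<sigma> h 0 (\<lambda>_. c')) z = Y \<sigma> h 0 (\<lambda>_. d) z"
    unfolding bracket_def Y0_eq[of _ z] der_Y0_horizontal[OF z] by metis
  then show ?thesis by (rule exI)
qed

end

section \<open>Almost 0-partially flat connections\<close>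

locale spin_connection = spin_domain M aE aH \<omega> \<sigma> h \<Omega> + connection_on M \<Omega> A
  for M :: "(complex^'n) set" and aE :: "complex^'n \<Rightarrow> complex^'p^'p^'n" and aH \<omega>
    and \<sigma> :: "complex^'n \<Rightarrow> complex^2^2^2^'p^'n" and h :: "2 \<Rightarrow> complex^'n \<Rightarrow> complex^2" and \<Omega> :: "('n hpoint) set"
    and A :: "'n hpoint \<Rightarrow> 'n hpoint \<Rightarrow> complex^'r^'r"
begin

lemma curv_vertical_combination:
  assumes z: "z \<in> \<Omega>" and "curv z v (dpp z) = 0" "curv z v (dmm z) = 0" "curv z v (d0 z) = 0"
    and w: "tangent z w" "fst w = 0"
  shows "curv z v w = 0"
proof -
  have "curv z v (hscale (v0 z w) (d0 z) + hscale (vmm z w) (dmm z) + hscale (vpp z w) (dpp z)) = 0"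
    using z assms(2-4)
    by (simp add: curv_add_right tangent_linear tangent_vertical curv_hscale_right)
  moreover have "w = hscale (v0 z w) (d0 z) + hscale (vmm z w) (dmm z) + hscale (vpp z w) (dpp z)"
    using tangent_expand[OF z w(1)] by (simp only: w(2) hlift_linear(3) add_0)
  ultimately show ?thesis by (simp only:)
qed

text \<open>The fields \<open>Y m\<close> and the three vertical fields span the tangent space, so a
  curvature component has to be checked on them only.\<close>

lemma curv_zero_span:
  assumes z: "z \<in> \<Omega>" and vert: "curv z v (dpp z) = 0" "curv z v (dmm z) = 0" "curv z v (d0 z) = 0"
    and Y: "\<And>m c. m \<le> 3 \<Longrightarrow> curv z v (Y \<sigma> h m (\<lambda>_. c) z) = 0" and w: "tangent z w"
  shows "curv z v w = 0"
proof -
  have "curv z v (\<Sum>s1\<in>UNIV. \<Sum>s2\<in>UNIV. \<Sum>s3\<in>UNIV. Y \<sigma> h (cnt s1 s2 s3) (\<lambda>_. coef s1 s2 s3 z w) z) = 0"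
    by (simp add: sum_2 curv_add_right[OF z] tangent_linear tangent_Y Y cnt_le)
  then have h: "curv z v (hlift (fst w)) = 0" by (simp only: horizontal_expand[OF z, symmetric])
  have th: "tangent z (hlift (fst w))" by (simp add: tangent_def hlift_linear)
  have "curv z v (w - hlift (fst w)) = 0"
    by (rule curv_vertical_combination[OF z vert tangent_linear(2)[OF w th]]) (simp add: hlift_linear)
  then show ?thesis
    using curv_add_right[OF z th tangent_linear(2)[OF w th], of v] h by simp
qed

text \<open>By tensoriality a section of the dual of E may be replaced by the constant section with
  the same value at the base point.\<close>

lemma almost_flatI:
  assumes Y0: "\<And>z c c'. z \<in> \<Omega> \<Longrightarrow> curv z (Y \<sigma> h 0 (\<lambda>_. c) z) (Y \<sigma> h 0 (\<lambda>_. c') z) = 0"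
    and Yv: "\<And>z m c w. z \<in> \<Omega> \<Longrightarrow> m \<le> 2 \<Longrightarrow> tangent z w \<Longrightarrow> fst w = 0 \<Longrightarrow> curv z (Y \<sigma> h m (\<lambda>_. c) z) w = 0"
    and pp: "\<And>z w. z \<in> \<Omega> \<Longrightarrow> tangent z w \<Longrightarrow> curv z (dpp z) w = 0 \<and> curv z (d0 z) w = 0"
  shows "almost_0_partially_flat \<sigma> h \<Omega> A"
  unfolding almost_0_partially_flat_def
proof (intro conjI allI impI ballI)
  fix e e' :: "complex^'n \<Rightarrow> complex^'p" and z assume e: "sectionE (fst ` \<Omega>) e \<and> sectionE (fst ` \<Omega>) e'" and z: "z \<in> \<Omega>"
  have "curvature \<Omega> A (Y \<sigma> h 0 e) (Y \<sigma> h 0 e') z = 0"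
    unfolding curvature_eq[OF tangent_field_Y[OF conjunct1[OF e]] tangent_field_Y[OF conjunct2[OF e]] z]
      Y_eq_const[of \<sigma> h 0 e] Y_eq_const[of \<sigma> h 0 e'] by (rule Y0[OF z])
  then show "curvature \<Omega> A (Xppp \<sigma> h e) (Xppp \<sigma> h e') z = 0" by (simp only: Y_simps)
next
  fix e :: "complex^'n \<Rightarrow> complex^'p" and v z assume ev: "sectionE (fst ` \<Omega>) e \<and> vertical_field \<Omega> v" and z: "z \<in> \<Omega>"
  have v: "tangent_field \<Omega> v" "fst (v z) = 0" using ev z by (auto simp only: vertical_field_def)
  then have tv: "tangent z (v z)" using z by (simp only: tangent_field_iff)
  have *: "curvature \<Omega> A (Y \<sigma> h m e) v z = 0" if "m \<le> 2" for m
    unfolding curvature_eq[OF tangent_field_Y[OF conjunct1[OF ev]] v(1) z] Y_eq_const[of \<sigma> h m e] by (rule Yv[OF z that tv v(2)])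
  show "curvature \<Omega> A (Xppp \<sigma> h e) v z = 0" "curvature \<Omega> A (Xp \<sigma> h e) v z = 0" "curvature \<Omega> A (Xm \<sigma> h e) v z = 0"
    using *[of 0] *[of 1] *[of 2] by simp_all
next
  fix W z assume W: "tangent_field \<Omega> W" and z: "z \<in> \<Omega>"
  then have "tangent z (W z)" by (simp only: tangent_field_iff)
  then show "curvature \<Omega> A dpp W z = 0" "curvature \<Omega> A d0 W z = 0"
    using pp[OF z] by (simp_all add: curvature_eq[OF _ W z] tangent_field_vertical)
qed

text \<open>\<open>tangent_proj\<close> extends a tangent vector to a field on \<Omega>, vertical if
  the vector is; conditions on fields thus become conditions on vectors.\<close>

lemma almost_flatD:
  assumes fl: "almost_0_partially_flat \<sigma> h \<Omega> A" and z: "z \<in> \<Omega>"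
  shows "curv z (Y \<sigma> h 0 (\<lambda>_. c) z) (Y \<sigma> h 0 (\<lambda>_. c') z) = 0"
    "m \<le> 2 \<Longrightarrow> tangent z w \<Longrightarrow> fst w = 0 \<Longrightarrow> curv z (Y \<sigma> h m (\<lambda>_. c) z) w = 0"
    "tangent z w \<Longrightarrow> curv z (dpp z) w = 0" "tangent z w \<Longrightarrow> curv z (d0 z) w = 0"
proof -
  have s: "sectionE (fst ` \<Omega>) (\<lambda>_. c)" for c :: "complex^'p" by (rule sectionE_const)
  note tY = tangent_field_Y[OF s]
  have "curvature \<Omega> A (Xppp \<sigma> h (\<lambda>_. c)) (Xppp \<sigma> h (\<lambda>_. c')) z = 0"
    using fl s[of c] s[of c'] z unfolding almost_0_partially_flat_def by blast
  then show "curv z (Y \<sigma> h 0 (\<lambda>_. c) z) (Y \<sigma> h 0 (\<lambda>_. c') z) = 0"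
    using curvature_eq[OF tY tY z, of 0 c 0 c'] by simp
  have tp: "tangent_field \<Omega> (tangent_proj w)" for w by (rule tangent_field_proj) (rule dt_\<Omega>)
  show "curv z (Y \<sigma> h m (\<lambda>_. c) z) w = 0" if m: "m \<le> 2" and w: "tangent z w" "fst w = 0"
  proof -
    have vf: "vertical_field \<Omega> (tangent_proj w)" using tp[of w] w(2) by (simp add: vertical_field_def tangent_proj_def Drho_def)
    have "curvature \<Omega> A (Xppp \<sigma> h (\<lambda>_. c)) (tangent_proj w) z = 0 \<and> curvature \<Omega> A (Xp \<sigma> h (\<lambda>_. c)) (tangent_proj w) z = 0
       \<and> curvature \<Omega> A (Xm \<sigma> h (\<lambda>_. c)) (tangent_proj w) z = 0"
      using fl s[of c] vf z unfolding almost_0_partially_flat_def by blast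
    moreover have "m = 0 \<or> m = 1 \<or> m = 2" using m by linarith
    ultimately have "curvature \<Omega> A (Y \<sigma> h m (\<lambda>_. c)) (tangent_proj w) z = 0" by (elim disjE) simp_all
    then show ?thesis
      using curvature_eq[OF tY tp z, of m c w] by (simp only: tangent_proj_tangent[OF dt_\<Omega>[OF z] w(1)])
  qed
  have "curvature \<Omega> A dpp (tangent_proj w) z = 0 \<and> curvature \<Omega> A d0 (tangent_proj w) z = 0"
    using fl tp[of w] z unfolding almost_0_partially_flat_def by blast
  then show "tangent z w \<Longrightarrow> curv z (dpp z) w = 0" "tangent z w \<Longrightarrow> curv z (d0 z) w = 0"
    using curvature_eq[OF tangent_field_vertical(1) tp z, of w] curvature_eq[OF tangent_field_vertical(3) tp z, of w]
    by (simp_all add: tangent_proj_tangent[OF dt_\<Omega>[OF z]])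
qed

lemma A_scaleR: "z \<in> \<Omega> \<Longrightarrow> tangent z w \<Longrightarrow> A z (r *\<^sub>R w) = r *\<^sub>R A z w"
  using A_hscale[of z w "of_real r"] by (simp add: hs.sc_of_real mat_of_real)

text \<open>The formulas for the potentials are F(\<open>dmm\<close>, \<open>Y m\<close>) = 0 for m
  = 0, 1, 2, solved for the value of A on the bracket (3 - m) \<open>Y (m+1)\<close>. For m = 0 the
  vanishing of A on \<open>Y 0\<close> leaves only the derivative of \<open>Amm\<close>.\<close>

lemma has_potentialsI:
  assumes \<Phi>: "frame \<Omega> \<Phi>"
    and vert: "\<And>z. z \<in> \<Omega> \<Longrightarrow> A z (dpp z) = App z \<and> A z (dmm z) = Amm \<Omega> \<Phi> z \<and> A z (d0 z) = 0"
    and Y0: "\<And>z c. z \<in> \<Omega> \<Longrightarrow> A z (Y \<sigma> h 0 (\<lambda>_. c) z) = 0"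
    and flat: "\<And>z m c. z \<in> \<Omega> \<Longrightarrow> m < 3 \<Longrightarrow> curv z (dmm z) (Y \<sigma> h m (\<lambda>_. c) z) = 0"
  shows "has_potentials \<sigma> h \<Omega> App \<Phi> A"
proof -
  have eq: "real (3 - m) *\<^sub>R A z (Y \<sigma> h (Suc m) e z) = der \<Omega> (\<lambda>y. A y (Y \<sigma> h m e y)) z (dmm z)
      - der \<Omega> (Amm \<Omega> \<Phi>) z (Y \<sigma> h m e z) + comm (Amm \<Omega> \<Phi> z) (A z (Y \<sigma> h m e z))"
    if e: "sectionE (fst ` \<Omega>) e" and z: "z \<in> \<Omega>" and m: "m < 3" for e z m
  proof -
    have "curvature \<Omega> A dmm (Y \<sigma> h m e) z = 0"
      unfolding curvature_eq[OF tangent_field_vertical(2) tangent_field_Y[OF e] z] Y_eq_const[of \<sigma> h m e] by (rule flat[OF z m])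
    moreover have "der \<Omega> (\<lambda>y. A y (dmm y)) z (Y \<sigma> h m e z) = der \<Omega> (Amm \<Omega> \<Phi>) z (Y \<sigma> h m e z)"
      by (rule der_cong_mat[OF A_holo[OF tangent_field_vertical(2)] _ z tangent_Y]) (simp add: vert)
    moreover have "A z (bracket \<Omega> dmm (Y \<sigma> h m e) z) = real (3 - m) *\<^sub>R A z (Y \<sigma> h (Suc m) e z)"
      using m by (simp add: bracket_Y(1)[OF e z] A_scaleR[OF z tangent_Y])
    moreover have "a - b + k - d = 0 \<Longrightarrow> d = a - b + k" for a b k d :: "complex^'r^'r" by simp
    moreover have "A z (dmm z) = Amm \<Omega> \<Phi> z" using vert[OF z] by (elim conjE)
    ultimately show ?thesis unfolding curvature_def by (metis (no_types))
  qed
  have Y0e: "A z (Xppp \<sigma> h e z) = 0" if "z \<in> \<Omega>" for e z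
    using Y0[OF that, of "e (fst z)"] Y_eq_const[of \<sigma> h 0 e z] by simp
  have half: "real (3 - 1) = 2" "real (3 - 2) = 1" "real (3 - 0) = 3" by simp_all
  have Ysuc: "Y \<sigma> h (Suc 1) = Xm \<sigma> h" "Y \<sigma> h (Suc 2) = Xmmm \<sigma> h" by (simp_all add: Y_def fun_eq_iff)
  have r: "3 *\<^sub>R X = Z \<Longrightarrow> X = (1/3) *\<^sub>R Z" "2 *\<^sub>R X = Z \<Longrightarrow> X = (1/2) *\<^sub>R Z" for X Z :: "complex^'r^'r"
    by (erule subst, simp)+
  show ?thesis
    unfolding has_potentials_def
  proof (intro conjI allI impI ballI)
    fix z assume z: "z \<in> \<Omega>"
    show "A z (dpp z) = App z" "A z (dmm z) = Amm \<Omega> \<Phi> z" "A z (d0 z) = 0" using vert[OF z] by simp_all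
    fix e :: "complex^'n \<Rightarrow> complex^'p" assume e: "sectionE (fst ` \<Omega>) e"
    show "A z (Xppp \<sigma> h e z) = 0" by (rule Y0e[OF z])
    have "der \<Omega> (\<lambda>y. A y (Xppp \<sigma> h e y)) z (dmm z) = 0"
      by (rule der_zero[OF Y0e z tangent_vertical(2)])
    then show "A z (Xp \<sigma> h e z) = - ((1/3) *\<^sub>R der \<Omega> (Amm \<Omega> \<Phi>) z (Xppp \<sigma> h e z))"
      using r(1)[OF eq[OF e z zero_less_numeral, unfolded half Y_simps]] by (simp add: Y0e[OF z] comm_simps(7))
    have m: "(1::nat) < 3" "(2::nat) < 3" by simp_all
    show "A z (Xm \<sigma> h e z) = (1/2) *\<^sub>R (der \<Omega> (\<lambda>y. A y (Xp \<sigma> h e y)) z (dmm z)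
             - der \<Omega> (Amm \<Omega> \<Phi>) z (Xp \<sigma> h e z) + comm (Amm \<Omega> \<Phi> z) (A z (Xp \<sigma> h e z)))"
      by (rule r(2)[OF eq[OF e z m(1), unfolded half Ysuc Y_simps]])
    show "A z (Xmmm \<sigma> h e z) = der \<Omega> (\<lambda>y. A y (Xm \<sigma> h e y)) z (dmm z)
             - der \<Omega> (Amm \<Omega> \<Phi>) z (Xm \<sigma> h e z) + comm (Amm \<Omega> \<Phi> z) (A z (Xm \<sigma> h e z))"
      by (rule eq[OF e z m(2), unfolded half Ysuc Y_simps scaleR_one])
  qed
qed

end

section \<open>The connection of a pair\<close>

locale bridge = spin_domain M aE aH \<omega> \<sigma> h \<Omega>
  for M :: "(complex^'n) set" and aE :: "complex^'n \<Rightarrow> complex^'p^'p^'n" and aH \<omega>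
    and \<sigma> :: "complex^'n \<Rightarrow> complex^2^2^2^'p^'n" and h :: "2 \<Rightarrow> complex^'n \<Rightarrow> complex^2" and \<Omega> :: "('n hpoint) set" +
  fixes App \<Phi> :: "'n hpoint \<Rightarrow> complex^'r^'r"
  assumes App: "holo_mat hscale \<Omega> App" and \<Phi>: "holo_mat hscale \<Omega> \<Phi>" and \<Phi>_inv: "z \<in> \<Omega> \<Longrightarrow> invertible (\<Phi> z)"
    and App_Y0: "z \<in> \<Omega> \<Longrightarrow> der \<Omega> App z (Y \<sigma> h 0 (\<lambda>_. c) z) = 0"
    and \<Phi>_dpp: "z \<in> \<Omega> \<Longrightarrow> der \<Omega> \<Phi> z (dpp z) = - (App z ** \<Phi> z)" and \<Phi>_d0: "z \<in> \<Omega> \<Longrightarrow> der \<Omega> \<Phi> z (d0 z) = 0"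
begin

definition gi :: "'n hpoint \<Rightarrow> complex^'r^'r" where "gi z = matrix_inv (\<Phi> z)"

lemma holo_gi: "holo_mat hscale \<Omega> gi"
  unfolding gi_def[abs_def] by (rule hs.holo_matrix_inv[OF \<Phi> \<Phi>_inv])

lemma \<Phi>_gi: "z \<in> \<Omega> \<Longrightarrow> \<Phi> z ** gi z = mat 1" "z \<in> \<Omega> \<Longrightarrow> gi z ** \<Phi> z = mat 1"
  using matrix_inv_right[OF \<Phi>_inv] matrix_inv_left[OF \<Phi>_inv] by (simp_all add: gi_def)

lemma \<Phi>_cancel: "z \<in> \<Omega> \<Longrightarrow> \<Phi> z ** P = \<Phi> z ** Q \<Longrightarrow> P = Q" for P Q :: "complex^'r^'r"
  using \<Phi>_gi(2) by (metis matrix_mul_assoc matrix_mul_lid)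

text \<open>Values on \<open>Y m\<close> of the connection in the gauge \<Phi>, where it vanishes on
  vertical vectors. \<open>Bv 0\<close> is forced by A(\<open>Xppp\<close>) = 0 in the analytic
  frame, and F(\<open>dmm\<close>, \<open>Y m\<close>) = 0 forces each next one.\<close>

primrec Bv :: "nat \<Rightarrow> complex^'p \<Rightarrow> 'n hpoint \<Rightarrow> complex^'r^'r" where
  "Bv 0 c = (\<lambda>z. gi z ** der \<Omega> \<Phi> z (Y \<sigma> h 0 (\<lambda>_. c) z))"
| "Bv (Suc m) c = (\<lambda>z. (1 / real (3 - m)) *\<^sub>R der \<Omega> (Bv m c) z (dmm z))"

lemma holo_Bv: "holo_mat hscale \<Omega> (Bv m c)"
proof (induction m)
  case 0
  show ?case unfolding Bv.simps(1) by (rule hs.holo_mat_mult[OF holo_gi holo_mat_der[OF \<Phi> tangent_field_Y[OF sectionE_const]]])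
next
  case (Suc m)
  show ?case unfolding Bv.simps(2) by (rule hs.holo_mat_scaleR[OF holo_mat_der[OF Suc tangent_field_vertical(2)]])
qed

lemma \<Phi>_B0: "z \<in> \<Omega> \<Longrightarrow> \<Phi> z ** Bv 0 c z = der \<Omega> \<Phi> z (Y \<sigma> h 0 (\<lambda>_. c) z)"
  by (simp only: Bv.simps(1) matrix_mul_assoc \<Phi>_gi matrix_mul_lid)

lemma der_mat_const:
  fixes f :: "'n hpoint \<Rightarrow> complex^'r^'r"
  assumes f: "holo_mat hscale \<Omega> f" and z: "z \<in> \<Omega>" and w: "tangent z w"
  shows "der \<Omega> (\<lambda>y. mat k ** f y) z w = mat k ** der \<Omega> f z w"
  by (simp add: der_mult[OF hs.holo_mat_const f z w] der_const[OF z w])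

lemma Bv_linear: "z \<in> \<Omega> \<Longrightarrow> Bv m (c + d) z = Bv m c z + Bv m d z" "z \<in> \<Omega> \<Longrightarrow> Bv m (k *s c) z = mat k ** Bv m c z"
proof (induction m arbitrary: z)
  case 0
  {
    case 1
    show ?case unfolding Bv.simps(1) Y_linear(1) der_linear(1)[OF \<Phi> 1] by (rule mm.add_right)
  next
    case 2
    show ?case unfolding Bv.simps(1) Y_linear(2) der_hscale[OF \<Phi> 2 tangent_Y] by (rule mult_mat_left)
  }
next
  case (Suc m)
  {
    case 1
    have "der \<Omega> (Bv m (c + d)) z (dmm z) = der \<Omega> (\<lambda>y. Bv m c y + Bv m d y) z (dmm z)"
      by (rule der_cong_mat[OF holo_Bv Suc(1) 1 tangent_vertical(2)])
    then show ?case
      unfolding Bv.simps(2) by (simp only: der_add[OF holo_Bv holo_Bv 1 tangent_vertical(2)] scaleR_add_right)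
  next
    case 2
    have "der \<Omega> (Bv m (k *s c)) z (dmm z) = der \<Omega> (\<lambda>y. mat k ** Bv m c y) z (dmm z)"
      by (rule der_cong_mat[OF holo_Bv Suc(2) 2 tangent_vertical(2)])
    then show ?case
      unfolding Bv.simps(2) by (simp only: der_mat_const[OF holo_Bv 2 tangent_vertical(2)] mm.scaleR_right)
  }
qed

lemma Bv_expand:
  assumes z: "z \<in> \<Omega>" shows "(\<Sum>i\<in>UNIV. mat (c $ i) ** Bv m (axis i 1) z) = Bv m c z"
proof -
  have 0: "Bv m 0 z = 0" using Bv_linear(1)[OF z, of m 0 0] by simp
  have "Bv m (\<Sum>i\<in>I. c $ i *s axis i 1) z = (\<Sum>i\<in>I. mat (c $ i) ** Bv m (axis i 1) z)" if "finite I" for I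
    using that by (induction I) (simp_all add: 0 Bv_linear[OF z] del: Bv.simps)
  from this[of UNIV, OF finite] show ?thesis by (simp only: basis_expansion)
qed

lemma der_Bv_dmm: "m < 3 \<Longrightarrow> der \<Omega> (Bv m c) z (dmm z) = real (3 - m) *\<^sub>R Bv (Suc m) c z"
  by simp

text \<open>The \<open>Bv m\<close> arise by \<open>dmm\<close> from a vector of weight 3
  annihilated by \<open>dpp\<close>; the induction is the standard computation for a highest weight
  vector of sl_2, with the commutators supplied by \<open>der_bracket\<close>.\<close>

lemma der_Bv_d0_dpp:
  assumes "m \<le> 3" "z \<in> \<Omega>"
  shows "der \<Omega> (Bv m c) z (d0 z) = (3 - 2 * real m) *\<^sub>R Bv m c z \<and> der \<Omega> (Bv m c) z (dpp z) = real m *\<^sub>R Bv (m - 1) c z"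
  using assms
proof (induction m arbitrary: z)
  case 0
  let ?Y = "Y \<sigma> h 0 (\<lambda>_. c)" and ?D = "\<lambda>y. der \<Omega> \<Phi> y (Y \<sigma> h 0 (\<lambda>_. c) y)"
  note z = 0(2) and e = sectionE_const[of "fst ` \<Omega>" c]
  note tY = tangent_field_Y[OF e, of 0]
  have step: "\<Phi> z ** der \<Omega> (Bv 0 c) z v + der \<Omega> \<Phi> z v ** Bv 0 c z = der \<Omega> ?D z v" if v: "tangent z v" for v
  proof -
    have "der \<Omega> (\<lambda>y. \<Phi> y ** Bv 0 c y) z v = der \<Omega> ?D z v"
      by (rule der_cong_mat[OF hs.holo_mat_mult[OF \<Phi> holo_Bv] \<Phi>_B0 z v])
    then show ?thesis by (simp only: der_mult[OF \<Phi> holo_Bv z v])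
  qed
  have "der \<Omega> (\<lambda>y. der \<Omega> \<Phi> y (d0 y)) z (?Y z) = 0" by (rule der_zero[OF \<Phi>_d0 z tangent_Y])
  then have "der \<Omega> ?D z (d0 z) = der \<Omega> \<Phi> z (3 *\<^sub>R ?Y z)"
    using der_bracket[OF \<Phi> tangent_field_vertical(3) tY z] bracket_Y(3)[OF e z, of 0] by simp
  also have "\<dots> = 3 *\<^sub>R ?D z"
    using der_hscale[OF \<Phi> z tangent_Y, of 3 \<sigma> h 0 "\<lambda>_. c"] hs.sc_of_real[of 3 "?Y z"] mat_of_real[of 3 "?D z"] by simp
  finally have "\<Phi> z ** der \<Omega> (Bv 0 c) z (d0 z) = \<Phi> z ** (3 *\<^sub>R Bv 0 c z)"
    using step[OF tangent_vertical(3)] by (simp only: \<Phi>_d0[OF z] mm.zero_left add_0_right mm.scaleR_right \<Phi>_B0[OF z])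
  then have 1: "der \<Omega> (Bv 0 c) z (d0 z) = 3 *\<^sub>R Bv 0 c z" by (rule \<Phi>_cancel[OF z])
  \<comment> \<open>The prepotential enters here: \<open>App\<close> is constant along
    \<open>Xppp\<close>, so differentiating the equation of \<Phi> along \<open>Xppp\<close> leaves
    \<open>App\<close> undifferentiated, and \<open>dpp\<close> commutes with
    \<open>Xppp\<close>.\<close>
  have "der \<Omega> (\<lambda>y. der \<Omega> \<Phi> y (dpp y)) z (?Y z) = der \<Omega> (\<lambda>y. - (App y ** \<Phi> y)) z (?Y z)"
    by (rule der_cong_mat[OF holo_mat_der[OF \<Phi> tangent_field_vertical(1)] \<Phi>_dpp z tangent_Y])
  also have "\<dots> = - (App z ** ?D z)"
    by (simp only: der_minus[OF hs.holo_mat_mult[OF App \<Phi>] z tangent_Y] der_mult[OF App \<Phi> z tangent_Y] App_Y0[OF z] mm.zero_left add_0_right)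
  finally have "der \<Omega> ?D z (dpp z) = - (App z ** ?D z)"
    using der_bracket[OF \<Phi> tangent_field_vertical(1) tY z] bracket_Y(2)[OF e z, of 0]
    by (simp add: der_linear(3)[OF \<Phi> z] eq_neg_iff_add_eq_0)
  then have "\<Phi> z ** der \<Omega> (Bv 0 c) z (dpp z) = \<Phi> z ** 0"
    using step[OF tangent_vertical(1)]
    by (simp add: \<Phi>_dpp[OF z] mm_simps matrix_mul_assoc[symmetric] \<Phi>_B0[OF z] del: Bv.simps)
  then have "der \<Omega> (Bv 0 c) z (dpp z) = 0" by (rule \<Phi>_cancel[OF z])
  with 1 show ?case by (simp del: Bv.simps)
next
  case (Suc m)
  note z = Suc.prems(2)
  have m: "m < 3" "m \<le> 3" using Suc.prems(1) by simp_all
  let ?f = "Bv m c" and ?P = "\<lambda>y. der \<Omega> (Bv m c) y (dmm y)"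
  have P: "?P y = real (3 - m) *\<^sub>R Bv (Suc m) c y" for y by (rule der_Bv_dmm[OF m(1)])
  have dS: "der \<Omega> (Bv (Suc m) c) z w = (1 / real (3 - m)) *\<^sub>R der \<Omega> ?P z w" if "tangent z w" for w
    unfolding Bv.simps(2) by (rule der_scaleR[OF holo_mat_der[OF holo_Bv tangent_field_vertical(2)] z that])
  have dsc: "der \<Omega> ?f z (r *\<^sub>R w) = r *\<^sub>R der \<Omega> ?f z w" if "tangent z w" for r w
    using der_hscale[OF holo_Bv z that, of m c "of_real r"] by (simp only: hs.sc_of_real mat_of_real)
  have "der \<Omega> (\<lambda>y. der \<Omega> ?f y (d0 y)) z (dmm z) = der \<Omega> (\<lambda>y. (3 - 2 * real m) *\<^sub>R ?f y) z (dmm z)"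
    by (rule der_cong_mat[OF holo_mat_der[OF holo_Bv tangent_field_vertical(3)] _ z tangent_vertical(2)]) (rule conjunct1[OF Suc.IH[OF m(2)]])
  also have "\<dots> = (3 - 2 * real m) *\<^sub>R ?P z" by (rule der_scaleR[OF holo_Bv z tangent_vertical(2)])
  finally have "der \<Omega> ?P z (d0 z) = (3 - 2 * real m) *\<^sub>R ?P z + der \<Omega> ?f z (- (2 *\<^sub>R dmm z))"
    using der_bracket[OF holo_Bv tangent_field_vertical(3) tangent_field_vertical(2) z, of m c] by (simp only: bracket_vertical(3)[OF z] diff_eq_eq add.commute)
  also have "\<dots> = (3 - 2 * real m) *\<^sub>R ?P z - 2 *\<^sub>R ?P z"
    by (simp only: der_linear(4)[OF holo_Bv z] dsc[OF tangent_vertical(2)] diff_conv_add_uminus)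
  also have "\<dots> = (3 - 2 * real (Suc m)) *\<^sub>R ?P z"
    unfolding scaleR_left_diff_distrib[symmetric] by (rule arg_cong[where f = "\<lambda>r. r *\<^sub>R ?P z"]) simp
  finally have 1: "der \<Omega> (Bv (Suc m) c) z (d0 z) = (3 - 2 * real (Suc m)) *\<^sub>R Bv (Suc m) c z"
    unfolding dS[OF tangent_vertical(3)] by (simp add: mult_ac)
  have IH2: "der \<Omega> ?f y (dpp y) = real m *\<^sub>R Bv (m - 1) c y" if "y \<in> \<Omega>" for y
    using conjunct2[OF Suc.IH[OF m(2) that]] .
  have "der \<Omega> (\<lambda>y. der \<Omega> ?f y (dpp y)) z (dmm z) = der \<Omega> (\<lambda>y. real m *\<^sub>R Bv (m - 1) c y) z (dmm z)"
    by (rule der_cong_mat[OF holo_mat_der[OF holo_Bv tangent_field_vertical(1)] IH2 z tangent_vertical(2)])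
  also have "\<dots> = real m *\<^sub>R der \<Omega> (Bv (m - 1) c) z (dmm z)" by (rule der_scaleR[OF holo_Bv z tangent_vertical(2)])
  \<comment> \<open>Lowering and raising again gives m (3 - (m - 1)) = m (4 - m).\<close>
  also have "\<dots> = (real m * (4 - real m)) *\<^sub>R ?f z"
  proof (cases m)
    case (Suc k)
    then show ?thesis using m by (simp add: der_Bv_dmm of_nat_diff del: Bv.simps)
  qed simp
  finally have "der \<Omega> ?P z (dpp z) = (real m * (4 - real m)) *\<^sub>R ?f z + der \<Omega> ?f z (d0 z)"
    using der_bracket[OF holo_Bv tangent_field_vertical(1) tangent_field_vertical(2) z, of m c]
    by (simp only: bracket_vertical(1)[OF z] diff_eq_eq add.commute)
  \<comment> \<open>The bracket adds the weight 3 - 2 m, and m (4 - m) + (3 - 2 m) = (3 - m) (m +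
    1).\<close>
  also have "\<dots> = (real (3 - m) * real (Suc m)) *\<^sub>R ?f z"
    unfolding conjunct1[OF Suc.IH[OF m(2) z]] scaleR_left_distrib[symmetric]
    by (rule arg_cong[where f = "\<lambda>r. r *\<^sub>R ?f z"]) (use m in \<open>simp add: of_nat_diff algebra_simps\<close>)
  finally have "der \<Omega> (Bv (Suc m) c) z (dpp z) = real (Suc m) *\<^sub>R ?f z"
    unfolding dS[OF tangent_vertical(1)] using m by simp
  with 1 show ?case by (simp del: Bv.simps)
qed

text \<open>The form with value \<open>Bv m\<close> on \<open>Y m\<close> and 0 on vertical vectors.
  Writing it with the holomorphic coframe makes its holomorphy visible.\<close>

definition AB :: "'n hpoint \<Rightarrow> 'n hpoint \<Rightarrow> complex^'r^'r" where
  "AB z w = (\<Sum>s1\<in>UNIV. \<Sum>s2\<in>UNIV. \<Sum>s3\<in>UNIV. \<Sum>i\<in>UNIV. mat (coef s1 s2 s3 z w $ i) ** Bv (cnt s1 s2 s3) (axis i 1) z)"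

lemma connection_AB: "connection \<Omega> AB"
  unfolding connection_def
proof (intro conjI ballI allI impI)
  fix z v w assume z: "z \<in> \<Omega>"
  show "AB z (v + w) = AB z v + AB z w"
    by (simp only: AB_def coef_linear(1)[OF z] vector_add_component mat_simps(1) sum.distrib)
  show "AB z (hscale c w) = mat c ** AB z w" for c
    by (simp only: AB_def coef_linear(2)[OF z] vector_smult_component mat_simps(3) mm.sum_right)
next
  fix W assume "tangent_field \<Omega> W"
  then have W: "hs.holo_fld \<Omega> W" by (simp only: tangent_field_iff)
  show "holo_mat hscale \<Omega> (\<lambda>z. AB z (W z))"
    unfolding AB_def by (intro hs.holo_mat_sum hs.holo_mat_smult holo_coef[OF W] holo_Bv)
qed

lemma AB_vertical: "z \<in> \<Omega> \<Longrightarrow> fst w = 0 \<Longrightarrow> AB z w = 0"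
  by (simp add: AB_def coef_linear(3) mat_0 mm.zero_left)

lemma AB_Y:
  assumes z: "z \<in> \<Omega>" and m: "m \<le> 3" shows "AB z (Y \<sigma> h m (\<lambda>_. c) z) = Bv m c z"
proof -
  let ?k = "\<lambda>s1 s2 s3. if cnt s1 s2 s3 = m then wt m else 0"
  have "AB z (Y \<sigma> h m (\<lambda>_. c) z) = (\<Sum>s1\<in>UNIV. \<Sum>s2\<in>UNIV. \<Sum>s3\<in>UNIV. mat (?k s1 s2 s3) ** Bv (cnt s1 s2 s3) c z)"
    by (simp only: AB_def coef_Y[OF z m] Bv_expand[OF z] Bv_linear(2)[OF z])
  also have "\<dots> = (\<Sum>s1\<in>UNIV. \<Sum>s2\<in>UNIV. \<Sum>s3\<in>UNIV. mat (?k s1 s2 s3) ** Bv m c z)"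
    by (intro sum.cong refl) (simp add: mat_0 mm.zero_left del: Bv.simps)
  also have "\<dots> = mat (\<Sum>s1\<in>UNIV. \<Sum>s2\<in>UNIV. \<Sum>s3\<in>UNIV. ?k s1 s2 s3) ** Bv m c z"
    by (simp only: sum_2 mat_simps(1))
  \<comment> \<open>Each m occurs for binom(3, m) triples, which the weight \<open>wt m\<close>
    compensates.\<close>
  also have "(\<Sum>s1\<in>UNIV. \<Sum>s2\<in>UNIV. \<Sum>s3\<in>UNIV. ?k s1 s2 s3) = 1"
    using m by (elim nat_le_3_cases) (simp_all add: sum_2 cnt_def wt_def)
  finally show ?thesis by simp
qed

sublocale B: spin_connection M aE aH \<omega> \<sigma> h \<Omega> AB
  by unfold_locales (rule connection_AB)

text \<open>The form vanishes along vertical fields, so the curvature is V applied to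
  \<open>Bv m\<close> minus the form on the bracket; each vanishing becomes one relation of the
  representation.\<close>

lemma curv_vertical_Y:
  assumes z: "z \<in> \<Omega>" and m: "m \<le> 3" and V: "tangent_field \<Omega> V" "\<And>y. fst (V y) = 0"
  shows "B.curv z (V z) (Y \<sigma> h m (\<lambda>_. c) z) = der \<Omega> (Bv m c) z (V z) - AB z (bracket \<Omega> V (Y \<sigma> h m (\<lambda>_. c)) z)"
proof -
  note tY = tangent_field_Y[OF sectionE_const, of m c]
  have 1: "der \<Omega> (\<lambda>y. AB y (Y \<sigma> h m (\<lambda>_. c) y)) z (V z) = der \<Omega> (Bv m c) z (V z)"
    by (rule der_cong_mat[OF B.A_holo[OF tY] AB_Y[OF _ m] z bspec[OF conjunct1[OF V(1)[unfolded tangent_field_iff]] z]])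
  have 2: "der \<Omega> (\<lambda>y. AB y (V y)) z (Y \<sigma> h m (\<lambda>_. c) z) = 0"
    by (rule der_zero[OF AB_vertical[OF _ V(2)] z tangent_Y])
  show ?thesis
    unfolding B.curvature_eq[OF V(1) tY z, symmetric] curvature_def 1 2 AB_vertical[OF z V(2)]
    by (simp add: comm_simps(6))
qed

lemma curv_vertical:
  assumes z: "z \<in> \<Omega>" and V: "tangent_field \<Omega> V" "\<And>y. fst (V y) = 0" and W: "tangent_field \<Omega> W" "\<And>y. fst (W y) = 0"
    and b: "fst (bracket \<Omega> V W z) = 0"
  shows "B.curv z (V z) (W z) = 0"
proof -
  have t: "tangent z (X z)" if "tangent_field \<Omega> X" for X
    by (rule bspec[OF conjunct1[OF that[unfolded tangent_field_iff]] z])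
  have 1: "der \<Omega> (\<lambda>y. AB y (W y)) z (V z) = 0" by (rule der_zero[OF AB_vertical[OF _ W(2)] z t[OF V(1)]])
  have 2: "der \<Omega> (\<lambda>y. AB y (V y)) z (W z) = 0" by (rule der_zero[OF AB_vertical[OF _ V(2)] z t[OF W(1)]])
  show ?thesis
    unfolding B.curvature_eq[OF V(1) W(1) z, symmetric] curvature_def 1 2 AB_vertical[OF z V(2)] AB_vertical[OF z b]
    by (simp add: comm_simps(6))
qed

text \<open>With \<open>dmm\<close> nothing is claimed for m = 3: F(\<open>dmm\<close>,
  \<open>Xmmm\<close>) is not among the components that an almost 0-partially flat connection has to
  kill.\<close>

lemma curv_AB:
  assumes z: "z \<in> \<Omega>" and m: "m \<le> 3"
  shows "B.curv z (dpp z) (Y \<sigma> h m (\<lambda>_. c) z) = 0" "B.curv z (d0 z) (Y \<sigma> h m (\<lambda>_. c) z) = 0"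
    "m < 3 \<Longrightarrow> B.curv z (dmm z) (Y \<sigma> h m (\<lambda>_. c) z) = 0"
proof -
  note e = sectionE_const[of "fst ` \<Omega>" c]
  have m1: "m - 1 \<le> 3" using m by simp
  show "B.curv z (dpp z) (Y \<sigma> h m (\<lambda>_. c) z) = 0"
    unfolding curv_vertical_Y[OF z m tangent_field_vertical(1) vertical_sel(1)] bracket_Y(2)[OF e z m]
      B.A_scaleR[OF z tangent_Y] AB_Y[OF z m1] conjunct2[OF der_Bv_d0_dpp[OF m z]] by (rule diff_self)
  show "B.curv z (d0 z) (Y \<sigma> h m (\<lambda>_. c) z) = 0"
    unfolding curv_vertical_Y[OF z m tangent_field_vertical(3) vertical_sel(7)] bracket_Y(3)[OF e z m]
      B.A_scaleR[OF z tangent_Y] AB_Y[OF z m] conjunct1[OF der_Bv_d0_dpp[OF m z]] by (rule diff_self)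
  show "B.curv z (dmm z) (Y \<sigma> h m (\<lambda>_. c) z) = 0" if "m < 3"
  proof -
    have m2: "Suc m \<le> 3" using that by simp
    show ?thesis
      unfolding curv_vertical_Y[OF z m tangent_field_vertical(2) vertical_sel(4)] bracket_Y(1)[OF e z m that]
        B.A_scaleR[OF z tangent_Y] AB_Y[OF z m2] der_Bv_dmm[OF that] by (rule diff_self)
  qed
qed

lemma curv_AB_vertical:
  assumes z: "z \<in> \<Omega>"
  shows "B.curv z (dpp z) (dpp z) = 0" "B.curv z (dpp z) (dmm z) = 0" "B.curv z (dpp z) (d0 z) = 0"
    "B.curv z (d0 z) (dpp z) = 0" "B.curv z (d0 z) (dmm z) = 0" "B.curv z (d0 z) (d0 z) = 0"
proof -
  note v = tangent_field_vertical(1) vertical_sel(1) and w = tangent_field_vertical(2) vertical_sel(4) and u = tangent_field_vertical(3) vertical_sel(7)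
  have self: "fst (bracket \<Omega> X X z) = 0" for X by (simp add: bracket_def)
  have s: "fst (r *\<^sub>R y) = 0" if "fst y = 0" for r and y :: "'n hpoint" using that by simp
  show "B.curv z (dpp z) (dpp z) = 0" by (rule curv_vertical[OF z v v self])
  show "B.curv z (dpp z) (dmm z) = 0" by (rule curv_vertical[OF z v w]) (simp add: bracket_vertical[OF z] vertical_sel)
  show 1: "B.curv z (d0 z) (dpp z) = 0" by (rule curv_vertical[OF z u v]) (simp add: bracket_vertical[OF z] vertical_sel)
  show "B.curv z (d0 z) (dmm z) = 0" by (rule curv_vertical[OF z u w]) (simp add: bracket_vertical[OF z] vertical_sel)
  show "B.curv z (d0 z) (d0 z) = 0" by (rule curv_vertical[OF z u u self])
  show "B.curv z (dpp z) (d0 z) = 0" using 1 B.curv_antisym[of z "dpp z" "d0 z"] by simp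
qed

text \<open>Along D_{3+} the form is \<Phi>^{-1} d\<Phi>, which is flat. Integrability enters
  through \<open>bracket_Y0\<close>: the form must have this shape on the bracket as well.\<close>

lemma curv_AB_Y0: 
  assumes z: "z \<in> \<Omega>" shows "B.curv z (Y \<sigma> h 0 (\<lambda>_. c) z) (Y \<sigma> h 0 (\<lambda>_. c') z) = 0"
proof -
  let ?Y = "\<lambda>c. Y \<sigma> h 0 (\<lambda>_. c)"
  let ?D = "\<lambda>c y. der \<Omega> \<Phi> y (Y \<sigma> h 0 (\<lambda>_. c) y)"
  note tY = tangent_field_Y[OF sectionE_const, of 0]
  obtain d where d: "bracket \<Omega> (?Y c) (?Y c') z = ?Y d z" using bracket_Y0[OF z, of c c'] by (elim exE)
  have der: "\<Phi> z ** der \<Omega> (\<lambda>y. AB y (?Y c' y)) z (?Y c z) = der \<Omega> (?D c') z (?Y c z) - ?D c z ** Bv 0 c' z" for c c'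
  proof -
    have 1: "der \<Omega> (\<lambda>y. AB y (?Y c' y)) z (?Y c z) = der \<Omega> (Bv 0 c') z (?Y c z)"
      by (rule der_cong_mat[OF B.A_holo[OF tY] AB_Y[OF _ le0] z tangent_Y])
    have "der \<Omega> (\<lambda>y. \<Phi> y ** Bv 0 c' y) z (?Y c z) = der \<Omega> (?D c') z (?Y c z)"
      by (rule der_cong_mat[OF hs.holo_mat_mult[OF \<Phi> holo_Bv] \<Phi>_B0 z tangent_Y])
    then show ?thesis unfolding 1 der_mult[OF \<Phi> holo_Bv z tangent_Y] by (simp only: eq_diff_eq)
  qed
  have "\<Phi> z ** B.curv z (?Y c z) (?Y c' z) = \<Phi> z ** 0"
    unfolding B.curvature_eq[OF tY tY z, symmetric] curvature_def comm_def mm_simps der d AB_Y[OF z le0] matrix_mul_assoc \<Phi>_B0[OF z]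
    using der_bracket[OF \<Phi> tY tY z, of c' c] by (simp add: d[unfolded Y_simps] del: Bv.simps)
  then show ?thesis by (rule \<Phi>_cancel[OF z])
qed

lemma gi_frame: "frame \<Omega> gi"
  unfolding frame_def invertible_def using holo_gi \<Phi>_gi by blast

text \<open>The way back from the gauge \<Phi> to the analytic frame, by the inverse
  \<open>gi\<close> of \<Phi>.\<close>

definition A :: "'n hpoint \<Rightarrow> 'n hpoint \<Rightarrow> complex^'r^'r" where "A = potential \<Omega> gi AB"

lemma connection_A: "connection \<Omega> A"
  unfolding A_def by (rule B.connection_potential[OF gi_frame])

sublocale A: spin_connection M aE aH \<omega> \<sigma> h \<Omega> A
  by unfold_locales (rule connection_A)

lemma curv_A: "z \<in> \<Omega> \<Longrightarrow> tangent z v \<Longrightarrow> tangent z w \<Longrightarrow> B.curv z v w = 0 \<Longrightarrow> A.curv z v w = 0"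
  unfolding A_def by (rule B.curv_potential_zero[OF gi_frame])

lemma A_eq:
  assumes z: "z \<in> \<Omega>" and w: "tangent z w"
  shows "A z w = \<Phi> z ** AB z w ** gi z - der \<Omega> \<Phi> z w ** gi z"
proof -
  have "\<Phi> z ** (gi z ** A z w) = \<Phi> z ** (AB z w ** gi z + der \<Omega> gi z w)"
    unfolding A_def by (simp only: B.potential_eq[OF gi_frame z])
  then have 1: "A z w = \<Phi> z ** AB z w ** gi z + \<Phi> z ** der \<Omega> gi z w"
    by (simp only: matrix_mul_assoc \<Phi>_gi[OF z] matrix_mul_lid mm.add_right)
  have "der \<Omega> (\<lambda>y. \<Phi> y ** gi y) z w = der \<Omega> (\<lambda>_. mat 1) z w"
    by (rule der_cong_mat[OF hs.holo_mat_mult[OF \<Phi> holo_gi] \<Phi>_gi(1) z w])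
  then have "\<Phi> z ** der \<Omega> gi z w + der \<Omega> \<Phi> z w ** gi z = 0"
    by (simp only: der_mult[OF \<Phi> holo_gi z w] der_const[OF z w])
  then have "\<Phi> z ** der \<Omega> gi z w = - (der \<Omega> \<Phi> z w ** gi z)" by (simp only: eq_neg_iff_add_eq_0)
  then show ?thesis by (simp only: 1 diff_conv_add_uminus)
qed

lemma A_values:
  assumes z: "z \<in> \<Omega>"
  shows "A z (dpp z) = App z" "A z (dmm z) = Amm \<Omega> \<Phi> z" "A z (d0 z) = 0" "A z (Y \<sigma> h 0 (\<lambda>_. c) z) = 0"
proof -
  note v = AB_vertical[OF z vertical_sel(1)] AB_vertical[OF z vertical_sel(4)] AB_vertical[OF z vertical_sel(7)]
  show "A z (dpp z) = App z"
    unfolding A_eq[OF z tangent_vertical(1)] v \<Phi>_dpp[OF z]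
    by (simp add: mm_simps matrix_mul_assoc[symmetric] \<Phi>_gi[OF z])
  show "A z (dmm z) = Amm \<Omega> \<Phi> z"
    unfolding A_eq[OF z tangent_vertical(2)] v Amm_def gi_def by (simp add: mm_simps)
  show "A z (d0 z) = 0"
    unfolding A_eq[OF z tangent_vertical(3)] v \<Phi>_d0[OF z] by (simp add: mm_simps)
  show "A z (Y \<sigma> h 0 (\<lambda>_. c) z) = 0"
    unfolding A_eq[OF z tangent_Y] AB_Y[OF z le0] \<Phi>_B0[OF z] by (rule diff_self)
qed

lemma almost_flat_A: "almost_0_partially_flat \<sigma> h \<Omega> A"
proof (rule A.almost_flatI)
  fix z assume z: "z \<in> \<Omega>"
  show "A.curv z (Y \<sigma> h 0 (\<lambda>_. c) z) (Y \<sigma> h 0 (\<lambda>_. c') z) = 0" for c c'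
    by (rule curv_A[OF z tangent_Y tangent_Y curv_AB_Y0[OF z]])
  show "A.curv z (dpp z) w = 0 \<and> A.curv z (d0 z) w = 0" if w: "tangent z w" for w
    by (intro conjI curv_A[OF z _ w] tangent_vertical B.curv_zero_span[OF z _ _ _ _ w] curv_AB[OF z] curv_AB_vertical[OF z])
  show "A.curv z (Y \<sigma> h m (\<lambda>_. c) z) w = 0" if m: "m \<le> 2" and w: "tangent z w" "fst w = 0" for m c w
  proof (rule curv_A[OF z tangent_Y w(1)], rule B.curv_vertical_combination[OF z _ _ _ w])
    have m: "m \<le> 3" "m < 3" using m by simp_all
    show "B.curv z (Y \<sigma> h m (\<lambda>_. c) z) (dpp z) = 0" unfolding B.curv_antisym[of z _ "dpp z"] curv_AB(1)[OF z m(1)] by (rule minus_zero)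
    show "B.curv z (Y \<sigma> h m (\<lambda>_. c) z) (dmm z) = 0" unfolding B.curv_antisym[of z _ "dmm z"] curv_AB(3)[OF z m] by (rule minus_zero)
    show "B.curv z (Y \<sigma> h m (\<lambda>_. c) z) (d0 z) = 0" unfolding B.curv_antisym[of z _ "d0 z"] curv_AB(2)[OF z m(1)] by (rule minus_zero)
  qed
qed

lemma has_potentials_A: "has_potentials \<sigma> h \<Omega> App \<Phi> A"
proof (rule A.has_potentialsI)
  show "frame \<Omega> \<Phi>" using \<Phi> \<Phi>_inv by (simp add: frame_def)
  show "z \<in> \<Omega> \<Longrightarrow> A z (dpp z) = App z \<and> A z (dmm z) = Amm \<Omega> \<Phi> z \<and> A z (d0 z) = 0" for z
    by (intro conjI A_values)
  show "A.curv z (dmm z) (Y \<sigma> h m (\<lambda>_. c) z) = 0" if "z \<in> \<Omega>" "m < 3" for z m c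
    by (rule curv_A[OF that(1) tangent_vertical(2) tangent_Y curv_AB(3)[OF that(1) less_imp_le[OF that(2)] that(2)]])
qed (rule A_values)

lemma analytic_frame_A: "analytic_frame \<sigma> h \<Omega> A (\<lambda>_. mat 1)"
proof -
  have 1: "A z (Xppp \<sigma> h e z) = 0" if "z \<in> \<Omega>" for e z
    using A_values(4)[OF that, of "e (fst z)"] Y_eq_const[of \<sigma> h 0 e z] by simp
  have "frame \<Omega> (\<lambda>_. mat 1 :: complex^'r^'r)"
    unfolding frame_def invertible_def using hs.holo_mat_const matrix_mul_lid by blast
  moreover have "tangent z (Xppp \<sigma> h e z)" for e z using tangent_Y[of z \<sigma> h 0 e] by simp
  ultimately show ?thesis
    unfolding analytic_frame_def by (simp add: der_const tangent_vertical A_values(3) 1)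
qed

end

text \<open>The formulas determine the form recursively on \<open>Y 0\<close> to \<open>Y 3\<close>
  and directly on the vertical fields, and these span the tangent space. Each stage differentiates
  the previous potential, so agreement is carried along on all of \<Omega>.\<close>

lemma (in spin_domain) potentials_unique:
  fixes A A' :: "'n hpoint \<Rightarrow> 'n hpoint \<Rightarrow> complex^'r^'r"
  assumes c: "connection \<Omega> A" "connection \<Omega> A'" and p: "has_potentials \<sigma> h \<Omega> App \<Phi> A" "has_potentials \<sigma> h \<Omega> App \<Phi> A'"
    and z: "z \<in> \<Omega>" and w: "tangent z w"
  shows "A' z w = A z w"
proof -
  interpret A: connection_on M \<Omega> A by unfold_locales (rule c(1))
  interpret A': connection_on M \<Omega> A' by unfold_locales (rule c(2))
  note s = sectionE_const[of "fst ` \<Omega>"]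
  have v: "A' z (dpp z) = A z (dpp z)" "A' z (dmm z) = A z (dmm z)" "A' z (d0 z) = A z (d0 z)"
    using p z unfolding has_potentials_def by metis+
  have dm: "der \<Omega> (\<lambda>y. A' y (Y \<sigma> h m (\<lambda>_. c) y)) z (dmm z) = der \<Omega> (\<lambda>y. A y (Y \<sigma> h m (\<lambda>_. c) y)) z (dmm z)"
    if "\<And>z. z \<in> \<Omega> \<Longrightarrow> A' z (Y \<sigma> h m (\<lambda>_. c) z) = A z (Y \<sigma> h m (\<lambda>_. c) z)" "z \<in> \<Omega>" for m c z
    by (rule der_cong_mat[OF A'.A_holo[OF tangent_field_Y[OF s]] that tangent_vertical(2)])
  have Y01: "B z (Xppp \<sigma> h (\<lambda>_. c) z) = 0 \<and> B z (Xp \<sigma> h (\<lambda>_. c) z) = - ((1/3) *\<^sub>R der \<Omega> (Amm \<Omega> \<Phi>) z (Xppp \<sigma> h (\<lambda>_. c) z))"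
    if "has_potentials \<sigma> h \<Omega> App \<Phi> B" "z \<in> \<Omega>" for B c z using that s[of c] unfolding has_potentials_def by blast
  have Y0: "A' z (Y \<sigma> h 0 (\<lambda>_. c) z) = A z (Y \<sigma> h 0 (\<lambda>_. c) z)" if "z \<in> \<Omega>" for z c
    using Y01[OF p(1) that, of c] Y01[OF p(2) that, of c] unfolding Y_simps by (simp only:)
  have Y1: "A' z (Y \<sigma> h 1 (\<lambda>_. c) z) = A z (Y \<sigma> h 1 (\<lambda>_. c) z)" if "z \<in> \<Omega>" for z c
    using Y01[OF p(1) that, of c] Y01[OF p(2) that, of c] unfolding Y_simps by (simp only:)
  have Y2: "A' z (Y \<sigma> h 2 (\<lambda>_. c) z) = A z (Y \<sigma> h 2 (\<lambda>_. c) z)" if z: "z \<in> \<Omega>" for z c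
  proof -
    have "B z (Xm \<sigma> h (\<lambda>_. c) z) = (1/2) *\<^sub>R (der \<Omega> (\<lambda>y. B y (Xp \<sigma> h (\<lambda>_. c) y)) z (dmm z)
             - der \<Omega> (Amm \<Omega> \<Phi>) z (Xp \<sigma> h (\<lambda>_. c) z) + comm (Amm \<Omega> \<Phi> z) (B z (Xp \<sigma> h (\<lambda>_. c) z)))"
      if "has_potentials \<sigma> h \<Omega> App \<Phi> B" for B using that s[of c] z unfolding has_potentials_def by blast
    from this[OF p(1)] this[OF p(2)] show ?thesis
      using dm[of 1 c, OF Y1 z] Y1[OF z, of c] unfolding Y_simps by (simp only:)
  qed
  have Y3: "A' z (Y \<sigma> h 3 (\<lambda>_. c) z) = A z (Y \<sigma> h 3 (\<lambda>_. c) z)" for c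
  proof -
    have "B z (Xmmm \<sigma> h (\<lambda>_. c) z) = der \<Omega> (\<lambda>y. B y (Xm \<sigma> h (\<lambda>_. c) y)) z (dmm z)
             - der \<Omega> (Amm \<Omega> \<Phi>) z (Xm \<sigma> h (\<lambda>_. c) z) + comm (Amm \<Omega> \<Phi> z) (B z (Xm \<sigma> h (\<lambda>_. c) z))"
      if "has_potentials \<sigma> h \<Omega> App \<Phi> B" for B using that s[of c] z unfolding has_potentials_def by blast
    from this[OF p(1)] this[OF p(2)] show ?thesis
      using dm[of 2 c, OF Y2 z] Y2[OF z, of c] unfolding Y_simps by (simp only:)
  qed
  have Y: "A' z (Y \<sigma> h m (\<lambda>_. c) z) = A z (Y \<sigma> h m (\<lambda>_. c) z)" if "m \<le> 3" for m c
    using that Y0[OF z] Y1[OF z] Y2[OF z] Y3 by (elim nat_le_3_cases) (simp_all only:)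
  have th: "tangent z (hlift (fst w))" by (simp add: tangent_def hlift_linear)
  have t: "tangent z (hlift (fst w))" "tangent z (hscale k (d0 z))" "tangent z (hscale k (dmm z))" "tangent z (hscale k (dpp z))" for k
    by (rule th) (intro tangent_linear tangent_vertical)+
  have H: "A' z (hlift (fst w)) = A z (hlift (fst w))"
    unfolding horizontal_expand[OF z]
    by (simp only: sum_2 A.A_add[OF z] A'.A_add[OF z] tangent_linear tangent_Y Y[OF cnt_le])
  let ?w = "hlift (fst w) + hscale (v0 z w) (d0 z) + hscale (vmm z w) (dmm z) + hscale (vpp z w) (dpp z)"
  have "A' z ?w = A z ?w"
    by (simp only: A.A_add[OF z] A'.A_add[OF z] tangent_linear t A.A_hscale[OF z] A'.A_hscale[OF z] tangent_vertical v H)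
  then show ?thesis by (simp only: tangent_expand[OF z w, symmetric])
qed

section \<open>Local frames parallel along an involutive family\<close>

context connection_on
begin

text \<open>A right inverse of \<open>Drho z\<close> on the tangent vectors at \<open>rho z\<close>,
  with values tangent to the level set of \<open>dt\<close> through z. Lifted fields keep their
  bracket relations, so an involutive family on \<Omega> becomes one on the open set
  \<open>ext\<close>.\<close>

definition lift :: "'n hpoint \<Rightarrow> 'n hpoint \<Rightarrow> 'n hpoint" where
  "lift z w = (fst w, uplus w, dt z *s uminus' w)"

lemma lift_linear: "lift z (v - w) = lift z v - lift z w" "lift z (hscale k w) = hscale k (lift z w)" "lift z 0 = 0"
  "lift z (v + w) = lift z v + lift z w"
  by (simp_all add: lift_def prod_eq_iff vec_eq_iff algebra_simps)

lemma lift_sum: "lift z (\<Sum>i\<in>I. f i) = (\<Sum>i\<in>I. lift z (f i))"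
  by (induction I rule: infinite_finite_induct) (simp_all add: lift_linear)

lemma lift_1: "dt z = 1 \<Longrightarrow> lift z w = w"
  by (simp add: lift_def prod_eq_iff)

lemma ddt_lift:
  assumes "dt z \<noteq> 0" "tangent (rho z) w" shows "ddt z (lift z w) = 0"
proof -
  have "uminus' z = dt z *s uminus' (rho z)" using assms(1) by (simp add: rho_def vec_eq_iff)
  then have u: "uminus' z $ a = dt z * uminus' (rho z) $ a" for a by (metis vector_smult_component)
  have "ddt z (lift z w) = dt z * ddt (rho z) w"
    unfolding ddt_def lift_def u by (simp add: rho_def algebra_simps)
  then show ?thesis using assms(2) by (simp add: tangent_iff)
qed

lemma Drho_lift:
  assumes "dt z \<noteq> 0" "tangent (rho z) w" shows "Drho z (lift z w) = w"
  unfolding Drho_def ddt_lift[OF assms] using assms(1) by (simp add: lift_def prod_eq_iff vec_eq_iff)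

lemma fd_lift:
  assumes X: "hs.holo_fld \<Omega> X" and z: "z \<in> ext" and w: "tangent (rho z) w"
  shows "fd (\<lambda>y. lift y (X (rho y))) z (lift z w) = lift z (der \<Omega> X (rho z) w)"
proof -
  have d: "((\<lambda>y. X (rho y)) has_derivative (\<lambda>w. der \<Omega> X (rho z) (Drho z w))) (at z)"
    by (rule has_derivative_comp_rho[OF has_derivative_fld[OF X rho_ext(2)[OF z]] z])
  have b: "bounded_bilinear ((*s) :: complex \<Rightarrow> complex^2 \<Rightarrow> complex^2)" by (rule vs.bounded_bilinear_sc)
  have D: "((\<lambda>y. lift y (X (rho y))) has_derivative (\<lambda>w. (fst (der \<Omega> X (rho z) (Drho z w)), uplus (der \<Omega> X (rho z) (Drho z w)),
      dt z *s uminus' (der \<Omega> X (rho z) (Drho z w)) + ddt z w *s uminus' (X (rho z))))) (at z)"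
    unfolding lift_def
    by (intro has_derivative_Pair bounded_bilinear.FDERIV[OF b] has_derivative_dt has_derivative_fst has_derivative_snd d)
  show ?thesis
    unfolding fd_eqI[OF D] ddt_lift[OF rho_ext(3)[OF z] w] Drho_lift[OF rho_ext(3)[OF z] w] by (simp add: lift_def)
qed

lemma holo_fld_lift:
  assumes X: "hs.holo_fld \<Omega> X" shows "hs.holo_fld ext (\<lambda>y. lift y (X (rho y)))"
  by (rule holo_fldI) (simp_all add: lift_def holo_fld_coord[OF holo_fld_comp_rho[OF X]] hs.holo_mult holo_dt)

text \<open>The Frobenius theorem for connections, carried to harmonic space: the lifted family is
  an \<open>involutive_frame\<close> on \<open>ext\<close>, and the parallel frame is restricted to
  \<Omega>, where the lift is the identity.\<close>

lemma local_parallel_frame: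
  fixes Z :: "'q::finite \<Rightarrow> 'n hpoint \<Rightarrow> 'n hpoint" and \<pi> :: "'q \<Rightarrow> 'n hpoint \<Rightarrow> complex"
  assumes z0: "z0 \<in> \<Omega>" and Z: "\<And>i. tangent_field \<Omega> (Z i)"
    and lin: "\<And>i. bounded_linear (\<pi> i)" and sc: "\<And>i k w. \<pi> i (hscale k w) = k * \<pi> i w"
    and dual: "\<And>i j. \<pi> i (Z j z0) = (if i = j then 1 else 0)"
    and inv: "\<And>z i j. z \<in> \<Omega> \<Longrightarrow> \<exists>c. bracket \<Omega> (Z i) (Z j) z = (\<Sum>m\<in>UNIV. hscale (c m) (Z m z))"
    and flat: "\<And>z i j. z \<in> \<Omega> \<Longrightarrow> curv z (Z i z) (Z j z) = 0"
  shows "\<exists>\<Omega>' \<psi>. z0 \<in> \<Omega>' \<and> \<Omega>' \<subseteq> \<Omega> \<and> openin (top_of_set (harmonic_space M)) \<Omega>' \<and> frame \<Omega>' \<psi> \<and>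
    (\<forall>z\<in>\<Omega>'. \<forall>i. der \<Omega>' \<psi> z (Z i z) + A z (Z i z) ** \<psi> z = 0)"
proof -
  have Zh: "hs.holo_fld \<Omega> (Z i)" and Zt: "z \<in> \<Omega> \<Longrightarrow> tangent z (Z i z)" for i z
    using Z[of i] unfolding tangent_field_iff by simp_all
  let ?Y = "\<lambda>i z. lift z (Z i (rho z))" and ?b = "\<lambda>i z. A (rho z) (Z i (rho z))"
  have fdb: "fd (?b j) z (?Y i z) = der \<Omega> (\<lambda>y. A y (Z j y)) (rho z) (Z i (rho z))" if z: "z \<in> ext" for i j z
  proof -
    have "fd (?b j) z (?Y i z) = der \<Omega> (\<lambda>y. A y (Z j y)) (rho z) (Drho z (?Y i z))"
      by (rule fd_eqI[OF has_derivative_comp_rho[OF has_derivative_holo_mat[OF A_holo[OF Z] rho_ext(2)[OF z]] z]])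
    then show ?thesis by (simp only: Drho_lift[OF rho_ext(3)[OF z] Zt[OF rho_ext(2)[OF z]]])
  qed
  interpret F: involutive_frame hscale ext z0 ?Y \<pi> ?b
  proof (rule involutive_frame.intro, rule hs.complex_scaling_axioms, rule involutive_frame_axioms.intro)
    show "open ext" by (rule open_ext)
    show "z0 \<in> ext" using z0 \<Omega>_ext by (rule rev_subsetD)
    show "hs.holo_fld ext (?Y i)" for i by (rule holo_fld_lift[OF Zh])
    show "bounded_linear (\<pi> i)" for i by (rule lin)
    show "\<pi> i (hscale k w) = k * \<pi> i w" for i k w by (rule sc)
    have "(\<chi> i j. \<pi> i (?Y j z0)) = mat 1"
      by (simp only: rho_fixed[OF dt_\<Omega>[OF z0]] lift_1[OF dt_\<Omega>[OF z0]] dual mat_def)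
    then show "det (\<chi> i j. \<pi> i (?Y j z0)) \<noteq> 0" by simp
    show "holo_mat hscale ext (?b i)" for i by (rule holo_mat_comp_rho[OF A_holo[OF Z]])
    show "\<exists>c. fd (?Y j) z (?Y i z) - fd (?Y i) z (?Y j z) = (\<Sum>m\<in>UNIV. hscale (c m) (?Y m z)) \<and>
        fd (?b j) z (?Y i z) - fd (?b i) z (?Y j z) + (?b i z ** ?b j z - ?b j z ** ?b i z) = (\<Sum>m\<in>UNIV. mat (c m) ** ?b m z)"
      if z: "z \<in> ext" for i j z
    proof -
      note r = rho_ext(2)[OF z]
      obtain c where c: "bracket \<Omega> (Z i) (Z j) (rho z) = (\<Sum>m\<in>UNIV. hscale (c m) (Z m (rho z)))"
        using inv[OF r, of i j] by (elim exE)
      have 1: "fd (?Y j) z (?Y i z) - fd (?Y i) z (?Y j z) = (\<Sum>m\<in>UNIV. hscale (c m) (?Y m z))"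
        unfolding fd_lift[OF Zh z Zt[OF r]] lift_linear(1)[symmetric] bracket_def[symmetric] c lift_sum lift_linear(2) ..
      have "curvature \<Omega> A (Z i) (Z j) (rho z) = 0"
        unfolding curvature_eq[OF Z Z r] by (rule flat[OF r])
      then have "fd (?b j) z (?Y i z) - fd (?b i) z (?Y j z) + (?b i z ** ?b j z - ?b j z ** ?b i z) = A (rho z) (bracket \<Omega> (Z i) (Z j) (rho z))"
        unfolding fdb[OF z] curvature_def comm_def by (simp only: right_minus_eq)
      also have "\<dots> = (\<Sum>m\<in>UNIV. mat (c m) ** ?b m z)"
        unfolding c by (simp only: A_sum[OF r tangent_linear(3)[OF Zt[OF r]]] A_hscale[OF r Zt[OF r]])
      finally show ?thesis using 1 by (intro exI[of _ c] conjI)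
    qed
  qed
  have "\<exists>N (\<Psi> :: 'n hpoint \<Rightarrow> complex^'r^'r). open N \<and> z0 \<in> N \<and> N \<subseteq> ext \<and> holo_mat hscale N \<Psi> \<and> (\<forall>z\<in>N. invertible (\<Psi> z)) \<and>
    (\<forall>z\<in>N. \<forall>i. fd \<Psi> z (?Y i z) + ?b i z ** \<Psi> z = 0)"
  proof (rule F.parallel_frame)
    fix N and \<Psi> :: "'n hpoint \<Rightarrow> complex^'r^'r"
    assume a: "open N" "z0 \<in> N" "N \<subseteq> ext" "holo_mat hscale N \<Psi>" "\<And>z. z \<in> N \<Longrightarrow> invertible (\<Psi> z)"
      "\<And>z i. z \<in> N \<Longrightarrow> fd \<Psi> z (?Y i z) + ?b i z ** \<Psi> z = 0"
    show "\<exists>N (\<Psi> :: 'n hpoint \<Rightarrow> complex^'r^'r). open N \<and> z0 \<in> N \<and> N \<subseteq> ext \<and> holo_mat hscale N \<Psi> \<and> (\<forall>z\<in>N. invertible (\<Psi> z)) \<and>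
      (\<forall>z\<in>N. \<forall>i. fd \<Psi> z (?Y i z) + ?b i z ** \<Psi> z = 0)" by (intro exI[of _ N] exI[of _ \<Psi>] conjI ballI allI a)
  qed
  then obtain N and \<Psi> :: "'n hpoint \<Rightarrow> complex^'r^'r" where N: "open N" "z0 \<in> N" "N \<subseteq> ext" and \<Psi>: "holo_mat hscale N \<Psi>" "\<forall>z\<in>N. invertible (\<Psi> z)"
    "\<forall>z\<in>N. \<forall>i. fd \<Psi> z (?Y i z) + ?b i z ** \<Psi> z = 0"
    by blast
  have op: "openin (top_of_set (harmonic_space M)) (\<Omega> \<inter> N)" by (rule openin_Int_open[OF \<Omega> N(1)])
  interpret R: harmonic_domain M "\<Omega> \<inter> N" by unfold_locales (rule M, rule op)
  have "frame (\<Omega> \<inter> N) \<Psi>" using \<Psi>(2) hs.holo_mat_subset[OF \<Psi>(1), of "\<Omega> \<inter> N"] by (simp add: frame_def)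
  moreover have "der (\<Omega> \<inter> N) \<Psi> z (Z i z) + A z (Z i z) ** \<Psi> z = 0" if z: "z \<in> \<Omega> \<inter> N" for z i
  proof -
    note zz = IntD1[OF z] IntD2[OF z]
    have "der (\<Omega> \<inter> N) \<Psi> z (Z i z) = fd \<Psi> z (Z i z)"
      by (rule R.der_eqI[OF has_derivative_at_withinI[OF hs.holo_matD_fd(1)[OF \<Psi>(1) N(1) zz(2)]] z Zt[OF zz(1)]])
    then show ?thesis
      using spec[OF bspec[OF \<Psi>(3) zz(2)], of i] by (simp only: rho_fixed[OF dt_\<Omega>[OF zz(1)]] lift_1[OF dt_\<Omega>[OF zz(1)]])
  qed
  ultimately show ?thesis
    by (intro exI[of _ "\<Omega> \<inter> N"] exI[of _ \<Psi>] conjI ballI allI IntI z0 N(2) Int_lower1 op)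
qed

lemma curv_restrict:
  assumes sub: "harmonic_domain M \<Omega>'" "\<Omega>' \<subseteq> \<Omega>" and z: "z \<in> \<Omega>'" and t: "tangent z v" "tangent z w"
  shows "connection_on.curv \<Omega>' A z v w = curv z v w"
proof -
  interpret R: harmonic_domain M \<Omega>' by (rule sub(1))
  interpret R: connection_on M \<Omega>' A by unfold_locales (rule connection_restrict[OF sub])
  have tf: "tangent_field \<Omega>' (tangent_proj v)" for v by (rule tangent_field_proj[OF R.dt_\<Omega>])
  show ?thesis
    unfolding R.curv_curvature[OF z t] curvature_eq_curv[OF sub tf tf z]
      tangent_proj_tangent[OF R.dt_\<Omega>[OF z] t(1)] tangent_proj_tangent[OF R.dt_\<Omega>[OF z] t(2)] ..
qed

end

context spin_connection
begin

lemma Y0_expand: "Y \<sigma> h 0 (\<lambda>_. d) z = (\<Sum>i\<in>UNIV. hscale (d $ i) (Y \<sigma> h 0 (\<lambda>_. axis i 1) z))"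
proof -
  have 0: "Y \<sigma> h 0 (\<lambda>_. 0) z = 0" using Y_linear(1)[of \<sigma> h 0 0 0 z] by simp
  have "Y \<sigma> h 0 (\<lambda>_. \<Sum>i\<in>I. d $ i *s axis i 1) z = (\<Sum>i\<in>I. hscale (d $ i) (Y \<sigma> h 0 (\<lambda>_. axis i 1) z))" if "finite I" for I
    using that
  proof (induction I)
    case empty
    show ?case unfolding sum.empty by (rule 0)
  next
    case (insert i I)
    then show ?case by (simp only: sum.insert not_False_eq_True Y_linear)
  qed
  from this[of UNIV, OF finite] show ?thesis by (simp only: basis_expansion)
qed

lemma spin_connection_restrict:
  assumes "harmonic_domain M \<Omega>'" "\<Omega>' \<subseteq> \<Omega>" shows "spin_connection M aE aH \<omega> \<sigma> h \<Omega>' A"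
proof -
  interpret R: harmonic_domain M \<Omega>' by (rule assms(1))
  show ?thesis by unfold_locales (rule connection_restrict[OF assms])
qed

lemma almost_flat_restrict:
  assumes fl: "almost_0_partially_flat \<sigma> h \<Omega> A" and sub: "harmonic_domain M \<Omega>'" "\<Omega>' \<subseteq> \<Omega>"
  shows "almost_0_partially_flat \<sigma> h \<Omega>' A"
proof -
  interpret R: spin_connection M aE aH \<omega> \<sigma> h \<Omega>' A by (rule spin_connection_restrict[OF sub])
  show ?thesis
  proof (rule R.almost_flatI)
    fix z assume z: "z \<in> \<Omega>'"
    note r = curv_restrict[OF sub z] and zW = subsetD[OF sub(2) z]
    show "R.curv z (Y \<sigma> h 0 (\<lambda>_. c) z) (Y \<sigma> h 0 (\<lambda>_. c') z) = 0" for c c'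
      unfolding r[OF tangent_Y tangent_Y] by (rule almost_flatD(1)[OF fl zW])
    show "R.curv z (Y \<sigma> h m (\<lambda>_. c) z) w = 0" if "m \<le> 2" "tangent z w" "fst w = 0" for m c w
      unfolding r[OF tangent_Y that(2)] by (rule almost_flatD(2)[OF fl zW that])
    show "R.curv z (dpp z) w = 0 \<and> R.curv z (d0 z) w = 0" if "tangent z w" for w
      unfolding r[OF tangent_vertical(1) that] r[OF tangent_vertical(3) that]
      by (intro conjI almost_flatD(3,4)[OF fl zW that])
  qed
qed

text \<open>The distribution spanned by D_{3+} and \<open>d0\<close> is involutive, by
  0-admissibility and the weight relation with \<open>d0\<close>, and the curvature vanishes on it;
  so parallel frames exist.\<close>

lemma local_analytic_frame:
  assumes fl: "almost_0_partially_flat \<sigma> h \<Omega> A" and z0: "z0 \<in> \<Omega>"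
  shows "\<exists>\<Omega>' \<psi>. z0 \<in> \<Omega>' \<and> \<Omega>' \<subseteq> \<Omega> \<and> openin (top_of_set (harmonic_space M)) \<Omega>' \<and> analytic_frame \<sigma> h \<Omega>' A \<psi>"
proof -
  \<comment> \<open>The type \<open>'p option\<close> indexes the frame: \<open>None\<close> stands
    for \<open>d0\<close> and \<open>Some i\<close> for the i-th constant basis section.\<close>
  define Z :: "'p option \<Rightarrow> 'n hpoint \<Rightarrow> 'n hpoint" where
    "Z i = (case i of None \<Rightarrow> d0 | Some i \<Rightarrow> Y \<sigma> h 0 (\<lambda>_. axis i 1))" for i
  \<comment> \<open>Constant functionals, obtained by freezing the coframe at z0; duality with the
    frame is required at z0 only.\<close>
  define \<pi> :: "'p option \<Rightarrow> 'n hpoint \<Rightarrow> complex" where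
    "\<pi> i w = (case i of None \<Rightarrow> v0 z0 w | Some i \<Rightarrow> coef 1 1 1 z0 w $ i)" for i w
  have Z_simps: "Z None = d0" "Z (Some i) = Y \<sigma> h 0 (\<lambda>_. axis i 1)" for i by (simp_all add: Z_def del: Y_simps)
  have bl: "bounded_linear f" if "\<And>v w. f (v + w) = f v + f w" "\<And>k w. f (hscale k w) = k * f w" for f :: "'n hpoint \<Rightarrow> complex"
    by (rule linear_conv_bounded_linear[THEN iffD1], rule linearI)
      (use that hs.sc_of_real in \<open>simp_all add: scaleR_conv_of_real flip: hs.sc_of_real\<close>)
  have \<pi>: "\<pi> i (v + w) = \<pi> i v + \<pi> i w" "\<pi> i (hscale k w) = k * \<pi> i w" for i v w k
    by (simp_all add: \<pi>_def v0_def coef_linear[OF z0] algebra_simps split: option.split)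
  have span: "\<exists>c. Y \<sigma> h 0 (\<lambda>_. d) z = (\<Sum>m\<in>UNIV. hscale (c m) (Z m z))" for d z
  proof
    show "Y \<sigma> h 0 (\<lambda>_. d) z = (\<Sum>m\<in>UNIV. hscale (case_option 0 (($) d) m) (Z m z))"
      unfolding UNIV_option_conv
      by (simp add: sum.reindex Z_simps Y0_expand[of d] prod_eq_iff del: Y_simps)
  qed
  have br: "\<exists>d. bracket \<Omega> (Z i) (Z j) z = Y \<sigma> h 0 (\<lambda>_. d) z" if z: "z \<in> \<Omega>" for i j z
  proof -
    note e = sectionE_const
    have s: "3 *\<^sub>R Y \<sigma> h 0 (\<lambda>_. d) z = Y \<sigma> h 0 (\<lambda>_. 3 *s d) z" for d
      using hs.sc_of_real[of 3 "Y \<sigma> h 0 (\<lambda>_. d) z"] by (simp only: Y_linear(2) of_real_numeral)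
    have b: "bracket \<Omega> d0 (Y \<sigma> h 0 (\<lambda>_. d)) z = Y \<sigma> h 0 (\<lambda>_. 3 *s d) z" for d
      using bracket_Y(3)[OF e z le0, of d] s[of d] by simp
    have n: "- Y \<sigma> h 0 (\<lambda>_. d) z = Y \<sigma> h 0 (\<lambda>_. - d) z" for d
      using Y_linear(1)[of \<sigma> h 0 d "- d" z] Y_linear(1)[of \<sigma> h 0 0 0 z] by (intro minus_unique) simp
    have a: "bracket \<Omega> X W z = - bracket \<Omega> W X z" for X W by (simp add: bracket_def)
    show ?thesis
    proof (cases i; cases j)
      assume "i = None" "j = None"
      then show ?thesis using Y_linear(1)[of \<sigma> h 0 0 0 z] by (intro exI[of _ 0]) (simp add: bracket_def Z_simps)
    next
      fix l assume "i = None" "j = Some l"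
      then show ?thesis by (intro exI) (simp only: Z_simps b)
    next
      fix k assume ij: "i = Some k" "j = None"
      have "bracket \<Omega> (Z i) (Z j) z = Y \<sigma> h 0 (\<lambda>_. - (3 *s axis k 1)) z"
        unfolding ij Z_simps a[of _ d0] b n ..
      then show ?thesis by (rule exI)
    next
      fix k l assume "i = Some k" "j = Some l"
      then show ?thesis using bracket_Y0[OF z, of "axis k 1" "axis l 1"] by (simp only: Z_simps)
    qed
  qed
  have tZ: "tangent z (Z i z)" for i z by (cases i) (simp_all only: Z_simps tangent_vertical tangent_Y)
  have "\<exists>\<Omega>' \<psi>. z0 \<in> \<Omega>' \<and> \<Omega>' \<subseteq> \<Omega> \<and> openin (top_of_set (harmonic_space M)) \<Omega>' \<and> frame \<Omega>' \<psi> \<and>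
    (\<forall>z\<in>\<Omega>'. \<forall>i. der \<Omega>' \<psi> z (Z i z) + A z (Z i z) ** \<psi> z = 0)"
  proof (rule local_parallel_frame[OF z0, where \<pi> = \<pi>])
    show "tangent_field \<Omega> (Z i)" for i
      by (cases i) (simp_all only: Z_simps tangent_field_vertical tangent_field_Y[OF sectionE_const])
    show "bounded_linear (\<pi> i)" for i by (rule bl[OF \<pi>])
    show "\<pi> i (hscale k w) = k * \<pi> i w" for i k w by (rule \<pi>(2))
    have d1: "v0 z0 (d0 z0) = 1" using dt_\<Omega>[OF z0] by (simp add: v0_def vertical_sel dt_def)
    have c1: "cnt 1 1 1 = 0" by (simp add: cnt_def)
    show "\<pi> i (Z j z0) = (if i = j then 1 else 0)" for i j
      by (cases i; cases j) (simp_all add: \<pi>_def Z_simps d1[unfolded v0_def vertical_sel] v0_def Y_horizontal coef_linear(3)[OF z0] vertical_sel coef_Y[OF z0] c1 wt_def axis_def del: Y_simps)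
    show "\<exists>c. bracket \<Omega> (Z i) (Z j) z = (\<Sum>m\<in>UNIV. hscale (c m) (Z m z))" if zO: "z \<in> \<Omega>" for z i j
    proof -
      obtain d where d: "bracket \<Omega> (Z i) (Z j) z = Y \<sigma> h 0 (\<lambda>_. d) z" using br[OF zO, of i j] by (elim exE)
      obtain c where c: "Y \<sigma> h 0 (\<lambda>_. d) z = (\<Sum>m\<in>UNIV. hscale (c m) (Z m z))" using span[of d z] by (elim exE)
      show ?thesis by (rule exI[of _ c], rule trans[OF d c])
    qed
    show "curv z (Z i z) (Z j z) = 0" if z: "z \<in> \<Omega>" for z i j
    proof (cases i)
      case None
      show ?thesis unfolding None Z_simps by (rule almost_flatD(4)[OF fl z tZ])
    next
      case (Some k)
      show ?thesis
      proof (cases j)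
        case None
        show ?thesis unfolding None curv_antisym[of z "Z i z"] Z_simps almost_flatD(4)[OF fl z tZ] by (rule minus_zero)
      next
        case j: (Some l)
        show ?thesis unfolding Some j Z_simps by (rule almost_flatD(1)[OF fl z])
      qed
    qed
  qed
  then obtain \<Omega>' \<psi> where O: "z0 \<in> \<Omega>'" "\<Omega>' \<subseteq> \<Omega>" "openin (top_of_set (harmonic_space M)) \<Omega>'" and \<psi>: "frame \<Omega>' \<psi>"
    and par': "\<forall>z\<in>\<Omega>'. \<forall>i. der \<Omega>' \<psi> z (Z i z) + A z (Z i z) ** \<psi> z = 0" by blast
  note par = spec[OF bspec[OF par']]
  interpret R: harmonic_domain M \<Omega>' by unfold_locales (rule open_M, rule O(3))
  have \<psi>h: "holo_mat hscale \<Omega>' \<psi>" using \<psi> by (simp add: frame_def)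
  have "der \<Omega>' \<psi> z (Xppp \<sigma> h e z) + A z (Xppp \<sigma> h e z) ** \<psi> z = 0" if z: "z \<in> \<Omega>'" for e z
  proof -
    let ?F = "\<lambda>w. der \<Omega>' \<psi> z w + A z w ** \<psi> z"
    note zW = subsetD[OF O(2) z]
    let ?c = "e (fst z)" and ?y = "\<lambda>i. Y \<sigma> h 0 (\<lambda>_. axis i 1) z"
    have 0: "?F (?y i) = 0" for i using par[OF z, of "Some i"] by (simp only: Z_simps)
    have "?F (\<Sum>i\<in>I. hscale (?c $ i) (?y i)) = 0" if "finite I" for I
      using that
    proof (induction I)
      case empty
      show ?case by (simp add: R.der_linear(3)[OF \<psi>h z] A_0[OF zW] mm.zero_left)
    next
      case (insert i I)
      have "?F (\<Sum>i\<in>insert i I. hscale (?c $ i) (?y i)) = mat (?c $ i) ** ?F (?y i) + ?F (\<Sum>i\<in>I. hscale (?c $ i) (?y i))"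
        using insert.hyps
        by (simp add: R.der_linear(1)[OF \<psi>h z] R.der_hscale[OF \<psi>h z tangent_Y] A_add[OF zW tangent_linear(3)[OF tangent_Y] tangent_sum[OF tangent_linear(3)[OF tangent_Y]]]
            A_hscale[OF zW tangent_Y] mm.add_left mm.add_right matrix_mul_assoc del: Y_simps)
      then show ?case unfolding 0 insert.IH by (simp add: mm.zero_right)
    qed
    from this[of UNIV, OF finite] have "?F (Y \<sigma> h 0 (\<lambda>_. ?c) z) = 0" by (simp only: Y0_expand[of ?c])
    then show ?thesis using Y_eq_const[of \<sigma> h 0 e z] by simp
  qed
  moreover have "der \<Omega>' \<psi> z (d0 z) + A z (d0 z) ** \<psi> z = 0" if "z \<in> \<Omega>'" for z using par[OF that, of None] by (simp only: Z_simps)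
  ultimately have "analytic_frame \<sigma> h \<Omega>' A \<psi>" using \<psi> by (simp add: analytic_frame_def)
  with O show ?thesis by blast
qed

end

section \<open>Potentials in an analytic frame\<close>

locale analytic_connection = spin_connection M aE aH \<omega> \<sigma> h \<Omega> A
  for M :: "(complex^'n) set" and aE :: "complex^'n \<Rightarrow> complex^'p^'p^'n" and aH \<omega>
    and \<sigma> :: "complex^'n \<Rightarrow> complex^2^2^2^'p^'n" and h :: "2 \<Rightarrow> complex^'n \<Rightarrow> complex^2" and \<Omega> :: "('n hpoint) set"
    and A :: "'n hpoint \<Rightarrow> 'n hpoint \<Rightarrow> complex^'r^'r" +
  fixes \<psi> :: "'n hpoint \<Rightarrow> complex^'r^'r"
  assumes fl: "almost_0_partially_flat \<sigma> h \<Omega> A" and an: "analytic_frame \<sigma> h \<Omega> A \<psi>"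
begin

lemma \<psi>: "frame \<Omega> \<psi>" using an by (simp add: analytic_frame_def)

definition B :: "'n hpoint \<Rightarrow> 'n hpoint \<Rightarrow> complex^'r^'r" where "B = potential \<Omega> \<psi> A"

definition App :: "'n hpoint \<Rightarrow> complex^'r^'r" where "App z = B z (dpp z)"

sublocale B: spin_connection M aE aH \<omega> \<sigma> h \<Omega> B
  by unfold_locales (simp only: B_def connection_potential[OF \<psi>])

lemma curv_B: "z \<in> \<Omega> \<Longrightarrow> tangent z v \<Longrightarrow> tangent z w \<Longrightarrow> curv z v w = 0 \<Longrightarrow> B.curv z v w = 0"
  unfolding B_def by (rule curv_potential_zero[OF \<psi>])

lemma B_zero:
  assumes z: "z \<in> \<Omega>" and "der \<Omega> \<psi> z w + A z w ** \<psi> z = 0" shows "B z w = 0"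
proof -
  have "\<psi> z ** B z w = 0" unfolding B_def potential_eq[OF \<psi> z] using assms(2) by (simp only: add.commute)
  then have "matrix_inv (\<psi> z) ** (\<psi> z ** B z w) = 0" by (simp add: mm.zero_right)
  then show ?thesis by (simp add: matrix_mul_assoc matrix_inv_left[OF psi_inv[OF \<psi> z]])
qed

lemma B_d0: "z \<in> \<Omega> \<Longrightarrow> B z (d0 z) = 0"
  by (rule B_zero) (use an in \<open>auto simp only: analytic_frame_def\<close>)

lemma B_Y0: "z \<in> \<Omega> \<Longrightarrow> B z (Y \<sigma> h 0 e z) = 0"
  using B_zero[of z "Xppp \<sigma> h (\<lambda>_. e (fst z)) z"] an sectionE_const[of "fst ` \<Omega>" "e (fst z)"] Y_eq_const[of \<sigma> h 0 e z]
  unfolding analytic_frame_def Y_simps by metis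

text \<open>Flatness in the directions \<open>dpp\<close> and \<open>d0\<close> leaves only
  F(\<open>dmm\<close>, \<open>dmm\<close>), which vanishes by antisymmetry.\<close>

lemma curv_B_vertical:
  assumes z: "z \<in> \<Omega>" and v: "v \<in> {dpp, dmm, d0}" and w: "w \<in> {dpp, dmm, d0}" shows "B.curv z (v z) (w z) = 0"
proof -
  have t: "tangent z (v z)" if "v \<in> {dpp, dmm, d0}" for v using that tangent_vertical by blast
  have 1: "curv z (v z) (w z) = 0" if "v = dpp \<or> v = d0" "w \<in> {dpp, dmm, d0}" for v w
    using that(1) almost_flatD(3,4)[OF fl z t[OF that(2)]] by blast
  have self: "curv z x x = 0" for x
  proof -
    have "(2::real) *\<^sub>R curv z x x = 0" unfolding scaleR_2 by (subst (2) curv_antisym) (rule right_minus)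
    then show ?thesis by (simp only: scaleR_eq_0_iff zero_neq_numeral[symmetric] simp_thms)
  qed
  have "curv z (v z) (w z) = 0"
  proof (cases "v = dmm")
    case True
    show ?thesis
    proof (cases "w = dmm")
      case False
      then have "w = dpp \<or> w = d0" using w by blast
      from 1[OF this v] show ?thesis using curv_antisym[of z "v z" "w z"] by simp
    qed (simp only: True self)
  qed (use 1 v w in blast)
  then show ?thesis by (rule curv_B[OF z t[OF v] t[OF w]])
qed

text \<open>In an analytic frame the form vanishes on \<open>d0\<close> and \<open>Xppp\<close>, so
  F(\<open>d0\<close>, \<open>dpp\<close>) = 0 and F(\<open>Xppp\<close>, \<open>dpp\<close>) = 0
  reduce to the two equations of a prepotential.\<close>

lemma prepotential_App: "prepotential \<sigma> h \<Omega> App"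
  unfolding prepotential_def
proof (intro conjI ballI allI impI)
  show "holo_mat hscale \<Omega> App" unfolding App_def[abs_def] by (rule B.A_holo[OF tangent_field_vertical(1)])
  fix z assume z: "z \<in> \<Omega>"
  have z1: "der \<Omega> (\<lambda>y. B y (d0 y)) z (dpp z) = 0" by (rule der_zero[OF B_d0 z tangent_vertical(1)])
  have "curvature \<Omega> B d0 dpp z = 0"
    unfolding B.curvature_eq[OF tangent_field_vertical(3,1) z] by (rule curv_B_vertical[OF z]) simp_all
  then show "der \<Omega> App z (d0 z) = 2 *\<^sub>R App z"
    unfolding curvature_def z1 B_d0[OF z] comm_simps(6) bracket_vertical(2)[OF z] B.A_scaleR[OF z tangent_vertical(1)] App_def[symmetric]
    by simp
  fix e :: "complex^'n \<Rightarrow> complex^'p" assume e: "sectionE (fst ` \<Omega>) e"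
  let ?Y = "Y \<sigma> h 0 e"
  have z2: "der \<Omega> (\<lambda>y. B y (?Y y)) z (dpp z) = 0" by (rule der_zero[OF B_Y0 z tangent_vertical(1)])
  have "bracket \<Omega> ?Y dpp z = - bracket \<Omega> dpp ?Y z" by (simp add: bracket_def)
  then have br: "bracket \<Omega> ?Y dpp z = 0" using bracket_Y(2)[OF e z le0] by simp
  have "B.curv z (?Y z) (dpp z) = 0"
    by (rule curv_B[OF z tangent_Y tangent_vertical(1)], subst Y_eq_const)
      (rule almost_flatD(2)[OF fl z le0 tangent_vertical(1) vertical_sel(1)])
  then have "curvature \<Omega> B ?Y dpp z = 0" by (simp only: B.curvature_eq[OF tangent_field_Y[OF e] tangent_field_vertical(1) z])
  then show "der \<Omega> App z (Xppp \<sigma> h e z) = 0"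
    unfolding curvature_def z2 B_Y0[OF z] comm_simps(6) br B.A_0[OF z] App_def[symmetric] by simp
qed

text \<open>A frame parallel in all three vertical directions serves as \<Phi>: its equation along
  \<open>dmm\<close> identifies B(\<open>dmm\<close>) with \<open>Amm\<close>, and the horizontal
  potentials follow from the curvature.\<close>

lemma potentials:
  assumes \<Phi>: "frame \<Omega> \<Phi>" and par: "\<And>z v. z \<in> \<Omega> \<Longrightarrow> v \<in> {dpp, dmm, d0} \<Longrightarrow> der \<Omega> \<Phi> z (v z) + B z (v z) ** \<Phi> z = 0"
  shows "prepotential \<sigma> h \<Omega> App \<and> solves_bridge \<Omega> App \<Phi> \<and> has_potentials \<sigma> h \<Omega> App \<Phi> (potential \<Omega> \<psi> A)"
proof (intro conjI prepotential_App)
  have p: "der \<Omega> \<Phi> z (dpp z) = - (App z ** \<Phi> z)" "der \<Omega> \<Phi> z (dmm z) = - (B z (dmm z) ** \<Phi> z)" "der \<Omega> \<Phi> z (d0 z) = 0" if z: "z \<in> \<Omega>" for z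
    using par[OF z, of dpp] par[OF z, of dmm] par[OF z, of d0] by (simp_all add: App_def B_d0[OF z] mm.zero_left eq_neg_iff_add_eq_0)
  then show "solves_bridge \<Omega> App \<Phi>" using \<Phi> by (simp add: solves_bridge_def)
  show "has_potentials \<sigma> h \<Omega> App \<Phi> (potential \<Omega> \<psi> A)"
    unfolding B_def[symmetric]
  proof (rule B.has_potentialsI[OF \<Phi>])
    fix z assume z: "z \<in> \<Omega>"
    have "invertible (\<Phi> z)" using \<Phi> z by (simp add: frame_def)
    then have "Amm \<Omega> \<Phi> z = B z (dmm z)"
      by (simp add: Amm_def p(2)[OF z] mm.minus_left matrix_mul_assoc[symmetric] matrix_inv_right)
    then show "B z (dpp z) = App z \<and> B z (dmm z) = Amm \<Omega> \<Phi> z \<and> B z (d0 z) = 0" by (simp add: App_def B_d0[OF z])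
    show "B z (Y \<sigma> h 0 (\<lambda>_. c) z) = 0" for c by (rule B_Y0[OF z])
    show "B.curv z (dmm z) (Y \<sigma> h m (\<lambda>_. c) z) = 0" if "m < 3" for m c
    proof -
      have "m \<le> 2" using that by simp
      then have "curv z (dmm z) (Y \<sigma> h m (\<lambda>_. c) z) = 0"
        using curv_antisym[of z "dmm z"] almost_flatD(2)[OF fl z _ tangent_vertical(2) vertical_sel(4)] by simp
      then show ?thesis by (rule curv_B[OF z tangent_vertical(2) tangent_Y])
    qed
  qed
qed

lemma analytic_connection_restrict:
  assumes sub: "harmonic_domain M \<Omega>'" "\<Omega>' \<subseteq> \<Omega>" shows "analytic_connection M aE aH \<omega> \<sigma> h \<Omega>' A \<psi>"
    and "z \<in> \<Omega>' \<Longrightarrow> tangent z w \<Longrightarrow> potential \<Omega>' \<psi> A z w = B z w"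
proof -
  interpret R: spin_connection M aE aH \<omega> \<sigma> h \<Omega>' A by (rule spin_connection_restrict[OF sub])
  note d = der_restrict[OF sub psi_holo[OF \<psi>]]
  have "frame \<Omega>' \<psi>" using psi_inv[OF \<psi>] hs.holo_mat_subset[OF psi_holo[OF \<psi>] sub(2)] subsetD[OF sub(2)] by (simp add: frame_def)
  \<comment> \<open>A section over the projection of \<Omega>' need not be given on that of
    \<Omega>, so its value at the point is used as a constant section.\<close>
  moreover have "der \<Omega> \<psi> z (Xppp \<sigma> h e z) + A z (Xppp \<sigma> h e z) ** \<psi> z = 0" if "z \<in> \<Omega>" for e z
    using that an sectionE_const[of "fst ` \<Omega>" "e (fst z)"] Y_eq_const[of \<sigma> h 0 e z] unfolding analytic_frame_def Y_simps by metis
  moreover have "der \<Omega> \<psi> z (d0 z) + A z (d0 z) ** \<psi> z = 0" if "z \<in> \<Omega>" for z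
    using that an unfolding analytic_frame_def by blast
  moreover have "tangent z (Xppp \<sigma> h e z)" for e z using tangent_Y[of z \<sigma> h 0 e] by simp
  ultimately have "analytic_frame \<sigma> h \<Omega>' A \<psi>"
    using subsetD[OF sub(2)] by (simp add: analytic_frame_def d tangent_vertical)
  then show "analytic_connection M aE aH \<omega> \<sigma> h \<Omega>' A \<psi>"
    by unfold_locales (rule almost_flat_restrict[OF fl sub])
  show "z \<in> \<Omega>' \<Longrightarrow> tangent z w \<Longrightarrow> potential \<Omega>' \<psi> A z w = B z w"
    by (simp add: B_def potential_def d)
qed

text \<open>The vertical distribution is involutive and the connection is flat on it, so
  \<open>local_parallel_frame\<close> applies in the analytic frame.\<close>

lemma local_bridge:
  assumes z0: "z0 \<in> \<Omega>"
  shows "\<exists>\<Omega>' App \<Phi>. z0 \<in> \<Omega>' \<and> \<Omega>' \<subseteq> \<Omega> \<and> openin (top_of_set (harmonic_space M)) \<Omega>' \<and>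
    prepotential \<sigma> h \<Omega>' App \<and> solves_bridge \<Omega>' App \<Phi> \<and> has_potentials \<sigma> h \<Omega>' App \<Phi> (potential \<Omega>' \<psi> A)"
proof -
  define Z :: "3 \<Rightarrow> 'n hpoint \<Rightarrow> 'n hpoint" where "Z i = (if i = 1 then d0 else if i = 2 then dmm else dpp)" for i
  define \<pi> where "\<pi> i w = (if i = 1 then v0 z0 w else if i = 2 then vmm z0 w else vpp z0 w)" for i :: 3 and w
  have n3: "(1::3) \<noteq> 2" "(1::3) \<noteq> 3" "(2::3) \<noteq> 3" "(2::3) \<noteq> 1" "(3::3) \<noteq> 1" "(3::3) \<noteq> 2" by simp_all
  have Zs: "Z 1 = d0" "Z 2 = dmm" "Z 3 = dpp" by (simp_all only: Z_def n3 if_True if_False simp_thms)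
  have bl: "bounded_linear f" if "\<And>v w. f (v + w) = f v + f w" "\<And>k w. f (hscale k w) = k * f w" for f :: "'n hpoint \<Rightarrow> complex"
    by (rule linear_conv_bounded_linear[THEN iffD1], rule linearI)
      (use that hs.sc_of_real in \<open>simp_all add: scaleR_conv_of_real flip: hs.sc_of_real\<close>)
  have \<pi>: "\<pi> i (v + w) = \<pi> i v + \<pi> i w" "\<pi> i (hscale k w) = k * \<pi> i w" for i v w k
    by (simp_all add: \<pi>_def v0_def vmm_def vpp_def algebra_simps)
  have "\<exists>\<Omega>' \<Phi>. z0 \<in> \<Omega>' \<and> \<Omega>' \<subseteq> \<Omega> \<and> openin (top_of_set (harmonic_space M)) \<Omega>' \<and> frame \<Omega>' \<Phi> \<and>
    (\<forall>z\<in>\<Omega>'. \<forall>i. der \<Omega>' \<Phi> z (Z i z) + B z (Z i z) ** \<Phi> z = 0)"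
  proof (rule B.local_parallel_frame[OF z0, where \<pi> = \<pi>])
    show "tangent_field \<Omega> (Z i)" for i by (simp add: Z_def tangent_field_vertical)
    show "bounded_linear (\<pi> i)" for i by (rule bl[OF \<pi>])
    show "\<pi> i (hscale k w) = k * \<pi> i w" for i k w by (rule \<pi>(2))
    have dtz: "uplus z0 $ 1 * uminus' z0 $ 2 - uplus z0 $ 2 * uminus' z0 $ 1 = 1" using dt_\<Omega>[OF z0] by (simp add: dt_def)
    show "\<pi> i (Z j z0) = (if i = j then 1 else 0)" for i j
      using exhaust_3[of i] exhaust_3[of j] dtz
      by (elim disjE) (simp_all add: \<pi>_def Zs n3 v0_def vmm_def vpp_def vertical_sel mult.commute)
    show "\<exists>c. bracket \<Omega> (Z i) (Z j) z = (\<Sum>m\<in>UNIV. hscale (c m) (Z m z))" if z: "z \<in> \<Omega>" for z i j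
    proof -
      have t: "fst (bracket \<Omega> (Z i) (Z j) z) = 0"
      proof -
        have tz: "tangent z (d0 z)" "tangent z (dmm z)" "tangent z (dpp z)" by (rule tangent_vertical)+
        show ?thesis
          using exhaust_3[of i] exhaust_3[of j]
          by (elim disjE) (simp_all add: bracket_def Zs der_vertical[OF z] tz vertical_sel)
      qed
      let ?w = "bracket \<Omega> (Z i) (Z j) z"
      have "tangent z ?w" by (rule tangent_bracket[OF _ _ z]) (simp_all add: Z_def tangent_field_vertical)
      from tangent_expand[OF z this] have "?w = hscale (v0 z ?w) (d0 z) + hscale (vmm z ?w) (dmm z) + hscale (vpp z ?w) (dpp z)"
        by (simp only: t hlift_linear(3) add_0)
      also have "\<dots> = (\<Sum>m\<in>UNIV. hscale (if m = 1 then v0 z ?w else if m = 2 then vmm z ?w else vpp z ?w) (Z m z))"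
        unfolding sum_3 by (simp only: Zs n3 if_True if_False simp_thms)
      finally show ?thesis by (rule exI[of _ "\<lambda>m :: 3. if m = 1 then v0 z ?w else if m = 2 then vmm z ?w else vpp z ?w"])
    qed
    show "B.curv z (Z i z) (Z j z) = 0" if z: "z \<in> \<Omega>" for z i j
      by (rule curv_B_vertical[OF z]) (simp_all add: Z_def)
  qed
  then obtain \<Omega>' \<Phi> where O: "z0 \<in> \<Omega>'" "\<Omega>' \<subseteq> \<Omega>" "openin (top_of_set (harmonic_space M)) \<Omega>'" and \<Phi>: "frame \<Omega>' \<Phi>"
    and par': "\<forall>z\<in>\<Omega>'. \<forall>i. der \<Omega>' \<Phi> z (Z i z) + B z (Z i z) ** \<Phi> z = 0" by blast
  note par = spec[OF bspec[OF par']]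
  have sub: "harmonic_domain M \<Omega>'" by unfold_locales (rule open_M, rule O(3))
  interpret R: analytic_connection M aE aH \<omega> \<sigma> h \<Omega>' A \<psi> by (rule analytic_connection_restrict(1)[OF sub O(2)])
  have eq: "R.B z w = B z w" if "z \<in> \<Omega>'" "tangent z w" for z w
    unfolding R.B_def by (rule analytic_connection_restrict(2)[OF sub O(2) that])
  have "der \<Omega>' \<Phi> z (v z) + R.B z (v z) ** \<Phi> z = 0" if z: "z \<in> \<Omega>'" and v: "v \<in> {dpp, dmm, d0}" for z v
    using v par[OF z, of 1] par[OF z, of 2] par[OF z, of 3] unfolding Zs
    by (elim insertE emptyE) (simp_all only: eq[OF z tangent_vertical(1)] eq[OF z tangent_vertical(2)] eq[OF z tangent_vertical(3)])
  then have "prepotential \<sigma> h \<Omega>' R.App \<and> solves_bridge \<Omega>' R.App \<Phi> \<and> has_potentials \<sigma> h \<Omega>' R.App \<Phi> (potential \<Omega>' \<psi> A)"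
    by (rule R.potentials[OF \<Phi>])
  with O show ?thesis by (intro exI[of _ \<Omega>'] exI[of _ R.App] exI[of _ \<Phi>] conjI) (elim conjE, assumption)+
qed

end

section \<open>Vertical parallel frames\<close>

context harmonic_domain
begin

text \<open>Along a holomorphic curve with velocity \<gamma>' the hypothesis is a linear equation in
  one complex variable on the whole plane, solved by the exponential.\<close>

lemma flow:
  fixes f :: "'n hpoint \<Rightarrow> complex^'r^'r" and \<gamma> :: "complex \<Rightarrow> 'n hpoint"
  assumes f: "holo_mat hscale \<Omega> f" and \<gamma>: "\<And>t. \<gamma> t \<in> \<Omega>" and \<gamma>': "\<And>t. (\<gamma> has_derivative (\<lambda>s. hscale s (\<gamma>' t))) (at t)"
    and tan: "\<And>t. tangent (\<gamma> t) (\<gamma>' t)" and eq: "\<And>t. der \<Omega> f (\<gamma> t) (\<gamma>' t) = mat k ** f (\<gamma> t)"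
  shows "f (\<gamma> t) = mat (exp (k * t)) ** f (\<gamma> 0)"
proof -
  have d: "((\<lambda>t. f (\<gamma> t) $ i $ j) has_field_derivative k * f (\<gamma> t) $ i $ j) (at t)" for i j t
  proof -
    have r: "range \<gamma> \<subseteq> \<Omega>" using \<gamma> by (rule image_subsetI)
    have "((\<lambda>t. f (\<gamma> t)) has_derivative (\<lambda>s. der \<Omega> f (\<gamma> t) (hscale s (\<gamma>' t)))) (at t)"
      by (rule has_derivative_in_compose[OF \<gamma>' has_derivative_subset[OF has_derivative_holo_mat[OF f \<gamma>] r]])
    then have 1: "((\<lambda>t. f (\<gamma> t)) has_derivative (\<lambda>s. mat s ** (mat k ** f (\<gamma> t)))) (at t)"
      by (simp only: der_hscale[OF f \<gamma> tan] eq)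
    have "bounded_linear (\<lambda>A :: complex^'r^'r. A $ i $ j)"
      by (intro bounded_linear_compose[OF bounded_linear_vec_nth] bounded_linear_vec_nth)
    from bounded_linear.has_derivative[OF this 1] show ?thesis
      unfolding has_field_derivative_def mat_mult_nth by (rule has_derivative_eq_rhs) (simp add: fun_eq_iff mult_ac)
  qed
  have "f (\<gamma> t) $ i $ j = exp (k * t) * f (\<gamma> 0) $ i $ j" for i j
  proof -
    have "((\<lambda>t. exp (- (k * t)) * f (\<gamma> t) $ i $ j) has_field_derivative 0) (at t within UNIV)" for t
      by (rule derivative_eq_intros d refl)+ (simp add: algebra_simps)
    then obtain c where c: "\<And>t. exp (- (k * t)) * f (\<gamma> t) $ i $ j = c"
      using has_field_derivative_zero_constant[OF convex_UNIV, of "\<lambda>t. exp (- (k * t)) * f (\<gamma> t) $ i $ j"] by blast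
    have "exp (- (k * t)) * f (\<gamma> t) $ i $ j = f (\<gamma> 0) $ i $ j" using c[of t] c[of 0] by simp
    then have "exp (k * t) * (exp (- (k * t)) * f (\<gamma> t) $ i $ j) = exp (k * t) * f (\<gamma> 0) $ i $ j" by simp
    moreover have "exp (k * t) * exp (- (k * t)) = 1" by (simp add: exp_minus)
    ultimately show ?thesis by (simp only: mult.assoc[symmetric] mult_1_left)
  qed
  then show ?thesis by (simp add: vec_eq_iff mat_mult_nth)
qed

lemma flow_d0:
  fixes f :: "'n hpoint \<Rightarrow> complex^'r^'r"
  assumes f: "holo_mat hscale \<Omega> f" and \<gamma>: "\<And>t. (x, exp t *s p, exp (- t) *s q) \<in> \<Omega>"
    and eq: "\<And>z. z \<in> \<Omega> \<Longrightarrow> der \<Omega> f z (d0 z) = mat k ** f z"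
  shows "f (x, exp t *s p, exp (- t) *s q) = mat (exp (k * t)) ** f (x, p, q)"
proof -
  let ?\<gamma> = "\<lambda>t. (x, exp t *s p, exp (- t) *s q) :: 'n hpoint"
  have b: "bounded_bilinear ((*s) :: complex \<Rightarrow> complex^2 \<Rightarrow> complex^2)" by (rule vs.bounded_bilinear_sc)
  have e: "(exp has_derivative (\<lambda>s. s * exp t)) (at t)" "((\<lambda>t. exp (- t)) has_derivative (\<lambda>s. s * (- exp (- t)))) (at t)" for t :: complex
  proof -
    have "(exp has_field_derivative exp t) (at t)" by (rule DERIV_exp)
    then show "(exp has_derivative (\<lambda>s. s * exp t)) (at t)" unfolding has_field_derivative_def by (rule has_derivative_eq_rhs) (simp add: fun_eq_iff mult.commute)
    have "((\<lambda>t. exp (- t)) has_field_derivative - exp (- t)) (at t)" by (rule derivative_eq_intros refl)+ simp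
    then show "((\<lambda>t. exp (- t)) has_derivative (\<lambda>s. s * (- exp (- t)))) (at t)" unfolding has_field_derivative_def by (rule has_derivative_eq_rhs) (simp add: fun_eq_iff mult.commute)
  qed
  have "(?\<gamma> has_derivative (\<lambda>s. (0, (s * exp t) *s p, (s * (- exp (- t))) *s q))) (at t)" for t
    by (intro has_derivative_Pair has_derivative_const bounded_linear.has_derivative[OF bounded_bilinear.bounded_linear_left[OF b]] e)
  moreover have "(0, (s * exp t) *s p, (s * (- exp (- t))) *s q) = hscale s (d0 (?\<gamma> t))" for s t
    by (simp add: hscale_def d0_def vec_eq_iff)
  ultimately have "(?\<gamma> has_derivative (\<lambda>s. hscale s (d0 (?\<gamma> t)))) (at t)" for t by (simp only:)
  from flow[OF f \<gamma> this tangent_vertical(3) eq[OF \<gamma>], of t] show ?thesis by simp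
qed

lemma flow_dpp:
  fixes f :: "'n hpoint \<Rightarrow> complex^'r^'r"
  assumes f: "holo_mat hscale \<Omega> f" and \<gamma>: "\<And>t. (x, p, q + t *s p) \<in> \<Omega>"
    and eq: "\<And>z. z \<in> \<Omega> \<Longrightarrow> der \<Omega> f z (dpp z) = 0"
  shows "f (x, p, q + t *s p) = f (x, p, q)"
proof -
  let ?\<gamma> = "\<lambda>t. (x, p, q + t *s p) :: 'n hpoint"
  have b: "bounded_bilinear ((*s) :: complex \<Rightarrow> complex^2 \<Rightarrow> complex^2)" by (rule vs.bounded_bilinear_sc)
  have "(?\<gamma> has_derivative (\<lambda>s. (0, 0, 0 + s *s p))) (at t)" for t
    by (intro has_derivative_Pair has_derivative_const has_derivative_add bounded_linear_imp_has_derivative[OF bounded_bilinear.bounded_linear_left[OF b]])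
  moreover have "(0, 0, 0 + s *s p) = hscale s (dpp (?\<gamma> t))" for s t by (simp add: hscale_def dpp_def)
  ultimately have d: "(?\<gamma> has_derivative (\<lambda>s. hscale s (dpp (?\<gamma> t)))) (at t)" for t by (simp only:)
  have "der \<Omega> f (?\<gamma> t) (dpp (?\<gamma> t)) = mat 0 ** f (?\<gamma> t)" for t by (simp only: eq[OF \<gamma>] mat_0 mm.zero_left)
  from flow[OF f \<gamma> d tangent_vertical(1) this, of t] show ?thesis by simp
qed

end

section \<open>Charts of the fibre\<close>

definition vec2 :: "complex \<Rightarrow> complex \<Rightarrow> complex^2" where "vec2 a b = (\<chi> i. if i = 1 then a else b)"

lemma vec2_nth [simp]: "vec2 a b $ 1 = a" "vec2 a b $ 2 = b" by (simp_all add: vec2_def)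

text \<open>The coordinate that is nonzero in the chart; \<open>L'\<close> is the other one, with a
  sign that gives the determinant the same form for both values of \<alpha>, so that one argument
  covers both charts.\<close>

definition L :: "2 \<Rightarrow> complex^2 \<Rightarrow> complex" where "L \<alpha> p = p $ \<alpha>"
definition L' :: "2 \<Rightarrow> complex^2 \<Rightarrow> complex" where "L' \<alpha> p = (if \<alpha> = 1 then p $ 2 else - p $ 1)"
definition vecL :: "2 \<Rightarrow> complex \<Rightarrow> complex \<Rightarrow> complex^2" where "vecL \<alpha> a b = (if \<alpha> = 1 then vec2 a b else vec2 (- b) a)"

text \<open>The point with coordinates \<open>(x, y, \<tau>)\<close> of the slice \<open>u\<^sub>+\<^sup>\<alpha> = 1\<close>.\<close>
definition pt :: "2 \<Rightarrow> complex^'n \<Rightarrow> complex \<Rightarrow> complex \<Rightarrow> 'n hpoint" where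
  "pt \<alpha> x y \<tau> = (x, vecL \<alpha> 1 y, vecL \<alpha> 0 1 + \<tau> *s vecL \<alpha> 1 y)"

lemma L_det: "L \<alpha> p * L' \<alpha> q - L' \<alpha> p * L \<alpha> q = p $ 1 * q $ 2 - p $ 2 * q $ 1"
  using exhaust_2[of \<alpha>] by (elim disjE) (simp_all add: L_def L'_def mult.commute)

lemma vecL_eqI: "L \<alpha> p = L \<alpha> q \<Longrightarrow> L' \<alpha> p = L' \<alpha> q \<Longrightarrow> p = q"
  using exhaust_2[of \<alpha>] by (elim disjE) (simp_all add: L_def L'_def vec_eq_iff forall_2)

lemma L_simps: "L \<alpha> (p + q) = L \<alpha> p + L \<alpha> q" "L' \<alpha> (p + q) = L' \<alpha> p + L' \<alpha> q" "L \<alpha> (k *s p) = k * L \<alpha> p" "L' \<alpha> (k *s p) = k * L' \<alpha> p"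
  "L \<alpha> (vecL \<alpha> a b) = a" "L' \<alpha> (vecL \<alpha> a b) = b" "L \<alpha> (- p) = - L \<alpha> p" "L' \<alpha> (- p) = - L' \<alpha> p" "L \<alpha> 0 = 0" "L' \<alpha> 0 = 0"
  using exhaust_2[of \<alpha>] by (elim disjE; simp add: L_def L'_def vecL_def)+

definition chart :: "2 \<Rightarrow> ('n::finite hpoint) set" where "chart \<alpha> = {z. uplus z $ \<alpha> \<noteq> 0}"

lemma open_chart: "open (chart \<alpha>)"
proof -
  have "chart \<alpha> = (\<lambda>z :: 'a hpoint. uplus z $ \<alpha>) -` (- {0})" by (auto simp: chart_def)
  moreover have "continuous_on UNIV (\<lambda>z :: 'a hpoint. uplus z $ \<alpha>)" by (intro continuous_intros)
  ultimately show ?thesis using open_vimage[of "- {0 :: complex}"] by (metis open_Compl closed_singleton)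
qed

lemma chartD: "z \<in> chart \<alpha> \<longleftrightarrow> L \<alpha> (uplus z) \<noteq> 0" by (simp add: chart_def L_def)

lemma dt_L: "dt z = L \<alpha> (uplus z) * L' \<alpha> (uminus' z) - L' \<alpha> (uplus z) * L \<alpha> (uminus' z)"
  unfolding L_det by (simp add: dt_def)

lemma pt_in: "x \<in> V \<Longrightarrow> pt \<alpha> x y \<tau> \<in> harmonic_space V \<inter> chart \<alpha>"
  by (simp only: Int_iff harmonic_space_iff chartD dt_L[of _ \<alpha>]) (simp add: pt_def L_simps algebra_simps)

lemma has_derivative_L: 
  "((\<lambda>z :: 'n::finite hpoint. L \<alpha> (uplus z)) has_derivative (\<lambda>w. L \<alpha> (uplus w))) F"
  "((\<lambda>z :: 'n::finite hpoint. L' \<alpha> (uplus z)) has_derivative (\<lambda>w. L' \<alpha> (uplus w))) F"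
  "((\<lambda>z :: 'n::finite hpoint. L \<alpha> (uminus' z)) has_derivative (\<lambda>w. L \<alpha> (uminus' w))) F"
proof -
  show "((\<lambda>z :: 'n hpoint. L \<alpha> (uplus z)) has_derivative (\<lambda>w. L \<alpha> (uplus w))) F" "((\<lambda>z :: 'n hpoint. L \<alpha> (uminus' z)) has_derivative (\<lambda>w. L \<alpha> (uminus' w))) F"
    unfolding L_def by (intro has_derivative_coord has_derivative_ident)+
  show "((\<lambda>z :: 'n hpoint. L' \<alpha> (uplus z)) has_derivative (\<lambda>w. L' \<alpha> (uplus w))) F"
  proof (cases "\<alpha> = 1")
    case True
    show ?thesis unfolding L'_def True if_True simp_thms by (intro has_derivative_coord has_derivative_ident)
  next
    case False
    show ?thesis unfolding L'_def if_not_P[OF False] by (intro has_derivative_minus has_derivative_coord has_derivative_ident)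
  qed
qed

lemma holo_L: "hs.holo_fld S X \<Longrightarrow> holo hscale S (\<lambda>z. L \<alpha> (uplus (X z)))" "hs.holo_fld S X \<Longrightarrow> holo hscale S (\<lambda>z. L' \<alpha> (uplus (X z)))"
  "hs.holo_fld S X \<Longrightarrow> holo hscale S (\<lambda>z. L \<alpha> (uminus' (X z)))"
  using exhaust_2[of \<alpha>] by (auto simp: L_def L'_def holo_fld_coord hs.holo_minus)

lemma holo_vecL: "holo hscale S a \<Longrightarrow> holo hscale S b \<Longrightarrow> holo hscale S (\<lambda>z. vecL \<alpha> (a z) (b z) $ i)"
  using exhaust_2[of \<alpha>] exhaust_2[of i] by (auto simp: vecL_def hs.holo_minus)

lemma holo_pt:
  assumes "holo hscale S y" "holo hscale S \<tau>" shows "hs.holo_fld S (\<lambda>z :: 'n::finite hpoint. pt \<alpha> (fst z) (y z) (\<tau> z))"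
  by (rule holo_fldI) (simp_all add: pt_def holo_vecL assms hs.holo_add hs.holo_mult)

lemma der_Int:
  assumes "open W" "z \<in> W" shows "der (S \<inter> W) f z = der S f z"
proof -
  have "at z within S \<inter> W = at z within S"
    by (rule at_within_nhd[OF assms(2,1)]) blast
  then show ?thesis by (simp add: der_def fun_eq_iff)
qed

text \<open>The parameter space is encoded in the type of points: x in the base slot and two chart
  coordinates in the slot of u_+. The second of them is the variable of the equation, the first a
  parameter.\<close>

lemma chart_ode:
  fixes b :: "'n::finite hpoint \<Rightarrow> complex^'r^'r"
  assumes V: "open V" and b: "holo_mat hscale (fst -` V) b"
  shows "\<exists>\<Psi> :: 'n hpoint \<Rightarrow> complex^'r^'r. holo_mat hscale (fst -` V) \<Psi> \<and>
    (\<forall>z\<in>fst -` V. invertible (\<Psi> z) \<and> fd \<Psi> z (0, vec2 0 1, 0) = b z ** \<Psi> z)"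
proof -
  let ?e = "(0, vec2 0 1, 0) :: 'n hpoint"
  let ?P = "\<lambda>w. hscale (uplus w $ 2) ?e"
  have R: "radial hscale ?P"
  proof (rule radial.intro, rule hs.complex_scaling_axioms, rule radial_axioms.intro)
    show "bounded_linear ?P"
      by (rule bounded_linear_compose[OF bounded_bilinear.bounded_linear_left[OF hs.bounded_bilinear_sc] bounded_linear_coord(2)])
  qed (simp_all add: hscale_def vec_eq_iff)
  show ?thesis
  proof (rule radial.ode_matrix[OF R])
    show "radial.star_shaped ?P 0 (fst -` V)"
      unfolding radial.star_shaped_def[OF R] radial.ray_def[OF R] using open_vimage_fst[OF V] by (auto simp: hscale_def)
    show "bounded_linear (\<lambda>w :: 'n hpoint. uplus w $ 2)" by (rule bounded_linear_coord(2))
  qed (simp_all add: b)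
qed

context spin_manifold
begin

lemma spin_domain_Int:
  assumes V: "open V" "V \<subseteq> M" and W: "open W"
  shows "spin_domain M aE aH \<omega> \<sigma> h (harmonic_space V \<inter> W)"
proof -
  have "harmonic_space V \<inter> W = harmonic_space M \<inter> (fst -` V \<inter> W)" using V(2) by (auto simp: harmonic_space_def)
  then have "openin (top_of_set (harmonic_space M)) (harmonic_space V \<inter> W)"
    using openin_open_Int[OF open_Int[OF open_vimage_fst[OF V(1)] W]] by simp
  then show ?thesis by unfold_locales (rule open_M)
qed

text \<open>Chain rule for a solution pulled back by chart coordinates (r, s): along a vertical
  vector that fixes r, only the derivative of s contributes.\<close>

lemma chart_compose:
  fixes \<Psi> :: "'n hpoint \<Rightarrow> complex^'r^'r"
  assumes V: "open V" "V \<subseteq> M" and W: "open W" and \<Psi>: "holo_mat hscale (fst -` V) \<Psi>"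
    "\<And>z. z \<in> fst -` V \<Longrightarrow> fd \<Psi> z (0, vec2 0 1, 0) = b z ** \<Psi> z"
    and r: "(r has_derivative r') (at z within harmonic_space V \<inter> W)" and s: "(s has_derivative s') (at z within harmonic_space V \<inter> W)"
    and z: "z \<in> harmonic_space V \<inter> W" and v: "tangent z v" "fst v = 0" "r' v = 0"
  shows "der (harmonic_space V \<inter> W) (\<lambda>z. \<Psi> (fst z, vec2 (r z) (s z), 0)) z v
     = mat (s' v) ** (b (fst z, vec2 (r z) (s z), 0) ** \<Psi> (fst z, vec2 (r z) (s z), 0))"
proof -
  interpret D: spin_domain M aE aH \<omega> \<sigma> h "harmonic_space V \<inter> W" by (rule spin_domain_Int[OF V W])
  let ?q = "\<lambda>z :: 'n hpoint. (fst z, vec2 (r z) (s z), 0) :: 'n hpoint"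
  have o: "open (fst -` V :: 'n hpoint set)" by (rule open_vimage_fst[OF V(1)])
  have qV: "?q z \<in> fst -` V" using z by (simp add: harmonic_space_def)
  have v2: "((\<lambda>z. vec2 (r z) (s z)) has_derivative (\<lambda>w. vec2 (r' w) (s' w))) (at z within harmonic_space V \<inter> W)"
  proof (rule has_derivative_vec)
    fix i :: 2
    show "((\<lambda>z. vec2 (r z) (s z) $ i) has_derivative (\<lambda>w. vec2 (r' w) (s' w) $ i)) (at z within harmonic_space V \<inter> W)"
      using exhaust_2[of i] r s by (elim disjE) simp_all
  qed
  have "(?q has_derivative (\<lambda>w. (fst w, vec2 (r' w) (s' w), 0))) (at z within harmonic_space V \<inter> W)"
    by (intro has_derivative_Pair has_derivative_const v2 has_derivative_fst has_derivative_ident)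
  from has_derivative_compose[OF this hs.holo_matD_fd(1)[OF \<Psi>(1) o qV]]
  have "der (harmonic_space V \<inter> W) (\<lambda>z. \<Psi> (?q z)) z v = fd \<Psi> (?q z) (fst v, vec2 (r' v) (s' v), 0)"
    by (rule D.der_eqI[OF _ z v(1)])
  also have "(fst v, vec2 (r' v) (s' v), 0) = hscale (s' v) (0, vec2 0 1, 0 :: complex^2)"
    unfolding v by (simp add: hscale_def vec_eq_iff forall_2)
  finally show ?thesis by (simp only: hs.fd_mat_sc[OF \<Psi>(1) o qV] \<Psi>(2)[OF qV])
qed

context
  fixes V :: "(complex^'n) set" and \<alpha> :: 2
  assumes V: "open V" "V \<subseteq> M"
begin

abbreviation \<Omega>c :: "'n hpoint set" where "\<Omega>c \<equiv> harmonic_space V \<inter> chart \<alpha>"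
text \<open>\<open>yc\<close> is the affine coordinate of the direction of u_+ and is annihilated by
  \<open>dpp\<close> and \<open>d0\<close>. \<open>tc\<close> is annihilated by \<open>d0\<close>,
  and \<open>dpp\<close> maps it to the square of \<open>L \<alpha> (uplus z)\<close>.\<close>

abbreviation yc :: "'n hpoint \<Rightarrow> complex" where "yc z \<equiv> L' \<alpha> (uplus z) / L \<alpha> (uplus z)"
abbreviation tc :: "'n hpoint \<Rightarrow> complex" where "tc z \<equiv> L \<alpha> (uplus z) * L \<alpha> (uminus' z)"

interpretation D: spin_domain M aE aH \<omega> \<sigma> h \<Omega>c by (rule spin_domain_Int[OF V open_chart])

text \<open>The flow of \<open>d0\<close> multiplies u_+ by e^t and u_- by e^{-t}. It carries a
  point of the slice with u_+^\<alpha> = 1 to z, and a function of weight k acquires the factor e^{k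
  t}.\<close>

lemma weight:
  fixes f :: "'n hpoint \<Rightarrow> complex^'r^'r"
  assumes f: "holo_mat hscale \<Omega>c f" and eq: "\<And>z. z \<in> \<Omega>c \<Longrightarrow> der \<Omega>c f z (d0 z) = mat k ** f z" and z: "z \<in> \<Omega>c"
  shows "\<exists>t. exp t = L \<alpha> (uplus z) \<and> f z = mat (exp (k * t)) ** f (pt \<alpha> (fst z) (yc z) (tc z))"
proof -
  have a: "L \<alpha> (uplus z) \<noteq> 0" and x: "fst z \<in> V" and d: "dt z = 1" using z by (simp_all add: chartD harmonic_space_iff)
  define t where "t = Ln (L \<alpha> (uplus z))"
  have t: "exp t = L \<alpha> (uplus z)" "exp (- t) = 1 / L \<alpha> (uplus z)" using a by (simp_all add: t_def exp_minus field_simps)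
  obtain p q where pq: "pt \<alpha> (fst z) (yc z) (tc z) = (fst z, p, q)" "p = vecL \<alpha> 1 (yc z)" "q = vecL \<alpha> 0 1 + tc z *s vecL \<alpha> 1 (yc z)"
    by (simp add: pt_def)
  have q: "L \<alpha> q = tc z" "L' \<alpha> q = L \<alpha> (uplus z) * L' \<alpha> (uminus' z)"
    using d a by (simp_all add: pq(3) L_simps dt_L[of z \<alpha>] field_simps)
  have "uplus z = exp t *s p" "uminus' z = exp (- t) *s q"
    unfolding t by (rule vecL_eqI[of \<alpha>]; use a q in \<open>simp add: pq(2) L_simps\<close>)+
  then have ze: "z = (fst z, exp t *s p, exp (- t) *s q)" by (simp only: prod_eq_iff fst_conv snd_conv)
  have pt: "(fst z, p, q) \<in> \<Omega>c" unfolding pq(1)[symmetric] by (rule pt_in[OF x])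
  have "(fst z, exp s *s p, exp (- s) *s q) \<in> \<Omega>c" for s
  proof -
    have "exp s * exp (- s) = 1" by (simp add: exp_minus)
    then have "dt (fst z, exp s *s p, exp (- s) *s q) = dt (fst z, p, q)" unfolding dt_def by simp algebra
    then show ?thesis using pt by (simp add: harmonic_space_iff chartD L_simps)
  qed
  from D.flow_d0[OF f this eq, of t] have "f z = mat (exp (k * t)) ** f (fst z, p, q)" by (simp only: ze[symmetric])
  then show ?thesis using t(1) by (intro exI[of _ t]) (simp only: pq(1))
qed

lemma has_derivative_yc:
  assumes "z \<in> \<Omega>c"
  shows "(yc has_derivative (\<lambda>w. (L' \<alpha> (uplus w) * L \<alpha> (uplus z) - L' \<alpha> (uplus z) * L \<alpha> (uplus w)) / (L \<alpha> (uplus z) * L \<alpha> (uplus z)))) (at z within \<Omega>c)"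
  by (rule has_derivative_divide'[OF has_derivative_L(2,1)]) (use assms in \<open>simp add: chartD\<close>)

lemma yc_vertical:
  assumes z: "z \<in> \<Omega>c"
  defines "y' \<equiv> (\<lambda>w. (L' \<alpha> (uplus w) * L \<alpha> (uplus z) - L' \<alpha> (uplus z) * L \<alpha> (uplus w)) / (L \<alpha> (uplus z) * L \<alpha> (uplus z)))"
  shows "y' (dpp z) = 0" "y' (d0 z) = 0" "y' (dmm z) = 1 / (L \<alpha> (uplus z))^2"
proof -
  have "L' \<alpha> (uminus' z) * L \<alpha> (uplus z) - L' \<alpha> (uplus z) * L \<alpha> (uminus' z) = 1"
    using z dt_L[of z \<alpha>] by (simp add: harmonic_space_iff mult.commute)
  then show "y' (dmm z) = 1 / (L \<alpha> (uplus z))^2" by (simp add: y'_def vertical_sel power2_eq_square)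
qed (simp_all add: y'_def vertical_sel L_simps)

lemma holo_yc: "holo hscale \<Omega>c yc"
  by (intro hs.holo_divide holo_L hs.holo_fld_id) (simp add: chartD)

lemma frame_compose:
  fixes \<Psi> :: "'n hpoint \<Rightarrow> complex^'r^'r"
  assumes \<Psi>: "holo_mat hscale (fst -` V) \<Psi>" "\<And>z. z \<in> fst -` V \<Longrightarrow> invertible (\<Psi> z)"
    and "holo hscale \<Omega>c r" "holo hscale \<Omega>c s"
  shows "frame \<Omega>c (\<lambda>z. \<Psi> (fst z, vec2 (r z) (s z), 0))"
proof -
  have i: "(fst z, vec2 (r z) (s z), 0) \<in> fst -` V" if "z \<in> \<Omega>c" for z :: "'n hpoint" using that by (simp add: harmonic_space_def)
  have "holo hscale \<Omega>c (\<lambda>z. vec2 (r z) (s z) $ a)" for a using exhaust_2[of a] assms(3,4) by auto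
  then have "hs.holo_fld \<Omega>c (\<lambda>z. (fst z, vec2 (r z) (s z), 0))" by (intro holo_fldI) simp_all
  then have "holo_mat hscale \<Omega>c (\<lambda>z. \<Psi> (fst z, vec2 (r z) (s z), 0))"
    by (rule hs.holo_mat_compose_fld[OF \<Psi>(1)]) (rule image_subsetI, rule i)
  then show ?thesis using \<Psi>(2)[OF i] by (simp only: frame_def simp_thms ball_simps) blast
qed

text \<open>With u = \<open>L \<alpha> (uplus z)\<close>, the field \<open>dpp\<close> acts on
  functions of \<open>yc\<close> and \<open>tc\<close> as u^2 times the derivative in
  \<open>tc\<close>, and \<open>App\<close> is u^2 times its value on the slice. The factors cancel,
  leaving an ordinary equation on the slice.\<close>

lemma chart_bridge:
  fixes App :: "'n hpoint \<Rightarrow> complex^'r^'r"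
  assumes App: "holo_mat hscale \<Omega>c App" "\<And>z. z \<in> \<Omega>c \<Longrightarrow> der \<Omega>c App z (d0 z) = 2 *\<^sub>R App z"
  shows "\<exists>\<Phi>. frame \<Omega>c \<Phi> \<and> (\<forall>z\<in>\<Omega>c. der \<Omega>c \<Phi> z (dpp z) = - (App z ** \<Phi> z) \<and> der \<Omega>c \<Phi> z (d0 z) = 0)"
proof -
  define b where "b z = - App (pt \<alpha> (fst z) (uplus z $ 1) (uplus z $ 2))" for z :: "'n hpoint"
  have "holo_mat hscale (fst -` V) (\<lambda>z. App (pt \<alpha> (fst z) (uplus z $ 1) (uplus z $ 2)))"
    by (rule hs.holo_mat_compose_fld[OF App(1) holo_pt]) (simp_all only: holo_coord, rule image_subsetI, rule pt_in, simp)
  then have "holo_mat hscale (fst -` V) b" unfolding b_def[abs_def] by (rule hs.holo_mat_minus)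
  from chart_ode[OF V(1) this] obtain \<Psi> :: "'n hpoint \<Rightarrow> complex^'r^'r" where \<Psi>0: "holo_mat hscale (fst -` V) \<Psi>"
    "\<forall>z\<in>fst -` V. invertible (\<Psi> z) \<and> fd \<Psi> z (0, vec2 0 1, 0) = b z ** \<Psi> z" by blast
  note \<Psi> = \<Psi>0(1) conjunct1[OF bspec[OF \<Psi>0(2)]] conjunct2[OF bspec[OF \<Psi>0(2)]]
  let ?\<Phi> = "\<lambda>z. \<Psi> (fst z, vec2 (yc z) (tc z), 0)"
  have tcd: "(tc has_derivative (\<lambda>w. L \<alpha> (uplus z) * L \<alpha> (uminus' w) + L \<alpha> (uplus w) * L \<alpha> (uminus' z))) (at z within \<Omega>c)" for z
    by (rule has_derivative_mult[OF has_derivative_L(1,3)])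
  have d: "der \<Omega>c ?\<Phi> z (dpp z) = - (App z ** ?\<Phi> z)" "der \<Omega>c ?\<Phi> z (d0 z) = 0" if z: "z \<in> \<Omega>c" for z
  proof -
    have c: "der \<Omega>c ?\<Phi> z v = mat (L \<alpha> (uplus z) * L \<alpha> (uminus' v) + L \<alpha> (uplus v) * L \<alpha> (uminus' z)) **
        (b (fst z, vec2 (yc z) (tc z), 0) ** \<Psi> (fst z, vec2 (yc z) (tc z), 0))"
      if "tangent z v" "fst v = 0" "(L' \<alpha> (uplus v) * L \<alpha> (uplus z) - L' \<alpha> (uplus z) * L \<alpha> (uplus v)) / (L \<alpha> (uplus z) * L \<alpha> (uplus z)) = 0" for v
      by (rule chart_compose[OF V open_chart \<Psi>(1) \<Psi>(3) has_derivative_yc[OF z] tcd z that])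
    have e: "mat 2 ** App z = 2 *\<^sub>R App z" for z using mat_of_real[of 2 "App z"] by simp
    obtain t where t: "exp t = L \<alpha> (uplus z)" "App z = mat (exp (2 * t)) ** App (pt \<alpha> (fst z) (yc z) (tc z))"
      using weight[OF App(1) _ z, of 2] App(2) by (auto simp: e)
    have tt: "exp (2 * t) = L \<alpha> (uplus z) * L \<alpha> (uplus z)" using t(1) by (simp add: exp_double power2_eq_square)
    show "der \<Omega>c ?\<Phi> z (dpp z) = - (App z ** ?\<Phi> z)"
      unfolding c[OF tangent_vertical(1) vertical_sel(1) yc_vertical(1)[OF z]] t(2)
      by (simp add: b_def vertical_sel L_simps tt mm.minus_left mm.minus_right matrix_mul_assoc)
    show "der \<Omega>c ?\<Phi> z (d0 z) = 0"
      unfolding c[OF tangent_vertical(3) vertical_sel(7) yc_vertical(2)[OF z]]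
      by (simp add: vertical_sel L_simps mat_0 mm.zero_left)
  qed
  have "frame \<Omega>c ?\<Phi>"
    by (rule frame_compose[OF \<Psi>(1) \<Psi>(2) holo_yc hs.holo_mult[OF holo_L(1)[OF hs.holo_fld_id] holo_L(3)[OF hs.holo_fld_id]]])
  with d show ?thesis by (intro exI[of _ ?\<Phi>]) blast
qed

text \<open>The solution is a product: the first factor solves the equations along
  \<open>dpp\<close> and \<open>d0\<close>; its defect n along \<open>dmm\<close> is annihilated by
  \<open>dpp\<close>, by flatness, and has weight -2. So n comes from a function of x and
  \<open>yc\<close>, and the second factor solves an equation in \<open>yc\<close> alone.\<close>

lemma chart_vertical_frame:
  fixes App N :: "'n hpoint \<Rightarrow> complex^'r^'r"
  assumes App: "holo_mat hscale \<Omega>c App" "\<And>z. z \<in> \<Omega>c \<Longrightarrow> der \<Omega>c App z (d0 z) = 2 *\<^sub>R App z"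
    and N: "holo_mat hscale \<Omega>c N" "\<And>z. z \<in> \<Omega>c \<Longrightarrow> der \<Omega>c N z (d0 z) = - (2 *\<^sub>R N z)"
    and flat: "\<And>z. z \<in> \<Omega>c \<Longrightarrow> der \<Omega>c N z (dpp z) - der \<Omega>c App z (dmm z) + comm (App z) (N z) = 0"
  shows "\<exists>\<Phi>. frame \<Omega>c \<Phi> \<and> (\<forall>z\<in>\<Omega>c. der \<Omega>c \<Phi> z (dpp z) = - (App z ** \<Phi> z) \<and> der \<Omega>c \<Phi> z (dmm z) = - (N z ** \<Phi> z) \<and> der \<Omega>c \<Phi> z (d0 z) = 0)"
proof -
  have "\<exists>\<Phi>. frame \<Omega>c \<Phi> \<and> (\<forall>z\<in>\<Omega>c. der \<Omega>c \<Phi> z (dpp z) = - (App z ** \<Phi> z) \<and> der \<Omega>c \<Phi> z (d0 z) = 0)"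
    by (rule chart_bridge[OF App])
  then obtain \<Phi> where fr: "frame \<Omega>c \<Phi>" and \<Phi>0: "\<forall>z\<in>\<Omega>c. der \<Omega>c \<Phi> z (dpp z) = - (App z ** \<Phi> z) \<and> der \<Omega>c \<Phi> z (d0 z) = 0"
    by blast
  note \<Phi> = conjunct1[OF bspec[OF \<Phi>0]] conjunct2[OF bspec[OF \<Phi>0]]
  have h: "holo_mat hscale \<Omega>c \<Phi>" and inv: "\<And>z. z \<in> \<Omega>c \<Longrightarrow> invertible (\<Phi> z)" using fr by (simp_all add: frame_def)
  have cancel: "\<Phi> z ** P = 0 \<Longrightarrow> P = 0" if "z \<in> \<Omega>c" for z and P :: "complex^'r^'r"
    using matrix_inv_left[OF inv[OF that]] by (metis matrix_mul_assoc matrix_mul_lid mm.zero_right)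
  note tv = tangent_vertical and fv = D.tangent_field_vertical
  define X where "X z = N z ** \<Phi> z + der \<Omega>c \<Phi> z (dmm z)" for z
  define n where "n z = matrix_inv (\<Phi> z) ** X z" for z
  have hd: "holo_mat hscale \<Omega>c (\<lambda>z. der \<Omega>c \<Phi> z (dmm z))" by (rule D.holo_mat_der[OF h fv(2)])
  have hX: "holo_mat hscale \<Omega>c X" unfolding X_def[abs_def] by (intro hs.holo_mat_add hs.holo_mat_mult N(1) h hd)
  have hn: "holo_mat hscale \<Omega>c n" unfolding n_def[abs_def] by (intro hs.holo_mat_mult hs.holo_matrix_inv h hX inv)
  have \<Phi>n: "\<Phi> z ** n z = X z" if "z \<in> \<Omega>c" for z
    unfolding n_def by (simp only: matrix_mul_assoc matrix_inv_right[OF inv[OF that]] matrix_mul_lid)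
  have dX: "der \<Omega>c X z v = \<Phi> z ** der \<Omega>c n z v + der \<Omega>c \<Phi> z v ** n z" if z: "z \<in> \<Omega>c" and v: "tangent z v" for z v
    using D.der_cong_mat[OF hs.holo_mat_mult[OF h hn] \<Phi>n z v] by (simp only: D.der_mult[OF h hn z v])
  have dX': "der \<Omega>c X z v = N z ** der \<Omega>c \<Phi> z v + der \<Omega>c N z v ** \<Phi> z + der \<Omega>c (\<lambda>z. der \<Omega>c \<Phi> z (dmm z)) z v" if z: "z \<in> \<Omega>c" and v: "tangent z v" for z v
    unfolding X_def[abs_def] by (simp only: D.der_add[OF hs.holo_mat_mult[OF N(1) h] hd z v] D.der_mult[OF N(1) h z v])
  have npp: "der \<Omega>c n z (dpp z) = 0" if z: "z \<in> \<Omega>c" for z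
  proof (rule cancel[OF z])
    have "der \<Omega>c (\<lambda>z. der \<Omega>c \<Phi> z (dpp z)) z (dmm z) = der \<Omega>c (\<lambda>z. - (App z ** \<Phi> z)) z (dmm z)"
      by (rule D.der_cong_mat[OF D.holo_mat_der[OF h fv(1)] \<Phi>(1) z tv(2)])
    also have "\<dots> = - (App z ** der \<Omega>c \<Phi> z (dmm z) + der \<Omega>c App z (dmm z) ** \<Phi> z)"
      by (simp only: D.der_minus[OF hs.holo_mat_mult[OF App(1) h] z tv(2)] D.der_mult[OF App(1) h z tv(2)])
    finally have "der \<Omega>c (\<lambda>z. der \<Omega>c \<Phi> z (dmm z)) z (dpp z) = - (App z ** der \<Omega>c \<Phi> z (dmm z) + der \<Omega>c App z (dmm z) ** \<Phi> z)"
      using D.der_bracket[OF h fv(1) fv(2) z] \<Phi>(2)[OF z] by (simp only: D.bracket_vertical(1)[OF z] right_minus_eq)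
    then have 1: "der \<Omega>c X z (dpp z) = - (N z ** (App z ** \<Phi> z)) + der \<Omega>c N z (dpp z) ** \<Phi> z - App z ** der \<Omega>c \<Phi> z (dmm z) - der \<Omega>c App z (dmm z) ** \<Phi> z"
      unfolding dX'[OF z tv(1)] \<Phi>(1)[OF z] by (simp add: mm.minus_right)
    have "(der \<Omega>c N z (dpp z) - der \<Omega>c App z (dmm z) + comm (App z) (N z)) ** \<Phi> z = 0" by (simp only: flat[OF z] mm.zero_left)
    then have 2: "der \<Omega>c N z (dpp z) ** \<Phi> z = der \<Omega>c App z (dmm z) ** \<Phi> z - App z ** (N z ** \<Phi> z) + N z ** (App z ** \<Phi> z)"
      by (simp add: comm_def mm.add_left mm.diff_left matrix_mul_assoc algebra_simps)
    have "der \<Omega>c X z (dpp z) = - (App z ** X z)" unfolding 1 2 by (simp add: X_def mm.add_right)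
    moreover have "der \<Omega>c X z (dpp z) = \<Phi> z ** der \<Omega>c n z (dpp z) - App z ** X z"
      unfolding dX[OF z tv(1)] \<Phi>(1)[OF z] by (simp add: mm.minus_left matrix_mul_assoc[symmetric] \<Phi>n[OF z])
    ultimately show "\<Phi> z ** der \<Omega>c n z (dpp z) = 0" by simp
  qed
  have n0: "der \<Omega>c n z (d0 z) = mat (- 2) ** n z" if z: "z \<in> \<Omega>c" for z
  proof -
    have "der \<Omega>c (\<lambda>z. der \<Omega>c \<Phi> z (d0 z)) z (dmm z) = 0" by (rule D.der_zero[OF \<Phi>(2) z tv(2)])
    then have "der \<Omega>c (\<lambda>z. der \<Omega>c \<Phi> z (dmm z)) z (d0 z) = der \<Omega>c \<Phi> z (- (2 *\<^sub>R dmm z))"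
      using D.der_bracket[OF h fv(3) fv(2) z] by (simp only: D.bracket_vertical(3)[OF z] diff_zero)
    also have "\<dots> = - (2 *\<^sub>R der \<Omega>c \<Phi> z (dmm z))"
      unfolding D.der_linear(4)[OF h z]
      using D.der_hscale[OF h z tv(2), of "of_real 2"] by (simp only: hs.sc_of_real mat_of_real)
    finally have "der \<Omega>c X z (d0 z) = - (2 *\<^sub>R X z)"
      unfolding dX'[OF z tv(3)] \<Phi>(2)[OF z] N(2)[OF z]
      by (simp add: X_def mm.zero_right mm.minus_left mm.scaleR_left scaleR_add_right)
    then have "\<Phi> z ** (der \<Omega>c n z (d0 z) + 2 *\<^sub>R n z) = 0"
      unfolding dX[OF z tv(3)] \<Phi>(2)[OF z] by (simp add: mm.zero_left mm.add_right mm.scaleR_right \<Phi>n[OF z])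
    then have "der \<Omega>c n z (d0 z) = - (2 *\<^sub>R n z)" using cancel[OF z] by (simp only: eq_neg_iff_add_eq_0)
    then show ?thesis using mat_of_real[of "- 2" "n z"] by simp
  qed
  \<comment> \<open>The flow of \<open>dpp\<close> adds multiples of u_+ to u_-, so on the slice n
    does not depend on the last coordinate.\<close>
  have nz: "\<exists>t. exp t = L \<alpha> (uplus z) \<and> n z = mat (exp (- 2 * t)) ** n (pt \<alpha> (fst z) (yc z) 0)" if z: "z \<in> \<Omega>c" for z
  proof -
    have x: "fst z \<in> V" using z by (simp add: harmonic_space_def)
    have "(fst z, vecL \<alpha> 1 (yc z), vecL \<alpha> 0 1 + t *s vecL \<alpha> 1 (yc z)) \<in> \<Omega>c" for t
      using pt_in[OF x, of \<alpha> "yc z" t] by (simp only: pt_def)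
    then have "n (fst z, vecL \<alpha> 1 (yc z), vecL \<alpha> 0 1 + t *s vecL \<alpha> 1 (yc z)) = n (fst z, vecL \<alpha> 1 (yc z), vecL \<alpha> 0 1)" for t
      by (rule D.flow_dpp[OF hn _ npp])
    then have 1: "n (pt \<alpha> (fst z) (yc z) \<tau>) = n (pt \<alpha> (fst z) (yc z) 0)" for \<tau>
      by (simp only: pt_def vector_smult_lzero add_0_right)
    have "\<exists>t. exp t = L \<alpha> (uplus z) \<and> n z = mat (exp (- 2 * t)) ** n (pt \<alpha> (fst z) (yc z) (tc z))" by (rule weight[OF hn n0 z])
    then show ?thesis by (simp only: 1[of "tc z"])
  qed
  define b where "b z = - n (pt \<alpha> (fst z) (uplus z $ 2) 0)" for z :: "'n hpoint"
  have "holo_mat hscale (fst -` V) (\<lambda>z. n (pt \<alpha> (fst z) (uplus z $ 2) 0))"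
    by (rule hs.holo_mat_compose_fld[OF hn holo_pt]) (simp_all only: holo_coord hs.holo_const, rule image_subsetI, rule pt_in, simp)
  then have "holo_mat hscale (fst -` V) b" unfolding b_def[abs_def] by (rule hs.holo_mat_minus)
  from chart_ode[OF V(1) this] obtain \<Psi> :: "'n hpoint \<Rightarrow> complex^'r^'r" where \<Psi>0: "holo_mat hscale (fst -` V) \<Psi>"
    "\<forall>z\<in>fst -` V. invertible (\<Psi> z) \<and> fd \<Psi> z (0, vec2 0 1, 0) = b z ** \<Psi> z" by blast
  note \<Psi> = \<Psi>0(1) conjunct1[OF bspec[OF \<Psi>0(2)]] conjunct2[OF bspec[OF \<Psi>0(2)]]
  let ?G = "\<lambda>z. \<Psi> (fst z, vec2 0 (yc z), 0)"
  have G: "der \<Omega>c ?G z (dpp z) = 0" "der \<Omega>c ?G z (d0 z) = 0" "der \<Omega>c ?G z (dmm z) = - (n z ** ?G z)" if z: "z \<in> \<Omega>c" for z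
  proof -
    have c: "der \<Omega>c ?G z v = mat ((L' \<alpha> (uplus v) * L \<alpha> (uplus z) - L' \<alpha> (uplus z) * L \<alpha> (uplus v)) / (L \<alpha> (uplus z) * L \<alpha> (uplus z))) **
        (b (fst z, vec2 0 (yc z), 0) ** \<Psi> (fst z, vec2 0 (yc z), 0))" if "tangent z v" "fst v = 0" for v
      by (rule chart_compose[OF V open_chart \<Psi>(1) \<Psi>(3) has_derivative_const has_derivative_yc[OF z] z that refl])
    show "der \<Omega>c ?G z (dpp z) = 0"
      unfolding c[OF tv(1) vertical_sel(1)] yc_vertical(1)[OF z] by (simp only: mat_0 mm.zero_left)
    show "der \<Omega>c ?G z (d0 z) = 0"
      unfolding c[OF tv(3) vertical_sel(7)] yc_vertical(2)[OF z] by (simp only: mat_0 mm.zero_left)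
    obtain t where t: "exp t = L \<alpha> (uplus z)" "n z = mat (exp (- 2 * t)) ** n (pt \<alpha> (fst z) (yc z) 0)" using nz[OF z] by (elim exE conjE)
    \<comment> \<open>Weight -2 gives the factor u^{-2} with u =
      \<open>L \<alpha> (uplus z)\<close>, and the derivative of \<open>yc\<close> along
      \<open>dmm\<close> is the same factor.\<close>
    have "exp (- 2 * t) = inverse (exp (2 * t))" by (simp add: exp_minus)
    also have "\<dots> = 1 / (L \<alpha> (uplus z))^2" by (simp only: exp_double t(1) inverse_eq_divide)
    finally show "der \<Omega>c ?G z (dmm z) = - (n z ** ?G z)"
      unfolding c[OF tv(2) vertical_sel(4)] yc_vertical(3)[OF z] t(2)
      by (simp add: b_def mm.minus_left mm.minus_right matrix_mul_assoc)
  qed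
  have frG: "frame \<Omega>c ?G" by (rule frame_compose[OF \<Psi>(1) \<Psi>(2) hs.holo_const holo_yc])
  then have hG: "holo_mat hscale \<Omega>c ?G" by (simp add: frame_def)
  have "frame \<Omega>c (\<lambda>z. \<Phi> z ** ?G z)"
    using fr frG hs.holo_mat_mult[OF h hG] by (simp add: frame_def invertible_mult)
  moreover have "der \<Omega>c (\<lambda>z. \<Phi> z ** ?G z) z (dpp z) = - (App z ** (\<Phi> z ** ?G z)) \<and> der \<Omega>c (\<lambda>z. \<Phi> z ** ?G z) z (dmm z) = - (N z ** (\<Phi> z ** ?G z))
      \<and> der \<Omega>c (\<lambda>z. \<Phi> z ** ?G z) z (d0 z) = 0" if z: "z \<in> \<Omega>c" for z
  proof -
    have "\<Phi> z ** (n z ** ?G z) = (N z ** \<Phi> z + der \<Omega>c \<Phi> z (dmm z)) ** ?G z"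
      by (simp only: matrix_mul_assoc \<Phi>n[OF z] X_def)
    then show ?thesis
      by (simp only: D.der_mult[OF h hG z tv(1)] D.der_mult[OF h hG z tv(2)] D.der_mult[OF h hG z tv(3)] G[OF z] \<Phi>[OF z])
        (simp add: mm_simps matrix_mul_assoc)
  qed
  ultimately show ?thesis by (intro exI[of _ "\<lambda>z. \<Phi> z ** ?G z"] conjI ballI) simp_all
qed

end

end

section \<open>Gluing the two charts\<close>

lemma holo_mat_cover:
  assumes f: "holo_mat hscale (S \<inter> W) f" "holo_mat hscale (S \<inter> W') f" and W: "open W" "open W'" and S: "S \<subseteq> W \<union> W'"
  shows "holo_mat hscale S f"
proof -
  have "holo hscale S g" if "holo hscale (S \<inter> W) g" "holo hscale (S \<inter> W') g" for g :: "'a hpoint \<Rightarrow> complex"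
    unfolding holo_def
  proof
    fix z assume z: "z \<in> S"
    have at: "at z within S \<inter> T' = at z within S" if "open T'" "z \<in> T'" for T'
      by (rule at_within_nhd[OF that(2,1)]) blast
    have "z \<in> W \<or> z \<in> W'" using z S by blast
    then show "\<exists>L. (g has_derivative L) (at z within S) \<and> (\<forall>c w. L (hscale c w) = c * L w)"
    proof
      assume "z \<in> W"
      then show ?thesis using that(1) z at[OF W(1)] unfolding holo_def by (metis IntI)
    next
      assume "z \<in> W'"
      then show ?thesis using that(2) z at[OF W(2)] unfolding holo_def by (metis IntI)
    qed
  qed
  then show ?thesis using f by (simp add: holo_mat_def)
qed

context spin_manifold
begin

text \<open>Over a fixed x three flows connect any point of the overlap to the base point:
  \<open>d0\<close> scales u_+^1 to 1, \<open>dpp\<close> normalises u_-, and \<open>dmm\<close>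
  moves u_+^2 to 1.\<close>

lemma overlap_constant:
  fixes K :: "'n hpoint \<Rightarrow> complex^'r^'r"
  assumes V: "open V" "V \<subseteq> M"
  defines "O' \<equiv> harmonic_space V \<inter> (chart 1 \<inter> chart 2)"
  assumes K: "holo_mat hscale O' K" and K0: "\<And>z v. z \<in> O' \<Longrightarrow> v \<in> {dpp, dmm, d0} \<Longrightarrow> der O' K z (v z) = 0" and z: "z \<in> O'"
  shows "K z = K (fst z, vec2 1 1, vec2 0 1)"
proof -
  interpret E: spin_domain M aE aH \<omega> \<sigma> h O' unfolding O'_def by (rule spin_domain_Int[OF V open_Int[OF open_chart open_chart]])
  have inO: "w \<in> O' \<longleftrightarrow> fst w \<in> V \<and> dt w = 1 \<and> uplus w $ 1 \<noteq> 0 \<and> uplus w $ 2 \<noteq> 0" for w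
    by (simp only: O'_def Int_iff harmonic_space_iff chart_def mem_Collect_eq conj_assoc)
  define x a b where "x = fst z" and "a = uplus z $ 1" and "b = uplus z $ 2"
  have x: "x \<in> V" and nz: "a \<noteq> 0" "b \<noteq> 0" and d: "a * uminus' z $ 2 - b * uminus' z $ 1 = 1"
    using z by (simp_all add: inO x_def a_def b_def dt_def)
  define t where "t = Ln a"
  have t: "exp t = a" "exp (- t) = inverse a" using nz(1) by (simp_all add: t_def exp_minus)
  define s where "s = Ln (b / a)"
  have s: "exp s = b / a" using nz by (simp add: s_def)
  have m0: "mat (0::complex) ** P = 0" for P :: "complex^'r^'r" by (simp only: mat_0 mm.zero_left)
  let ?p = "vec2 1 (b / a)" and ?q = "a *s uminus' z"
  have "uplus z = exp t *s ?p" "uminus' z = exp (- t) *s ?q"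
    using nz by (simp_all add: t vec_eq_iff forall_2 a_def b_def)
  then have ze: "z = (x, exp t *s ?p, exp (- t) *s ?q)" by (simp only: prod_eq_iff fst_conv snd_conv x_def)
  have "(x, exp r *s ?p, exp (- r) *s ?q) \<in> O'" for r
  proof -
    have "exp r * exp (- r) = 1" by (simp add: exp_minus)
    then have "dt (x, exp r *s ?p, exp (- r) *s ?q) = 1 * (a * uminus' z $ 2) - b / a * (a * uminus' z $ 1)"
      unfolding dt_def by simp algebra
    also have "\<dots> = 1" using nz d by simp
    finally show ?thesis using x nz by (simp add: inO)
  qed
  then have "K (x, exp t *s ?p, exp (- t) *s ?q) = mat (exp (0 * t)) ** K (x, ?p, ?q)"
    by (rule E.flow_d0[OF K]) (simp only: K0 m0 insert_iff simp_thms)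
  then have 1: "K z = K (x, ?p, ?q)" by (simp only: ze[symmetric] mult_zero_left exp_zero matrix_mul_lid)
  have q: "?q = vec2 0 1 + (a * uminus' z $ 1) *s ?p"
    using nz d by (simp add: vec_eq_iff forall_2 eq_diff_eq diff_eq_eq mult.commute)
  have "(x, ?p, vec2 0 1 + r *s ?p) \<in> O'" for r
    using x nz by (simp add: inO dt_def algebra_simps)
  then have 2: "K (x, ?p, ?q) = K (x, ?p, vec2 0 1)"
    unfolding q by (rule E.flow_dpp[OF K]) (simp only: K0 insert_iff simp_thms)
  \<comment> \<open>The second coordinate of u_+ must not vanish on the way, hence the exponential
    curve; its velocity is e^r times \<open>dmm\<close>.\<close>
  let ?g = "\<lambda>r. (x, vec2 1 (exp r), vec2 0 1) :: 'n hpoint"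
  have g: "?g r \<in> O'" for r using x by (simp add: inO dt_def)
  have "((\<lambda>r. vec2 1 (exp r)) has_derivative (\<lambda>k. vec2 0 (k * exp r))) (at r)" for r :: complex
  proof (rule has_derivative_vec)
    fix i :: 2
    have "(exp has_field_derivative exp r) (at r)" by (rule DERIV_exp)
    then have "(exp has_derivative (\<lambda>k. k * exp r)) (at r)"
      unfolding has_field_derivative_def by (rule has_derivative_eq_rhs) (simp add: fun_eq_iff mult.commute)
    then show "((\<lambda>r. vec2 1 (exp r) $ i) has_derivative (\<lambda>k. vec2 0 (k * exp r) $ i)) (at r)"
      using exhaust_2[of i] by (elim disjE) simp_all
  qed
  then have "(?g has_derivative (\<lambda>k. (0, vec2 0 (k * exp r), 0))) (at r)" for r
    by (intro has_derivative_Pair has_derivative_const)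
  moreover have "(0, vec2 0 (k * exp r), 0) = hscale k (hscale (exp r) (dmm (?g r)))" for k r
    by (simp add: hscale_def dmm_def vec_eq_iff forall_2)
  ultimately have g': "(?g has_derivative (\<lambda>k. hscale k (hscale (exp r) (dmm (?g r))))) (at r)" for r by (simp only:)
  have "der O' K (?g r) (hscale (exp r) (dmm (?g r))) = mat 0 ** K (?g r)" for r
  proof -
    have "der O' K (?g r) (dmm (?g r)) = 0" by (rule K0[OF g]) simp
    then show ?thesis by (simp only: E.der_hscale[OF K g tangent_vertical(2)] m0 mm.zero_right)
  qed
  from E.flow[OF K g g' tangent_linear(3)[OF tangent_vertical(2)] this, of s]
  have "K (x, ?p, vec2 0 1) = K (x, vec2 1 1, vec2 0 1)" by (simp add: s)
  then show ?thesis using 1 2 by (simp only: x_def)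
qed

text \<open>The transition matrix of the two chart solutions is constant on fibres, so it extends
  from the overlap to the second chart as a function of x. Multiplying the second solution by it
  makes the two agree.\<close>

theorem vertical_frame:
  fixes App N :: "'n hpoint \<Rightarrow> complex^'r^'r"
  assumes V: "open V" "V \<subseteq> M"
  defines "S \<equiv> harmonic_space V"
  assumes App: "holo_mat hscale S App" "\<And>z. z \<in> S \<Longrightarrow> der S App z (d0 z) = 2 *\<^sub>R App z"
    and N: "holo_mat hscale S N" "\<And>z. z \<in> S \<Longrightarrow> der S N z (d0 z) = - (2 *\<^sub>R N z)"
    and flat: "\<And>z. z \<in> S \<Longrightarrow> der S N z (dpp z) - der S App z (dmm z) + comm (App z) (N z) = 0"
  shows "\<exists>\<Phi>. frame S \<Phi> \<and> (\<forall>z\<in>S. der S \<Phi> z (dpp z) = - (App z ** \<Phi> z) \<and> der S \<Phi> z (dmm z) = - (N z ** \<Phi> z) \<and> der S \<Phi> z (d0 z) = 0)"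
proof -
  \<comment> \<open>The three equations are treated as one, indexed by the vertical field; this
    requires \<open>dpp\<close>, \<open>dmm\<close> and \<open>d0\<close> to be distinct
    functions.\<close>
  define C where "C v z = (if v = dpp then App z else if v = dmm then N z else 0)" for v :: "'n hpoint \<Rightarrow> 'n hpoint" and z
  have p: "dpp p = (0, 0, vec2 1 0)" "dmm p = (0, 0, 0)" "d0 p = (0, vec2 1 0, 0)" if "p = (0, vec2 1 0, 0)" for p :: "'n hpoint"
    unfolding that by (simp_all add: dpp_def dmm_def d0_def)
  have n0: "vec2 1 0 \<noteq> 0" by (simp add: vec_eq_iff forall_2)
  have ne: "dmm \<noteq> (dpp :: 'n hpoint \<Rightarrow> _)" "d0 \<noteq> (dpp :: 'n hpoint \<Rightarrow> _)" "d0 \<noteq> (dmm :: 'n hpoint \<Rightarrow> _)"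
    using p[OF refl] n0 by (metis prod.inject)+
  have Cs: "C dpp z = App z" "C dmm z = N z" "C d0 z = 0" for z by (simp_all add: C_def ne)
  have eqs: "(\<forall>v\<in>{dpp, dmm, d0}. X v = - (C v z ** P)) \<longleftrightarrow> X dpp = - (App z ** P) \<and> X dmm = - (N z ** P) \<and> X d0 = 0"
    for X :: "('n hpoint \<Rightarrow> 'n hpoint) \<Rightarrow> complex^'r^'r" and P z
    by (simp add: Cs mm.zero_left)
  have tv: "tangent z (v z)" "fst (v z) = 0" if "v \<in> {dpp, dmm, d0}" for v and z :: "'n hpoint"
    using that by (elim insertE emptyE; simp only: tangent_vertical vertical_sel)+
  have ex: "\<exists>\<Phi> :: 'n hpoint \<Rightarrow> complex^'r^'r. frame (S \<inter> chart \<alpha>) \<Phi> \<and>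
      (\<forall>z\<in>S \<inter> chart \<alpha>. \<forall>v\<in>{dpp, dmm, d0}. der (S \<inter> chart \<alpha>) \<Phi> z (v z) = - (C v z ** \<Phi> z))" for \<alpha>
  proof -
    have D: "der (S \<inter> chart \<alpha>) f z = der S f z" if "z \<in> S \<inter> chart \<alpha>" for f :: "'n hpoint \<Rightarrow> complex^'r^'r" and z
      by (rule der_Int[OF open_chart IntD2[OF that]])
    have "\<exists>\<Phi>. frame (S \<inter> chart \<alpha>) \<Phi> \<and> (\<forall>z\<in>S \<inter> chart \<alpha>. der (S \<inter> chart \<alpha>) \<Phi> z (dpp z) = - (App z ** \<Phi> z) \<and>
        der (S \<inter> chart \<alpha>) \<Phi> z (dmm z) = - (N z ** \<Phi> z) \<and> der (S \<inter> chart \<alpha>) \<Phi> z (d0 z) = 0)"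
    proof (rule chart_vertical_frame[OF V, folded S_def])
      show "holo_mat hscale (S \<inter> chart \<alpha>) App" "holo_mat hscale (S \<inter> chart \<alpha>) N"
        by (rule hs.holo_mat_subset[OF App(1)], rule Int_lower1) (rule hs.holo_mat_subset[OF N(1)], rule Int_lower1)
      fix z assume z: "z \<in> S \<inter> chart \<alpha>"
      show "der (S \<inter> chart \<alpha>) App z (d0 z) = 2 *\<^sub>R App z" unfolding D[OF z] by (rule App(2)[OF IntD1[OF z]])
      show "der (S \<inter> chart \<alpha>) N z (d0 z) = - (2 *\<^sub>R N z)" unfolding D[OF z] by (rule N(2)[OF IntD1[OF z]])
      show "der (S \<inter> chart \<alpha>) N z (dpp z) - der (S \<inter> chart \<alpha>) App z (dmm z) + comm (App z) (N z) = 0"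
        unfolding D[OF z] by (rule flat[OF IntD1[OF z]])
    qed
    then show ?thesis by (simp only: eqs)
  qed
  obtain \<Phi>1 :: "'n hpoint \<Rightarrow> complex^'r^'r" where f1: "frame (S \<inter> chart 1) \<Phi>1"
    and d1: "\<forall>z\<in>S \<inter> chart 1. \<forall>v\<in>{dpp, dmm, d0}. der (S \<inter> chart 1) \<Phi>1 z (v z) = - (C v z ** \<Phi>1 z)" using ex[of 1] by blast
  obtain \<Phi>2 :: "'n hpoint \<Rightarrow> complex^'r^'r" where f2: "frame (S \<inter> chart 2) \<Phi>2"
    and d2: "\<forall>z\<in>S \<inter> chart 2. \<forall>v\<in>{dpp, dmm, d0}. der (S \<inter> chart 2) \<Phi>2 z (v z) = - (C v z ** \<Phi>2 z)" using ex[of 2] by blast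
  define O' :: "'n hpoint set" where "O' = S \<inter> (chart 1 \<inter> chart 2)"
  have oO: "open (chart 1 \<inter> chart 2 :: 'n hpoint set)" by (rule open_Int[OF open_chart open_chart])
  interpret E: spin_domain M aE aH \<omega> \<sigma> h O' unfolding O'_def S_def by (rule spin_domain_Int[OF V oO])
  interpret D1: spin_domain M aE aH \<omega> \<sigma> h "S \<inter> chart 1" unfolding S_def by (rule spin_domain_Int[OF V open_chart])
  interpret D2: spin_domain M aE aH \<omega> \<sigma> h "S \<inter> chart 2" unfolding S_def by (rule spin_domain_Int[OF V open_chart])
  have sub: "O' \<subseteq> S \<inter> chart 1" "O' \<subseteq> S \<inter> chart 2" by (auto simp only: O'_def)
  have h1: "holo_mat hscale (S \<inter> chart 1) \<Phi>1" and h2: "holo_mat hscale (S \<inter> chart 2) \<Phi>2" using f1 f2 by (simp_all add: frame_def)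
  have i1: "z \<in> S \<inter> chart 1 \<Longrightarrow> invertible (\<Phi>1 z)" and i2: "z \<in> S \<inter> chart 2 \<Longrightarrow> invertible (\<Phi>2 z)" for z
    using f1 f2 unfolding frame_def by blast+
  note hO = hs.holo_mat_subset[OF h1 sub(1)] hs.holo_mat_subset[OF h2 sub(2)]
  define K where "K z = matrix_inv (\<Phi>2 z) ** \<Phi>1 z" for z
  have hK: "holo_mat hscale O' K"
    unfolding K_def[abs_def] by (rule hs.holo_mat_mult[OF hs.holo_matrix_inv[OF hO(2)] hO(1)]) (rule i2[OF subsetD[OF sub(2)]])
  have \<Phi>K: "\<Phi>2 z ** K z = \<Phi>1 z" if "z \<in> O'" for z
    unfolding K_def by (simp only: matrix_mul_assoc matrix_inv_right[OF i2[OF subsetD[OF sub(2) that]]] matrix_mul_lid)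
  have dO: "der O' \<Phi>1 z = der (S \<inter> chart 1) \<Phi>1 z" "der O' \<Phi>2 z = der (S \<inter> chart 2) \<Phi>2 z" if "z \<in> O'" for z
  proof -
    have z: "z \<in> chart 1" "z \<in> chart 2" using that by (simp_all only: O'_def Int_iff)
    show "der O' \<Phi>1 z = der (S \<inter> chart 1) \<Phi>1 z"
      unfolding O'_def der_Int[OF oO IntI[OF z]] der_Int[OF open_chart z(1)] ..
    show "der O' \<Phi>2 z = der (S \<inter> chart 2) \<Phi>2 z"
      unfolding O'_def der_Int[OF oO IntI[OF z]] der_Int[OF open_chart z(2)] ..
  qed
  \<comment> \<open>Both frames satisfy the same linear equations, so their quotient has derivative
    zero in the vertical directions.\<close>
  have K0: "der O' K z (v z) = 0" if z: "z \<in> O'" and v: "v \<in> {dpp, dmm, d0}" for z v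
  proof -
    have "der O' (\<lambda>z. \<Phi>2 z ** K z) z (v z) = der O' \<Phi>1 z (v z)"
      by (rule E.der_cong_mat[OF hs.holo_mat_mult[OF hO(2) hK] \<Phi>K z tv(1)[OF v]])
    then have "\<Phi>2 z ** der O' K z (v z) - C v z ** (\<Phi>2 z ** K z) = - (C v z ** \<Phi>1 z)"
      unfolding E.der_mult[OF hO(2) hK z tv(1)[OF v]] dO[OF z] bspec[OF bspec[OF d1 subsetD[OF sub(1) z]] v] bspec[OF bspec[OF d2 subsetD[OF sub(2) z]] v]
      by (simp add: mm.minus_left matrix_mul_assoc)
    then have "\<Phi>2 z ** der O' K z (v z) = 0" by (simp add: \<Phi>K[OF z])
    then have "matrix_inv (\<Phi>2 z) ** (\<Phi>2 z ** der O' K z (v z)) = 0" by (simp only: mm.zero_right)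
    then show ?thesis by (simp only: matrix_mul_assoc matrix_inv_left[OF i2[OF subsetD[OF sub(2) z]]] matrix_mul_lid)
  qed
  \<comment> \<open>A point of the overlap above each x, depending holomorphically on x; evaluating
    K there defines the extension.\<close>
  define c where "c x = (x, vec2 1 1, vec2 0 1)" for x :: "complex^'n"
  have Kc: "K z = K (c (fst z))" if "z \<in> O'" for z
    unfolding c_def by (rule overlap_constant[OF V, folded S_def, folded O'_def, OF hK _ that]) (rule K0, assumption, assumption)
  have cO: "c (fst z) \<in> O'" if "z \<in> S" for z :: "'n hpoint"
    using that by (simp add: O'_def S_def c_def chart_def harmonic_space_iff dt_def)
  let ?k = "\<lambda>z. K (c (fst z))" and ?S2 = "S \<inter> chart 2"
  have r: "(\<lambda>z. c (fst z)) ` ?S2 \<subseteq> O'" by (rule image_subsetI) (rule cO[OF IntD1])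
  have hk: "holo_mat hscale ?S2 ?k"
    by (rule hs.holo_mat_compose_fld[OF hK _ r]) (rule holo_fldI, simp_all add: c_def)
  have dk: "der ?S2 ?k z (v z) = 0" if z: "z \<in> ?S2" and v: "v \<in> {dpp, dmm, d0}" for z v
  proof -
    have cd: "((\<lambda>z. c (fst z)) has_derivative (\<lambda>w. (fst w, 0, 0))) (at z within ?S2)"
      unfolding c_def by (intro has_derivative_Pair has_derivative_const has_derivative_fst has_derivative_ident)
    note Kd = E.has_derivative_holo_mat[OF hK cO[OF IntD1[OF z]]]
    have "der ?S2 ?k z (v z) = der O' K (c (fst z)) (fst (v z), 0, 0)"
      by (rule D2.der_eqI[OF has_derivative_in_compose[OF cd has_derivative_subset[OF Kd r]] z tv(1)[OF v]])
    then show ?thesis using E.der_linear(3)[OF hK cO[OF IntD1[OF z]]] by (simp add: tv(2)[OF v] zero_prod_def)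
  qed
  let ?Q = "\<lambda>z. \<Phi>2 z ** ?k z"
  define \<Phi> where "\<Phi> z = (if uplus z $ 1 \<noteq> 0 then \<Phi>1 z else ?Q z)" for z
  have e1: "\<Phi>1 z = \<Phi> z" if "z \<in> S \<inter> chart 1" for z using that by (simp add: \<Phi>_def chart_def)
  have e2: "?Q z = \<Phi> z" if z: "z \<in> ?S2" for z
  proof (cases "uplus z $ 1 \<noteq> 0")
    case True
    then have "z \<in> O'" using z by (simp add: O'_def chart_def)
    then show ?thesis using True \<Phi>K[of z] Kc[of z] by (simp add: \<Phi>_def)
  qed (simp add: \<Phi>_def)
  have hQ: "holo_mat hscale ?S2 ?Q" by (rule hs.holo_mat_mult[OF h2 hk])
  have cover: "S \<subseteq> chart 1 \<union> chart 2"
  proof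
    fix z assume "z \<in> S"
    then have "dt z = 1" by (simp add: S_def harmonic_space_iff)
    then show "z \<in> chart 1 \<union> chart 2" by (auto simp: chart_def dt_def)
  qed
  have "holo_mat hscale S \<Phi>"
    by (rule holo_mat_cover[OF hs.holo_mat_cong[OF h1 e1] hs.holo_mat_cong[OF hQ e2] open_chart open_chart cover])
  moreover have P: "invertible (\<Phi> z) \<and> (\<forall>v\<in>{dpp, dmm, d0}. der S \<Phi> z (v z) = - (C v z ** \<Phi> z))" if z: "z \<in> S" for z
  proof -
    have "z \<in> chart 1 \<or> z \<in> chart 2" using subsetD[OF cover z] by (simp only: Un_iff)
    then show "invertible (\<Phi> z) \<and> (\<forall>v\<in>{dpp, dmm, d0}. der S \<Phi> z (v z) = - (C v z ** \<Phi> z))"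
    proof
      assume c1: "z \<in> chart 1"
      note z1 = IntI[OF z c1]
      have dd: "der S \<Phi> z (v z) = - (C v z ** \<Phi> z)" if v: "v \<in> {dpp, dmm, d0}" for v
      proof -
        have "der S \<Phi> z (v z) = der (S \<inter> chart 1) \<Phi>1 z (v z)"
          unfolding der_Int[OF open_chart c1, where S = S and f = \<Phi>, symmetric] by (rule D1.der_cong_mat[OF h1 e1 z1 tv(1)[OF v], symmetric])
        then show ?thesis using bspec[OF bspec[OF d1 z1] v] by (simp only: e1[OF z1])
      qed
      have "invertible (\<Phi> z)" using i1[OF z1] by (simp only: e1[OF z1])
      then show ?thesis by (intro conjI ballI dd)
    next
      assume c2: "z \<in> chart 2"
      note z2 = IntI[OF z c2]
      have dd: "der S \<Phi> z (v z) = - (C v z ** \<Phi> z)" if v: "v \<in> {dpp, dmm, d0}" for v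
      proof -
        have "der S \<Phi> z (v z) = der ?S2 ?Q z (v z)"
          unfolding der_Int[OF open_chart c2, where S = S and f = \<Phi>, symmetric] by (rule D2.der_cong_mat[OF hQ e2 z2 tv(1)[OF v], symmetric])
        also have "\<dots> = - (C v z ** \<Phi>2 z) ** ?k z"
          unfolding D2.der_mult[OF h2 hk z2 tv(1)[OF v]] dk[OF z2 v] bspec[OF bspec[OF d2 z2] v] by (simp add: mm.zero_right)
        finally show ?thesis by (simp only: e2[OF z2, symmetric] mm.minus_left matrix_mul_assoc)
      qed
      have "invertible (?k z)"
      proof -
        note o = cO[OF z]
        have "invertible (matrix_inv (\<Phi>2 (c (fst z))))"
          using matrix_inv_right[OF i2[OF subsetD[OF sub(2) o]]] matrix_inv_left[OF i2[OF subsetD[OF sub(2) o]]] unfolding invertible_def by blast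
        then show ?thesis unfolding K_def by (rule invertible_mult[OF _ i1[OF subsetD[OF sub(1) o]]])
      qed
      then have "invertible (?Q z)" by (rule invertible_mult[OF i2[OF z2]])
      then have "invertible (\<Phi> z)" by (simp only: e2[OF z2])
      then show ?thesis by (intro conjI ballI dd)
    qed
  qed
  ultimately have "frame S \<Phi> \<and> (\<forall>z\<in>S. \<forall>v\<in>{dpp, dmm, d0}. der S \<Phi> z (v z) = - (C v z ** \<Phi> z))"
    unfolding frame_def by (intro conjI ballI conjunct1[OF P] bspec[OF conjunct2[OF P]])
  then show ?thesis unfolding eqs by (rule exI[of _ \<Phi>])
qed

end

context analytic_connection
begin

text \<open>The components F(\<open>d0\<close>, \<open>dmm\<close>) and F(\<open>dpp\<close>,
  \<open>dmm\<close>) in the analytic frame; the bracket of \<open>dpp\<close> and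
  \<open>dmm\<close> is \<open>d0\<close>, on which the form vanishes.\<close>

lemma vertical_equations:
  assumes z: "z \<in> \<Omega>"
  shows "der \<Omega> (\<lambda>y. B y (dmm y)) z (d0 z) = - (2 *\<^sub>R B z (dmm z))"
    "der \<Omega> (\<lambda>y. B y (dmm y)) z (dpp z) - der \<Omega> App z (dmm z) + comm (App z) (B z (dmm z)) = 0"
proof -
  have z0: "der \<Omega> (\<lambda>y. B y (d0 y)) z (dmm z) = 0" by (rule der_zero[OF B_d0 z tangent_vertical(2)])
  have "curvature \<Omega> B d0 dmm z = 0"
    unfolding B.curvature_eq[OF tangent_field_vertical(3,2) z] by (rule curv_B_vertical[OF z]) simp_all
  then show "der \<Omega> (\<lambda>y. B y (dmm y)) z (d0 z) = - (2 *\<^sub>R B z (dmm z))"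
    unfolding curvature_def z0 B_d0[OF z] comm_simps(6) bracket_vertical(3)[OF z] scaleR_minus_left[symmetric] B.A_scaleR[OF z tangent_vertical(2)]
    by (simp add: eq_neg_iff_add_eq_0)
  have "curvature \<Omega> B dpp dmm z = 0"
    unfolding B.curvature_eq[OF tangent_field_vertical(1,2) z] by (rule curv_B_vertical[OF z]) simp_all
  then show "der \<Omega> (\<lambda>y. B y (dmm y)) z (dpp z) - der \<Omega> App z (dmm z) + comm (App z) (B z (dmm z)) = 0"
    unfolding curvature_def bracket_vertical(1)[OF z] B_d0[OF z] App_def[symmetric] by simp
qed

text \<open>Over a full preimage of V the set contains whole fibres, so
  \<open>vertical_frame\<close> provides one frame \<Phi> on all of \<Omega>.\<close>

lemma global_bridge:
  assumes V: "open V" "V \<subseteq> M" "\<Omega> = harmonic_space V"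
  shows "\<exists>App \<Phi>. prepotential \<sigma> h \<Omega> App \<and> solves_bridge \<Omega> App \<Phi> \<and> has_potentials \<sigma> h \<Omega> App \<Phi> (potential \<Omega> \<psi> A)"
proof -
  have hA: "holo_mat hscale \<Omega> App" and A0: "z \<in> \<Omega> \<Longrightarrow> der \<Omega> App z (d0 z) = 2 *\<^sub>R App z" for z
    using prepotential_App by (simp_all add: prepotential_def)
  have "\<exists>\<Phi>. frame \<Omega> \<Phi> \<and> (\<forall>z\<in>\<Omega>. der \<Omega> \<Phi> z (dpp z) = - (App z ** \<Phi> z) \<and> der \<Omega> \<Phi> z (dmm z) = - (B z (dmm z) ** \<Phi> z) \<and> der \<Omega> \<Phi> z (d0 z) = 0)"
    unfolding V(3)
    by (rule vertical_frame[OF V(1,2), folded V(3), OF hA A0 B.A_holo[OF tangent_field_vertical(2)] vertical_equations, unfolded V(3)])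
  then obtain \<Phi> :: "'n hpoint \<Rightarrow> complex^'r^'r" where \<Phi>: "frame \<Omega> \<Phi>"
    "\<forall>z\<in>\<Omega>. der \<Omega> \<Phi> z (dpp z) = - (App z ** \<Phi> z) \<and> der \<Omega> \<Phi> z (dmm z) = - (B z (dmm z) ** \<Phi> z) \<and> der \<Omega> \<Phi> z (d0 z) = 0" by blast
  have "der \<Omega> \<Phi> z (v z) + B z (v z) ** \<Phi> z = 0" if z: "z \<in> \<Omega>" and v: "v \<in> {dpp, dmm, d0}" for z v
    using v bspec[OF \<Phi>(2) z] by (elim insertE emptyE) (simp_all add: App_def B_d0[OF z] mm.zero_left)
  then have "prepotential \<sigma> h \<Omega> App \<and> solves_bridge \<Omega> App \<Phi> \<and> has_potentials \<sigma> h \<Omega> App \<Phi> (potential \<Omega> \<psi> A)"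
    by (rule potentials[OF \<Phi>(1)])
  then show ?thesis by (intro exI)
qed

end

theorem theorem7:
  fixes M V :: "(complex^'n) set"
    and aE :: "complex^'n \<Rightarrow> complex^'p^'p^'n"
    and aH :: "complex^'n \<Rightarrow> complex^2^2^'n"
    and \<omega> :: "complex^'n \<Rightarrow> complex^2^2"
    and \<sigma> :: "complex^'n \<Rightarrow> complex^2^2^2^'p^'n"
    and h :: "2 \<Rightarrow> complex^'n \<Rightarrow> complex^2"
    and U :: "('n hpoint) set"
  assumes M: "half_flat_grassmann M aE aH \<omega> \<sigma>"
    and h: "symplectic_frame M aH \<omega> h"
    and adm: "zero_admissible M aE aH \<sigma> h"
    and V: "V \<subseteq> M" "open V" "V \<noteq> {}" "connected V" "simply_connected V"
    and U: "U = fst -` V \<inter> harmonic_space M"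
  shows "
    \<comment> \<open>existence of \<open>\<Phi>\<close> over each of the two sets \<open>u\<^sub>+\<^sup>\<alpha> \<noteq> 0\<close>, which cover \<open>U\<close>\<close>
    (\<forall>App :: 'n hpoint \<Rightarrow> complex^'r^'r. prepotential \<sigma> h U App \<longrightarrow>
       (\<forall>\<alpha>. \<exists>\<Phi>. solves_bridge {z\<in>U. uplus z $ \<alpha> \<noteq> 0} App \<Phi>)) \<and>
    \<comment> \<open>the pair determines a connection (over \<open>U\<close> if \<open>\<Phi>\<close> is defined on \<open>U\<close>)\<close>
    (\<forall>(App :: 'n hpoint \<Rightarrow> complex^'r^'r) \<Phi> \<Omega>.
       prepotential \<sigma> h U App \<and> openin (top_of_set (harmonic_space M)) \<Omega> \<and> \<Omega> \<subseteq> U \<and>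
       solves_bridge \<Omega> App \<Phi> \<longrightarrow>
       (\<exists>A. connection \<Omega> A \<and> almost_0_partially_flat \<sigma> h \<Omega> A \<and>
            analytic_frame \<sigma> h \<Omega> A (\<lambda>_. mat 1) \<and> has_potentials \<sigma> h \<Omega> App \<Phi> A \<and>
            (\<forall>A'. connection \<Omega> A' \<and> has_potentials \<sigma> h \<Omega> App \<Phi> A' \<longrightarrow>
                 (\<forall>z\<in>\<Omega>. \<forall>w. tangent z w \<longrightarrow> A' z w = A z w)))) \<and>
    \<comment> \<open>converse: analytic frames exist locally, and in any of them the connection is locally of this form\<close>
    (\<forall>W (A :: 'n hpoint \<Rightarrow> 'n hpoint \<Rightarrow> complex^'r^'r).
       openin (top_of_set (harmonic_space M)) W \<and> connection W A \<and> almost_0_partially_flat \<sigma> h W A \<longrightarrow>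
       (\<forall>z\<in>W. \<exists>\<Omega> \<psi>. z \<in> \<Omega> \<and> \<Omega> \<subseteq> W \<and> openin (top_of_set (harmonic_space M)) \<Omega> \<and>
            analytic_frame \<sigma> h \<Omega> A \<psi>) \<and>
       (\<forall>\<Omega> \<psi>. openin (top_of_set (harmonic_space M)) \<Omega> \<and> \<Omega> \<subseteq> W \<and> analytic_frame \<sigma> h \<Omega> A \<psi> \<longrightarrow>
            (\<forall>z\<in>\<Omega>. \<exists>\<Omega>' App \<Phi>. z \<in> \<Omega>' \<and> \<Omega>' \<subseteq> \<Omega> \<and> openin (top_of_set (harmonic_space M)) \<Omega>' \<and>
                 prepotential \<sigma> h \<Omega>' App \<and> solves_bridge \<Omega>' App \<Phi> \<and>
                 has_potentials \<sigma> h \<Omega>' App \<Phi> (potential \<Omega>' \<psi> A)))) \<and>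
    \<comment> \<open>converse over \<open>U\<close>: in any analytic frame over \<open>U\<close> the connection is of this form on all of \<open>U\<close>\<close>
    (\<forall>(A :: 'n hpoint \<Rightarrow> 'n hpoint \<Rightarrow> complex^'r^'r) \<psi>.
       connection U A \<and> almost_0_partially_flat \<sigma> h U A \<and> analytic_frame \<sigma> h U A \<psi> \<longrightarrow>
       (\<exists>App \<Phi>. prepotential \<sigma> h U App \<and> solves_bridge U App \<Phi> \<and>
            has_potentials \<sigma> h U App \<Phi> (potential U \<psi> A)))"
proof (intro conjI allI impI)
  have sm: "spin_manifold M aE aH \<omega> \<sigma> h" by (rule spin_manifold.intro[OF M h adm])
  interpret spin_manifold M aE aH \<omega> \<sigma> h by (rule sm)
  have UV: "U = harmonic_space V" using V(1) unfolding U by (auto simp: harmonic_space_def)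
  have VV: "open V" "V \<subseteq> M" by (rule V(2), rule V(1))
  have sdU: "spin_domain M aE aH \<omega> \<sigma> h U" using spin_domain_Int[OF VV open_UNIV] by (simp only: UV Int_UNIV_right)
  interpret U: spin_domain M aE aH \<omega> \<sigma> h U by (rule sdU)
  have hd: "harmonic_domain M \<Omega>" if "openin (top_of_set (harmonic_space M)) \<Omega>" for \<Omega> :: "'n hpoint set"
    by (rule harmonic_domain.intro[OF open_M that])
  have sd: "spin_domain M aE aH \<omega> \<sigma> h \<Omega>" if "openin (top_of_set (harmonic_space M)) \<Omega>" for \<Omega> :: "'n hpoint set"
    by (rule spin_domain.intro[OF sm hd[OF that]])
  {
    fix App :: "'n hpoint \<Rightarrow> complex^'r^'r" and \<alpha> :: 2
    assume pre: "prepotential \<sigma> h U App"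
    have c: "{z \<in> U. uplus z $ \<alpha> \<noteq> 0} = harmonic_space V \<inter> chart \<alpha>" by (simp only: UV chart_def Collect_conj_eq Collect_mem_eq)
    have hA: "holo_mat hscale U App" using pre by (simp only: prepotential_def)
    have "\<exists>\<Phi>. frame (harmonic_space V \<inter> chart \<alpha>) \<Phi> \<and> (\<forall>z\<in>harmonic_space V \<inter> chart \<alpha>.
        der (harmonic_space V \<inter> chart \<alpha>) \<Phi> z (dpp z) = - (App z ** \<Phi> z) \<and> der (harmonic_space V \<inter> chart \<alpha>) \<Phi> z (d0 z) = 0)"
    proof (rule chart_bridge[OF VV])
      show "holo_mat hscale (harmonic_space V \<inter> chart \<alpha>) App"
        by (rule hs.holo_mat_subset[OF hA[unfolded UV]]) (rule Int_lower1)
      show "der (harmonic_space V \<inter> chart \<alpha>) App z (d0 z) = 2 *\<^sub>R App z" if z: "z \<in> harmonic_space V \<inter> chart \<alpha>" for z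
      proof -
        have "der U App z (d0 z) = 2 *\<^sub>R App z"
          using pre IntD1[OF z, folded UV] unfolding prepotential_def by blast
        then show ?thesis unfolding der_Int[OF open_chart IntD2[OF z]] UV .
      qed
    qed
    then show "\<exists>\<Phi>. solves_bridge {z \<in> U. uplus z $ \<alpha> \<noteq> 0} App \<Phi>" by (simp only: c solves_bridge_def)
  }
  {
    fix App \<Phi> :: "'n hpoint \<Rightarrow> complex^'r^'r" and \<Omega>
    assume a: "prepotential \<sigma> h U App \<and> openin (top_of_set (harmonic_space M)) \<Omega> \<and> \<Omega> \<subseteq> U \<and> solves_bridge \<Omega> App \<Phi>"
    then have pre: "prepotential \<sigma> h U App" and op: "openin (top_of_set (harmonic_space M)) \<Omega>" and sub: "\<Omega> \<subseteq> U" and br: "solves_bridge \<Omega> App \<Phi>"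
      by blast+
    have hA: "holo_mat hscale U App" using pre by (simp only: prepotential_def)
    \<comment> \<open>The zero connection on U gives access to \<open>der_restrict\<close>, which
      compares derivatives on U and on the smaller set \<Omega>.\<close>
    interpret Z: connection_on M U "\<lambda>_ _. 0 :: complex^'r^'r"
      by unfold_locales (simp add: connection_def mm.zero_right)
    interpret S: spin_domain M aE aH \<omega> \<sigma> h \<Omega> by (rule sd[OF op])
    have "bridge M aE aH \<omega> \<sigma> h \<Omega> App \<Phi>"
    proof unfold_locales
      show "holo_mat hscale \<Omega> App" by (rule hs.holo_mat_subset[OF hA sub])
      show "holo_mat hscale \<Omega> \<Phi>" using br by (simp only: solves_bridge_def frame_def)
      fix z assume z: "z \<in> \<Omega>"
      show "invertible (\<Phi> z)" "der \<Omega> \<Phi> z (dpp z) = - (App z ** \<Phi> z)" "der \<Omega> \<Phi> z (d0 z) = 0"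
        using br z unfolding solves_bridge_def frame_def by blast+
      show "der \<Omega> App z (Y \<sigma> h 0 (\<lambda>_. c) z) = 0" for c :: "complex^'p"
      proof -
        have "der U App z (Xppp \<sigma> h (\<lambda>_. c) z) = 0"
          using pre subsetD[OF sub z] U.sectionE_const[of "fst ` U" c] unfolding prepotential_def by blast
        moreover have "der \<Omega> App z (Y \<sigma> h 0 (\<lambda>_. c) z) = der U App z (Y \<sigma> h 0 (\<lambda>_. c) z)"
          by (rule Z.der_restrict[OF hd[OF op] sub hA z tangent_Y])
        ultimately show ?thesis by simp
      qed
    qed
    then interpret B: bridge M aE aH \<omega> \<sigma> h \<Omega> App \<Phi> .
    show "\<exists>A. connection \<Omega> A \<and> almost_0_partially_flat \<sigma> h \<Omega> A \<and>
            analytic_frame \<sigma> h \<Omega> A (\<lambda>_. mat 1) \<and> has_potentials \<sigma> h \<Omega> App \<Phi> A \<and>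
            (\<forall>A'. connection \<Omega> A' \<and> has_potentials \<sigma> h \<Omega> App \<Phi> A' \<longrightarrow>
                 (\<forall>z\<in>\<Omega>. \<forall>w. tangent z w \<longrightarrow> A' z w = A z w))"
    proof (intro exI[of _ B.A] conjI allI impI ballI)
      show "A' z w = B.A z w" if "connection \<Omega> A' \<and> has_potentials \<sigma> h \<Omega> App \<Phi> A'" "z \<in> \<Omega>" "tangent z w" for A' z w
        by (rule S.potentials_unique[OF B.connection_A conjunct1[OF that(1)] B.has_potentials_A conjunct2[OF that(1)] that(2,3)])
    qed (rule B.connection_A B.almost_flat_A B.analytic_frame_A B.has_potentials_A)+
  }
  {
    fix W and A :: "'n hpoint \<Rightarrow> 'n hpoint \<Rightarrow> complex^'r^'r"
    assume a: "openin (top_of_set (harmonic_space M)) W \<and> connection W A \<and> almost_0_partially_flat \<sigma> h W A"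
    then have op: "openin (top_of_set (harmonic_space M)) W" and c: "connection W A" and fl: "almost_0_partially_flat \<sigma> h W A"
      by blast+
    interpret S: spin_domain M aE aH \<omega> \<sigma> h W by (rule sd[OF op])
    interpret S: spin_connection M aE aH \<omega> \<sigma> h W A by unfold_locales (rule c)
    show "\<forall>z\<in>W. \<exists>\<Omega> \<psi>. z \<in> \<Omega> \<and> \<Omega> \<subseteq> W \<and> openin (top_of_set (harmonic_space M)) \<Omega> \<and> analytic_frame \<sigma> h \<Omega> A \<psi>"
      by (rule ballI) (rule S.local_analytic_frame[OF fl])
    fix \<Omega> and \<psi> :: "'n hpoint \<Rightarrow> complex^'r^'r"
    assume b: "openin (top_of_set (harmonic_space M)) \<Omega> \<and> \<Omega> \<subseteq> W \<and> analytic_frame \<sigma> h \<Omega> A \<psi>"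
    then have op': "openin (top_of_set (harmonic_space M)) \<Omega>" and sub: "\<Omega> \<subseteq> W" and an: "analytic_frame \<sigma> h \<Omega> A \<psi>"
      by blast+
    have "analytic_connection M aE aH \<omega> \<sigma> h \<Omega> A \<psi>"
      by (rule analytic_connection.intro[OF S.spin_connection_restrict[OF hd[OF op'] sub]
          analytic_connection_axioms.intro[OF S.almost_flat_restrict[OF fl hd[OF op'] sub] an]])
    then interpret R: analytic_connection M aE aH \<omega> \<sigma> h \<Omega> A \<psi> .
    show "\<forall>z\<in>\<Omega>. \<exists>\<Omega>' App \<Phi>. z \<in> \<Omega>' \<and> \<Omega>' \<subseteq> \<Omega> \<and> openin (top_of_set (harmonic_space M)) \<Omega>' \<and>
                 prepotential \<sigma> h \<Omega>' App \<and> solves_bridge \<Omega>' App \<Phi> \<and> has_potentials \<sigma> h \<Omega>' App \<Phi> (potential \<Omega>' \<psi> A)"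
      by (rule ballI) (rule R.local_bridge)
  }
  {
    fix A :: "'n hpoint \<Rightarrow> 'n hpoint \<Rightarrow> complex^'r^'r" and \<psi>
    assume a: "connection U A \<and> almost_0_partially_flat \<sigma> h U A \<and> analytic_frame \<sigma> h U A \<psi>"
    then have c: "connection U A" and fl: "almost_0_partially_flat \<sigma> h U A" and an: "analytic_frame \<sigma> h U A \<psi>"
      by blast+
    have "spin_connection M aE aH \<omega> \<sigma> h U A" by unfold_locales (rule c)
    from analytic_connection.intro[OF this analytic_connection_axioms.intro[OF fl an]]
    interpret R: analytic_connection M aE aH \<omega> \<sigma> h U A \<psi> .
    show "\<exists>App \<Phi>. prepotential \<sigma> h U App \<and> solves_bridge U App \<Phi> \<and> has_potentials \<sigma> h U App \<Phi> (potential U \<psi> A)"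
      by (rule R.global_bridge[OF VV UV])
  }
qed

end
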